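(* Let $\theta\in(0,1)$ be an irrational number, and let $R$ be the hyperfinite type $\mathrm{II}_1$ factor with faithful normal tracial state $\tau$, generated by two unitaries $u,v$ with $vu=e^{2\pi i\theta}uv$. Then the Brown measure of $u+\lambda v$ (in $R$, with respect to $\tau$) is the Haar measure on the unit circle $\mathbb{T}$ if $0<\lambda\leq 1$, and the Haar measure on $\lambda\mathbb{T}$ if $\lambda>1$.
   Context: $R$ is the weak operator closure of the irrational rotation algebra $A_\theta=C^*(u,v)$ in the GNS representation of its unique tracial state. For $T$ in a finite von Neumann algebra $M$ with faithful normal tracial state $\tau$, the Fuglede-Kadison determinant is $\Delta(T)=\exp\{\tau(\ln|T|)\}$, with $\exp\{-\infty\}:=0$. The function $\zeta\mapsto\ln\Delta(T-\zeta 1)$ is subharmonic on $\mathbb{C}$, and the Brown measure $\mu_T$ of $T$ is the probability measure on $\mathbb{C}$ given, in the distribution sense, by $d\mu_T(\zeta)=\frac{1}{2\pi}\nabla^2\ln\Delta(T-\zeta 1)$, where $\nabla^2$ is the Laplacian on $\mathbb{C}\cong\mathbb{R}^2$. The Haar measure on $r\mathbb{T}$ ($r>0$) is the rotation-invariant Borel probability measure on the circle of radius $r$ centered at $0$. *)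

theory Defs
  imports "HOL-Probability.Probability"
begin

section \<open>Complex Hilbert spaces and bounded operators\<close>

text \<open>The library has real Hilbert spaces only. The inner product is linear in the first
  argument; its real part is the inner product of the underlying real Hilbert space, so that the
  norm is the one induced by it.\<close>

class complex_hilbert_space = real_inner + banach +
  fixes scaleC :: "complex \<Rightarrow> 'a \<Rightarrow> 'a" (infixr "*\<^sub>C" 75)
    and cinner :: "'a \<Rightarrow> 'a \<Rightarrow> complex"
  assumes scaleC_add_right: "c *\<^sub>C (x + y) = c *\<^sub>C x + c *\<^sub>C y"
    and scaleC_add_left: "(c + d) *\<^sub>C x = c *\<^sub>C x + d *\<^sub>C x"
    and scaleC_scaleC: "c *\<^sub>C d *\<^sub>C x = (c * d) *\<^sub>C x"
    and scaleC_of_real: "complex_of_real r *\<^sub>C x = r *\<^sub>R x"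
    and cinner_add_left: "cinner (x + y) z = cinner x z + cinner y z"
    and cinner_scaleC_left: "cinner (c *\<^sub>C x) y = c * cinner x y"
    and cinner_commute: "cinner y x = cnj (cinner x y)"
    and Re_cinner: "Re (cinner x y) = inner x y"

definition bounded_op :: "('h::complex_hilbert_space \<Rightarrow> 'h) \<Rightarrow> bool" where
  "bounded_op T \<longleftrightarrow> bounded_linear T \<and> (\<forall>c x. T (c *\<^sub>C x) = c *\<^sub>C T x)"

definition cadjoint :: "('h::complex_hilbert_space \<Rightarrow> 'h) \<Rightarrow> 'h \<Rightarrow> 'h" where
  "cadjoint T = (THE S. \<forall>x y. cinner (T x) y = cinner x (S y))"

definition self_adjoint :: "('h::complex_hilbert_space \<Rightarrow> 'h) \<Rightarrow> bool" where
  "self_adjoint T \<longleftrightarrow> bounded_op T \<and> cadjoint T = T"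

definition unitary :: "('h::complex_hilbert_space \<Rightarrow> 'h) \<Rightarrow> bool" where
  "unitary U \<longleftrightarrow> bounded_op U \<and> cadjoint U \<circ> U = id \<and> U \<circ> cadjoint U = id"

definition projection :: "('h::complex_hilbert_space \<Rightarrow> 'h) \<Rightarrow> bool" where
  "projection P \<longleftrightarrow> self_adjoint P \<and> P \<circ> P = P"

definition positive_op :: "('h::complex_hilbert_space \<Rightarrow> 'h) \<Rightarrow> bool" where
  "positive_op T \<longleftrightarrow> bounded_op T \<and> (\<forall>x. Im (cinner (T x) x) = 0 \<and> 0 \<le> Re (cinner (T x) x))"

definition op_le :: "('h::complex_hilbert_space \<Rightarrow> 'h) \<Rightarrow> ('h \<Rightarrow> 'h) \<Rightarrow> bool" where
  "op_le S T \<longleftrightarrow> positive_op (\<lambda>x. T x - S x)"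

text \<open>The square root is unique; \<open>SOME\<close> is used as for \<^const>\<open>adjoint\<close>.\<close>

definition abs_op :: "('h::complex_hilbert_space \<Rightarrow> 'h) \<Rightarrow> 'h \<Rightarrow> 'h" where
  "abs_op T = (SOME S. positive_op S \<and> S \<circ> S = cadjoint T \<circ> T)"


section \<open>Von Neumann algebras\<close>

definition star_subalgebra :: "('h::complex_hilbert_space \<Rightarrow> 'h) set \<Rightarrow> bool" where
  "star_subalgebra A \<longleftrightarrow>
     (\<forall>T\<in>A. bounded_op T) \<and> id \<in> A \<and>
     (\<forall>S\<in>A. \<forall>T\<in>A. (\<lambda>x. S x + T x) \<in> A \<and> S \<circ> T \<in> A) \<and>
     (\<forall>T\<in>A. cadjoint T \<in> A \<and> (\<forall>c. (\<lambda>x. c *\<^sub>C T x) \<in> A))"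

definition wot_closure :: "('h::complex_hilbert_space \<Rightarrow> 'h) set \<Rightarrow> ('h \<Rightarrow> 'h) set" where
  "wot_closure A = {T. bounded_op T \<and>
     (\<forall>F e. finite F \<and> e > 0 \<longrightarrow>
        (\<exists>S\<in>A. \<forall>(x, y)\<in>F. cmod (cinner (T x) y - cinner (S x) y) < e))}"

definition von_neumann_algebra :: "('h::complex_hilbert_space \<Rightarrow> 'h) set \<Rightarrow> bool" where
  "von_neumann_algebra M \<longleftrightarrow> star_subalgebra M \<and> wot_closure M = M"

definition generated_vna :: "('h::complex_hilbert_space \<Rightarrow> 'h) set \<Rightarrow> ('h \<Rightarrow> 'h) set" where
  "generated_vna S = \<Inter>{N. von_neumann_algebra N \<and> S \<subseteq> N}"

definition factor :: "('h::complex_hilbert_space \<Rightarrow> 'h) set \<Rightarrow> bool" where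
  "factor M \<longleftrightarrow> von_neumann_algebra M \<and>
     (\<forall>Z\<in>M. (\<forall>T\<in>M. Z \<circ> T = T \<circ> Z) \<longrightarrow> (\<exists>c. Z = (\<lambda>x. c *\<^sub>C x)))"

text \<open>Finite, and without minimal projections; in a factor the latter are the nonzero abelian
  ones.\<close>

definition type_II1_factor :: "('h::complex_hilbert_space \<Rightarrow> 'h) set \<Rightarrow> bool" where
  "type_II1_factor M \<longleftrightarrow> factor M \<and>
     (\<forall>V\<in>M. cadjoint V \<circ> V = id \<longrightarrow> V \<circ> cadjoint V = id) \<and>
     (\<forall>P\<in>M. projection P \<and> P \<noteq> (\<lambda>x. 0) \<longrightarrow>
        (\<exists>Q\<in>M. projection Q \<and> op_le Q P \<and> Q \<noteq> (\<lambda>x. 0) \<and> Q \<noteq> P))"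

definition hyperfinite :: "('h::complex_hilbert_space \<Rightarrow> 'h) set \<Rightarrow> bool" where
  "hyperfinite M \<longleftrightarrow> (\<exists>A :: nat \<Rightarrow> ('h \<Rightarrow> 'h) set.
     incseq A \<and>
     (\<forall>n. star_subalgebra (A n) \<and>
        (\<exists>F. finite F \<and> F \<subseteq> A n \<and> (\<forall>T\<in>A n. \<exists>c. T = (\<lambda>x. \<Sum>S\<in>F. c S *\<^sub>C S x)))) \<and>
     M = wot_closure (\<Union>n. A n))"

text \<open>The last two conjuncts are faithfulness and normality (preservation of suprema of
  bounded upward directed families of self-adjoint elements). Only the values of \<open>\<tau>\<close> on \<open>M\<close>
  matter.\<close>

definition faithful_normal_tracial_state ::
    "('h::complex_hilbert_space \<Rightarrow> 'h) set \<Rightarrow> (('h \<Rightarrow> 'h) \<Rightarrow> complex) \<Rightarrow> bool" where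
  "faithful_normal_tracial_state M \<tau> \<longleftrightarrow>
     (\<forall>S\<in>M. \<forall>T\<in>M. \<tau> (\<lambda>x. S x + T x) = \<tau> S + \<tau> T) \<and>
     (\<forall>c. \<forall>T\<in>M. \<tau> (\<lambda>x. c *\<^sub>C T x) = c * \<tau> T) \<and>
     \<tau> id = 1 \<and>
     (\<forall>T\<in>M. positive_op T \<longrightarrow> Im (\<tau> T) = 0 \<and> 0 \<le> Re (\<tau> T)) \<and>
     (\<forall>S\<in>M. \<forall>T\<in>M. \<tau> (S \<circ> T) = \<tau> (T \<circ> S)) \<and>
     (\<forall>T\<in>M. \<tau> (cadjoint T \<circ> T) = 0 \<longrightarrow> T = (\<lambda>x. 0)) \<and>
     (\<forall>D A. D \<subseteq> {T\<in>M. self_adjoint T} \<and> D \<noteq> {} \<and>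
        (\<forall>S\<in>D. \<forall>T\<in>D. \<exists>U\<in>D. op_le S U \<and> op_le T U) \<and>
        A \<in> M \<and> self_adjoint A \<and> (\<forall>T\<in>D. op_le T A) \<and>
        (\<forall>B\<in>M. self_adjoint B \<and> (\<forall>T\<in>D. op_le T B) \<longrightarrow> op_le A B)
        \<longrightarrow> Re (\<tau> A) = (SUP T\<in>D. Re (\<tau> T)))"


section \<open>The Fuglede--Kadison determinant\<close>

text \<open>The resolution of the identity of a bounded self-adjoint operator:
  \<open>A = \<integral> t dE t\<close> in the weak sense, which by polarization needs to be tested on the diagonal
  only.\<close>

definition resolution_of :: "(real \<Rightarrow> 'h \<Rightarrow> 'h) \<Rightarrow> ('h::complex_hilbert_space \<Rightarrow> 'h) \<Rightarrow> bool" where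
  "resolution_of E A \<longleftrightarrow>
     (\<forall>t. projection (E t)) \<and>
     (\<forall>s t. s \<le> t \<longrightarrow> op_le (E s) (E t)) \<and>
     (\<forall>t x. ((\<lambda>s. E s x) \<longlongrightarrow> E t x) (at_right t)) \<and>
     (\<exists>r. \<forall>t. (t < - r \<longrightarrow> E t = (\<lambda>x. 0)) \<and> (t \<ge> r \<longrightarrow> E t = id)) \<and>
     (\<forall>x. cinner (A x) x =
        complex_of_real (\<integral>t. t \<partial>interval_measure (\<lambda>t. Re (cinner (E t x) x))))"

text \<open>Unique by the spectral theorem.\<close>

definition spectral_resolution :: "('h::complex_hilbert_space \<Rightarrow> 'h) \<Rightarrow> real \<Rightarrow> 'h \<Rightarrow> 'h" where
  "spectral_resolution A = (SOME E. resolution_of E A)"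

definition spectral_distribution ::
    "(('h::complex_hilbert_space \<Rightarrow> 'h) \<Rightarrow> complex) \<Rightarrow> ('h \<Rightarrow> 'h) \<Rightarrow> real measure" where
  "spectral_distribution \<tau> A = interval_measure (\<lambda>t. Re (\<tau> (spectral_resolution A t)))"

text \<open>\<open>\<tau> (ln A)\<close> for a positive operator \<open>A\<close>, with values in \<open>[-\<infinity>, \<infinity>)\<close>. It is split into the
  positive and the negative part of the logarithm. The spectral distribution is carried by
  \<open>[0, \<infinity>)\<close>, and a spectral atom at \<open>0\<close> contributes \<open>-\<infinity>\<close> (whereas \<open>ln 0 = 0\<close> in the
  library).\<close>

definition trace_ln ::
    "(('h::complex_hilbert_space \<Rightarrow> 'h) \<Rightarrow> complex) \<Rightarrow> ('h \<Rightarrow> 'h) \<Rightarrow> ereal" where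
  "trace_ln \<tau> A =
     enn2ereal (\<integral>\<^sup>+t. (if t \<le> 0 then 0 else ennreal (ln t)) \<partial>spectral_distribution \<tau> A) -
     enn2ereal (\<integral>\<^sup>+t. (if t \<le> 0 then \<infinity> else ennreal (- ln t)) \<partial>spectral_distribution \<tau> A)"

definition fuglede_kadison ::
    "(('h::complex_hilbert_space \<Rightarrow> 'h) \<Rightarrow> complex) \<Rightarrow> ('h \<Rightarrow> 'h) \<Rightarrow> real" where
  "fuglede_kadison \<tau> T =
     (if trace_ln \<tau> (abs_op T) = -\<infinity> then 0 else exp (real_of_ereal (trace_ln \<tau> (abs_op T))))"


section \<open>The Brown measure\<close>

definition dir_deriv :: "'a::euclidean_space \<Rightarrow> ('a \<Rightarrow> real) \<Rightarrow> 'a \<Rightarrow> real" where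
  "dir_deriv v f = (\<lambda>x. frechet_derivative f (at x) v)"

primrec times_differentiable :: "nat \<Rightarrow> ('a::euclidean_space \<Rightarrow> real) \<Rightarrow> bool" where
  "times_differentiable 0 f \<longleftrightarrow> continuous_on UNIV f"
| "times_differentiable (Suc k) f \<longleftrightarrow>
     f differentiable_on UNIV \<and> (\<forall>v. times_differentiable k (dir_deriv v f))"

definition test_function :: "('a::euclidean_space \<Rightarrow> real) \<Rightarrow> bool" where
  "test_function \<phi> \<longleftrightarrow>
     (\<forall>k. times_differentiable k \<phi>) \<and> compact (closure {x. \<phi> x \<noteq> 0})"

definition laplacian :: "('a::euclidean_space \<Rightarrow> real) \<Rightarrow> 'a \<Rightarrow> real" where
  "laplacian f = (\<lambda>x. \<Sum>b\<in>Basis. dir_deriv b (dir_deriv b f) x)"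

text \<open>The logarithm of the determinant is locally integrable, being subharmonic; in particular the
  set where the determinant vanishes is Lebesgue null, and the library convention \<open>ln 0 = 0\<close> is
  harmless.\<close>

definition is_brown_measure ::
    "(('h::complex_hilbert_space \<Rightarrow> 'h) \<Rightarrow> complex) \<Rightarrow> ('h \<Rightarrow> 'h) \<Rightarrow> complex measure \<Rightarrow> bool" where
  "is_brown_measure \<tau> T \<mu> \<longleftrightarrow>
     prob_space \<mu> \<and> sets \<mu> = sets borel \<and>
     (\<forall>\<phi>. test_function \<phi> \<longrightarrow>
        integrable lborel (\<lambda>z. ln (fuglede_kadison \<tau> (\<lambda>x. T x - z *\<^sub>C x)) * laplacian \<phi> z) \<and>
        (\<integral>z. \<phi> z \<partial>\<mu>) =
          1 / (2 * pi) *
          (\<integral>z. ln (fuglede_kadison \<tau> (\<lambda>x. T x - z *\<^sub>C x)) * laplacian \<phi> z \<partial>lborel))"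

definition brown_measure ::
    "(('h::complex_hilbert_space \<Rightarrow> 'h) \<Rightarrow> complex) \<Rightarrow> ('h \<Rightarrow> 'h) \<Rightarrow> complex measure" where
  "brown_measure \<tau> T = (THE \<mu>. is_brown_measure \<tau> T \<mu>)"

definition haar_on_circle :: "real \<Rightarrow> complex measure \<Rightarrow> bool" where
  "haar_on_circle r \<mu> \<longleftrightarrow>
     prob_space \<mu> \<and> sets \<mu> = sets borel \<and> emeasure \<mu> (sphere 0 r) = 1 \<and>
     (\<forall>w. cmod w = 1 \<longrightarrow> distr \<mu> borel (\<lambda>z. w * z) = \<mu>)"

end

theory Submission
  imports Defs "HOL-Real_Asymp.Real_Asymp"
begin

text \<open>
  Let \<open>S = a u + b v\<close> with \<open>|a|, |b| \<le> 1\<close>. Conjugation by \<open>u\<^sup>* v\<close> multiplies \<open>S\<close> by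
  \<open>q = e\<^bsup>2\<pi>i\<theta>\<^esup>\<close>, so \<open>\<tau> (S\<^sup>n) = 0\<close> for \<open>n > 0\<close>, and \<open>1 - q\<^sup>k S\<close> is unitarily equivalent to \<open>1 - S\<close> for
  all \<open>k\<close>. Since \<open>S\<^sup>n\<close> is \<open>u\<^sup>n\<close> times a q-binomial product, whose coefficients grow
  subexponentially because the powers of \<open>q\<close> are equidistributed, the spectral radius of \<open>S\<close> is at
  most \<open>1\<close>, and \<open>\<Delta> (1 - t S) = 1\<close> for \<open>0 \<le> t < 1\<close> by the power series of the logarithm; hence
  \<open>\<Delta> (1 - S) \<ge> 1\<close>. Conversely, \<open>\<Delta> (1 - S)\<^sup>n\<close> is at most the norm of the product of \<open>1 - q\<^sup>k S\<close> over
  \<open>k < n\<close>, which again grows subexponentially. Multiplication by \<open>u\<^sup>*\<close> or \<open>v\<^sup>*\<close> moves the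
  largest coefficient to the constant term, so that
  \<open>\<Delta> (a u + b v + c) = max {|a|, |b|, |c|}\<close>
  for all \<open>a\<close>, \<open>b\<close>, \<open>c\<close> that do not all vanish. With \<open>m = max 1 \<lambda>\<close>, the Brown measure of
  \<open>u + \<lambda> v\<close> is therefore the Laplacian of \<open>ln (max m |z|) / 2\<pi>\<close>, and this is the Haar measure on the
  circle of radius \<open>m\<close> by Green's formula.
\<close>

section \<open>Hilbert space preliminaries\<close>

text \<open>\<open>fuglede_kadison\<close> rests on a spectral resolution picked by
  \<open>SOME\<close>, and \<open>1 - S\<close> need not be invertible, so the determinant itself is
  hard to compute with. The work is done on \<open>ld (star X * X + e *\<^sub>R 1)\<close> for
  \<open>e > 0\<close>, where \<open>ld y\<close>, the trace of \<open>ln y\<close>, is a power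
  series in the trace; differentiating it along paths yields monotonicity and multiplicativity. Of
  the latter only the superadditivity of the lower bounds \<open>ld_ge\<close> is carried to
  \<open>e = 0\<close>, which is what a product of many factors requires. The spectral distribution
  returns at the end, by monotone convergence in \<open>e\<close>. The q-binomial coefficients occur
  twice: \<open>S^n\<close> is \<open>u^n\<close> times a product in the unitary
  \<open>u^* v\<close>, and the factors \<open>1 - q^k S\<close> multiply to a product of the same
  kind in \<open>S\<close>. On the unit circle the logarithmic series of
  \<open>1 + q^k \<zeta>\<close> does not converge absolutely, so the product is estimated at radius
  \<open>\<rho> < 1\<close>; Cauchy's estimate then costs \<open>\<rho>^(-n)\<close>, which is
  harmless for \<open>\<rho>\<close> close to \<open>1\<close>. Irrationality of
  \<open>\<theta>\<close> enters as \<open>q^j \<noteq> 1\<close>, for the vanishing traces and for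
  the bounded geometric sums.\<close>

lemma scaleC_one [simp]: "1 *\<^sub>C x = (x::'h::complex_hilbert_space)"
  using scaleC_of_real[of 1 x] by simp

lemma scaleC_zero_left [simp]: "0 *\<^sub>C x = (0::'h::complex_hilbert_space)"
  using scaleC_of_real[of 0 x] by simp

lemma scaleR_scaleC: "r *\<^sub>R (x::'h::complex_hilbert_space) = complex_of_real r *\<^sub>C x"
  by (simp add: scaleC_of_real)

lemma scaleC_zero_right [simp]: "c *\<^sub>C 0 = (0::'h::complex_hilbert_space)"
  using scaleC_scaleC[of c 0 "0::'h"] by simp

lemma scaleC_minus_left: "(- c) *\<^sub>C x = - (c *\<^sub>C (x::'h::complex_hilbert_space))"
  using scaleC_add_left[of "-c" c x] by (simp add: eq_neg_iff_add_eq_0)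

lemma cinner_add_right: "cinner x (y + z) = cinner x y + cinner x (z::'h::complex_hilbert_space)"
  using cinner_commute[of x "y + z"] cinner_commute[of x y] cinner_commute[of x z]
  by (simp add: cinner_add_left)

lemma cinner_scaleC_right: "cinner x (c *\<^sub>C y) = cnj c * cinner x (y::'h::complex_hilbert_space)"
  using cinner_commute[of x "c *\<^sub>C y"] cinner_commute[of x y]
  by (simp add: cinner_scaleC_left)

lemma cinner_scaleR_left: "cinner (r *\<^sub>R x) y = of_real r * cinner x (y::'h::complex_hilbert_space)"
  by (simp add: scaleR_scaleC cinner_scaleC_left)

lemma cinner_scaleR_right: "cinner x (r *\<^sub>R y) = of_real r * cinner x (y::'h::complex_hilbert_space)"
  by (simp add: scaleR_scaleC cinner_scaleC_right)

lemma cinner_zero_left [simp]: "cinner 0 (x::'h::complex_hilbert_space) = 0"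
  using cinner_add_left[of 0 0 x] by simp

lemma cinner_zero_right [simp]: "cinner (x::'h::complex_hilbert_space) 0 = 0"
  using cinner_add_right[of x 0 0] by simp

lemma cinner_minus_left: "cinner (- x) y = - cinner x (y::'h::complex_hilbert_space)"
  using cinner_add_left[of "-x" x y] by (simp add: eq_neg_iff_add_eq_0)

lemma cinner_minus_right: "cinner x (- y) = - cinner x (y::'h::complex_hilbert_space)"
  using cinner_add_right[of x "-y" y] by (simp add: eq_neg_iff_add_eq_0)

lemma cinner_diff_left: "cinner (x - y) z = cinner x z - cinner y (z::'h::complex_hilbert_space)"
  using cinner_add_left[of x "-y" z] by (simp add: cinner_minus_left)

lemma cinner_diff_right: "cinner x (y - z) = cinner x y - cinner x (z::'h::complex_hilbert_space)"
  using cinner_add_right[of x y "-z"] by (simp add: cinner_minus_right)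

lemmas cinner_algebra = cinner_add_left cinner_add_right cinner_diff_left cinner_diff_right
  cinner_minus_left cinner_minus_right cinner_scaleC_left cinner_scaleC_right
  cinner_scaleR_left cinner_scaleR_right

lemma cinner_self: "cinner x x = complex_of_real ((norm (x::'h::complex_hilbert_space))\<^sup>2)"
proof -
  have "Im (cinner x x) = 0"
    using cinner_commute[of x x] by (metis add.inverse_inverse cnj.simps(2) eq_neg_iff_add_eq_0 mult_2 mult_eq_0_iff zero_neq_numeral)
  then show ?thesis
    using Re_cinner[of x x] by (simp add: complex_eq_iff power2_norm_eq_inner)
qed

lemma norm_scaleC: "norm (c *\<^sub>C x) = cmod c * norm (x::'h::complex_hilbert_space)"
proof -
  have "complex_of_real ((norm (c *\<^sub>C x))\<^sup>2) = complex_of_real ((cmod c * norm x)\<^sup>2)"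
    unfolding cinner_self[symmetric] cinner_scaleC_left cinner_scaleC_right
    using complex_norm_square[of c] by (simp add: cinner_self power_mult_distrib algebra_simps)
  then have "(norm (c *\<^sub>C x))\<^sup>2 = (cmod c * norm x)\<^sup>2" by (simp only: of_real_eq_iff)
  then show ?thesis by (simp add: power2_eq_iff_nonneg)
qed

lemma cinner_Cauchy_Schwarz: "cmod (cinner x y) \<le> norm x * norm (y::'h::complex_hilbert_space)"
proof (cases "cinner x y = 0")
  case False
  define c where "c = cnj (cinner x y) / complex_of_real (cmod (cinner x y))"
  have 1: "cmod c = 1" using False by (simp add: c_def norm_divide)
  have "c * cinner x y = complex_of_real (cmod (cinner x y))"
    using False complex_norm_square[of "cinner x y"]
    by (simp add: c_def field_simps power2_eq_square)
  then have "cmod (cinner x y) = Re (cinner (c *\<^sub>C x) y)" by (simp add: cinner_scaleC_left)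
  also have "\<dots> \<le> norm (c *\<^sub>C x) * norm y"
    unfolding Re_cinner by (rule norm_cauchy_schwarz)
  finally show ?thesis using 1 by (simp add: norm_scaleC)
qed simp

lemma bounded_bilinear_cinner: "bounded_bilinear (cinner :: 'h::complex_hilbert_space \<Rightarrow> 'h \<Rightarrow> complex)"
  by standard (auto simp: cinner_algebra scaleR_conv_of_real
      intro!: exI[of _ 1] cinner_Cauchy_Schwarz)

lemmas tendsto_cinner = bounded_bilinear.tendsto[OF bounded_bilinear_cinner]

lemma cinner_ext_right: "(\<And>y. cinner y x = cinner y z) \<Longrightarrow> x = (z::'h::complex_hilbert_space)"
  using cinner_self[of "x - z"] by (simp add: cinner_diff_right)

text \<open>Minimizing \<open>\<parallel>x\<parallel>\<^sup>2 - 2 f x\<close> over \<open>K\<close> yields both the orthogonal projection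
  (\<open>f = inner a\<close>) and the Riesz representation (\<open>K = UNIV\<close>).\<close>

lemma riesz_on_subspace:
  fixes f :: "'a::{real_inner,banach} \<Rightarrow> real"
  assumes f: "bounded_linear f" and K: "subspace K" "closed K"
  shows "\<exists>y\<in>K. \<forall>h\<in>K. f h = inner h y"
proof -
  interpret f: bounded_linear f by fact
  define J where "J x = (norm x)\<^sup>2 - 2 * f x" for x
  define m where "m = Inf (J ` K)"
  have ne: "J ` K \<noteq> {}" using subspace_0[OF K(1)] by auto
  have bdd: "bdd_below (J ` K)"
  proof -
    have "- (onorm f)\<^sup>2 \<le> J x" for x
    proof -
      have "f x \<le> onorm f * norm x" using onorm[OF f, of x] by simp
      moreover have "0 \<le> (norm x - onorm f)\<^sup>2" by simp
      ultimately show ?thesis unfolding J_def by (simp add: power2_eq_square algebra_simps)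
    qed
    then show ?thesis by (intro bdd_belowI2) auto
  qed
  have mJ: "m \<le> J x" if "x \<in> K" for x
    unfolding m_def using that by (intro cInf_lower bdd) auto
  have "\<exists>x\<in>K. J x < m + 1 / real (Suc n)" for n
    using cInf_lessD[OF ne, of "m + 1 / real (Suc n)"] unfolding m_def by auto
  then obtain X where X: "\<And>n. X n \<in> K" "\<And>n. J (X n) < m + 1 / real (Suc n)" by metis
  \<comment> \<open>By the parallelogram law, in which the linear part of \<open>J\<close> cancels,
    a minimizing sequence is Cauchy.\<close>
  have par: "(norm (x - y))\<^sup>2 \<le> 2 * (J x - m) + 2 * (J y - m)" if "x \<in> K" "y \<in> K" for x y
  proof -
    have "m \<le> J ((1/2) *\<^sub>R (x + y))"
      using that K(1) by (intro mJ subspace_scale subspace_add)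
    moreover have "(norm (x - y))\<^sup>2 = 2 * J x + 2 * J y - 4 * J ((1/2) *\<^sub>R (x + y))"
      unfolding J_def power2_norm_eq_inner
      by (simp add: f.add f.scaleR inner_diff inner_add algebra_simps inner_commute)
    ultimately show ?thesis by simp
  qed
  have "Cauchy X"
  proof (rule metric_CauchyI)
    fix e :: real assume e: "e > 0"
    obtain N where N: "4 / e\<^sup>2 < real N" using reals_Archimedean2 by blast
    show "\<exists>M. \<forall>i\<ge>M. \<forall>j\<ge>M. dist (X i) (X j) < e"
    proof (intro exI allI impI)
      fix i j assume ij: "N \<le> i" "N \<le> j"
      have "1 / real (Suc i) \<le> 1 / real (Suc N)" "1 / real (Suc j) \<le> 1 / real (Suc N)"
        using ij by (auto simp: field_simps)
      then have "(norm (X i - X j))\<^sup>2 < 4 / real (Suc N)"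
        using par[OF X(1) X(1), of i j] X(2)[of i] X(2)[of j] by simp
      also have "\<dots> \<le> e\<^sup>2"
        using N e by (simp add: field_simps) (metis add_increasing less_eq_real_def zero_le_power2)
      finally show "dist (X i) (X j) < e"
        using e by (simp add: dist_norm power2_less_imp_less)
    qed
  qed
  then obtain y where y: "X \<longlonglongrightarrow> y" using Cauchy_convergent convergent_def by blast
  have yK: "y \<in> K" using closed_sequentially[OF K(2) _ y] X(1) by blast
  have Jy: "J y \<le> m"
  proof (rule LIMSEQ_le)
    show "(\<lambda>n. J (X n)) \<longlonglongrightarrow> J y" unfolding J_def by (intro tendsto_intros y f.tendsto)
    show "(\<lambda>n. m + 1 / real (Suc n)) \<longlonglongrightarrow> m"
      using tendsto_add[OF tendsto_const LIMSEQ_inverse_real_of_nat, of m] by (simp add: inverse_eq_divide)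
    show "\<exists>N. \<forall>n\<ge>N. J (X n) \<le> m + 1 / real (Suc n)" using X(2) less_imp_le by blast
  qed
  have "f h = inner h y" if h: "h \<in> K" for h
  proof -
    define b where "b = inner h y - f h"
    define a where "a = (norm h)\<^sup>2"
    have q: "0 \<le> a * t\<^sup>2 + 2 * b * t" for t
    proof -
      have "J y \<le> J (y + t *\<^sub>R h)"
        using Jy mJ[of "y + t *\<^sub>R h"] yK h K(1) by (meson order_trans subspace_add subspace_scale)
      then show ?thesis
        unfolding J_def a_def b_def power2_norm_eq_inner
        by (simp add: f.add f.scaleR inner_add inner_commute power2_eq_square algebra_simps)
    qed
    have a: "a \<ge> 0" by (simp add: a_def)
    \<comment> \<open>The minimizer of the quadratic would be \<open>- b / a\<close>; the
      denominator \<open>a + 1\<close> also covers \<open>h = 0\<close>, where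
      \<open>a = 0\<close>.\<close>
    have "a * (- b / (a + 1))\<^sup>2 + 2 * b * (- b / (a + 1)) = - (b\<^sup>2 * (a + 2) / (a + 1)\<^sup>2)"
      using a by (simp add: divide_simps power2_eq_square) (simp add: algebra_simps)
    with q[of "- b / (a + 1)"] have "b\<^sup>2 * (a + 2) / (a + 1)\<^sup>2 \<le> 0" by linarith
    then have "b\<^sup>2 * (a + 2) \<le> 0" using a by (simp add: divide_le_0_iff)
    then have "b = 0" using a by (smt (verit) mult_pos_pos zero_less_power2)
    then show ?thesis by (simp add: b_def)
  qed
  with yK show ?thesis by blast
qed

lemma bounded_op_bounded_linear: "bounded_op T \<Longrightarrow> bounded_linear T"
  by (simp add: bounded_op_def)

lemma bounded_opI:
  fixes T :: "'h::complex_hilbert_space \<Rightarrow> 'h"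
  assumes "\<And>x y. T (x + y) = T x + T y" "\<And>c x. T (c *\<^sub>C x) = c *\<^sub>C T x"
    and "\<And>x. norm (T x) \<le> norm x * K"
  shows "bounded_op T"
  unfolding bounded_op_def
  by (auto intro!: bounded_linear_intro[where K=K] simp: assms scaleR_scaleC)

text \<open>The real Riesz representation yields a vector that is correct for real parts; inserting
  \<open>\<i> *\<^sub>C x\<close> for \<open>x\<close> shows that the imaginary parts agree as
  well.\<close>

lemma cadjoint_exists:
  fixes T :: "'h::complex_hilbert_space \<Rightarrow> 'h"
  assumes T: "bounded_op T"
  shows "\<exists>S. bounded_op S \<and> (\<forall>x y. cinner (T x) y = cinner x (S y))"
proof -
  interpret T: bounded_linear T using T by (simp add: bounded_op_def)
  have Tc: "T (c *\<^sub>C x) = c *\<^sub>C T x" for c x using T by (simp add: bounded_op_def)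
  have "\<exists>z. \<forall>x. cinner (T x) y = cinner x z" for y
  proof -
    have "bounded_linear (\<lambda>x. inner (T x) y)"
      by (rule bounded_linear_compose[OF bounded_linear_inner_left]) (rule T.bounded_linear_axioms)
    from riesz_on_subspace[OF this subspace_UNIV closed_UNIV]
    obtain z where z: "\<And>x. inner (T x) y = inner x z" by blast
    have "cinner (T x) y = cinner x z" for x
    proof (rule complex_eqI)
      show "Re (cinner (T x) y) = Re (cinner x z)" by (simp add: Re_cinner z)
      have "Re (cinner (T (\<i> *\<^sub>C x)) y) = Re (cinner (\<i> *\<^sub>C x) z)" by (simp only: Re_cinner z)
      then show "Im (cinner (T x) y) = Im (cinner x z)" by (simp add: Tc cinner_scaleC_left)
    qed
    then show ?thesis by blast
  qed
  then obtain S where S: "\<And>x y. cinner (T x) y = cinner x (S y)" by metis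
  have "bounded_op S"
  proof (rule bounded_opI)
    show "S (x + y) = S x + S y" for x y
      by (rule cinner_ext_right) (simp add: S[symmetric] cinner_add_right)
    show "S (c *\<^sub>C x) = c *\<^sub>C S x" for c x
      by (rule cinner_ext_right) (simp add: S[symmetric] cinner_scaleC_right)
    show "norm (S x) \<le> norm x * onorm T" for x
    proof (cases "S x = 0")
      case False
      have "(norm (S x))\<^sup>2 = cmod (cinner (T (S x)) x)"
        by (simp add: S cinner_self norm_power)
      also have "\<dots> \<le> norm (T (S x)) * norm x" by (rule cinner_Cauchy_Schwarz)
      also have "\<dots> \<le> onorm T * norm (S x) * norm x"
        by (intro mult_right_mono onorm[OF T.bounded_linear_axioms]) simp
      finally have "norm (S x) * norm (S x) \<le> (norm x * onorm T) * norm (S x)"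
        by (simp add: power2_eq_square mult_ac)
      then show ?thesis using False by (simp add: mult_le_cancel_right)
    qed (simp add: onorm_pos_le T.bounded_linear_axioms)
  qed
  with S show ?thesis by blast
qed

lemma cadjoint_unique:
  fixes T :: "'h::complex_hilbert_space \<Rightarrow> 'h"
  assumes "\<And>x y. cinner (T x) y = cinner x (S y)"
  shows "cadjoint T = S"
  unfolding cadjoint_def
proof (rule the_equality)
  fix S' assume S': "\<forall>x y. cinner (T x) y = cinner x (S' y)"
  show "S' = S"
    by (rule ext, rule cinner_ext_right) (simp add: S'[rule_format, symmetric] assms)
qed (use assms in blast)

lemma
  assumes "bounded_op T"
  shows bounded_op_cadjoint: "bounded_op (cadjoint T)"
    and cinner_cadjoint: "cinner (T x) y = cinner x (cadjoint T y)"
proof -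
  obtain S where "bounded_op S" "\<forall>x y. cinner (T x) y = cinner x (S y)"
    using cadjoint_exists[OF assms] by blast
  with cadjoint_unique[of T S] show "bounded_op (cadjoint T)" "cinner (T x) y = cinner x (cadjoint T y)"
    by auto
qed

section \<open>The algebra of bounded operators\<close>

text \<open>A type of its own turns the bounded operators into a Banach algebra in the sense of the
  type classes, so that power series, Cauchy products and derivatives apply to them.\<close>

typedef (overloaded) 'h cop = "{T :: 'h::complex_hilbert_space \<Rightarrow> 'h. bounded_op T}"
  morphisms ap Op
  by (rule exI[of _ "\<lambda>x. 0"]) (auto intro: bounded_opI[where K=0])

setup_lifting type_definition_cop

lemma cop_eqI: "(\<And>x. ap S x = ap T x) \<Longrightarrow> S = T"
  by (metis ap_inject ext)

lemma bounded_op_ap [simp]: "bounded_op (ap T)"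
  using ap[of T] by simp

lemma bounded_linear_ap: "bounded_linear (ap T)"
  by (rule bounded_op_bounded_linear) simp

lemma ap_Op [simp]: "bounded_op T \<Longrightarrow> ap (Op T) = T"
  by (simp add: Op_inverse)

lemma ap_scaleC [simp]: "ap T (c *\<^sub>C x) = c *\<^sub>C ap T x"
  using bounded_op_ap[of T] unfolding bounded_op_def by blast

lemma ap_add_vec [simp]: "ap T (x + y) = ap T x + ap T y"
  by (simp add: bounded_linear_ap linear_simps)

lemma ap_zero_vec [simp]: "ap T 0 = 0"
  by (simp add: bounded_linear_ap linear_simps)

lemma ap_diff_vec [simp]: "ap T (x - y) = ap T x - ap T y"
  by (simp add: bounded_linear_ap linear_simps)

lemma ap_scaleR_vec [simp]: "ap T (r *\<^sub>R x) = r *\<^sub>R ap T x"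
  by (simp add: bounded_linear_ap linear_simps)

lemma bounded_op_compose: "bounded_op S \<Longrightarrow> bounded_op T \<Longrightarrow> bounded_op (S \<circ> T)"
  unfolding bounded_op_def o_def by (auto intro: bounded_linear_compose)

lemma bounded_op_plus: "bounded_op S \<Longrightarrow> bounded_op T \<Longrightarrow> bounded_op (\<lambda>x. S x + T x)"
  unfolding bounded_op_def by (auto intro: bounded_linear_add simp: scaleC_add_right)

lemma bounded_op_scaleC: "bounded_op T \<Longrightarrow> bounded_op (\<lambda>x. c *\<^sub>C T x)"
proof -
  assume T: "bounded_op T"
  have "bounded_linear (\<lambda>x::'a. c *\<^sub>C x)"
    by (rule bounded_linear_intro[where K="cmod c"])
      (simp_all add: scaleC_add_right scaleR_scaleC scaleC_scaleC norm_scaleC mult.commute)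
  from bounded_linear_compose[OF this bounded_op_bounded_linear[OF T]]
  show ?thesis using T by (simp add: bounded_op_def scaleC_scaleC mult.commute)
qed

lemma bounded_op_id: "bounded_op (\<lambda>x. x)"
  by (rule bounded_opI[where K=1]) auto

lift_definition sc :: "complex \<Rightarrow> 'h::complex_hilbert_space cop" is "\<lambda>c x. c *\<^sub>C x"
  by (rule bounded_op_scaleC) (rule bounded_op_id)

instantiation cop :: (complex_hilbert_space) "{real_vector, monoid_mult}"
begin
lift_definition zero_cop :: "'a cop" is "\<lambda>x. 0" by (auto intro: bounded_opI[where K=0])
lift_definition one_cop :: "'a cop" is "\<lambda>x. x" by (rule bounded_op_id)
lift_definition plus_cop :: "'a cop \<Rightarrow> 'a cop \<Rightarrow> 'a cop" is "\<lambda>S T x. S x + T x"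
  by (rule bounded_op_plus)
lift_definition minus_cop :: "'a cop \<Rightarrow> 'a cop \<Rightarrow> 'a cop" is "\<lambda>S T x. S x - T x"
  using bounded_op_plus[OF _ bounded_op_scaleC, of _ _ "-1"] by (simp add: scaleC_minus_left)
lift_definition uminus_cop :: "'a cop \<Rightarrow> 'a cop" is "\<lambda>T x. - T x"
  using bounded_op_scaleC[of _ "-1"] by (simp add: scaleC_minus_left)
lift_definition times_cop :: "'a cop \<Rightarrow> 'a cop \<Rightarrow> 'a cop" is "\<lambda>S T x. S (T x)"
  using bounded_op_compose by (simp add: o_def)
lift_definition scaleR_cop :: "real \<Rightarrow> 'a cop \<Rightarrow> 'a cop" is "\<lambda>r T x. r *\<^sub>R T x"
  using bounded_op_scaleC by (simp add: scaleR_scaleC)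
instance
  by standard (transfer; simp add: algebra_simps scaleR_add_left scaleR_add_right fun_eq_iff)+
end

lemma ap_zero [simp]: "ap 0 x = 0" by transfer simp
lemma ap_one [simp]: "ap 1 x = x" by transfer simp
lemma ap_plus [simp]: "ap (S + T) x = ap S x + ap T x" by transfer simp
lemma ap_minus [simp]: "ap (S - T) x = ap S x - ap T x" by transfer simp
lemma ap_uminus [simp]: "ap (- T) x = - ap T x" by transfer simp
lemma ap_times [simp]: "ap (S * T) x = ap S (ap T x)" by transfer simp
lemma ap_scaleR [simp]: "ap (r *\<^sub>R T) x = r *\<^sub>R ap T x" by transfer simp
lemma ap_sc [simp]: "ap (sc c) x = c *\<^sub>C x" by transfer simp
lemma ap_sum [simp]: "ap (sum f A) x = (\<Sum>a\<in>A. ap (f a) x)"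
  by (induction A rule: infinite_finite_induct) auto

instantiation cop :: (complex_hilbert_space) real_normed_algebra
begin
lift_definition norm_cop :: "'a cop \<Rightarrow> real" is onorm .
definition "dist_cop (S :: 'a cop) T = norm (S - T)"
definition [code del]: "(uniformity :: ('a cop \<times> 'a cop) filter) = (INF e\<in>{0 <..}. principal {(x, y). dist x y < e})"
definition open_cop :: "'a cop set \<Rightarrow> bool"
  where [code del]: "open_cop S = (\<forall>x\<in>S. \<forall>\<^sub>F (x', y) in uniformity. x' = x \<longrightarrow> y \<in> S)"
definition "sgn_cop (T :: 'a cop) = inverse (norm T) *\<^sub>R T"
instance
proof
  fix S T U :: "'a cop" and r :: real
  show "dist S T = norm (S - T)" by (rule dist_cop_def)
  show "(uniformity :: ('a cop \<times> 'a cop) filter) = (INF e\<in>{0 <..}. principal {(x, y). dist x y < e})"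
    by (rule uniformity_cop_def)
  show "open X = (\<forall>x\<in>X. \<forall>\<^sub>F (x', y) in uniformity. x' = x \<longrightarrow> y \<in> X)" for X :: "'a cop set"
    by (rule open_cop_def)
  show "sgn T = inverse (norm T) *\<^sub>R T" by (rule sgn_cop_def)
  show "norm T = 0 \<longleftrightarrow> T = 0"
    by transfer (auto simp: onorm_eq_0 bounded_op_bounded_linear)
  show "norm (S + T) \<le> norm S + norm T"
    by transfer (simp add: onorm_triangle bounded_op_bounded_linear)
  show "norm (r *\<^sub>R T) = \<bar>r\<bar> * norm T"
    by transfer (simp add: onorm_scaleR bounded_op_bounded_linear)
  show "norm (S * T) \<le> norm S * norm T"
    by transfer (rule onorm_compose[unfolded o_def]; erule bounded_op_bounded_linear)
  show "S * (T + U) = S * T + S * U" "(S + T) * U = S * U + T * U"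
    "r *\<^sub>R S * T = r *\<^sub>R (S * T)" "S * r *\<^sub>R T = r *\<^sub>R (S * T)"
    by (rule cop_eqI; simp)+
qed
end

text \<open>Completeness is inherited from the bounded real-linear maps, into which the operators
  embed isometrically. Complex linearity passes to pointwise limits.\<close>

instance cop :: (complex_hilbert_space) banach
proof
  fix X :: "nat \<Rightarrow> 'a cop"
  assume X: "Cauchy X"
  define Y where "Y n = Blinfun (ap (X n))" for n
  have Y: "blinfun_apply (Y n) = ap (X n)" for n
    by (simp add: Y_def bounded_linear_Blinfun_apply bounded_linear_ap)
  have "norm (Y m - Y n) = norm (X m - X n)" for m n
    by (simp add: norm_blinfun.rep_eq norm_cop.rep_eq Y minus_blinfun.rep_eq minus_cop.rep_eq)
  then have "Cauchy Y" using X by (simp add: Cauchy_def dist_norm)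
  then obtain L where L: "Y \<longlonglongrightarrow> L" using Cauchy_convergent convergent_def by blast
  have ptw: "(\<lambda>n. ap (X n) x) \<longlonglongrightarrow> blinfun_apply L x" for x
    using bounded_linear.tendsto[OF blinfun.bounded_linear_left L, of x] by (simp add: Y)
  have "bounded_op (blinfun_apply L)"
    unfolding bounded_op_def
  proof (intro conjI allI blinfun.bounded_linear_right)
    fix c x
    have "(\<lambda>n. c *\<^sub>C ap (X n) x) \<longlonglongrightarrow> c *\<^sub>C blinfun_apply L x"
      by (rule bounded_linear.tendsto[OF _ ptw])
        (rule bounded_op_bounded_linear[OF bounded_op_scaleC[OF bounded_op_id]])
    moreover have "(\<lambda>n. c *\<^sub>C ap (X n) x) \<longlonglongrightarrow> blinfun_apply L (c *\<^sub>C x)"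
      using ptw[of "c *\<^sub>C x"] by simp
    ultimately show "blinfun_apply L (c *\<^sub>C x) = c *\<^sub>C blinfun_apply L x"
      using LIMSEQ_unique by blast
  qed
  then have *: "ap (Op (blinfun_apply L)) = blinfun_apply L" by simp
  have "norm (X n - Op (blinfun_apply L)) = norm (Y n - L)" for n
    by (simp add: norm_blinfun.rep_eq norm_cop.rep_eq Y minus_blinfun.rep_eq minus_cop.rep_eq *)
  then have "X \<longlonglongrightarrow> Op (blinfun_apply L)"
    using L by (simp add: LIMSEQ_iff)
  then show "convergent X" by (auto simp: convergent_def)
qed

lemma norm_ap: "norm (ap T x) \<le> norm T * norm x"
  by transfer (simp add: onorm bounded_op_bounded_linear)

lemma norm_cop_leI: "0 \<le> K \<Longrightarrow> (\<And>x. norm (ap T x) \<le> K * norm x) \<Longrightarrow> norm T \<le> K"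
  by transfer (simp add: onorm_bound)

text \<open>Equality fails on the zero space. For this reason the type is a
  \<open>real_normed_algebra\<close> with a unit but no \<open>real_normed_algebra_1\<close>, and
  the estimate for powers is proved separately.\<close>

lemma norm_one_cop_le: "norm (1 :: 'h::complex_hilbert_space cop) \<le> 1"
  by (rule norm_cop_leI) auto

lemma norm_power_cop_le: "norm ((T :: 'h::complex_hilbert_space cop) ^ n) \<le> norm T ^ n"
proof (induction n)
  case (Suc n)
  then show ?case
    using norm_mult_ineq[of T "T ^ n"] by (simp add: mult_left_mono order_trans)
qed (simp add: norm_one_cop_le)

lemma sc_0 [simp]: "sc 0 = 0" by (rule cop_eqI) simp
lemma sc_1 [simp]: "sc 1 = 1" by (rule cop_eqI) simp
lemma sc_add: "sc (c + d) = sc c + sc d" by (rule cop_eqI) (simp add: scaleC_add_left)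
lemma sc_minus: "sc (- c) = - sc c" by (rule cop_eqI) (simp add: scaleC_minus_left)
lemma sc_mult: "sc (c * d) = sc c * sc d" by (rule cop_eqI) (simp add: scaleC_scaleC mult.commute)
lemma sc_commute: "T * sc c = sc c * T" by (rule cop_eqI) simp
lemma sc_of_real_times: "sc (complex_of_real r) * T = r *\<^sub>R T"
  by (rule cop_eqI) (simp add: scaleC_of_real)
lemma norm_sc_le: "norm (sc c :: 'h::complex_hilbert_space cop) \<le> cmod c"
  by (rule norm_cop_leI) (auto simp: norm_scaleC)
lemma norm_sc_times_le: "norm (sc c * T) \<le> cmod c * norm T"
  by (meson norm_mult_ineq norm_sc_le mult_right_mono norm_ge_zero order_trans)
lemma sc_times_left_commute: "S * (sc c * T) = sc c * (S * T)"
  by (metis sc_commute mult.assoc)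

section \<open>The adjoint as an operation on \<open>cop\<close>\<close>

definition star :: "'h::complex_hilbert_space cop \<Rightarrow> 'h cop" where
  "star T = Op (cadjoint (ap T))"

lemma ap_star: "ap (star T) = cadjoint (ap T)"
  by (simp add: star_def bounded_op_cadjoint)

lemma cinner_star_right: "cinner x (ap (star T) y) = cinner (ap T x) y"
  by (simp add: ap_star cinner_cadjoint)

lemma cinner_star_left: "cinner (ap (star T) x) y = cinner x (ap T y)"
  by (metis cinner_star_right cinner_commute)

lemma cop_star_eqI: "(\<And>x y. cinner (ap T x) y = cinner x (ap S y)) \<Longrightarrow> star T = S"
  by (metis cinner_star_right cinner_ext_right cop_eqI)

lemma star_star [simp]: "star (star T) = T"
  by (rule cop_star_eqI) (simp add: cinner_star_left)
lemma star_add [simp]: "star (S + T) = star S + star T"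
  by (rule cop_star_eqI) (simp add: cinner_algebra cinner_star_right)
lemma star_diff [simp]: "star (S - T) = star S - star T"
  by (rule cop_star_eqI) (simp add: cinner_algebra cinner_star_right)
lemma star_uminus [simp]: "star (- T) = - star T"
  by (rule cop_star_eqI) (simp add: cinner_algebra cinner_star_right)
lemma star_mult [simp]: "star (S * T) = star T * star S"
  by (rule cop_star_eqI) (simp add: cinner_algebra cinner_star_right)
lemma star_sc [simp]: "star (sc c) = sc (cnj c)"
  by (rule cop_star_eqI) (simp add: cinner_algebra)
lemma star_scaleR [simp]: "star (r *\<^sub>R T) = r *\<^sub>R star T"
  by (rule cop_star_eqI) (simp add: cinner_algebra cinner_star_right)
lemma star_one [simp]: "star 1 = 1"
  by (rule cop_star_eqI) simp
lemma star_zero [simp]: "star 0 = 0"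
  by (rule cop_star_eqI) simp
lemma star_power [simp]: "star (T ^ n) = star T ^ n"
  by (induction n) (simp_all add: power_commutes)

lemma norm_star_le: "norm (star T) \<le> norm T"
proof (rule norm_cop_leI)
  fix x
  let ?y = "ap (star T) x"
  have "(norm ?y)\<^sup>2 = cmod (cinner (ap T ?y) x)"
    by (simp add: cinner_star_right[symmetric] cinner_self norm_power)
  also have "\<dots> \<le> norm (ap T ?y) * norm x" by (rule cinner_Cauchy_Schwarz)
  also have "\<dots> \<le> norm T * norm ?y * norm x" by (intro mult_right_mono norm_ap) simp
  finally have "norm ?y * norm ?y \<le> (norm T * norm x) * norm ?y"
    by (simp add: power2_eq_square mult_ac)
  then show "norm ?y \<le> norm T * norm x"
    by (cases "norm ?y = 0") (auto simp: mult_le_cancel_right)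
qed simp

lemma norm_star [simp]: "norm (star T) = norm T"
  using norm_star_le[of T] norm_star_le[of "star T"] by simp

subsection \<open>Positive operators\<close>

definition pos :: "'h::complex_hilbert_space cop \<Rightarrow> bool" where
  "pos T \<longleftrightarrow> positive_op (ap T)"

lemma pos_iff: "pos T \<longleftrightarrow> (\<forall>x. Im (cinner (ap T x) x) = 0 \<and> 0 \<le> Re (cinner (ap T x) x))"
  by (simp add: pos_def positive_op_def)

lemma pos_Re: "pos T \<Longrightarrow> 0 \<le> Re (cinner (ap T x) x)"
  by (simp add: pos_iff)

lemma polarization:
  "4 * cinner (ap T x) y = cinner (ap T (x + y)) (x + y) - cinner (ap T (x - y)) (x - y)
    + \<i> * cinner (ap T (x + \<i> *\<^sub>C y)) (x + \<i> *\<^sub>C y) - \<i> * cinner (ap T (x - \<i> *\<^sub>C y)) (x - \<i> *\<^sub>C y)"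
  by (simp add: cinner_algebra algebra_simps)

text \<open>By polarization the quadratic form determines the operator, and a real form of
  \<open>T\<close> agrees with that of its adjoint.\<close>

lemma star_eq_if_real: assumes "\<And>x. Im (cinner (ap T x) x) = 0" shows "star T = T"
proof (rule cop_star_eqI)
  fix x y
  have r: "cinner z (ap T z) = cinner (ap T z) z" for z
    using assms[of z] cinner_commute[of z "ap T z"] by (simp add: complex_eq_iff)
  have "4 * cinner (ap T x) y = 4 * cinner x (ap T y)"
  proof -
    have "4 * cinner x (ap T y) = cinner (x + y) (ap T (x + y)) - cinner (x - y) (ap T (x - y))
    + \<i> * cinner (x + \<i> *\<^sub>C y) (ap T (x + \<i> *\<^sub>C y)) - \<i> * cinner (x - \<i> *\<^sub>C y) (ap T (x - \<i> *\<^sub>C y))"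
      by (simp add: cinner_algebra algebra_simps)
    then show ?thesis unfolding polarization r by simp
  qed
  then show "cinner (ap T x) y = cinner x (ap T y)" by simp
qed

lemma pos_star: "pos T \<Longrightarrow> star T = T"
  by (rule star_eq_if_real) (simp add: pos_iff)

lemma Im_cinner_sa: "star T = T \<Longrightarrow> Im (cinner (ap T x) x) = 0"
  using cinner_star_right[of x T x] cinner_commute[of x "ap T x"] by (simp add: complex_eq_iff)

lemma posI: "star T = T \<Longrightarrow> (\<And>x. 0 \<le> Re (cinner (ap T x) x)) \<Longrightarrow> pos T"
  by (simp add: pos_iff Im_cinner_sa)

lemma pos_zero [simp]: "pos 0" by (simp add: pos_iff)
lemma pos_one [simp]: "pos 1" by (simp add: pos_iff cinner_self)
lemma pos_add: "pos S \<Longrightarrow> pos T \<Longrightarrow> pos (S + T)"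
  by (simp add: pos_iff cinner_algebra)
lemma pos_scaleR: "0 \<le> r \<Longrightarrow> pos T \<Longrightarrow> pos (r *\<^sub>R T)"
  by (simp add: pos_iff cinner_algebra)
lemma pos_conj: "pos P \<Longrightarrow> pos (star Y * P * Y)"
  by (simp add: pos_iff cinner_star_left)
lemma pos_star_mult [simp]: "pos (star Y * Y)"
  using pos_conj[OF pos_one, of Y] by simp
lemma pos_mult_star [simp]: "pos (Y * star Y)"
  using pos_star_mult[of "star Y"] by simp
lemma pos_power: assumes "pos C" shows "pos (C ^ n)"
proof (cases "even n")
  case True
  then obtain k where "n = k + k" by (metis evenE mult_2)
  then show ?thesis using pos_star_mult[of "C ^ k"] by (simp add: power_add pos_star assms)
next
  case False
  then obtain k where "n = k + 1 + k" by (metis oddE mult_2 add.commute add.assoc)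
  then show ?thesis using pos_conj[OF assms, of "C ^ k"]
    by (simp only: power_add) (simp add: pos_star assms)
qed

text \<open>For self-adjoint operators the numerical radius is the norm. Polarization bounds
  \<open>Re (cinner (ap S x) y)\<close> through the form at \<open>x + y\<close> and
  \<open>x - y\<close>; the test vector is the multiple of \<open>ap S x\<close> that has the norm
  of \<open>x\<close>.\<close>

lemma norm_sa_le:
  assumes S: "star S = S" and K: "0 \<le> K" "\<And>x. \<bar>Re (cinner (ap S x) x)\<bar> \<le> K * (norm x)\<^sup>2"
  shows "norm S \<le> K"
proof (rule norm_cop_leI[OF K(1)])
  fix x
  have key: "2 * Re (cinner (ap S x) y) \<le> K * ((norm x)\<^sup>2 + (norm y)\<^sup>2)" for x y
  proof -
    have "cinner (ap S y) x = cnj (cinner (ap S x) y)"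
      by (metis S cinner_commute cinner_star_right)
    then have "4 * Re (cinner (ap S x) y) = Re (cinner (ap S (x + y)) (x + y)) - Re (cinner (ap S (x - y)) (x - y))"
      by (simp add: cinner_algebra)
    also have "\<dots> \<le> K * (norm (x + y))\<^sup>2 + K * (norm (x - y))\<^sup>2"
      using K(2)[of "x + y"] K(2)[of "x - y"] by simp
    also have "\<dots> = 2 * (K * ((norm x)\<^sup>2 + (norm y)\<^sup>2))"
      unfolding power2_norm_eq_inner by (simp add: inner_add inner_diff algebra_simps inner_commute)
    finally show ?thesis by simp
  qed
  show "norm (ap S x) \<le> K * norm x"
  proof (cases "ap S x = 0 \<or> x = 0")
    case False
    define y where "y = (norm x / norm (ap S x)) *\<^sub>R ap S x"
    have "norm y = norm x" using False by (simp add: y_def)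
    moreover have "Re (cinner (ap S x) y) = norm x * norm (ap S x)"
      using False by (simp add: y_def cinner_algebra cinner_self power2_eq_square)
    ultimately have "norm x * norm (ap S x) \<le> K * (norm x)\<^sup>2" using key[of x y] by simp
    then show ?thesis using False by (simp add: power2_eq_square mult_ac)
  qed (use K in auto)
qed

lemma Re_cinner_le: "\<bar>Re (cinner (ap T x) x)\<bar> \<le> norm T * (norm x)\<^sup>2"
proof -
  have "\<bar>Re (cinner (ap T x) x)\<bar> \<le> norm (ap T x) * norm x"
    using abs_Re_le_cmod cinner_Cauchy_Schwarz order_trans by blast
  also have "\<dots> \<le> norm T * norm x * norm x" by (intro mult_right_mono norm_ap) simp
  finally show ?thesis by (simp add: power2_eq_square mult_ac)
qed

lemma pos_norm_minus: "star S = S \<Longrightarrow> norm S \<le> c \<Longrightarrow> pos (c *\<^sub>R 1 - S)"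
proof (rule posI)
  fix x assume "norm S \<le> c"
  then have "Re (cinner (ap S x) x) \<le> c * (norm x)\<^sup>2"
    using Re_cinner_le[of S x] by (meson abs_le_D1 mult_right_mono order_trans zero_le_power2)
  then show "0 \<le> Re (cinner (ap (c *\<^sub>R 1 - S) x) x)"
    by (simp add: cinner_algebra cinner_self)
qed simp

lemma pos_norm_le: "pos P \<Longrightarrow> pos (c *\<^sub>R 1 - P) \<Longrightarrow> 0 \<le> c \<Longrightarrow> norm P \<le> c"
  by (rule norm_sa_le) (auto simp: pos_star pos_iff cinner_algebra cinner_self)

lemma norm_star_mult_self: "norm (star X * X) = (norm X)\<^sup>2"
proof (rule antisym)
  show "norm (star X * X) \<le> (norm X)\<^sup>2"
    using norm_mult_ineq[of "star X" X] by (simp add: power2_eq_square)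
  have "norm X \<le> sqrt (norm (star X * X))"
  proof (rule norm_cop_leI)
    fix x
    have "(norm (ap X x))\<^sup>2 = Re (cinner (ap (star X * X) x) x)"
      by (simp add: cinner_star_left cinner_self)
    also have "\<dots> \<le> norm (star X * X) * (norm x)\<^sup>2"
      using Re_cinner_le[of "star X * X" x] by simp
    finally show "norm (ap X x) \<le> sqrt (norm (star X * X)) * norm x"
      by (metis norm_ge_zero real_le_rsqrt real_sqrt_abs abs_norm_cancel real_sqrt_mult)
  qed simp
  then show "(norm X)\<^sup>2 \<le> norm (star X * X)"
    by (metis norm_ge_zero real_sqrt_ge_0_iff real_sqrt_pow2 power_mono)
qed

text \<open>Von Neumann algebras and commutants of single operators are examples; the functional calculus
  of a self-adjoint element never leaves such a set.\<close>

definition closed_subalgebra :: "'h::complex_hilbert_space cop set \<Rightarrow> bool" where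
  "closed_subalgebra N \<longleftrightarrow> closed N \<and> (\<forall>c. sc c \<in> N) \<and> (\<forall>S\<in>N. \<forall>T\<in>N. S + T \<in> N \<and> S * T \<in> N)"

lemma csubD:
  assumes "closed_subalgebra N"
  shows csub_closed: "closed N" and csub_sc: "sc c \<in> N" and csub_one: "1 \<in> N" and csub_zero: "0 \<in> N"
    and csub_add: "S \<in> N \<Longrightarrow> T \<in> N \<Longrightarrow> S + T \<in> N"
    and csub_mult: "S \<in> N \<Longrightarrow> T \<in> N \<Longrightarrow> S * T \<in> N"
    and csub_scaleR: "T \<in> N \<Longrightarrow> r *\<^sub>R T \<in> N"
    and csub_uminus: "T \<in> N \<Longrightarrow> - T \<in> N"
    and csub_diff: "S \<in> N \<Longrightarrow> T \<in> N \<Longrightarrow> S - T \<in> N"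
proof -
  show 1: "closed N" "\<And>c. sc c \<in> N" "\<And>S T. S \<in> N \<Longrightarrow> T \<in> N \<Longrightarrow> S + T \<in> N" "\<And>S T. S \<in> N \<Longrightarrow> T \<in> N \<Longrightarrow> S * T \<in> N"
    using assms by (auto simp: closed_subalgebra_def)
  show "1 \<in> N" "0 \<in> N" using 1(2)[of 1] 1(2)[of 0] by auto
  show 2: "r *\<^sub>R T \<in> N" if "T \<in> N" for r T
    using 1(4)[OF 1(2)[of "of_real r"] that] by (simp add: sc_of_real_times)
  show 3: "- T \<in> N" if "T \<in> N" for T using 2[OF that, of "-1"] by simp
  show "S - T \<in> N" if "S \<in> N" "T \<in> N" for S T using 1(3)[OF that(1) 3[OF that(2)]] by simp
qed

lemma csub_power: "closed_subalgebra N \<Longrightarrow> T \<in> N \<Longrightarrow> T ^ n \<in> N"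
  by (induction n) (auto intro: csubD)

lemma csub_sum: "closed_subalgebra N \<Longrightarrow> (\<And>i. i \<in> A \<Longrightarrow> f i \<in> N) \<Longrightarrow> sum f A \<in> N"
  by (induction A rule: infinite_finite_induct) (auto intro: csubD)

lemma csub_lim: "closed_subalgebra N \<Longrightarrow> (\<And>n. X n \<in> N) \<Longrightarrow> X \<longlonglongrightarrow> L \<Longrightarrow> L \<in> N"
  using closed_sequentially csub_closed by blast

lemma csub_sums: "closed_subalgebra N \<Longrightarrow> (\<And>n. X n \<in> N) \<Longrightarrow> X sums L \<Longrightarrow> L \<in> N"
  unfolding sums_def using csub_lim[of N "\<lambda>n. sum X {..<n}"] csub_sum[of N _ X] by blast

lemma csub_commutant: "closed_subalgebra {X. X * B = B * X}"
proof -
  have "closed {X. X * B = B * X}" by (intro closed_Collect_eq continuous_intros)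
  moreover have "X * Y * B = B * (X * Y)" if "X * B = B * X" "Y * B = B * Y" for X Y
    by (metis that mult.assoc)
  ultimately show ?thesis
    unfolding closed_subalgebra_def by (auto simp: sc_commute algebra_simps)
qed

lemma csub_UNIV: "closed_subalgebra UNIV"
  by (simp add: closed_subalgebra_def)

section \<open>Square roots and absolute values\<close>

text \<open>The Taylor coefficients of \<open>sqrt (1 - x)\<close>. They are absolutely summable, so
  the series may be evaluated at operators of norm exactly \<open>1\<close>, which occur when the
  positive operator is not invertible.\<close>

definition sqrt_coeff :: "nat \<Rightarrow> real" where
  "sqrt_coeff n = ((1/2) gchoose n) * (-1) ^ n"

lemma sqrt_coeff_0 [simp]: "sqrt_coeff 0 = 1"
  by (simp add: sqrt_coeff_def)

lemma sqrt_coeff_Suc: "sqrt_coeff (Suc n) = sqrt_coeff n * (real n - 1/2) / real (Suc n)"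
proof -
  have "real (Suc n) * ((1/2) gchoose Suc n) = (1/2 - real n) * ((1/2) gchoose n)"
    using gbinomial_mult_1[of "1/2::real" n] by (simp add: algebra_simps)
  then have "((1/2) gchoose Suc n) = (1/2 - real n) * ((1/2) gchoose n) / real (Suc n)"
    by (metis nonzero_mult_div_cancel_left of_nat_eq_0_iff nat.distinct(1))
  then show ?thesis by (simp add: sqrt_coeff_def algebra_simps)
qed

lemma sqrt_coeff_nonpos: "sqrt_coeff (Suc n) \<le> 0"
proof (induction n)
  case (Suc n)
  then have "sqrt_coeff (Suc n) * (real (Suc n) - 1/2) \<le> 0" by (simp add: mult_nonpos_nonneg)
  then show ?case by (subst sqrt_coeff_Suc) (simp add: divide_nonpos_pos)
qed (simp add: sqrt_coeff_Suc)

text \<open>The partial sums are the Taylor coefficients of \<open>sqrt (1 - x) / (1 - x)\<close>,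
  that is of \<open>1 - x\<close> to the power \<open>-1/2\<close>, and these are positive.\<close>

lemma sum_sqrt_coeff_nonneg: "0 \<le> (\<Sum>k\<le>m. sqrt_coeff k)"
proof -
  have "(-1/2 gchoose m) * (-1) ^ m \<ge> (0::real)" for m
  proof (induction m)
    case (Suc m)
    define g h where "g = ((-1/2::real) gchoose m)" and "h = ((-1/2::real) gchoose Suc m)"
    have "real (Suc m) * h = (-1/2 - real m) * g"
      using gbinomial_mult_1[of "-1/2::real" m] unfolding g_def h_def by (simp add: algebra_simps)
    then have e: "h = (-1/2 - real m) * g / real (Suc m)"
      by (metis nonzero_mult_div_cancel_left of_nat_eq_0_iff nat.distinct(1))
    have "h * (-1) ^ Suc m = (g * (-1) ^ m) * ((1/2 + real m) / real (Suc m))"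
      unfolding e power_Suc by (simp add: field_simps)
    moreover have "0 \<le> (g * (-1) ^ m) * ((1/2 + real m) / real (Suc m))"
      by (rule mult_nonneg_nonneg) (use Suc in \<open>simp_all add: g_def\<close>)
    ultimately show ?case unfolding h_def by simp
  qed simp
  then show ?thesis
    using gbinomial_sum_lower_neg[of "1/2::real" m] by (simp add: sqrt_coeff_def mult.commute)
qed

lemma summable_sqrt_coeff: "summable (\<lambda>n. \<bar>sqrt_coeff n\<bar>)"
proof (rule bounded_imp_summable)
  fix m
  \<comment> \<open>All coefficients but the first, which is \<open>1\<close>, are
    nonpositive.\<close>
  have "(\<Sum>k\<le>m. \<bar>sqrt_coeff k\<bar>) = 2 - (\<Sum>k\<le>m. sqrt_coeff k)"
  proof (induction m)
    case (Suc m)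
    then show ?case using sqrt_coeff_nonpos[of m] by simp
  qed simp
  then show "(\<Sum>k\<le>m. \<bar>sqrt_coeff k\<bar>) \<le> 2" using sum_sqrt_coeff_nonneg[of m] by simp
qed simp

text \<open>The square of the series is \<open>1 - x\<close>, by Vandermonde's identity for the
  exponents \<open>1/2 + 1/2 = 1\<close>.\<close>

lemma sqrt_coeff_convolution:
  "(\<Sum>i\<le>k. sqrt_coeff i * sqrt_coeff (k - i)) = (if k = 0 then 1 else if k = 1 then -1 else 0)"
proof -
  have "(\<Sum>i\<le>k. sqrt_coeff i * sqrt_coeff (k - i)) = (-1) ^ k * (\<Sum>i\<le>k. ((1/2) gchoose i) * ((1/2) gchoose (k - i)))"
    unfolding sum_distrib_left
  proof (rule sum.cong)
    fix i assume "i \<in> {..k}"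
    then have "(-1::real) ^ k = (-1) ^ i * (-1) ^ (k - i)" by (simp add: power_add[symmetric])
    then show "sqrt_coeff i * sqrt_coeff (k - i) = (-1) ^ k * (((1/2) gchoose i) * ((1/2) gchoose (k - i)))"
      by (simp add: sqrt_coeff_def)
  qed simp
  also have "(\<Sum>i\<le>k. ((1/2::real) gchoose i) * ((1/2) gchoose (k - i))) = (1 gchoose k)"
    using gbinomial_Vandermonde[of "1/2::real" "1/2" k] by (simp add: atMost_atLeast0)
  also have "(1 gchoose k :: real) = of_nat (1 choose k)"
    by (simp add: binomial_gbinomial)
  finally show ?thesis by (cases k rule: nat.exhaust) (auto simp: binomial_eq_0)
qed

lemma pos_lim: assumes "\<And>n. pos (X n)" "X \<longlonglongrightarrow> L" shows "pos L"
proof -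
  have lim: "(\<lambda>n. cinner (ap (X n) x) x) \<longlonglongrightarrow> cinner (ap L x) x" for x
  proof -
    have "(\<lambda>n. ap (X n - L) x) \<longlonglongrightarrow> 0"
    proof (rule Lim_null_comparison)
      show "\<forall>\<^sub>F n in sequentially. norm (ap (X n - L) x) \<le> norm (X n - L) * norm x"
        by (intro always_eventually allI norm_ap)
      show "(\<lambda>n. norm (X n - L) * norm x) \<longlonglongrightarrow> 0"
        using assms(2) by (intro tendsto_mult_left_zero tendsto_norm_zero) (simp add: LIM_zero)
    qed
    then have "(\<lambda>n. ap (X n) x) \<longlonglongrightarrow> ap L x" by (simp add: LIM_zero_iff)
    then show ?thesis by (intro tendsto_cinner tendsto_const)
  qed
  have "Im (cinner (ap L x) x) = 0" for x
    using LIMSEQ_unique[OF tendsto_Im[OF lim[of x]], of 0] assms(1) by (simp add: pos_iff)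
  moreover have "0 \<le> Re (cinner (ap L x) x)" for x
    using assms(1) by (intro LIMSEQ_le_const[OF tendsto_Re[OF lim[of x]]]) (auto simp: pos_iff)
  ultimately show ?thesis by (simp add: pos_iff)
qed

text \<open>After scaling, \<open>A = c *\<^sub>R (1 - X)\<close> with
  \<open>0 \<le> X \<le> 1\<close>, and the series of \<open>sqrt (1 - x)\<close> is evaluated at
  \<open>X\<close>. The last conjunct replaces a functional calculus: it places the root in the
  given algebra, and applied to commutants it shows what the root commutes with.\<close>

lemma pos_sqrt_exists:
  assumes A: "pos A"
  shows "\<exists>S. pos S \<and> S * S = A \<and> (\<forall>N. closed_subalgebra N \<longrightarrow> A \<in> N \<longrightarrow> S \<in> N)"
proof (cases "A = 0")
  case True
  then show ?thesis by (intro exI[of _ 0]) (auto intro: csub_zero)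
next
  case False
  define c where "c = norm A"
  have c: "c > 0" using False by (simp add: c_def)
  define X where "X = 1 - (1/c) *\<^sub>R A"
  have Xpos: "pos X"
    using pos_scaleR[of "1/c", OF _ pos_norm_minus[OF pos_star[OF A], of c]] c
    by (simp add: X_def c_def algebra_simps)
  have nX: "norm X \<le> 1"
    by (rule pos_norm_le[OF Xpos]) (use c A in \<open>simp_all add: X_def pos_scaleR\<close>)
  have nXk: "norm (X ^ k) \<le> 1" for k
    using norm_power_cop_le[of X k] nX by (meson norm_ge_zero order_trans power_le_one)
  define f where "f n = sqrt_coeff n *\<^sub>R X ^ n" for n
  have sf: "summable (\<lambda>n. norm (f n))"
    by (rule summable_comparison_test'[OF summable_sqrt_coeff, of 0])
      (use nXk in \<open>auto simp: f_def mult_left_le\<close>)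
  define Q where "Q = (\<Sum>n. f n)"
  have fQ: "f sums Q" unfolding Q_def by (rule summable_sums) (rule summable_norm_cancel[OF sf])
  have "(\<lambda>k. \<Sum>i\<le>k. f i * f (k - i)) sums (Q * Q)"
    unfolding Q_def by (rule Cauchy_product_sums[OF sf sf])
  moreover have "(\<Sum>i\<le>k. f i * f (k - i)) = (\<Sum>i\<le>k. sqrt_coeff i * sqrt_coeff (k - i)) *\<^sub>R X ^ k" for k
    unfolding scaleR_sum_left by (rule sum.cong) (auto simp: f_def power_add[symmetric])
  ultimately have "(\<lambda>k. (if k = 0 then 1 else if k = 1 then -1 else 0) *\<^sub>R X ^ k) sums (Q * Q)"
    by (simp only: sqrt_coeff_convolution)
  moreover have "(\<lambda>k. (if k = 0 then 1 else if k = 1 then -1 else 0) *\<^sub>R X ^ k) sums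
      (\<Sum>k\<in>{0,1}. (if k = 0 then 1 else if k = 1 then -1 else 0) *\<^sub>R X ^ k)"
    by (rule sums_finite) auto
  ultimately have QQ: "Q * Q = 1 - X" by (simp add: sums_unique2)
  \<comment> \<open>Each nonconstant term is a nonpositive multiple of \<open>X ^ k \<le> 1\<close>,
    so the partial sum dominates the sum of its coefficients times \<open>1\<close>, which is
    nonnegative.\<close>
  have part: "pos (\<Sum>k<n. f k)" for n
  proof -
    have "pos ((\<Sum>k\<le>m. f k) - (\<Sum>k\<le>m. sqrt_coeff k) *\<^sub>R 1)" for m
    proof (induction m)
      case (Suc m)
      have "pos ((- sqrt_coeff (Suc m)) *\<^sub>R (1 - X ^ Suc m))"
        using sqrt_coeff_nonpos[of m] pos_norm_minus[OF pos_star[OF pos_power[OF Xpos]] nXk, of "Suc m"]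
        by (intro pos_scaleR) auto
      from pos_add[OF Suc this] show ?case by (simp add: f_def algebra_simps)
    qed (simp add: f_def)
    from pos_add[OF this pos_scaleR[OF sum_sqrt_coeff_nonneg pos_one]] have "pos (\<Sum>k\<le>m. f k)" for m
      by (metis diff_add_cancel)
    then show ?thesis by (cases n) (auto simp: lessThan_Suc_atMost)
  qed
  have Qpos: "pos Q" by (rule pos_lim[OF part]) (use fQ in \<open>simp add: sums_def\<close>)
  have QN: "Q \<in> N" if N: "closed_subalgebra N" "A \<in> N" for N
  proof (rule csub_sums[OF N(1) _ fQ])
    have "X \<in> N" unfolding X_def using N by (intro csub_diff csub_one csub_scaleR)
    then show "f n \<in> N" for n unfolding f_def using N by (intro csub_scaleR csub_power)
  qed
  show ?thesis
  proof (intro exI conjI allI impI)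
    show "pos (sqrt c *\<^sub>R Q)" using Qpos c by (simp add: pos_scaleR)
    show "(sqrt c *\<^sub>R Q) * (sqrt c *\<^sub>R Q) = A" using c by (simp add: QQ X_def)
    show "sqrt c *\<^sub>R Q \<in> N" if "closed_subalgebra N" "A \<in> N" for N
      using that QN by (intro csub_scaleR) auto
  qed
qed

definition op_sqrt :: "'h::complex_hilbert_space cop \<Rightarrow> 'h cop" where
  "op_sqrt A = (SOME S. pos S \<and> S * S = A \<and> (\<forall>N. closed_subalgebra N \<longrightarrow> A \<in> N \<longrightarrow> S \<in> N))"

lemma
  assumes "pos A"
  shows pos_op_sqrt: "pos (op_sqrt A)"
    and op_sqrt_square: "op_sqrt A * op_sqrt A = A"
    and csub_op_sqrt: "closed_subalgebra N \<Longrightarrow> A \<in> N \<Longrightarrow> op_sqrt A \<in> N"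
  using someI_ex[OF pos_sqrt_exists[OF assms]] unfolding op_sqrt_def by blast+

text \<open>The form is the squared norm of \<open>ap (op_sqrt C) x\<close>.\<close>

lemma pos_form_zero: assumes "pos C" "Re (cinner (ap C x) x) \<le> 0" shows "ap C x = 0"
proof -
  let ?S = "op_sqrt C"
  have "C = star ?S * ?S" by (simp add: op_sqrt_square pos_star pos_op_sqrt assms(1))
  then have "ap C x = ap (star ?S) (ap ?S x)" by (metis ap_times)
  then have "(norm (ap ?S x))\<^sup>2 \<le> 0" using assms(2) by (simp add: cinner_star_left cinner_self)
  then have "ap ?S x = 0" by simp
  then show ?thesis using \<open>ap C x = _\<close> by simp
qed

lemma pos_antisym: assumes "pos C" "pos (- C)" shows "C = 0"
  by (rule cop_eqI) (use pos_form_zero[OF assms(1)] pos_Re[OF assms(2)] in \<open>simp add: cinner_minus_left\<close>)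

lemma sa_square_zero: "star D = D \<Longrightarrow> D * D = 0 \<Longrightarrow> D = 0"
  using norm_star_mult_self[of D] by simp

text \<open>With \<open>T = op_sqrt A\<close>, which commutes with \<open>S\<close>, the difference
  \<open>D = S - T\<close> satisfies \<open>(S + T) * D = 0\<close>. Hence the positive operators
  \<open>D * S * D\<close> and \<open>D * T * D\<close> add up to zero, so both vanish, and so does
  their difference \<open>D * D * D\<close>.\<close>

lemma pos_sqrt_unique:
  assumes "pos S" "S * S = A"
  shows "S = op_sqrt A"
proof -
  define T where "T = op_sqrt A"
  have A: "pos A" using pos_star_mult[of S] assms by (simp add: pos_star)
  have T: "pos T" "T * T = A" by (simp_all add: T_def pos_op_sqrt op_sqrt_square A)
  have "A * S = S * A" using assms(2) by (metis mult.assoc)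
  then have "T \<in> {X. X * S = S * X}"
    unfolding T_def by (intro csub_op_sqrt[OF A csub_commutant]) simp
  then have comm: "T * S = S * T" by simp
  define D where "D = S - T"
  have D: "star D = D" by (simp add: D_def pos_star assms T)
  have z: "(S + T) * D = 0" by (simp add: D_def algebra_simps comm assms T)
  have "D * S * D + D * T * D = D * ((S + T) * D)" by (simp add: algebra_simps)
  then have 1: "D * S * D + D * T * D = 0" by (simp add: z)
  have p: "pos (D * S * D)" "pos (D * T * D)"
    using pos_conj[OF assms(1), of D] pos_conj[OF T(1), of D] by (simp_all add: D)
  moreover have "D * T * D = - (D * S * D)" using 1 by (simp add: eq_neg_iff_add_eq_0 add.commute)
  ultimately have "D * S * D = 0" "D * T * D = 0"
    using pos_antisym[of "D * S * D"] pos_antisym[of "D * T * D"] by (simp_all only: minus_minus)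
  moreover have "D * D * D = D * S * D - D * T * D"
    by (subst (2) D_def) (simp add: algebra_simps)
  ultimately have "D * D * D = 0" by simp
  then have "(D * D) * (D * D) = 0" by (metis mult.assoc mult_zero_left)
  moreover have "star (D * D) = D * D" by (simp add: D)
  ultimately have "D * D = 0" using sa_square_zero by blast
  then have "D = 0" using D sa_square_zero by blast
  then show ?thesis by (simp add: D_def T_def)
qed

lemma abs_op_ap: "abs_op (ap X) = ap (op_sqrt (star X * X))"
proof -
  have "positive_op S \<and> S \<circ> S = cadjoint (ap X) \<circ> ap X \<longleftrightarrow> S = ap (op_sqrt (star X * X))" for S
  proof
    assume S: "positive_op S \<and> S \<circ> S = cadjoint (ap X) \<circ> ap X"
    then have "bounded_op S" by (simp add: positive_op_def)
    then have S': "ap (Op S) = S" by simp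
    then have "pos (Op S)" using S by (simp add: pos_def)
    moreover have "Op S * Op S = star X * X"
      by (rule cop_eqI) (use S in \<open>simp add: S' ap_star fun_eq_iff\<close>)
    ultimately show "S = ap (op_sqrt (star X * X))" using pos_sqrt_unique S' by metis
  next
    assume "S = ap (op_sqrt (star X * X))"
    moreover have "ap (op_sqrt (star X * X)) (ap (op_sqrt (star X * X)) x) = cadjoint (ap X) (ap X x)" for x
      by (metis ap_times ap_star op_sqrt_square pos_star_mult)
    ultimately show "positive_op S \<and> S \<circ> S = cadjoint (ap X) \<circ> ap X"
      using pos_op_sqrt[OF pos_star_mult, of X] by (auto simp: pos_def)
  qed
  then show ?thesis by (simp add: abs_op_def)
qed

section \<open>Existence of the spectral resolution\<close>

text \<open>The real Riesz argument on the kernel yields the orthogonal projection onto it; this map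
  is complex linear because the kernel is invariant under \<open>\<i>\<close>.\<close>

lemma kernel_projection_exists:
  fixes B :: "'h::complex_hilbert_space cop"
  shows "\<exists>P. star P = P \<and> P * P = P \<and> B * P = 0 \<and> (\<forall>x. ap B x = 0 \<longrightarrow> ap P x = x)"
proof -
  define K where "K = {x. ap B x = 0}"
  have K: "subspace K" by (auto simp: K_def subspace_def)
  have Kc: "c *\<^sub>C h \<in> K" if "h \<in> K" for c h using that by (simp add: K_def)
  have "closed K" unfolding K_def
    by (intro closed_Collect_eq continuous_intros linear_continuous_on bounded_linear_ap)
  then have "\<exists>y\<in>K. \<forall>h\<in>K. inner h x = inner h y" for x
    by (intro riesz_on_subspace bounded_linear_inner_left K)
  then obtain p where p: "\<And>x. p x \<in> K" "\<And>x h. h \<in> K \<Longrightarrow> inner h x = inner h (p x)" by metis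
  have pc: "cinner h x = cinner h (p x)" if h: "h \<in> K" for h x
  proof (rule complex_eqI)
    show "Re (cinner h x) = Re (cinner h (p x))" using p(2)[OF h] by (simp add: Re_cinner)
    have "Re (cinner (\<i> *\<^sub>C h) x) = Re (cinner (\<i> *\<^sub>C h) (p x))"
      using p(2)[OF Kc[OF h]] by (simp only: Re_cinner)
    then show "Im (cinner h x) = Im (cinner h (p x))" by (simp add: cinner_scaleC_left)
  qed
  have uniq: "y = p x" if y: "y \<in> K" "\<And>h. h \<in> K \<Longrightarrow> cinner h x = cinner h y" for x y
  proof -
    have m: "y - p x \<in> K" using y(1) p(1) K by (intro subspace_diff)
    have "cinner (y - p x) (y - p x) = 0"
      unfolding cinner_diff_right[of _ y] using y(2)[OF m] pc[OF m, of x] by simp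
    then show ?thesis by (simp add: cinner_self)
  qed
  have id: "p x = x" if "x \<in> K" for x using uniq[OF that] by simp
  have "bounded_op p"
  proof (rule bounded_opI)
    show "p (x + y) = p x + p y" for x y
      using p(1) by (intro uniq[symmetric]) (simp_all add: pc[symmetric] subspace_add[OF K] cinner_add_right)
    show "p (c *\<^sub>C x) = c *\<^sub>C p x" for c x
      using p(1) by (intro uniq[symmetric]) (simp_all add: pc[symmetric] Kc cinner_scaleC_right)
    show "norm (p x) \<le> norm x * 1" for x
    proof -
      have "(norm (p x))\<^sup>2 = cmod (cinner (p x) x)"
        using pc[OF p(1)[of x], of x] by (simp add: cinner_self norm_power)
      also have "\<dots> \<le> norm (p x) * norm x" by (rule cinner_Cauchy_Schwarz)
      finally show ?thesis by (cases "norm (p x) = 0") (auto simp: power2_eq_square)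
    qed
  qed
  then have P: "ap (Op p) = p" by simp
  show ?thesis
  proof (intro exI conjI allI impI)
    show "star (Op p) = Op p"
    proof (rule cop_star_eqI)
      fix x y
      have "cinner (p x) y = cinner (p x) (p y)" using pc[OF p(1)] by simp
      also have "\<dots> = cnj (cinner (p y) (p x))" by (rule cinner_commute)
      also have "\<dots> = cnj (cinner (p y) x)" using pc[OF p(1)[of y], of x] by simp
      also have "\<dots> = cinner x (p y)" by (rule cinner_commute[symmetric])
      finally show "cinner (ap (Op p) x) y = cinner x (ap (Op p) y)" by (simp add: P)
    qed
    show "Op p * Op p = Op p" by (rule cop_eqI) (simp add: P id p(1))
    show "B * Op p = 0" by (rule cop_eqI) (use p(1) in \<open>simp add: P K_def\<close>)
    show "ap (Op p) x = x" if "ap B x = 0" for x using that by (simp add: P id K_def)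
  qed
qed

text \<open>\<open>P\<close> is the projection onto the kernel of the positive part of \<open>B\<close>.\<close>

lemma spectral_cut:
  fixes B :: "'h::complex_hilbert_space cop"
  assumes B: "star B = B"
  shows "\<exists>P. star P = P \<and> P * P = P \<and> pos (- (B * P)) \<and> pos (B * (1 - P)) \<and>
    (\<forall>x. ap (B * (1 - P)) x = 0 \<longrightarrow> ap P x = x) \<and>
    (\<forall>X. star X = X \<longrightarrow> X * B = B * X \<longrightarrow> X * P = P * X)"
proof -
  define M where "M = op_sqrt (B * B)"
  have BB: "pos (B * B)" using pos_star_mult[of B] by (simp add: B)
  have M: "pos M" "M * M = B * B" by (simp_all add: M_def pos_op_sqrt op_sqrt_square BB)
  have Mcomm: "M * X = X * M" if "X * B = B * X" for X
  proof -
    have "(B * B) * X = X * (B * B)" by (metis that mult.assoc)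
    then have "M \<in> {Y. Y * X = X * Y}"
      unfolding M_def by (intro csub_op_sqrt[OF BB csub_commutant]) simp
    then show ?thesis by simp
  qed
  have MB: "M * B = B * M" by (rule Mcomm) simp
  define Bp where "Bp = (1/2) *\<^sub>R (M + B)"
  define Bm where "Bm = (1/2) *\<^sub>R (M - B)"
  have sa: "star Bp = Bp" "star Bm = Bm" by (simp_all add: Bp_def Bm_def B pos_star M)
  have "Bp * Bm = 0" by (simp add: Bp_def Bm_def algebra_simps M MB)
  have eqs: "Bp - Bm = B" "Bp + Bm = M"
    by (simp_all add: Bp_def Bm_def algebra_simps flip: scaleR_add_left)
  from kernel_projection_exists[of Bp] obtain P where
    P: "star P = P" "P * P = P" "Bp * P = 0" "\<And>x. ap Bp x = 0 \<Longrightarrow> ap P x = x" by blast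
  \<comment> \<open>\<open>Bp * Bm = 0\<close> puts the range of \<open>Bm\<close> into the kernel
    of \<open>Bp\<close>.\<close>
  have PBm: "P * Bm = Bm"
    by (rule cop_eqI) (use P(4) \<open>Bp * Bm = 0\<close> in \<open>metis ap_times ap_zero\<close>)
  have BmP: "Bm * P = Bm" using arg_cong[OF PBm, of star] by (simp add: sa P)
  have BP: "B * P = - Bm" by (simp add: eqs(1)[symmetric] left_diff_distrib P BmP)
  have MP: "M * P = Bm" by (simp add: eqs(2)[symmetric] distrib_right P BmP)
  have PM: "P * M = Bm" using arg_cong[OF MP, of star] by (simp add: sa P pos_star M)
  have "pos (star P * M * P)" by (rule pos_conj) (rule M)
  then have Bm: "pos Bm" by (simp add: P PM BmP)
  have "pos (star (1 - P) * M * (1 - P))" by (rule pos_conj) (rule M)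
  moreover have "star (1 - P) * M * (1 - P) = M - P * M - M * P + P * (M * P)"
    by (simp add: P algebra_simps)
  then have "star (1 - P) * M * (1 - P) = M - Bm" by (simp only: PM MP PBm) simp
  then have "star (1 - P) * M * (1 - P) = Bp" using eqs(2) by (simp add: diff_eq_eq)
  ultimately have Bp: "pos Bp" by simp
  have BQ: "B * (1 - P) = Bp" using eqs(1) by (simp add: right_diff_distrib BP algebra_simps)
  show ?thesis
  proof (intro exI conjI allI impI)
    show "star P = P" "P * P = P" by (fact P)+
    show "pos (- (B * P))" by (simp add: BP Bm)
    show "pos (B * (1 - P))" by (simp add: BQ Bp)
    show "ap P x = x" if "ap (B * (1 - P)) x = 0" for x using that P(4) by (simp add: BQ del: ap_times)
    fix X assume X: "star X = X" "X * B = B * X"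
    \<comment> \<open>\<open>X\<close> maps the kernel of \<open>Bp\<close> into itself; being
      self-adjoint, it then commutes with the projection onto it.\<close>
    have "X * Bp = Bp * X" using Mcomm[OF X(2)] X(2) by (simp add: Bp_def algebra_simps)
    then have "Bp * (X * P) = 0" by (metis P(3) mult.assoc mult_zero_right)
    have XP: "P * (X * P) = X * P"
      by (rule cop_eqI) (use P(4) \<open>Bp * (X * P) = 0\<close> in \<open>metis ap_times ap_zero\<close>)
    then have "star (P * (X * P)) = star (X * P)" by simp
    then have "P * X * P = P * X" by (simp add: P X mult.assoc)
    with XP show "X * P = P * X" by (simp add: mult.assoc)
  qed
qed

lemma cinner_sum_left: "cinner (sum f I) y = (\<Sum>i\<in>I. cinner (f i) (y::'h::complex_hilbert_space))"
  by (induction I rule: infinite_finite_induct) (simp_all add: cinner_add_left)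

lemma star_sum: "star (sum f I) = (\<Sum>i\<in>I. star (f i))"
  by (induction I rule: infinite_finite_induct) simp_all

section \<open>Stieltjes sums\<close>

definition grid :: "real \<Rightarrow> nat \<Rightarrow> nat \<Rightarrow> real" where
  "grid r m i = - r + 2 * r * real i / real m"

lemma grid_0 [simp]: "grid r m 0 = - r"
  by (simp add: grid_def)
lemma grid_last [simp]: "0 < m \<Longrightarrow> grid r m m = r"
  by (simp add: grid_def)
lemma grid_mono: "0 \<le> r \<Longrightarrow> i \<le> j \<Longrightarrow> grid r m i \<le> grid r m j"
  by (simp add: grid_def divide_right_mono mult_left_mono)
lemma grid_Suc: "grid r m (Suc i) = grid r m i + 2 * r / real m"
  by (simp add: grid_def field_simps add_divide_distrib)

lemma grid_interval:
  assumes r: "0 < r" and m: "0 < m" and t: "- r < t" "t \<le> r"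
  obtains i where "i < m" "grid r m i < t" "t \<le> grid r m (Suc i)"
proof -
  have "\<exists>i<m. \<not> t \<le> grid r m i \<and> t \<le> grid r m (Suc i)"
    using ex_least_nat_less[of "\<lambda>i. t \<le> grid r m i" m] r m t by auto
  with that show ?thesis by force
qed

text \<open>The distribution function of a measure of mass \<open>K\<close> on the interval from
  \<open>- r\<close> to \<open>r\<close>. It serves twice: for the vector functionals of a spectral
  family, where \<open>K\<close> is \<open>(norm x)\<^sup>2\<close>, and for its trace, where
  \<open>K = 1\<close>.\<close>

locale stieltjes =
  fixes F :: "real \<Rightarrow> real" and r K :: real
  assumes F_mono: "\<And>s t. s \<le> t \<Longrightarrow> F s \<le> F t"
    and F_rc: "\<And>t. (F \<longlongrightarrow> F t) (at_right t)"
    and r_pos: "0 < r"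
    and F_low: "\<And>t. t \<le> - r \<Longrightarrow> F t = 0"
    and F_high: "\<And>t. r \<le> t \<Longrightarrow> F t = K"
begin

abbreviation "M \<equiv> interval_measure F"

lemma emeasure_Ioc: "a \<le> b \<Longrightarrow> emeasure M {a<..b} = ennreal (F b - F a)"
  using F_mono F_rc by (intro emeasure_interval_measure_Ioc) (auto simp: continuous_within)

lemma K_nonneg: "0 \<le> K"
  using F_mono[of "-r" r] F_low[of "-r"] F_high[of r] r_pos by simp

lemma AE_Ioc: "AE t in M. t \<in> {- r<..r}"
proof -
  have 1: "emeasure M (\<Union>n::nat. {- r - real n<..- r}) = 0"
    by (rule emeasure_UN_eq_0) (auto simp: emeasure_Ioc F_low)
  have 2: "emeasure M (\<Union>n::nat. {r<..r + real n}) = 0"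
    by (rule emeasure_UN_eq_0) (auto simp: emeasure_Ioc F_high)
  have "(\<Union>n::nat. {- r - real n<..- r}) \<in> null_sets M" "(\<Union>n::nat. {r<..r + real n}) \<in> null_sets M"
    using 1 2 by (auto intro!: null_setsI)
  from AE_not_in[OF this(1)] AE_not_in[OF this(2)]
  show ?thesis
  proof eventually_elim
    case (elim t)
    obtain n :: nat where n: "\<bar>t\<bar> + r < real n" using reals_Archimedean2 by blast
    have "t \<notin> {- r - real n<..- r}" "t \<notin> {r<..r + real n}" using elim by blast+
    then show ?case using n r_pos by auto
  qed
qed

lemma emeasure_UNIV: "emeasure M UNIV = ennreal K"
proof -
  have "emeasure M UNIV = emeasure M {- r<..r}"
    by (rule emeasure_eq_AE) (use AE_Ioc in auto)
  then show ?thesis using r_pos by (simp add: emeasure_Ioc F_low F_high)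
qed

sublocale finite_measure M
  by standard (simp add: emeasure_UNIV space_interval_measure)

lemma measure_Ioc: "a \<le> b \<Longrightarrow> measure M {a<..b} = F b - F a"
  using emeasure_Ioc F_mono by (simp add: measure_def)

lemma measure_UNIV: "measure M UNIV = K"
  using emeasure_UNIV K_nonneg by (simp add: measure_def)

lemma integrable_bounded:
  fixes g :: "real \<Rightarrow> real"
  assumes "g \<in> borel_measurable borel" "\<And>t. \<bar>t\<bar> \<le> r \<Longrightarrow> \<bar>g t\<bar> \<le> B"
  shows "integrable M g"
proof (rule integrable_const_bound[where B=B])
  show "AE t in M. norm (g t) \<le> B" using AE_Ioc by eventually_elim (auto intro!: assms(2))
qed (use assms(1) in simp)

text \<open>The sums take right endpoints because the measure of the half-open cell
  \<open>{s<..t}\<close> is \<open>F t - F s\<close>. The integrand differs from the resulting step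
  function by at most its oscillation \<open>e\<close> over one mesh width.\<close>

lemma integral_sum_bound:
  fixes g :: "real \<Rightarrow> real"
  assumes g: "g \<in> borel_measurable borel" "\<And>t. \<bar>t\<bar> \<le> r \<Longrightarrow> \<bar>g t\<bar> \<le> B" and m: "0 < m"
    and e: "\<And>s t. \<lbrakk>\<bar>s\<bar> \<le> r; \<bar>t\<bar> \<le> r; \<bar>s - t\<bar> \<le> 2 * r / real m\<rbrakk> \<Longrightarrow> \<bar>g s - g t\<bar> \<le> e"
  shows "\<bar>(\<integral>t. g t \<partial>M) - (\<Sum>i<m. g (grid r m (Suc i)) * (F (grid r m (Suc i)) - F (grid r m i)))\<bar> \<le> e * K"
proof -
  define h where "h t = (\<Sum>i<m. g (grid r m (Suc i)) * indicator {grid r m i<..grid r m (Suc i)} t)" for t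
  have ih: "integrable M (\<lambda>t. g (grid r m (Suc i)) * indicator {grid r m i<..grid r m (Suc i)} t)" for i
    by (intro integrable_mult_right integrable_real_indicator) (auto simp: emeasure_eq_measure)
  have "(\<integral>t. h t \<partial>M) = (\<Sum>i<m. g (grid r m (Suc i)) * measure M {grid r m i<..grid r m (Suc i)})"
    unfolding h_def using ih by (subst Bochner_Integration.integral_sum) auto
  also have "\<dots> = (\<Sum>i<m. g (grid r m (Suc i)) * (F (grid r m (Suc i)) - F (grid r m i)))"
    using r_pos by (intro sum.cong refl) (simp add: measure_Ioc grid_mono)
  finally have hi: "(\<integral>t. h t \<partial>M) = \<dots>" .
  have hint: "integrable M h" unfolding h_def using ih by (intro Bochner_Integration.integrable_sum)
  have gint: "integrable M g" by (rule integrable_bounded[OF g])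
  have close: "\<bar>g t - h t\<bar> \<le> e" if t: "t \<in> {- r<..r}" for t
  proof -
    obtain i where i: "i < m" "grid r m i < t" "t \<le> grid r m (Suc i)"
      using grid_interval[OF r_pos m] t by auto
    have "indicator {grid r m j<..grid r m (Suc j)} t = (if j = i then 1 else 0 :: real)" for j
    proof (cases j i rule: linorder_cases)
      case less
      then have "grid r m (Suc j) \<le> grid r m i" using r_pos by (intro grid_mono) auto
      then show ?thesis using less i by (auto simp: indicator_def)
    next
      case greater
      then have "grid r m (Suc i) \<le> grid r m j" using r_pos by (intro grid_mono) auto
      then show ?thesis using greater i by (auto simp: indicator_def)
    qed (use i in auto)
    then have "h t = (\<Sum>j<m. if j = i then g (grid r m (Suc j)) else 0)"
      unfolding h_def by (intro sum.cong refl) auto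
    then have h: "h t = g (grid r m (Suc i))" using i(1) by simp
    have "grid r m (Suc i) \<le> grid r m m" using i(1) r_pos by (intro grid_mono) auto
    moreover have "grid r m 0 \<le> grid r m (Suc i)" using r_pos by (intro grid_mono) auto
    ultimately show ?thesis unfolding h using i t m by (intro e) (auto simp: grid_Suc abs_le_iff)
  qed
  have "\<bar>(\<integral>t. g t \<partial>M) - (\<integral>t. h t \<partial>M)\<bar> = \<bar>\<integral>t. g t - h t \<partial>M\<bar>"
    using gint hint by simp
  also have "\<dots> \<le> (\<integral>t. \<bar>g t - h t\<bar> \<partial>M)" by (rule integral_abs_bound)
  also have "\<dots> \<le> (\<integral>t. e \<partial>M)"
  proof (rule integral_mono_AE)
    show "AE t in M. \<bar>g t - h t\<bar> \<le> e" using AE_Ioc by eventually_elim (rule close)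
  qed (use gint hint in auto)
  also have "\<dots> = e * K" by (simp add: measure_UNIV space_interval_measure)
  finally show ?thesis by (simp add: hi)
qed

lemma integral_id_bound:
  assumes m: "0 < m"
  shows "\<bar>(\<integral>t. t \<partial>M) - (\<Sum>i<m. grid r m (Suc i) * (F (grid r m (Suc i)) - F (grid r m i)))\<bar> \<le> 2 * r / real m * K"
  by (rule integral_sum_bound[where B=r]) (use m in auto)

lemma integral_sum_tendsto:
  fixes g :: "real \<Rightarrow> real"
  assumes g: "continuous_on UNIV g"
  shows "(\<lambda>m. \<Sum>i<m. g (grid r m (Suc i)) * (F (grid r m (Suc i)) - F (grid r m i))) \<longlonglongrightarrow> (\<integral>t. g t \<partial>M)"
proof (rule LIMSEQ_I)
  fix e :: real assume e: "e > 0"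
  define d where "d = e / (K + 1)"
  have d: "d > 0" "d * K < e" using e K_nonneg by (auto simp: d_def field_simps)
  have cg: "continuous_on {-r..r} g" using g by (rule continuous_on_subset) simp
  then have "uniformly_continuous_on {-r..r} g" by (rule compact_uniformly_continuous) simp
  then obtain \<delta> where \<delta>: "\<delta> > 0" "\<And>s t. \<lbrakk>s \<in> {-r..r}; t \<in> {-r..r}; dist t s < \<delta>\<rbrakk> \<Longrightarrow> dist (g t) (g s) < d"
    using d unfolding uniformly_continuous_on_def by metis
  have "compact (g ` {-r..r})" by (rule compact_continuous_image[OF cg]) simp
  then have "bounded (g ` {-r..r})" by (rule compact_imp_bounded)
  then obtain B where "\<forall>y\<in>g ` {-r..r}. norm y \<le> B" unfolding bounded_iff by blast
  then have B: "\<And>t. t \<in> {-r..r} \<Longrightarrow> \<bar>g t\<bar> \<le> B" by simp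
  obtain N :: nat where N: "2 * r / \<delta> < real N" using reals_Archimedean2 by blast
  show "\<exists>no. \<forall>m\<ge>no. norm ((\<Sum>i<m. g (grid r m (Suc i)) * (F (grid r m (Suc i)) - F (grid r m i))) - (\<integral>t. g t \<partial>M)) < e"
  proof (intro exI allI impI)
    fix m assume m: "Suc N \<le> m"
    have "2 * r / \<delta> < real m" using N m by linarith
    then have m2: "2 * r / real m < \<delta>" using m \<delta>(1) by (simp add: field_simps)
    have "\<bar>(\<integral>t. g t \<partial>M) - (\<Sum>i<m. g (grid r m (Suc i)) * (F (grid r m (Suc i)) - F (grid r m i)))\<bar> \<le> d * K"
    proof (rule integral_sum_bound[where B=B])
      show "g \<in> borel_measurable borel" using g by (rule borel_measurable_continuous_onI)
      show "\<bar>g s - g t\<bar> \<le> d" if "\<bar>s\<bar> \<le> r" "\<bar>t\<bar> \<le> r" "\<bar>s - t\<bar> \<le> 2 * r / real m" for s t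
        using \<delta>(2)[of t s] that m2 by (auto simp: dist_real_def abs_le_iff)
    qed (use B m in \<open>auto simp: abs_le_iff\<close>)
    then show "norm ((\<Sum>i<m. g (grid r m (Suc i)) * (F (grid r m (Suc i)) - F (grid r m i))) - (\<integral>t. g t \<partial>M)) < e"
      using d(2) by (simp add: abs_minus_commute)
  qed
qed

end

section \<open>Spectral resolutions\<close>

definition spectral_family :: "(real \<Rightarrow> 'h::complex_hilbert_space cop) \<Rightarrow> 'h cop \<Rightarrow> bool" where
  "spectral_family E A \<longleftrightarrow> resolution_of (\<lambda>t. ap (E t)) (ap A)"

lemma projection_ap: "projection (ap P) \<longleftrightarrow> star P = P \<and> P * P = P"
proof -
  have "cadjoint (ap P) = ap P \<longleftrightarrow> star P = P" by (metis ap_star ap_inject)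
  moreover have "ap P \<circ> ap P = ap P \<longleftrightarrow> P * P = P"
    by (auto simp: fun_eq_iff intro!: cop_eqI) (metis ap_times)
  ultimately show ?thesis by (simp add: projection_def self_adjoint_def)
qed

lemma op_le_ap: "op_le (ap S) (ap T) \<longleftrightarrow> pos (T - S)"
proof -
  have "ap (T - S) = (\<lambda>x. ap T x - ap S x)" by (rule ext) simp
  then show ?thesis by (simp add: op_le_def pos_def)
qed

lemma spectral_family_iff:
  "spectral_family E A \<longleftrightarrow> (\<forall>t. star (E t) = E t \<and> E t * E t = E t) \<and>
     (\<forall>s t. s \<le> t \<longrightarrow> pos (E t - E s)) \<and>
     (\<forall>t x. ((\<lambda>s. ap (E s) x) \<longlongrightarrow> ap (E t) x) (at_right t)) \<and>
     (\<exists>r. \<forall>t. (t < - r \<longrightarrow> E t = 0) \<and> (t \<ge> r \<longrightarrow> E t = 1)) \<and>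
     (\<forall>x. cinner (ap A x) x =
        complex_of_real (\<integral>t. t \<partial>interval_measure (\<lambda>t. Re (cinner (ap (E t) x) x))))"
proof -
  have "ap T = (\<lambda>x. 0) \<longleftrightarrow> T = 0" "ap T = id \<longleftrightarrow> T = 1" for T :: "'a cop"
    by (auto simp: fun_eq_iff intro!: cop_eqI)
  then show ?thesis
    by (simp add: spectral_family_def resolution_of_def projection_ap op_le_ap)
qed

text \<open>On the kernel of \<open>Q\<close> the form of \<open>P\<close> is at most that of
  \<open>Q\<close>, which is zero there; so \<open>P\<close> kills the range of
  \<open>1 - Q\<close>.\<close>

lemma projection_le:
  assumes "star P = P" "P * P = P" "star Q = Q" "Q * Q = Q" "pos (Q - P)"
  shows "P * Q = P" "Q * P = P"
proof -
  have "P * (1 - Q) = 0"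
  proof (rule cop_eqI)
    fix y
    define x where "x = ap (1 - Q) y"
    have "ap Q (ap Q y) = ap Q y" using assms(4) by (metis ap_times)
    then have "ap Q x = 0" by (simp add: x_def)
    then have "Re (cinner (ap P x) x) \<le> 0" using pos_Re[OF assms(5), of x] by (simp add: cinner_algebra)
    moreover have "pos P" using pos_star_mult[of P] assms by simp
    ultimately have "ap P x = 0" by (intro pos_form_zero)
    then show "ap (P * (1 - Q)) y = ap 0 y" by (simp add: x_def)
  qed
  then show PQ: "P * Q = P" by (simp add: right_diff_distrib)
  show "Q * P = P" using arg_cong[OF PQ, of star] assms by simp
qed

lemma cinner_projection: "star P = P \<Longrightarrow> P * P = P \<Longrightarrow> cinner (ap P x) x = (norm (ap P x))\<^sup>2"
  by (metis ap_times cinner_self cinner_star_right)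

text \<open>\<open>E t\<close> projects onto the kernel of the positive part of
  \<open>A - t\<close>; this is the spectral projection of the closed half-line up to
  \<open>t\<close>. All properties follow from three inequalities for the form of \<open>A\<close>
  at unit vectors: it is at most \<open>t\<close> on the range of \<open>E t\<close>
  (\<open>up\<close>), at least \<open>t\<close> on the kernel (\<open>lo\<close>), and there even
  strictly larger (\<open>strict\<close>).\<close>

lemma spectral_family_exists:
  fixes A :: "'h::complex_hilbert_space cop"
  assumes A: "star A = A"
  shows "\<exists>E. spectral_family E A"
proof -
  have "\<forall>t. \<exists>P. star P = P \<and> P * P = P \<and> pos (- ((A - t *\<^sub>R 1) * P)) \<and> pos ((A - t *\<^sub>R 1) * (1 - P)) \<and>
    (\<forall>x. ap ((A - t *\<^sub>R 1) * (1 - P)) x = 0 \<longrightarrow> ap P x = x) \<and>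
    (\<forall>X. star X = X \<longrightarrow> X * (A - t *\<^sub>R 1) = (A - t *\<^sub>R 1) * X \<longrightarrow> X * P = P * X)"
    by (intro allI spectral_cut) (simp add: A)
  then obtain E where E: "\<And>t. star (E t) = E t" "\<And>t. E t * E t = E t"
      "\<And>t. pos (- ((A - t *\<^sub>R 1) * E t))" "\<And>t. pos ((A - t *\<^sub>R 1) * (1 - E t))"
      "\<And>t x. ap ((A - t *\<^sub>R 1) * (1 - E t)) x = 0 \<Longrightarrow> ap (E t) x = x"
      "\<And>t X. star X = X \<Longrightarrow> X * (A - t *\<^sub>R 1) = (A - t *\<^sub>R 1) * X \<Longrightarrow> X * E t = E t * X"
    by metis
  have EE: "ap (E t) (ap (E t) x) = ap (E t) x" for t x by (metis E(2) ap_times)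
  have up: "Re (cinner (ap A x) x) \<le> t * (norm x)\<^sup>2" if "ap (E t) x = x" for t x
    using pos_Re[OF E(3), of t x] that by (simp add: cinner_algebra cinner_self)
  have lo: "t * (norm x)\<^sup>2 \<le> Re (cinner (ap A x) x)" if "ap (E t) x = 0" for t x
    using pos_Re[OF E(4), of t x] that by (simp add: cinner_algebra cinner_self)
  have strict: "x = 0" if "ap (E t) x = 0" "Re (cinner (ap A x) x) \<le> t * (norm x)\<^sup>2" for t x
  proof -
    have "Re (cinner (ap ((A - t *\<^sub>R 1) * (1 - E t)) x) x) \<le> 0"
      using that by (simp add: cinner_algebra cinner_self)
    from E(5)[OF pos_form_zero[OF E(4) this]] show ?thesis using that(1) by simp
  qed
  have AE: "A * E t = E t * A" for t by (rule E(6)[OF A]) (simp add: algebra_simps)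
  have comm: "E s * E t = E t * E s" for s t
    by (rule E(6)[OF E(1)]) (simp add: algebra_simps AE)
  have below: "E s * (1 - E t) = 0" if st: "s \<le> t" for s t
  proof (rule cop_eqI)
    fix y
    define x where "x = ap (E s * (1 - E t)) y"
    have "E t * (E s * (1 - E t)) = 0"
      by (simp add: right_diff_distrib mult.assoc[symmetric] comm[of t s]) (simp add: mult.assoc E(2))
    then have 0: "ap (E t) x = 0" unfolding x_def by (metis ap_times ap_zero)
    have "ap (E s) x = x" by (simp add: x_def EE)
    from up[OF this] have "Re (cinner (ap A x) x) \<le> t * (norm x)\<^sup>2"
      using st by (meson mult_right_mono order_trans zero_le_power2)
    from strict[OF 0 this] show "ap (E s * (1 - E t)) y = ap 0 y" by (simp add: x_def)
  qed
  have ET: "E s * E t = E s" "E t * E s = E s" if "s \<le> t" for s t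
    using below[OF that] comm[of s t] by (simp_all add: right_diff_distrib)
  have mono: "pos (E t - E s)" if "s \<le> t" for s t
  proof -
    have "star (E t - E s) * (E t - E s) = E t - E s" by (simp add: algebra_simps E ET[OF that])
    then show ?thesis using pos_star_mult[of "E t - E s"] by simp
  qed
  have hi: "E t = 1" if t: "norm A \<le> t" for t
  proof -
    have "1 - E t = 0"
    proof (rule cop_eqI)
      fix y
      define x where "x = ap (1 - E t) y"
      have 0: "ap (E t) x = 0" by (simp add: x_def EE)
      have "Re (cinner (ap A x) x) \<le> t * (norm x)\<^sup>2"
        using Re_cinner_le[of A x] t by (meson abs_le_D1 mult_right_mono order_trans zero_le_power2)
      from strict[OF 0 this] show "ap (1 - E t) y = ap 0 y" by (simp add: x_def)
    qed
    then show ?thesis by simp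
  qed
  have low: "E t = 0" if t: "t < - norm A" for t
  proof (rule cop_eqI)
    fix y
    define x where "x = ap (E t) y"
    have "ap (E t) x = x" by (simp add: x_def EE)
    from up[OF this] have "- (norm A * (norm x)\<^sup>2) \<le> t * (norm x)\<^sup>2"
      using Re_cinner_le[of A x] by linarith
    then have "(- norm A - t) * (norm x)\<^sup>2 \<le> 0" by (simp add: algebra_simps)
    then have "x = 0" using t by (simp add: mult_le_0_iff)
    then show "ap (E t) y = ap 0 y" by (simp add: x_def)
  qed
  have nE: "norm (ap (E t) x) \<le> norm x" for t x
  proof -
    have "(norm (ap (E t) x))\<^sup>2 = cmod (cinner (ap (E t) x) x)"
      by (simp add: cinner_projection E norm_power)
    also have "\<dots> \<le> norm (ap (E t) x) * norm x" by (rule cinner_Cauchy_Schwarz)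
    finally show ?thesis by (cases "norm (ap (E t) x) = 0") (auto simp: power2_eq_square)
  qed
  have pyth: "(norm (ap (E t) x - ap (E s) x))\<^sup>2 = (norm (ap (E t) x))\<^sup>2 - (norm (ap (E s) x))\<^sup>2"
    if "s \<le> t" for s t x
  proof -
    have "star (E t - E s) = E t - E s" "(E t - E s) * (E t - E s) = E t - E s"
      by (simp_all add: algebra_simps E ET[OF that])
    from arg_cong[OF cinner_projection[OF this, of x], of Re] show ?thesis
      by (simp add: cinner_algebra cinner_projection E)
  qed
  \<comment> \<open>The norms of \<open>ap (E (s n)) x\<close> decrease, so these vectors converge
    to some \<open>y\<close>. The remainder \<open>z = y - ap (E t) x\<close> is fixed by
    \<open>E q\<close> for all \<open>q > t\<close>, hence its form is at most
    \<open>t * (norm z)\<^sup>2\<close>; it is also killed by \<open>E t\<close>, so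
    \<open>strict\<close> makes it vanish.\<close>
  have rc: "((\<lambda>s. ap (E s) x) \<longlongrightarrow> ap (E t) x) (at_right t)" for t x
  proof -
    define s where "s n = t + 1 / real (Suc n)" for n
    have st: "t < s n" for n by (simp add: s_def)
    have sl: "s \<longlonglongrightarrow> t"
      using tendsto_add[OF tendsto_const LIMSEQ_inverse_real_of_nat, of t]
      by (simp add: s_def[abs_def] inverse_eq_divide)
    have sdec: "s n \<le> s m" if "m \<le> n" for m n using that by (simp add: s_def frac_le)
    define g where "g n = (norm (ap (E (s n)) x))\<^sup>2" for n
    have gdec: "g n \<le> g m" if "m \<le> n" for m n
      using pyth[OF sdec[OF that], of x] zero_le_power2 unfolding g_def by (smt (verit))
    have "decseq g" using gdec by (simp add: decseq_def)
    moreover have "\<forall>n. 0 \<le> g n" by (simp add: g_def)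
    ultimately have "convergent g" using decseq_convergent[of g 0] convergentI by metis
    then have cg: "Cauchy g" by (simp add: convergent_Cauchy)
    have "Cauchy (\<lambda>n. ap (E (s n)) x)"
    proof (rule metric_CauchyI)
      fix e :: real assume e: "e > 0"
      then obtain M where M: "\<And>m n. m \<ge> M \<Longrightarrow> n \<ge> M \<Longrightarrow> dist (g m) (g n) < e\<^sup>2"
        using metric_CauchyD[OF cg, of "e\<^sup>2"] by auto
      have "dist (ap (E (s m)) x) (ap (E (s n)) x) < e" if "m \<ge> M" "n \<ge> M" for m n
      proof -
        have "(norm (ap (E (s m)) x - ap (E (s n)) x))\<^sup>2 = \<bar>g m - g n\<bar>"
        proof (cases "m \<le> n")
          case True
          then show ?thesis using pyth[OF sdec[OF True], of x] gdec[OF True] by (simp add: g_def)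
        next
          case False
          then have nm: "n \<le> m" by simp
          show ?thesis using pyth[OF sdec[OF nm], of x] gdec[OF nm] by (simp add: g_def norm_minus_commute)
        qed
        then show ?thesis using M[OF that] e by (simp add: dist_norm power2_less_imp_less)
      qed
      then show "\<exists>M. \<forall>m\<ge>M. \<forall>n\<ge>M. dist (ap (E (s m)) x) (ap (E (s n)) x) < e" by blast
    qed
    then obtain y where y: "(\<lambda>n. ap (E (s n)) x) \<longlonglongrightarrow> y"
      using Cauchy_convergent convergent_def by blast
    have fix_y: "ap (E q) y = y" if q: "t < q" for q
    proof (rule LIMSEQ_unique)
      show "(\<lambda>n. ap (E q) (ap (E (s n)) x)) \<longlonglongrightarrow> ap (E q) y"
        by (rule bounded_linear.tendsto[OF bounded_linear_ap y])
      have "\<forall>\<^sub>F n in sequentially. s n < q" using sl q by (rule order_tendstoD)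
      then have "\<forall>\<^sub>F n in sequentially. ap (E (s n)) x = ap (E q) (ap (E (s n)) x)"
        by eventually_elim (metis ET(2) ap_times less_imp_le)
      with y show "(\<lambda>n. ap (E q) (ap (E (s n)) x)) \<longlonglongrightarrow> y"
        by (rule Lim_transform_eventually)
    qed
    have "ap (E t) y = ap (E t) x"
    proof (rule LIMSEQ_unique)
      show "(\<lambda>n. ap (E t) (ap (E (s n)) x)) \<longlonglongrightarrow> ap (E t) y"
        by (rule bounded_linear.tendsto[OF bounded_linear_ap y])
      have "ap (E t) (ap (E (s n)) x) = ap (E t) x" for n by (metis ET(1) ap_times less_imp_le st)
      then show "(\<lambda>n. ap (E t) (ap (E (s n)) x)) \<longlonglongrightarrow> ap (E t) x" by simp
    qed
    define z where "z = y - ap (E t) x"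
    have Ez: "ap (E t) z = 0" by (simp add: z_def EE \<open>ap (E t) y = ap (E t) x\<close>)
    have "Re (cinner (ap A z) z) \<le> q * (norm z)\<^sup>2" if q: "t < q" for q
    proof (rule up)
      have "ap (E q) (ap (E t) x) = ap (E t) x" by (metis ET(2) ap_times less_imp_le q)
      then show "ap (E q) z = z" by (simp add: z_def fix_y[OF q])
    qed
    then have "Re (cinner (ap A z) z) \<le> s n * (norm z)\<^sup>2" for n using st by blast
    moreover have "(\<lambda>n. s n * (norm z)\<^sup>2) \<longlonglongrightarrow> t * (norm z)\<^sup>2" by (intro tendsto_intros sl)
    ultimately have "Re (cinner (ap A z) z) \<le> t * (norm z)\<^sup>2"
      by (intro LIMSEQ_le_const) auto
    from strict[OF Ez this] have lim: "(\<lambda>n. ap (E (s n)) x) \<longlonglongrightarrow> ap (E t) x"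
      using y by (simp add: z_def)
    show ?thesis
    proof (rule tendstoI)
      fix e :: real assume "e > 0"
      then obtain n where n: "dist (ap (E (s n)) x) (ap (E t) x) < e"
        using lim by (metis (no_types, lifting) eventually_sequentially le_refl tendstoD)
      have "dist (ap (E q) x) (ap (E t) x) < e" if "t < q" "q < s n" for q
      proof -
        have "ap (E q) x - ap (E t) x = ap (E q) (ap (E (s n)) x - ap (E t) x)"
          using that ET(1)[of q "s n"] ET(2)[of t q] by (metis ap_diff_vec ap_times less_imp_le)
        then have "dist (ap (E q) x) (ap (E t) x) \<le> dist (ap (E (s n)) x) (ap (E t) x)"
          using nE[of q "ap (E (s n)) x - ap (E t) x"] by (simp only: dist_norm)
        with n show ?thesis by simp
      qed
      then show "\<forall>\<^sub>F q in at_right t. dist (ap (E q) x) (ap (E t) x) < e"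
        unfolding eventually_at_right_field using st by blast
    qed
  qed
  \<comment> \<open>\<open>E\<close> is known to vanish only strictly below \<open>- norm A\<close>,
    whereas \<open>stieltjes\<close> asks for all \<open>t \<le> - r\<close>.\<close>
  define r where "r = norm A + 1"
  have r: "0 < r" by (simp add: r_def add_nonneg_pos)
  have int: "cinner (ap A x) x = complex_of_real (\<integral>t. t \<partial>interval_measure (\<lambda>t. Re (cinner (ap (E t) x) x)))" for x
  proof -
    define F where "F t = Re (cinner (ap (E t) x) x)" for t
    have F: "F t = (norm (ap (E t) x))\<^sup>2" for t by (simp add: F_def cinner_projection E)
    interpret stieltjes F r "(norm x)\<^sup>2"
    proof
      show "F s \<le> F t" if "s \<le> t" for s t
        using pos_Re[OF mono[OF that], of x] by (simp add: F_def cinner_algebra)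
      show "(F \<longlongrightarrow> F t) (at_right t)" for t
        unfolding F_def[abs_def] by (intro tendsto_Re tendsto_cinner rc tendsto_const)
      show "F t = 0" if "t \<le> - r" for t using that low[of t] by (simp add: F_def r_def)
      show "F t = (norm x)\<^sup>2" if "r \<le> t" for t using that hi[of t] by (simp add: F r_def)
    qed (rule r)
    define a where "a = Re (cinner (ap A x) x)"
    define S where "S m = (\<Sum>i<m. grid r m (Suc i) * (F (grid r m (Suc i)) - F (grid r m i)))" for m
    \<comment> \<open>On the range of an increment the form of \<open>A\<close> lies between the two
      endpoints, so the Stieltjes sum exceeds \<open>a\<close> by at most one mesh width times the
      total mass.\<close>
    have piece: "s * (F t - F s) \<le> Re (cinner (ap (A * (E t - E s)) x) x)"
        "Re (cinner (ap (A * (E t - E s)) x) x) \<le> t * (F t - F s)" if "s \<le> t" for s t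
    proof -
      define D where "D = E t - E s"
      define w where "w = ap D x"
      have D: "star D = D" "D * D = D" "A * D = D * A" "E t * D = D" "E s * D = 0"
        by (simp_all add: D_def algebra_simps E ET[OF that] AE)
      have "ap (A * D) x = ap D (ap A w)" by (metis D(2,3) ap_times w_def)
      then have 1: "cinner (ap (A * D) x) x = cinner (ap A w) w"
        by (metis D(1) cinner_star_left w_def)
      have 2: "F t - F s = (norm w)\<^sup>2"
        using pyth[OF that, of x] by (simp add: F w_def D_def)
      have "ap (E t) w = w" "ap (E s) w = 0" unfolding w_def by (metis D(4,5) ap_times ap_zero)+
      from up[OF this(1)] lo[OF this(2)]
      show "s * (F t - F s) \<le> Re (cinner (ap (A * (E t - E s)) x) x)"
        "Re (cinner (ap (A * (E t - E s)) x) x) \<le> t * (F t - F s)"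
        by (simp_all only: 1[unfolded D_def] 2)
    qed
    have aS: "\<bar>a - S m\<bar> \<le> 2 * r / real m * (norm x)\<^sup>2" if m: "0 < m" for m
    proof -
      let ?t = "grid r m"
      have "(\<Sum>i<m. A * (E (?t (Suc i)) - E (?t i))) = A * (E (?t m) - E (?t 0))"
        by (simp add: sum_distrib_left[symmetric] sum_lessThan_telescope[of "\<lambda>i. E (?t i)"])
      also have "\<dots> = A" using m by (simp add: hi r_def low)
      finally have "A = (\<Sum>i<m. A * (E (?t (Suc i)) - E (?t i)))" ..
      then have "a = Re (cinner (ap (\<Sum>i<m. A * (E (?t (Suc i)) - E (?t i))) x) x)" by (simp add: a_def)
      also have "\<dots> = (\<Sum>i<m. Re (cinner (ap (A * (E (?t (Suc i)) - E (?t i))) x) x))"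
        by (simp only: ap_sum cinner_sum_left Re_sum)
      finally have a: "a = \<dots>" .
      have le: "?t i \<le> ?t (Suc i)" for i using r by (intro grid_mono) auto
      have "a \<le> S m" unfolding a S_def by (intro sum_mono piece le)
      have "S m - a \<le> (\<Sum>i<m. (?t (Suc i) - ?t i) * (F (?t (Suc i)) - F (?t i)))"
        unfolding a S_def sum_subtractf[symmetric] using piece(1)[OF le]
        by (intro sum_mono) (simp add: left_diff_distrib)
      also have "\<dots> = 2 * r / real m * (\<Sum>i<m. F (?t (Suc i)) - F (?t i))"
        by (simp add: grid_Suc sum_distrib_left)
      also have "\<dots> = 2 * r / real m * (norm x)\<^sup>2"
        using m r by (simp add: sum_lessThan_telescope[of "\<lambda>i. F (?t i)"] F_low F_high)
      finally show ?thesis using \<open>a \<le> S m\<close> by simp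
    qed
    have "\<bar>a - (\<integral>t. t \<partial>M)\<bar> \<le> 4 * r * (norm x)\<^sup>2 / real m" if m: "0 < m" for m
    proof -
      define c where "c = 2 * r / real m * (norm x)\<^sup>2"
      have "\<bar>a - S m\<bar> \<le> c" "\<bar>(\<integral>t. t \<partial>M) - S m\<bar> \<le> c"
        using aS[OF m] integral_id_bound[OF m] unfolding S_def[symmetric] c_def .
      then have "\<bar>a - (\<integral>t. t \<partial>M)\<bar> \<le> c + c" by (simp add: abs_le_iff)
      then show ?thesis by (simp add: c_def field_simps)
    qed
    then have "\<forall>\<^sub>F m in sequentially. \<bar>a - (\<integral>t. t \<partial>M)\<bar> \<le> 4 * r * (norm x)\<^sup>2 / real m"
      by (auto simp: eventually_sequentially intro!: exI[of _ 1])
    moreover have "(\<lambda>m. 4 * r * (norm x)\<^sup>2 / real m) \<longlonglongrightarrow> 0" by (rule lim_const_over_n)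
    ultimately have "\<bar>a - (\<integral>t. t \<partial>M)\<bar> \<le> 0"
      by (intro tendsto_le[OF _ _ tendsto_const]) auto
    then have "a = (\<integral>t. t \<partial>M)" by simp
    then show ?thesis using Im_cinner_sa[OF A, of x] by (simp add: complex_eq_iff a_def F_def[abs_def])
  qed
  have "\<exists>r. \<forall>t. (t < - r \<longrightarrow> E t = 0) \<and> (t \<ge> r \<longrightarrow> E t = 1)"
    using hi low by blast
  then have "spectral_family E A"
    unfolding spectral_family_iff using E(1,2) mono rc int by blast
  then show ?thesis by blast
qed

text \<open>An arbitrary spectral family is treated, because \<open>spectral_resolution\<close> is
  some choice and need not a priori be the family constructed above.\<close>

locale spectral =
  fixes E :: "real \<Rightarrow> 'h::complex_hilbert_space cop" and A :: "'h cop" and r :: real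
  assumes fam: "spectral_family E A"
    and r_pos: "0 < r" and E_low: "\<And>t. t \<le> - r \<Longrightarrow> E t = 0" and E_high: "\<And>t. r \<le> t \<Longrightarrow> E t = 1"
begin

lemma
  shows E_star [simp]: "star (E t) = E t" and E_idem: "E t * E t = E t"
    and E_mono: "s \<le> t \<Longrightarrow> pos (E t - E s)"
    and E_rc: "((\<lambda>s. ap (E s) x) \<longlongrightarrow> ap (E t) x) (at_right t)"
    and A_form: "cinner (ap A x) x = complex_of_real (\<integral>t. t \<partial>interval_measure (\<lambda>t. Re (cinner (ap (E t) x) x)))"
  using fam unfolding spectral_family_iff by blast+

lemma A_star: "star A = A"
  by (rule star_eq_if_real) (simp add: A_form)

lemma E_mult: "s \<le> t \<Longrightarrow> E s * E t = E s" "s \<le> t \<Longrightarrow> E t * E s = E s"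
  using projection_le[of "E s" "E t"] by (simp_all add: E_idem E_mono)

lemma vector_stieltjes: "stieltjes (\<lambda>t. Re (cinner (ap (E t) x) x)) r ((norm x)\<^sup>2)"
proof
  show "Re (cinner (ap (E s) x) x) \<le> Re (cinner (ap (E t) x) x)" if "s \<le> t" for s t
    using pos_Re[OF E_mono[OF that], of x] by (simp add: cinner_algebra)
  show "((\<lambda>t. Re (cinner (ap (E t) x) x)) \<longlongrightarrow> Re (cinner (ap (E t) x) x)) (at_right t)" for t
    by (intro tendsto_Re tendsto_cinner E_rc tendsto_const)
qed (simp_all add: r_pos E_low E_high cinner_self)

text \<open>Riemann-Stieltjes approximation of the spectral integral of
  \<open>t ^ n\<close>.\<close>

definition step :: "nat \<Rightarrow> nat \<Rightarrow> 'h cop" where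
  "step n m = (\<Sum>i<m. (grid r m (Suc i)) ^ n *\<^sub>R (E (grid r m (Suc i)) - E (grid r m i)))"

lemma step_close:
  assumes m: "0 < m"
  shows "norm (A - step 1 m) \<le> 2 * r / real m"
proof (rule norm_sa_le)
  have "star (step 1 m) = step 1 m"
    unfolding step_def by (simp add: star_sum)
  then show "star (A - step 1 m) = A - step 1 m" by (simp add: A_star)
  show "0 \<le> 2 * r / real m" using r_pos by simp
  fix x
  interpret stieltjes "\<lambda>t. Re (cinner (ap (E t) x) x)" r "(norm x)\<^sup>2" by (rule vector_stieltjes)
  have "cinner (ap (step 1 m) x) x = (\<Sum>i<m. cinner (ap ((grid r m (Suc i)) *\<^sub>R (E (grid r m (Suc i)) - E (grid r m i))) x) x)"
    by (simp only: step_def power_one_right ap_sum cinner_sum_left)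
  then have "Re (cinner (ap (step 1 m) x) x) = (\<Sum>i<m. grid r m (Suc i) *
      (Re (cinner (ap (E (grid r m (Suc i))) x) x) - Re (cinner (ap (E (grid r m i)) x) x)))"
    by (simp add: cinner_algebra)
  with integral_id_bound[OF m] show "\<bar>Re (cinner (ap (A - step 1 m) x) x)\<bar> \<le> 2 * r / real m * (norm x)\<^sup>2"
    by (simp add: cinner_diff_left A_form)
qed

lemma increment_mult:
  "(E (grid r m (Suc i)) - E (grid r m i)) * (E (grid r m (Suc j)) - E (grid r m j)) =
     (if i = j then E (grid r m (Suc i)) - E (grid r m i) else 0)"
proof -
  have g: "grid r m a \<le> grid r m b" if "a \<le> b" for a b using r_pos that by (intro grid_mono) auto
  show ?thesis
  proof (cases i j rule: linorder_cases)
    case less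
    then have "grid r m (Suc i) \<le> grid r m j" "grid r m i \<le> grid r m j"
      "grid r m (Suc i) \<le> grid r m (Suc j)" "grid r m i \<le> grid r m (Suc j)" by (auto intro: g)
    then show ?thesis using less by (simp add: algebra_simps E_mult)
  next
    case greater
    then have "grid r m (Suc j) \<le> grid r m i" "grid r m j \<le> grid r m i"
      "grid r m (Suc j) \<le> grid r m (Suc i)" "grid r m j \<le> grid r m (Suc i)" by (auto intro: g)
    then show ?thesis using greater by (simp add: algebra_simps E_mult)
  next
    case equal
    then show ?thesis using g[of i "Suc i"] by (simp add: algebra_simps E_mult E_idem)
  qed
qed

text \<open>The increments are mutually orthogonal projections, so a power of the sum acts on the
  nodes alone. For \<open>n = 0\<close> the increments telescope to \<open>1\<close>.\<close>

lemma step_power: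
  assumes m: "0 < m"
  shows "step 1 m ^ n = step n m"
proof (induction n)
  case 0
  have "step 0 m = (\<Sum>i<m. E (grid r m (Suc i)) - E (grid r m i))" by (simp add: step_def)
  also have "\<dots> = E (grid r m m) - E (grid r m 0)" by (rule sum_lessThan_telescope)
  finally show ?case using m by (simp add: E_low E_high)
next
  case (Suc n)
  let ?D = "\<lambda>i. E (grid r m (Suc i)) - E (grid r m i)"
  have "step 1 m ^ Suc n = step 1 m * step n m" by (simp only: power_Suc Suc)
  also have "\<dots> = (\<Sum>i<m. \<Sum>j<m. (grid r m (Suc i) * grid r m (Suc j) ^ n) *\<^sub>R (?D i * ?D j))"
    unfolding step_def by (simp add: sum_product mult.commute[of "grid r m _ ^ n"])
  also have "\<dots> = (\<Sum>i<m. \<Sum>j<m. if i = j then (grid r m (Suc i) ^ Suc n) *\<^sub>R ?D i else 0)"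
    unfolding increment_mult by (intro sum.cong refl) auto
  also have "\<dots> = step (Suc n) m" by (simp add: step_def)
  finally show ?case .
qed

lemma step_tendsto: "step n \<longlonglongrightarrow> A ^ n"
proof -
  have "(\<lambda>m. A - step 1 m) \<longlonglongrightarrow> 0"
  proof (rule Lim_null_comparison)
    show "\<forall>\<^sub>F m in sequentially. norm (A - step 1 m) \<le> 2 * r / real m"
      by (intro eventually_sequentiallyI[of 1] step_close) simp
    show "(\<lambda>m. 2 * r / real m) \<longlonglongrightarrow> 0" by (rule lim_const_over_n)
  qed
  from tendsto_diff[OF tendsto_const this, of A] have "step 1 \<longlonglongrightarrow> A" by simp
  then have "(\<lambda>m. step 1 m ^ n) \<longlonglongrightarrow> A ^ n" by (induction n) (auto intro!: tendsto_mult)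
  moreover have "\<forall>\<^sub>F m in sequentially. step 1 m ^ n = step n m"
    by (intro eventually_sequentiallyI[of 1] step_power) simp
  ultimately show ?thesis by (rule Lim_transform_eventually)
qed

text \<open>Boundedness of the functional \<open>\<phi>\<close> permits the passage from
  \<open>step n m\<close> to \<open>A ^ n\<close>. Linearity and boundedness are required on a
  closed subalgebra only, so that vector functionals are covered as well as a trace, about which
  nothing is known outside its algebra.\<close>

lemma moment:
  fixes \<phi> :: "'h cop \<Rightarrow> real"
  assumes N: "closed_subalgebra N" "\<And>t. E t \<in> N"
    and add: "\<And>X Y. X \<in> N \<Longrightarrow> Y \<in> N \<Longrightarrow> \<phi> (X + Y) = \<phi> X + \<phi> Y"
    and scale: "\<And>c X. X \<in> N \<Longrightarrow> \<phi> (c *\<^sub>R X) = c * \<phi> X"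
    and bd: "\<And>X. X \<in> N \<Longrightarrow> \<bar>\<phi> X\<bar> \<le> C * norm X"
    and st: "stieltjes (\<lambda>t. \<phi> (E t)) r K"
  shows "(\<integral>t. t ^ n \<partial>interval_measure (\<lambda>t. \<phi> (E t))) = \<phi> (A ^ n)"
proof -
  interpret stieltjes "\<lambda>t. \<phi> (E t)" r K by fact
  have z: "\<phi> 0 = 0" using scale[OF csub_zero[OF N(1)], of 0] by simp
  have diff: "\<phi> (X - Y) = \<phi> X - \<phi> Y" if "X \<in> N" "Y \<in> N" for X Y
    using add[OF that(1) csub_uminus[OF N(1) that(2)]] scale[OF that(2), of "-1"] by simp
  have sum: "\<phi> (sum f I) = (\<Sum>i\<in>I. \<phi> (f i))" if "\<And>i. f i \<in> N" for f and I :: "nat set"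
    by (induction I rule: infinite_finite_induct) (auto simp: z add csub_sum[OF N(1)] that)
  have stepN: "step n m \<in> N" for n m
    unfolding step_def using N by (intro csub_sum csub_scaleR csub_diff) auto
  have AN: "A ^ n \<in> N" by (rule csub_lim[OF N(1) stepN step_tendsto])
  have "\<phi> (step n m) = (\<Sum>i<m. grid r m (Suc i) ^ n * (\<phi> (E (grid r m (Suc i))) - \<phi> (E (grid r m i))))" for m
    unfolding step_def using N by (subst sum) (auto simp: scale diff csub_diff csub_scaleR)
  moreover have "(\<lambda>m. \<Sum>i<m. grid r m (Suc i) ^ n * (\<phi> (E (grid r m (Suc i))) - \<phi> (E (grid r m i))))
      \<longlonglongrightarrow> (\<integral>t. t ^ n \<partial>M)"
    by (rule integral_sum_tendsto) (intro continuous_intros)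
  ultimately have 1: "(\<lambda>m. \<phi> (step n m)) \<longlonglongrightarrow> (\<integral>t. t ^ n \<partial>M)" by simp
  have "(\<lambda>m. \<phi> (step n m) - \<phi> (A ^ n)) \<longlonglongrightarrow> 0"
  proof (rule Lim_null_comparison)
    show "\<forall>\<^sub>F m in sequentially. norm (\<phi> (step n m) - \<phi> (A ^ n)) \<le> C * norm (step n m - A ^ n)"
      using bd[OF csub_diff[OF N(1) stepN AN]] by (auto simp: diff[OF stepN AN])
    show "(\<lambda>m. C * norm (step n m - A ^ n)) \<longlonglongrightarrow> 0"
      using step_tendsto[of n] by (intro tendsto_mult_right_zero tendsto_norm_zero) (simp add: LIM_zero)
  qed
  then have "(\<lambda>m. \<phi> (step n m)) \<longlonglongrightarrow> \<phi> (A ^ n)" by (simp add: LIM_zero_iff)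
  with 1 show ?thesis by (rule LIMSEQ_unique)
qed

lemma polynomial_form:
  "(\<integral>t. (\<Sum>i\<le>n. a i * t ^ i) \<partial>interval_measure (\<lambda>t. Re (cinner (ap (E t) x) x))) =
     Re (cinner (ap (\<Sum>i\<le>n. a i *\<^sub>R A ^ i) x) x)"
proof -
  interpret stieltjes "\<lambda>t. Re (cinner (ap (E t) x) x)" r "(norm x)\<^sup>2" by (rule vector_stieltjes)
  have mom: "(\<integral>t. t ^ i \<partial>M) = Re (cinner (ap (A ^ i) x) x)" for i
    by (rule moment[where C="(norm x)\<^sup>2" and \<phi>="\<lambda>X. Re (cinner (ap X x) x)", OF csub_UNIV _ _ _ _ vector_stieltjes])
      (simp_all add: cinner_algebra Re_cinner_le mult.commute[of "_ ^ 2"])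
  have int: "integrable M (\<lambda>t. t ^ i)" for i
    by (rule integrable_bounded[where B="r ^ i"]) (auto simp: power_abs intro!: power_mono)
  have "(\<integral>t. (\<Sum>i\<le>n. a i * t ^ i) \<partial>M) = (\<Sum>i\<le>n. a i * Re (cinner (ap (A ^ i) x) x))"
    using int by (simp add: mom)
  also have "\<dots> = Re (cinner (ap (\<Sum>i\<le>n. a i *\<^sub>R A ^ i) x) x)"
    by (simp only: ap_sum cinner_sum_left Re_sum)
      (simp add: cinner_algebra)
  finally show ?thesis .
qed

text \<open>Continuous ramps decreasing to the indicator of the half-line up to \<open>t\<close> are
  approximated uniformly by polynomials; dominated convergence for each vector functional then gives
  weak convergence. Polynomials in \<open>A\<close> stay in every closed subalgebra that contains
  \<open>A\<close>.\<close>

lemma projection_weak_limit: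
  obtains p :: "nat \<Rightarrow> 'h cop"
  where "\<And>N k. closed_subalgebra N \<Longrightarrow> A \<in> N \<Longrightarrow> p k \<in> N"
    and "\<And>x y. (\<lambda>k. cinner (ap (p k) x) y) \<longlonglongrightarrow> cinner (ap (E t) x) y"
proof -
  define f where "f k s = max 0 (min 1 (1 - real k * (s - t)))" for k s
  have "\<exists>g. real_polynomial_function g \<and> (\<forall>s\<in>{-r..r}. \<bar>f k s - g s\<bar> < 1 / real (Suc k))" for k
  proof -
    have "continuous_on {-r..r} (f k)" unfolding f_def by (intro continuous_intros)
    then obtain h where "real_polynomial_function h" "\<And>s. s \<in> {-r..r} \<Longrightarrow> \<bar>f k s - h s\<bar> < 1 / real (Suc k)"
      by (rule Stone_Weierstrass_real_polynomial_function[OF compact_Icc, of _ _ _ "1 / real (Suc k)"]) simp_all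
    then show ?thesis by blast
  qed
  then obtain g where g: "\<And>k. real_polynomial_function (g k)"
    "\<And>k s. s \<in> {-r..r} \<Longrightarrow> \<bar>f k s - g k s\<bar> < 1 / real (Suc k)" by metis
  have "\<exists>a n. g k = (\<lambda>s. \<Sum>i\<le>n. a i * s ^ i)" for k
    using g(1)[of k] real_polynomial_function_iff_sum by blast
  then obtain a n where an: "\<And>k. g k = (\<lambda>s. \<Sum>i\<le>n k. a k i * s ^ i)" by metis
  define p where "p k = (\<Sum>i\<le>n k. a k i *\<^sub>R A ^ i)" for k
  have lim: "(\<lambda>k. Re (cinner (ap (p k) x) x)) \<longlonglongrightarrow> Re (cinner (ap (E t) x) x)" for x
  proof -
    interpret stieltjes "\<lambda>t. Re (cinner (ap (E t) x) x)" r "(norm x)\<^sup>2" by (rule vector_stieltjes)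
    have mg: "g k \<in> borel_measurable M" for k
      unfolding an by measurable
    have "(\<lambda>k. \<integral>s. g k s \<partial>M) \<longlonglongrightarrow> (\<integral>s. indicator {..t} s \<partial>M)"
    proof (rule integral_dominated_convergence[where w="\<lambda>s. 2"])
      show "AE s in M. (\<lambda>k. g k s) \<longlonglongrightarrow> indicator {..t} s"
        using AE_Ioc
      proof eventually_elim
        case (elim s)
        have "(\<lambda>k. f k s) \<longlonglongrightarrow> indicator {..t} s"
        proof (cases "s \<le> t")
          case True
          then have "f k s = 1" for k
            by (simp add: f_def min_def max_def mult_le_0_iff not_le)
          then show ?thesis using True by simp
        next
          case False
          obtain N :: nat where N: "1 / (s - t) < real N" using reals_Archimedean2 by blast
          have "f k s = 0" if "k \<ge> N" for k
          proof -
            have "1 / (s - t) < real k" using N that by linarith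
            then have "1 < real k * (s - t)" using False by (simp add: field_simps)
            then show ?thesis by (simp add: f_def)
          qed
          then show ?thesis using False by (intro tendsto_eventually) (auto simp: eventually_sequentially)
        qed
        moreover have "(\<lambda>k. g k s - f k s) \<longlonglongrightarrow> 0"
        proof (rule Lim_null_comparison)
          show "\<forall>\<^sub>F k in sequentially. norm (g k s - f k s) \<le> inverse (real (Suc k))"
            using g(2)[of s] elim by (auto simp: abs_minus_commute inverse_eq_divide less_imp_le)
        qed (rule LIMSEQ_inverse_real_of_nat)
        ultimately show ?case using tendsto_add[of "\<lambda>k. g k s - f k s" 0 sequentially "\<lambda>k. f k s"] by simp
      qed
      show "AE s in M. norm (g k s) \<le> 2" for k
        using AE_Ioc
      proof eventually_elim
        case (elim s)
        have "\<bar>f k s - g k s\<bar> < 1 / real (Suc k)" using g(2)[of s] elim by auto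
        moreover have "1 / real (Suc k) \<le> 1" by simp
        moreover have "\<bar>f k s\<bar> \<le> 1" by (simp add: f_def)
        ultimately show ?case unfolding real_norm_def by linarith
      qed
    qed (use mg in \<open>auto\<close>)
    moreover have "(\<integral>s. indicator {..t} s \<partial>M) = Re (cinner (ap (E t) x) x)"
    proof -
      \<comment> \<open>A left endpoint outside the support, so that the half-open interval has the
        full mass of \<open>{..t}\<close>.\<close>
      define b where "b = min t (- r)"
      have "(\<integral>s. indicator {..t} s \<partial>M) = measure M {..t}" by simp
      also have "\<dots> = measure M {b<..t}"
        by (rule measure_eq_AE) (use AE_Ioc in \<open>auto elim!: eventually_mono simp: b_def\<close>)
      also have "\<dots> = Re (cinner (ap (E t) x) x)"
        by (subst measure_Ioc) (auto simp: b_def E_low min_def)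
      finally show ?thesis .
    qed
    moreover have "(\<integral>s. g k s \<partial>M) = Re (cinner (ap (p k) x) x)" for k
      unfolding an p_def by (rule polynomial_form)
    ultimately show ?thesis by simp
  qed
  have star_p: "star (p k) = p k" for k
    unfolding p_def by (simp add: star_sum A_star)
  have lim2: "(\<lambda>k. cinner (ap (p k) x) x) \<longlonglongrightarrow> cinner (ap (E t) x) x" for x
  proof -
    have e: "complex_of_real (Re (cinner (ap T x) x)) = cinner (ap T x) x" if "star T = T" for T :: "'h cop"
      using Im_cinner_sa[OF that] by (simp add: complex_eq_iff)
    show ?thesis using tendsto_of_real[OF lim[of x], where 'a=complex] by (simp only: e[OF star_p] e[OF E_star])
  qed
  show thesis
  proof (rule that[of p])
    show "p k \<in> N" if "closed_subalgebra N" "A \<in> N" for N k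
      unfolding p_def using that by (intro csub_sum csub_scaleR csub_power)
    fix x y
    have "(\<lambda>k. 4 * cinner (ap (p k) x) y) \<longlonglongrightarrow> 4 * cinner (ap (E t) x) y"
      unfolding polarization by (intro tendsto_intros lim2)
    from tendsto_mult[OF tendsto_const[of "1/4"] this]
    show "(\<lambda>k. cinner (ap (p k) x) y) \<longlonglongrightarrow> cinner (ap (E t) x) y" by simp
  qed
qed

end

lemma spectral_family_spectral:
  assumes "spectral_family E A"
  obtains r where "spectral E A r"
proof -
  obtain r where r: "\<And>t. t < - r \<Longrightarrow> E t = 0" "\<And>t. t \<ge> r \<Longrightarrow> E t = 1"
    using assms unfolding spectral_family_iff by blast
  have "spectral E A (\<bar>r\<bar> + 1)"
    by standard (use assms r in auto)
  then show thesis by (rule that)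
qed

section \<open>Tracial algebras\<close>

locale pretracial_algebra =
  fixes N :: "'h::complex_hilbert_space cop set" and tr :: "'h cop \<Rightarrow> complex"
  assumes csub: "closed_subalgebra N"
    and star_N [intro!]: "X \<in> N \<Longrightarrow> star X \<in> N"
    and tr_add: "X \<in> N \<Longrightarrow> Y \<in> N \<Longrightarrow> tr (X + Y) = tr X + tr Y"
    and tr_sc: "X \<in> N \<Longrightarrow> tr (sc c * X) = c * tr X"
    and tr_one: "tr 1 = 1"
    and tr_pos: "X \<in> N \<Longrightarrow> pos X \<Longrightarrow> Im (tr X) = 0 \<and> 0 \<le> Re (tr X)"
    and tr_commute: "X \<in> N \<Longrightarrow> Y \<in> N \<Longrightarrow> tr (X * Y) = tr (Y * X)"
begin

lemmas N_intros [intro!] = csub_one[OF csub] csub_zero[OF csub] csub_add[OF csub] csub_mult[OF csub]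
  csub_scaleR[OF csub] csub_uminus[OF csub] csub_diff[OF csub] csub_sc[OF csub] csub_power[OF csub]

lemma tr_scaleR: "X \<in> N \<Longrightarrow> tr (r *\<^sub>R X) = of_real r * tr X"
  using tr_sc[of X "of_real r"] by (simp add: sc_of_real_times)
lemma tr_zero: "tr 0 = 0"
  using tr_scaleR[of 0 0] by (simp add: N_intros)
lemma tr_uminus: "X \<in> N \<Longrightarrow> tr (- X) = - tr X"
  using tr_scaleR[of X "-1"] by simp
lemma tr_diff: "X \<in> N \<Longrightarrow> Y \<in> N \<Longrightarrow> tr (X - Y) = tr X - tr Y"
  using tr_add[of X "- Y"] by (simp add: tr_uminus N_intros)
lemma tr_sum: "(\<And>i. i \<in> I \<Longrightarrow> f i \<in> N) \<Longrightarrow> tr (sum f I) = (\<Sum>i\<in>I. tr (f i))"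
  by (induction I rule: infinite_finite_induct) (auto simp: tr_zero tr_add csub_sum[OF csub])

lemma tr_sa: assumes "X \<in> N" "star X = X" shows "Im (tr X) = 0" "\<bar>Re (tr X)\<bar> \<le> norm X"
proof -
  have "pos (norm X *\<^sub>R 1 - X)" "pos (norm X *\<^sub>R 1 - (- X))"
    by (rule pos_norm_minus; simp add: assms)+
  from tr_pos[OF _ this(1)] tr_pos[OF _ this(2)]
  show "Im (tr X) = 0" "\<bar>Re (tr X)\<bar> \<le> norm X"
    using assms by (auto simp: tr_diff tr_add tr_scaleR tr_one N_intros)
qed

lemma tr_star: assumes X: "X \<in> N" shows "tr (star X) = cnj (tr X)"
proof -
  have "Im (tr (X + star X)) = 0" using X by (intro tr_sa) (auto simp: add.commute)
  moreover have "Im (tr (sc \<i> * (X - star X))) = 0"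
    using X by (intro tr_sa) (auto simp: algebra_simps sc_commute sc_minus)
  ultimately show ?thesis using X by (simp add: tr_add tr_sc tr_diff N_intros star_N complex_eq_iff)
qed

text \<open>Real and imaginary part are bounded separately by means of self-adjoint elements, whence
  the factor \<open>2\<close>; this is enough for the continuity of the trace.\<close>

lemma tr_norm: assumes X: "X \<in> N" shows "cmod (tr X) \<le> 2 * norm X"
proof -
  have "\<bar>Re (tr ((1/2) *\<^sub>R (X + star X)))\<bar> \<le> norm ((1/2) *\<^sub>R (X + star X))"
    using X by (intro tr_sa) (auto simp: algebra_simps)
  also have "\<dots> \<le> norm X" using norm_triangle_ineq[of X "star X"] by simp
  finally have 1: "\<bar>Re (tr X)\<bar> \<le> norm X"
    using X by (simp add: tr_scaleR tr_add N_intros star_N tr_star)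
  have "\<bar>Re (tr (sc (\<i>/2) * (X - star X)))\<bar> \<le> norm (sc (\<i>/2) * (X - star X))"
    using X by (intro tr_sa) (auto simp: algebra_simps sc_commute sc_minus)
  also have "\<dots> \<le> (1/2) * norm (X - star X)"
    using norm_sc_times_le[of "\<i>/2" "X - star X"] by (simp add: norm_divide)
  also have "\<dots> \<le> norm X" using norm_triangle_ineq4[of X "star X"] by simp
  finally have 2: "\<bar>Im (tr X)\<bar> \<le> norm X"
    using X by (simp add: tr_sc tr_diff N_intros star_N tr_star)
  show ?thesis using 1 2 cmod_le[of "tr X"] by simp
qed

lemma tr_tendsto:
  assumes "\<And>n. X n \<in> N" "L \<in> N" "(X \<longlongrightarrow> L) F"
  shows "((\<lambda>n. tr (X n)) \<longlongrightarrow> tr L) F"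
proof -
  have "((\<lambda>n. tr (X n) - tr L) \<longlongrightarrow> 0) F"
  proof (rule Lim_null_comparison)
    show "\<forall>\<^sub>F n in F. norm (tr (X n) - tr L) \<le> 2 * norm (X n - L)"
      using tr_norm[OF csub_diff[OF csub assms(1,2)]] by (simp add: tr_diff assms(1,2))
    show "((\<lambda>n. 2 * norm (X n - L)) \<longlongrightarrow> 0) F"
      using assms(3) by (intro tendsto_mult_right_zero tendsto_norm_zero) (simp add: LIM_zero)
  qed
  then show ?thesis by (simp add: LIM_zero_iff)
qed

end

text \<open>The normality of the trace enters only through the distributions of positive elements.\<close>

locale tracial_algebra = pretracial_algebra N tr
  for N :: "'h::complex_hilbert_space cop set" and tr :: "'h cop \<Rightarrow> complex" +
  assumes distribution: "X \<in> N \<Longrightarrow> pos X \<Longrightarrow> \<exists>\<nu>::real measure. prob_space \<nu> \<and> sets \<nu> = sets borel \<and>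
      (AE s in \<nu>. 0 \<le> s \<and> s \<le> norm X) \<and> (\<forall>n. (\<integral>s. s ^ n \<partial>\<nu>) = Re (tr (X ^ n)))"

section \<open>Von Neumann algebras as tracial algebras\<close>

text \<open>A nonzero vector in the range of \<open>E t\<close> has its distribution below
  \<open>t\<close>, so for \<open>t < 0\<close> its form is negative, against positivity of
  \<open>A\<close>. Dually, at unit vectors in the range of \<open>1 - E t\<close> the form is at
  least \<open>t\<close>, which cannot exceed \<open>norm A\<close>.\<close>

lemma spectral_support:
  assumes "spectral E A r" and A: "pos A"
  shows "t < 0 \<Longrightarrow> E t = 0" and "norm A < t \<Longrightarrow> E t = 1"
proof -
  interpret spectral E A r by fact
  {
    assume t: "t < 0"
    show "E t = 0"
    proof (rule cop_eqI)
      fix y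
      define w where "w = ap (E t) y"
      have w: "ap (E s) w = w" if "t \<le> s" for s
        unfolding w_def using E_mult(2)[OF that] by (metis ap_times)
      interpret stieltjes "\<lambda>t. Re (cinner (ap (E t) w) w)" r "(norm w)\<^sup>2" by (rule vector_stieltjes)
      have "measure M {t<..max t r} = 0"
        by (subst measure_Ioc) (simp_all add: w cinner_self)
      then have "{t<..max t r} \<in> null_sets M" by (intro null_setsI) (simp_all add: emeasure_eq_measure)
      from AE_not_in[OF this] have "AE s in M. s \<le> t"
        using AE_Ioc by eventually_elim (auto simp: max_def split: if_splits)
      then have "(\<integral>s. s \<partial>M) \<le> (\<integral>s. t \<partial>M)"
        by (intro integral_mono_AE) (auto intro: integrable_bounded[where g="\<lambda>s. s" and B=r])
      then have "Re (cinner (ap A w) w) \<le> t * (norm w)\<^sup>2"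
        by (simp add: A_form measure_UNIV space_interval_measure mult.commute)
      then have "0 \<le> t * (norm w)\<^sup>2" using pos_Re[OF A, of w] by linarith
      then have "w = 0" using t by (simp add: zero_le_mult_iff)
      then show "ap (E t) y = ap 0 y" by (simp add: w_def)
    qed
  next
    assume t: "norm A < t"
    have "1 - E t = 0"
    proof (rule cop_eqI)
      fix y
      define w where "w = ap (1 - E t) y"
      have w: "ap (E s) w = 0" if "s \<le> t" for s
      proof -
        have "E s * (1 - E t) = 0" using E_mult(1)[OF that] by (simp add: right_diff_distrib)
        then show ?thesis unfolding w_def by (metis ap_times ap_zero)
      qed
      interpret stieltjes "\<lambda>t. Re (cinner (ap (E t) w) w)" r "(norm w)\<^sup>2" by (rule vector_stieltjes)
      have "measure M {min t (- r)<..t} = 0"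
        by (subst measure_Ioc) (simp_all add: w)
      then have "{min t (- r)<..t} \<in> null_sets M" by (intro null_setsI) (simp_all add: emeasure_eq_measure)
      from AE_not_in[OF this] have "AE s in M. t \<le> s"
        using AE_Ioc by eventually_elim (auto simp: min_def split: if_splits)
      then have "(\<integral>s. t \<partial>M) \<le> (\<integral>s. s \<partial>M)"
        by (intro integral_mono_AE) (auto intro: integrable_bounded[where g="\<lambda>s. s" and B=r])
      then have "t * (norm w)\<^sup>2 \<le> Re (cinner (ap A w) w)"
        by (simp add: A_form measure_UNIV space_interval_measure mult.commute)
      also have "\<dots> \<le> norm A * (norm w)\<^sup>2" using Re_cinner_le[of A w] by simp
      finally have "w = 0" using t by (simp add: mult_le_cancel_right)
      then show "ap (1 - E t) y = ap 0 y" by (simp add: w_def)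
    qed
    then show "E t = 1" by simp
  }
qed

locale traced_vna =
  fixes R :: "('h::complex_hilbert_space \<Rightarrow> 'h) set" and \<tau> :: "('h \<Rightarrow> 'h) \<Rightarrow> complex"
  assumes vna: "von_neumann_algebra R" and trace: "faithful_normal_tracial_state R \<tau>"
begin

definition N :: "'h cop set" where "N = {X. ap X \<in> R}"
definition tr :: "'h cop \<Rightarrow> complex" where "tr X = \<tau> (ap X)"

lemma star_sub: "star_subalgebra R" and wot: "wot_closure R = R"
  using vna by (auto simp: von_neumann_algebra_def)

text \<open>\<open>wot_closure\<close> tests finitely many matrix entries at a time, and finitely
  many limits are approached simultaneously.\<close>

lemma weak_limit:
  assumes p: "\<And>k. p k \<in> N" and lim: "\<And>x y. (\<lambda>k. cinner (ap (p k) x) y) \<longlonglongrightarrow> cinner (ap L x) y"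
  shows "L \<in> N"
proof -
  have "ap L \<in> wot_closure R"
    unfolding wot_closure_def
  proof (intro CollectI conjI allI impI)
    fix F :: "('h \<times> 'h) set" and e :: real
    assume F: "finite F \<and> 0 < e"
    have "\<forall>\<^sub>F k in sequentially. \<forall>q\<in>F. dist (cinner (ap (p k) (fst q)) (snd q)) (cinner (ap L (fst q)) (snd q)) < e"
      using F by (intro eventually_ball_finite ballI tendstoD[OF lim]) auto
    then obtain k where k: "\<forall>q\<in>F. dist (cinner (ap (p k) (fst q)) (snd q)) (cinner (ap L (fst q)) (snd q)) < e"
      by (auto simp: eventually_sequentially)
    show "\<exists>S\<in>R. \<forall>(x, y)\<in>F. cmod (cinner (ap L x) y - cinner (S x) y) < e"
      using p[of k] k by (intro bexI[of _ "ap (p k)"]) (auto simp: N_def dist_norm norm_minus_commute)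
  qed simp
  then show ?thesis by (simp add: wot N_def)
qed

lemma csub_N: "closed_subalgebra N"
  unfolding closed_subalgebra_def
proof (intro conjI allI ballI)
  show "closed N"
    unfolding closed_sequential_limits
  proof (intro allI impI)
    fix p L assume pL: "(\<forall>k. p k \<in> N) \<and> p \<longlonglongrightarrow> L"
    show "L \<in> N"
    proof (rule weak_limit[of p])
      fix x y
      have "(\<lambda>k. ap (p k - L) x) \<longlonglongrightarrow> 0"
      proof (rule Lim_null_comparison)
        show "\<forall>\<^sub>F k in sequentially. norm (ap (p k - L) x) \<le> norm (p k - L) * norm x"
          by (intro always_eventually allI norm_ap)
        show "(\<lambda>k. norm (p k - L) * norm x) \<longlonglongrightarrow> 0"
          using pL by (intro tendsto_mult_left_zero tendsto_norm_zero) (simp add: LIM_zero)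
      qed
      then have "(\<lambda>k. ap (p k) x) \<longlonglongrightarrow> ap L x" by (simp add: LIM_zero_iff)
      then show "(\<lambda>k. cinner (ap (p k) x) y) \<longlonglongrightarrow> cinner (ap L x) y"
        by (intro tendsto_cinner tendsto_const)
    qed (use pL in auto)
  qed
  show "sc c \<in> N" for c
  proof -
    have "ap (sc c :: 'h cop) = (\<lambda>x. c *\<^sub>C id x)" by (rule ext) simp
    moreover have "(\<lambda>x. c *\<^sub>C id x) \<in> R" using star_sub unfolding star_subalgebra_def by blast
    ultimately show ?thesis by (simp add: N_def)
  qed
  fix X Y assume "X \<in> N" "Y \<in> N"
  moreover have "ap (X + Y) = (\<lambda>x. ap X x + ap Y x)" "ap (X * Y) = ap X \<circ> ap Y" by (rule ext, simp)+
  ultimately show "X + Y \<in> N" "X * Y \<in> N" using star_sub by (auto simp: N_def star_subalgebra_def)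
qed

lemma star_in_N: "X \<in> N \<Longrightarrow> star X \<in> N"
  using star_sub by (simp add: N_def star_subalgebra_def ap_star)

lemma trace_props:
  shows "X \<in> N \<Longrightarrow> Y \<in> N \<Longrightarrow> tr (X + Y) = tr X + tr Y"
    and "X \<in> N \<Longrightarrow> tr (sc c * X) = c * tr X"
    and "tr 1 = 1"
    and "X \<in> N \<Longrightarrow> pos X \<Longrightarrow> Im (tr X) = 0 \<and> 0 \<le> Re (tr X)"
    and "X \<in> N \<Longrightarrow> Y \<in> N \<Longrightarrow> tr (X * Y) = tr (Y * X)"
proof -
  have a: "ap (X + Y) = (\<lambda>x. ap X x + ap Y x)" "ap (X * Y) = ap X \<circ> ap Y"
    "ap (sc c * X) = (\<lambda>x. c *\<^sub>C ap X x)" "ap 1 = (id :: 'h \<Rightarrow> 'h)" for X Y :: "'h cop" and c by (rule ext, simp)+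
  note t = trace[unfolded faithful_normal_tracial_state_def]
  show "X \<in> N \<Longrightarrow> Y \<in> N \<Longrightarrow> tr (X + Y) = tr X + tr Y" using t by (simp add: tr_def N_def a(1))
  show "X \<in> N \<Longrightarrow> tr (sc c * X) = c * tr X" using t by (simp add: tr_def N_def a(3))
  show "tr 1 = 1" using t by (simp add: tr_def a(4))
  show "X \<in> N \<Longrightarrow> pos X \<Longrightarrow> Im (tr X) = 0 \<and> 0 \<le> Re (tr X)"
    using t by (simp add: tr_def N_def pos_def)
  show "X \<in> N \<Longrightarrow> Y \<in> N \<Longrightarrow> tr (X * Y) = tr (Y * X)" using t by (simp add: tr_def N_def a(2))
qed

lemma normality:
  assumes "D \<subseteq> {X \<in> N. star X = X}" "D \<noteq> {}" "\<And>S T. S \<in> D \<Longrightarrow> T \<in> D \<Longrightarrow> \<exists>U\<in>D. pos (U - S) \<and> pos (U - T)"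
    "A \<in> N" "star A = A" "\<And>T. T \<in> D \<Longrightarrow> pos (A - T)"
    "\<And>B. B \<in> N \<Longrightarrow> star B = B \<Longrightarrow> (\<And>T. T \<in> D \<Longrightarrow> pos (B - T)) \<Longrightarrow> pos (B - A)"
  shows "Re (tr A) = (SUP T\<in>D. Re (tr T))"
proof -
  have sa: "self_adjoint (ap X) \<longleftrightarrow> star X = X" for X :: "'h cop"
    unfolding self_adjoint_def by (metis ap_star ap_inject bounded_op_ap)
  have "\<forall>D A. D \<subseteq> {T\<in>R. self_adjoint T} \<and> D \<noteq> {} \<and>
        (\<forall>S\<in>D. \<forall>T\<in>D. \<exists>U\<in>D. op_le S U \<and> op_le T U) \<and>
        A \<in> R \<and> self_adjoint A \<and> (\<forall>T\<in>D. op_le T A) \<and>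
        (\<forall>B\<in>R. self_adjoint B \<and> (\<forall>T\<in>D. op_le T B) \<longrightarrow> op_le A B)
        \<longrightarrow> Re (\<tau> A) = (SUP T\<in>D. Re (\<tau> T))"
    using trace unfolding faithful_normal_tracial_state_def by blast
  from this[rule_format, of "ap ` D" "ap A"]
  have "Re (\<tau> (ap A)) = (SUP T\<in>ap ` D. Re (\<tau> T))"
  proof (rule meta_mp, intro conjI)
    show "ap ` D \<subseteq> {T\<in>R. self_adjoint T}" using assms(1) by (auto simp: sa N_def)
    show "\<forall>S\<in>ap ` D. \<forall>T\<in>ap ` D. \<exists>U\<in>ap ` D. op_le S U \<and> op_le T U"
      using assms(3) by (simp add: op_le_ap)
    show "\<forall>B\<in>R. self_adjoint B \<and> (\<forall>T\<in>ap ` D. op_le T B) \<longrightarrow> op_le (ap A) B"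
    proof (intro ballI impI)
      fix B assume B: "B \<in> R" "self_adjoint B \<and> (\<forall>T\<in>ap ` D. op_le T B)"
      then obtain B' where B': "B = ap B'" by (metis ap_Op self_adjoint_def)
      show "op_le (ap A) B" using B assms(7)[of B'] by (simp add: B' op_le_ap sa N_def)
    qed
  qed (use assms in \<open>auto simp: N_def sa op_le_ap\<close>)
  then show ?thesis by (simp add: tr_def image_image)
qed

lemma spectral_projection_in_N:
  assumes "spectral E A r" "A \<in> N" shows "E t \<in> N"
proof -
  interpret spectral E A r by fact
  obtain p where p: "\<And>N k. closed_subalgebra N \<Longrightarrow> A \<in> N \<Longrightarrow> p k \<in> N"
    "\<And>x y. (\<lambda>k. cinner (ap (p k) x) y) \<longlonglongrightarrow> cinner (ap (E t) x) y"
    using projection_weak_limit by metis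
  show ?thesis using p(1)[OF csub_N assms(2)] p(2) by (rule weak_limit)
qed

text \<open>Only right continuity is not formal: the elements \<open>1 - E s\<close> for
  \<open>s > t\<close> form an upward directed family whose supremum is \<open>1 - E t\<close>, by
  strong right continuity of \<open>E\<close>, and normality makes the trace preserve it.\<close>

lemma trace_stieltjes:
  assumes "spectral E A r" "A \<in> N"
  shows "stieltjes (\<lambda>t. Re (tr (E t))) r 1"
proof
  interpret spectral E A r by fact
  have EN: "E t \<in> N" for t by (rule spectral_projection_in_N[OF assms])
  have z: "tr 0 = 0" using trace_props(2)[OF csub_zero[OF csub_N], of 0] by simp
  have um: "tr (- X) = - tr X" if "X \<in> N" for X
    using trace_props(2)[OF that, of "-1"] by (simp add: sc_minus)
  have diff: "tr (X - Y) = tr X - tr Y" if "X \<in> N" "Y \<in> N" for X Y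
    using trace_props(1)[OF that(1) csub_uminus[OF csub_N that(2)]] um[OF that(2)] by simp
  show mono: "Re (tr (E s)) \<le> Re (tr (E t))" if "s \<le> t" for s t
    using trace_props(4)[OF csub_diff[OF csub_N EN EN] E_mono[OF that]] by (simp add: diff EN)
  show "0 < r" by (rule r_pos)
  show "Re (tr (E t)) = 0" if "t \<le> - r" for t using E_low[OF that] by (simp add: z)
  show "Re (tr (E t)) = 1" if "r \<le> t" for t using E_high[OF that] trace_props(3) by simp
  fix t
  define D where "D = (\<lambda>s. 1 - E s) ` {t<..}"
  have sup: "Re (tr (1 - E t)) = (SUP T\<in>D. Re (tr T))"
  proof (rule normality)
    show "D \<subseteq> {X \<in> N. star X = X}" by (auto simp: D_def intro!: csub_diff[OF csub_N] csub_one[OF csub_N] EN)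
    show "D \<noteq> {}" by (auto simp: D_def)
    show "1 - E t \<in> N" by (intro csub_diff[OF csub_N] csub_one[OF csub_N] EN)
    show "pos (1 - E t - T)" if "T \<in> D" for T using that by (auto simp: D_def E_mono)
    show "\<exists>U\<in>D. pos (U - S) \<and> pos (U - T)" if ST: "S \<in> D" "T \<in> D" for S T
    proof -
      obtain a b where ab: "t < a" "t < b" "S = 1 - E a" "T = 1 - E b" using ST by (auto simp: D_def)
      then show ?thesis by (intro bexI[of _ "1 - E (min a b)"]) (auto simp: E_mono D_def)
    qed
    show "pos (B - (1 - E t))" if B: "B \<in> N" "star B = B" "\<And>T. T \<in> D \<Longrightarrow> pos (B - T)" for B
    proof (rule posI)
      show "star (B - (1 - E t)) = B - (1 - E t)" by (simp add: B)
      fix x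
      have "((\<lambda>s. Re (cinner (ap (B - (1 - E s)) x) x)) \<longlongrightarrow> Re (cinner (ap (B - (1 - E t)) x) x)) (at_right t)"
        unfolding ap_minus cinner_diff_left ap_one by (intro tendsto_intros tendsto_cinner E_rc)
      moreover have "\<forall>\<^sub>F s in at_right t. 0 \<le> Re (cinner (ap (B - (1 - E s)) x) x)"
        unfolding eventually_at_right_field
        by (intro exI[of _ "t + 1"]) (auto intro!: pos_Re B(3) simp: D_def simp del: ap_minus)
      ultimately show "0 \<le> Re (cinner (ap (B - (1 - E t)) x) x)"
        by (rule tendsto_lowerbound) simp
    qed
  qed simp
  have tr1: "Re (tr (1 - E s)) = 1 - Re (tr (E s))" for s
    by (simp add: diff csub_one[OF csub_N] EN trace_props(3))
  show "((\<lambda>t. Re (tr (E t))) \<longlongrightarrow> Re (tr (E t))) (at_right t)"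
  proof (rule tendstoI)
    fix e :: real assume e: "e > 0"
    have "bdd_above ((\<lambda>T. Re (tr T)) ` D)"
      using mono by (auto simp: D_def tr1 intro!: bdd_aboveI2[of _ _ "1 - Re (tr (E t))"])
    moreover have "(SUP T\<in>D. Re (tr T)) - e < (SUP T\<in>D. Re (tr T))" using e by simp
    ultimately obtain T where T: "T \<in> D" "(SUP T\<in>D. Re (tr T)) - e < Re (tr T)"
      by (subst (asm) less_cSUP_iff) (auto simp: D_def)
    then obtain s where s: "t < s" "1 - Re (tr (E t)) - e < 1 - Re (tr (E s))"
      using sup by (auto simp: D_def tr1)
    have "dist (Re (tr (E q))) (Re (tr (E t))) < e" if "t < q" "q < s" for q
      using mono[of t q] mono[of q s] that s by (simp add: dist_real_def)
    then show "\<forall>\<^sub>F q in at_right t. dist (Re (tr (E q))) (Re (tr (E t))) < e"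
      unfolding eventually_at_right_field using s by blast
  qed
qed

sublocale pretracial_algebra N tr
  by standard (use csub_N star_in_N trace_props in auto)

lemma trace_distribution:
  assumes sp: "spectral E A r" and A: "A \<in> N" "pos A"
  defines "M \<equiv> interval_measure (\<lambda>t. Re (tr (E t)))"
  shows "prob_space M" "sets M = sets borel" "AE s in M. 0 \<le> s \<and> s \<le> norm A"
    "(\<integral>s. s ^ n \<partial>M) = Re (tr (A ^ n))"
proof -
  interpret spectral E A r by fact
  interpret S: stieltjes "\<lambda>t. Re (tr (E t))" r 1 by (rule trace_stieltjes[OF sp A(1)])
  show "prob_space M" "sets M = sets borel"
    unfolding M_def by (intro prob_spaceI) (simp_all add: S.emeasure_UNIV space_interval_measure)
  \<comment> \<open>\<open>spectral_support\<close> speaks of points strictly outside the interval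
    from \<open>0\<close> to \<open>norm A\<close>; countably many half-open intervals exhaust the
    rest of the support.\<close>
  have "AE s in M. s \<notin> {- r<..- 1 / real (Suc n)}" for n
  proof (cases "- r \<le> - 1 / real (Suc n)")
    case True
    have "E (- 1 / real (Suc n)) = 0" by (rule spectral_support(1)[OF sp A(2)]) simp
    then have "emeasure M {- r<..- 1 / real (Suc n)} = 0"
      using True unfolding M_def by (subst S.emeasure_Ioc) (simp_all add: E_low)
    then show ?thesis by (intro AE_not_in null_setsI) (simp_all add: M_def)
  qed simp
  moreover have "AE s in M. s \<notin> {norm A + 1 / real (Suc n)<..r}" for n
  proof (cases "norm A + 1 / real (Suc n) \<le> r")
    case True
    have "E (norm A + 1 / real (Suc n)) = 1" by (rule spectral_support(2)[OF sp A(2)]) simp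
    then have "emeasure M {norm A + 1 / real (Suc n)<..r} = 0"
      using True unfolding M_def by (subst S.emeasure_Ioc) (simp_all add: E_high)
    then show ?thesis by (intro AE_not_in null_setsI) (simp_all add: M_def)
  qed simp
  ultimately have "AE s in M. \<forall>n. s \<notin> {- r<..- 1 / real (Suc n)} \<and> s \<notin> {norm A + 1 / real (Suc n)<..r}"
    by (simp add: AE_all_countable)
  then show "AE s in M. 0 \<le> s \<and> s \<le> norm A"
    using S.AE_Ioc unfolding M_def[symmetric]
  proof eventually_elim
    case (elim s)
    have "0 \<le> s"
    proof (rule ccontr)
      assume s: "\<not> 0 \<le> s"
      then obtain n where "inverse (real (Suc n)) < - s" using reals_Archimedean[of "- s"] by auto
      then have "s \<in> {- r<..- 1 / real (Suc n)}" using elim(2) by (simp add: inverse_eq_divide)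
      then show False using elim(1) by blast
    qed
    moreover have "s \<le> norm A"
    proof (rule ccontr)
      assume s: "\<not> s \<le> norm A"
      then obtain n where "inverse (real (Suc n)) < s - norm A" using reals_Archimedean[of "s - norm A"] by auto
      then have "s \<in> {norm A + 1 / real (Suc n)<..r}" using elim(2) by (simp add: inverse_eq_divide)
      then show False using elim(1) by blast
    qed
    ultimately show ?case by simp
  qed
  show "(\<integral>s. s ^ n \<partial>M) = Re (tr (A ^ n))"
    unfolding M_def
    by (rule moment[where C=2 and \<phi>="\<lambda>X. Re (tr X)" and K=1, OF csub])
      (use spectral_projection_in_N[OF sp A(1)] tr_norm order_trans[OF abs_Re_le_cmod] S.stieltjes_axioms
        in \<open>simp_all add: tr_add tr_scaleR\<close>)
qed

sublocale tracial_algebra N tr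
proof
  fix X assume X: "X \<in> N" "pos X"
  obtain E where E: "spectral_family E X" using spectral_family_exists[OF pos_star[OF X(2)]] by blast
  then obtain r where r: "spectral E X r" by (rule spectral_family_spectral)
  show "\<exists>\<nu>::real measure. prob_space \<nu> \<and> sets \<nu> = sets borel \<and>
      (AE s in \<nu>. 0 \<le> s \<and> s \<le> norm X) \<and> (\<forall>n. (\<integral>s. s ^ n \<partial>\<nu>) = Re (tr (X ^ n)))"
    using trace_distribution[OF r X] by blast
qed

end

section \<open>The logarithm of the determinant\<close>

text \<open>With \<open>y = c *\<^sub>R (1 - C)\<close> and
  \<open>0 \<le> C \<le> 1 - a / c\<close>, the inverse is a Neumann series. Its partial sums are
  positive and lie in every closed subalgebra containing \<open>y\<close>, and the limit inherits
  both.\<close>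

lemma pos_inverse_exists:
  assumes y: "pos (y - a *\<^sub>R 1)" and a: "0 < a"
  shows "\<exists>G. G * y = 1 \<and> y * G = 1 \<and> pos G \<and> norm G \<le> 1 / a \<and> (\<forall>N. closed_subalgebra N \<longrightarrow> y \<in> N \<longrightarrow> G \<in> N)"
proof -
  have py: "pos y" using pos_add[OF y pos_scaleR[OF _ pos_one, of a]] a by simp
  have form: "a * (norm x)\<^sup>2 \<le> Re (cinner (ap y x) x)" for x
    using pos_Re[OF y, of x] by (simp add: cinner_algebra cinner_self)
  \<comment> \<open>The summand \<open>a\<close> keeps \<open>c \<ge> a > 0\<close> even on the zero
    space, where \<open>norm y = 0\<close>.\<close>
  define c where "c = norm y + a"
  have c: "0 < c" "a \<le> c" using a by (auto simp: c_def add_nonneg_pos)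
  define C where "C = 1 - (1/c) *\<^sub>R y"
  have "pos ((1/c) *\<^sub>R (c *\<^sub>R 1 - y))"
    using c a pos_star[OF py] by (intro pos_scaleR pos_norm_minus) (auto simp: c_def)
  then have C: "pos C" using c by (simp add: C_def scaleR_diff_right)
  define \<rho> where "\<rho> = 1 - a / c"
  have \<rho>: "0 \<le> \<rho>" "\<rho> < 1" using a c by (auto simp: \<rho>_def)
  have "pos ((1/c) *\<^sub>R (y - a *\<^sub>R 1))" using y c by (intro pos_scaleR) auto
  moreover have "\<rho> *\<^sub>R 1 - C = (1/c) *\<^sub>R (y - a *\<^sub>R 1)"
    by (simp add: C_def \<rho>_def algebra_simps)
  ultimately have nC: "norm C \<le> \<rho>" by (intro pos_norm_le[OF C _ \<rho>(1)]) simp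
  have nCn: "norm (C ^ n) \<le> \<rho> ^ n" for n
    using norm_power_cop_le[of C n] power_mono[OF nC, of n] by simp
  have sC: "summable (\<lambda>n. C ^ n)"
    using nCn \<rho> by (intro summable_norm_cancel[OF summable_comparison_test'[OF summable_geometric, of \<rho> 0]]) auto
  define S where "S = (\<Sum>n. C ^ n)"
  have sums: "(\<lambda>n. C ^ n) sums S" unfolding S_def by (rule summable_sums[OF sC])
  have "(\<lambda>n. C ^ Suc n) sums (S - 1)" using sums_Suc_iff[of "\<lambda>n. C ^ n" "S - 1"] sums by simp
  moreover have "(\<lambda>n. C ^ Suc n) sums (C * S)"
    unfolding power_Suc by (rule bounded_linear.sums[OF bounded_linear_mult_right sums])
  moreover have "(\<lambda>n. C ^ Suc n) sums (S * C)"
    unfolding power_Suc2 by (rule bounded_linear.sums[OF bounded_linear_mult_left sums])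
  ultimately have CS: "C * S = S - 1" "S * C = S - 1" using sums_unique2 by blast+
  have yC: "y = c *\<^sub>R (1 - C)" using c by (simp add: C_def)
  define G where "G = (1/c) *\<^sub>R S"
  have G: "G * y = 1" "y * G = 1" using c CS by (simp_all add: G_def yC algebra_simps)
  have yGx: "ap y (ap G x) = x" for x using G(2) by (metis ap_one ap_times)
  have "pos G"
  proof -
    have "(\<lambda>n. \<Sum>i<n. C ^ i) \<longlonglongrightarrow> S" using sums by (simp add: sums_def)
    moreover have "pos (\<Sum>i<n. C ^ i)" for n by (induction n) (auto intro: pos_add pos_power C)
    ultimately have "pos S" using pos_lim[of "\<lambda>n. \<Sum>i<n. C ^ i" S] by blast
    then show ?thesis using c by (simp add: G_def pos_scaleR)
  qed
  moreover have "norm G \<le> 1 / a"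
  proof (rule norm_cop_leI)
    fix x
    have "a * (norm (ap G x))\<^sup>2 \<le> Re (cinner x (ap G x))" using form[of "ap G x"] by (simp add: yGx)
    also have "\<dots> \<le> norm x * norm (ap G x)"
      by (rule order_trans[OF complex_Re_le_cmod cinner_Cauchy_Schwarz])
    finally have "a * norm (ap G x) * norm (ap G x) \<le> norm x * norm (ap G x)"
      by (simp add: power2_eq_square mult_ac)
    then have "a * norm (ap G x) \<le> norm x"
      by (cases "norm (ap G x) = 0") (auto simp: mult_le_cancel_right)
    then show "norm (ap G x) \<le> 1 / a * norm x" using a by (simp add: field_simps)
  qed (use a in simp)
  moreover have "G \<in> N" if N: "closed_subalgebra N" "y \<in> N" for N
  proof -
    have "C \<in> N" unfolding C_def using N by (intro csub_diff csub_one csub_scaleR)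
    then show ?thesis unfolding G_def using N csub_sums[OF N(1) _ sums]
      by (intro csub_scaleR) (auto intro: csub_power)
  qed
  ultimately show ?thesis using G by blast
qed

context tracial_algebra
begin

text \<open>\<open>tr (ln y)\<close> for positive invertible \<open>y\<close>, with \<open>ln (y / c)\<close> expanded around \<open>1\<close> for
  \<open>c = norm y + 1\<close>.\<close>

definition ld :: "'h cop \<Rightarrow> real" where
  "ld y = ln (norm y + 1) - (\<Sum>n. Re (tr ((1 - (1 / (norm y + 1)) *\<^sub>R y) ^ Suc n)) / real (Suc n))"

text \<open>The trace is used because \<open>tr 1 = 1\<close> excludes the zero space, on which the
  claim fails for \<open>a > 0\<close>.\<close>

lemma lower_bound_le_norm: assumes "y \<in> N" "pos (y - a *\<^sub>R 1)" shows "a \<le> norm y"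
proof -
  have "star (y - a *\<^sub>R 1) = y - a *\<^sub>R 1" using assms(2) by (rule pos_star)
  then have "star y = y" by simp
  then have "Re (tr y) \<le> norm y" using tr_sa(2)[OF assms(1)] by simp
  moreover have "0 \<le> Re (tr (y - a *\<^sub>R 1))" using tr_pos[OF _ assms(2)] assms(1) by auto
  ultimately show ?thesis using assms(1) by (simp add: tr_diff tr_scaleR tr_one N_intros)
qed

text \<open>The generality in \<open>h\<close> is for \<open>h s = s\<^sup>2\<close>, with
  \<open>\<nu>\<close> the distribution of a square root of \<open>x\<close>. The induction needs
  all powers \<open>j\<close>, since expanding one factor raises the power of
  \<open>x\<close>.\<close>

lemma polynomial_moment:
  assumes x: "x \<in> N" and \<nu>: "prob_space \<nu>" "h \<in> borel_measurable \<nu>" "AE s in \<nu>. 0 \<le> h s \<and> h s \<le> B"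
    and mom: "\<And>n. (\<integral>s. h s ^ n \<partial>\<nu>) = Re (tr (x ^ n))"
  shows "(\<integral>s. h s ^ j * (\<alpha> + \<beta> * h s) ^ n \<partial>\<nu>) = Re (tr (x ^ j * (\<alpha> *\<^sub>R 1 + \<beta> *\<^sub>R x) ^ n))"
proof (induction n arbitrary: j)
  case 0
  then show ?case by (simp add: mom)
next
  case (Suc n)
  interpret prob_space \<nu> by fact
  let ?P = "\<alpha> *\<^sub>R 1 + \<beta> *\<^sub>R x"
  have P: "?P ^ n \<in> N" using x by auto
  have int: "integrable \<nu> (\<lambda>s. h s ^ j * (\<alpha> + \<beta> * h s) ^ n)" for j
  proof (rule integrable_const_bound[where B="B ^ j * (\<bar>\<alpha>\<bar> + \<bar>\<beta>\<bar> * B) ^ n"])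
    show "AE s in \<nu>. norm (h s ^ j * (\<alpha> + \<beta> * h s) ^ n) \<le> B ^ j * (\<bar>\<alpha>\<bar> + \<bar>\<beta>\<bar> * B) ^ n"
      using \<nu>(3)
    proof eventually_elim
      case (elim s)
      have "\<bar>\<alpha> + \<beta> * h s\<bar> \<le> \<bar>\<alpha>\<bar> + \<bar>\<beta>\<bar> * B"
        using elim abs_triangle_ineq[of \<alpha> "\<beta> * h s"] mult_left_mono[of "h s" B "\<bar>\<beta>\<bar>"] by (simp add: abs_mult)
      then show ?case
        unfolding real_norm_def abs_mult power_abs using elim by (intro mult_mono power_mono) auto
    qed
  qed (use \<nu>(2) in measurable)
  have "(\<integral>s. h s ^ j * (\<alpha> + \<beta> * h s) ^ Suc n \<partial>\<nu>) =
      (\<integral>s. \<alpha> * (h s ^ j * (\<alpha> + \<beta> * h s) ^ n) + \<beta> * (h s ^ Suc j * (\<alpha> + \<beta> * h s) ^ n) \<partial>\<nu>)"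
    by (intro Bochner_Integration.integral_cong) (auto simp: algebra_simps)
  also have "\<dots> = \<alpha> * Re (tr (x ^ j * ?P ^ n)) + \<beta> * Re (tr (x ^ Suc j * ?P ^ n))"
    using int[of j] int[of "Suc j"] by (simp add: Suc del: power_Suc)
  also have "\<dots> = Re (tr (\<alpha> *\<^sub>R (x ^ j * ?P ^ n) + \<beta> *\<^sub>R (x ^ Suc j * ?P ^ n)))"
    using x P by (simp add: tr_add tr_scaleR N_intros del: power_Suc)
  also have "\<alpha> *\<^sub>R (x ^ j * ?P ^ n) + \<beta> *\<^sub>R (x ^ Suc j * ?P ^ n) = x ^ j * ?P ^ Suc n"
    unfolding power_Suc2[of x j] power_Suc[of ?P n] by (simp add: algebra_simps)
  finally show ?case .
qed

text \<open>In \<open>ln (h s + a) = ln c + ln (1 - u)\<close> the quantity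
  \<open>u = 1 - (h s + a) / c\<close> lies between \<open>0\<close> and
  \<open>1 - a / c < 1\<close>, so the logarithmic series is dominated by a geometric one and may be
  integrated termwise.\<close>

lemma ld_integral:
  assumes x: "x \<in> N" and \<nu>: "prob_space \<nu>" "h \<in> borel_measurable \<nu>" "AE s in \<nu>. 0 \<le> h s \<and> h s \<le> B"
    and mom: "\<And>n. (\<integral>s. h s ^ n \<partial>\<nu>) = Re (tr (x ^ n))"
    and a: "0 < a" and c: "B + a \<le> c"
  shows "(\<lambda>n. Re (tr ((1 - (1/c) *\<^sub>R (x + a *\<^sub>R 1)) ^ Suc n)) / real (Suc n)) sums (ln c - (\<integral>s. ln (h s + a) \<partial>\<nu>))"
proof -
  interpret prob_space \<nu> by fact
  have "AE s in \<nu>. 0 \<le> B" using \<nu>(3) by eventually_elim auto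
  then have B: "0 \<le> B" by simp
  have c0: "0 < c" using B a c by linarith
  define \<rho> where "\<rho> = 1 - a / c"
  have \<rho>: "0 \<le> \<rho>" "\<rho> < 1" using a c c0 B by (auto simp: \<rho>_def)
  define f where "f n s = (1 - (h s + a) / c) ^ Suc n / real (Suc n)" for n s
  have mf [measurable]: "f n \<in> borel_measurable \<nu>" for n unfolding f_def using \<nu>(2) by measurable
  have range: "AE s in \<nu>. 0 \<le> 1 - (h s + a) / c \<and> 1 - (h s + a) / c \<le> \<rho> \<and> 0 < h s + a"
    using \<nu>(3) by eventually_elim (use c c0 a in \<open>auto simp: \<rho>_def divide_simps\<close>)
  have bd: "AE s in \<nu>. norm (f n s) \<le> \<rho> ^ n" for n
    using range
  proof eventually_elim
    case (elim s)
    have "norm (f n s) \<le> \<rho> ^ Suc n / real (Suc n)"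
      unfolding f_def using elim by (auto intro!: divide_right_mono power_mono simp del: power_Suc)
    also have "\<dots> \<le> \<rho> ^ Suc n / 1" using \<rho> by (intro divide_left_mono) auto
    also have "\<dots> \<le> \<rho> ^ n" using \<rho> by (simp add: mult_left_le_one_le)
    finally show ?case .
  qed
  have int: "integrable \<nu> (f n)" for n
    by (rule integrable_const_bound[OF bd mf])
  have sums: "(\<lambda>n. integral\<^sup>L \<nu> (f n)) sums (\<integral>s. (\<Sum>n. f n s) \<partial>\<nu>)"
  proof (rule sums_integral[OF int])
    have "AE s in \<nu>. \<forall>n. norm (f n s) \<le> \<rho> ^ n" using bd by (simp add: AE_all_countable)
    then show "AE s in \<nu>. summable (\<lambda>n. norm (f n s))"
      by eventually_elim (rule summable_comparison_test'[OF summable_geometric[of \<rho>], of 0], use \<rho> in auto)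
    have "(\<integral>s. norm (f n s) \<partial>\<nu>) \<le> \<rho> ^ n" for n
    proof -
      have "(\<integral>s. norm (f n s) \<partial>\<nu>) \<le> (\<integral>s. \<rho> ^ n \<partial>\<nu>)"
        using int bd by (intro integral_mono_AE) auto
      then show ?thesis by (simp add: prob_space)
    qed
    then show "summable (\<lambda>n. \<integral>s. norm (f n s) \<partial>\<nu>)"
      using \<rho> by (intro summable_comparison_test'[OF summable_geometric[of \<rho>], of 0]) auto
  qed
  have "AE s in \<nu>. (\<Sum>n. f n s) = ln c - ln (h s + a)"
    using range
  proof eventually_elim
    case (elim s)
    define u where "u = 1 - (h s + a) / c"
    have u: "0 \<le> u" "u < 1" using elim \<rho> by (auto simp: u_def)
    have "(\<lambda>n. u ^ Suc n / real (Suc n)) sums - ln (1 - u)"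
      using ln_series'[of "- u"] u sums_minus[of "\<lambda>n. - ((- (- u)) ^ n) / real n" "ln (1 - u)"]
        sums_Suc_iff[of "\<lambda>n. u ^ n / real n" "- ln (1 - u)"] by (simp add: field_simps)
    moreover have "1 - u = (h s + a) / c" by (simp add: u_def)
    ultimately have "(\<lambda>n. f n s) sums - ln ((h s + a) / c)" by (simp add: f_def u_def)
    then show ?case using elim c0 by (simp add: sums_iff ln_div)
  qed
  then have "(\<integral>s. (\<Sum>n. f n s) \<partial>\<nu>) = (\<integral>s. ln c - ln (h s + a) \<partial>\<nu>)"
  proof (intro integral_cong_AE)
    show "(\<lambda>s. \<Sum>n. f n s) \<in> borel_measurable \<nu>" by measurable
    show "(\<lambda>s. ln c - ln (h s + a)) \<in> borel_measurable \<nu>"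
      using \<nu>(2) by (intro borel_measurable_diff borel_measurable_ln borel_measurable_add) simp_all
  qed
  also have "\<dots> = ln c - (\<integral>s. ln (h s + a) \<partial>\<nu>)"
  proof -
    have "integrable \<nu> (\<lambda>s. ln (h s + a))"
    proof (rule integrable_const_bound[where B="\<bar>ln a\<bar> + \<bar>ln (B + a)\<bar>"])
      show "AE s in \<nu>. norm (ln (h s + a)) \<le> \<bar>ln a\<bar> + \<bar>ln (B + a)\<bar>"
        using \<nu>(3)
      proof eventually_elim
        case (elim s)
        have "ln a \<le> ln (h s + a)" "ln (h s + a) \<le> ln (B + a)" using elim a by (auto intro!: ln_mono)
        then show ?case by auto
      qed
    qed (use \<nu>(2) in measurable)
    then show ?thesis by (simp add: prob_space)
  qed
  finally have val: "(\<integral>s. (\<Sum>n. f n s) \<partial>\<nu>) = ln c - (\<integral>s. ln (h s + a) \<partial>\<nu>)" .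
  have "integral\<^sup>L \<nu> (f n) = Re (tr ((1 - (1/c) *\<^sub>R (x + a *\<^sub>R 1)) ^ Suc n)) / real (Suc n)" for n
  proof -
    have "integral\<^sup>L \<nu> (f n) = (\<integral>s. h s ^ 0 * ((1 - a / c) + (- (1 / c)) * h s) ^ Suc n \<partial>\<nu>) / real (Suc n)"
    proof -
      have e: "(1 - a / c) + (- (1 / c)) * h s = 1 - (h s + a) / c" for s
        by (simp add: add_divide_distrib)
      show ?thesis unfolding f_def e by (simp del: power_Suc)
    qed
    also have "\<dots> = Re (tr (x ^ 0 * ((1 - a / c) *\<^sub>R 1 + (- (1 / c)) *\<^sub>R x) ^ Suc n)) / real (Suc n)"
      by (subst polynomial_moment[OF x \<nu> mom]) simp
    also have "(1 - a / c) *\<^sub>R 1 + (- (1 / c)) *\<^sub>R x = 1 - (1/c) *\<^sub>R (x + a *\<^sub>R 1)"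
      by (simp add: algebra_simps)
    finally show ?thesis by simp
  qed
  with sums show ?thesis by (simp add: val)
qed

text \<open>The constant in the definition of \<open>ld\<close> may be replaced by any
  \<open>c \<ge> norm y\<close>: for each \<open>c\<close> the series is \<open>ln c\<close> minus
  one and the same integral of the logarithm. This lets elements be compared by expanding them with
  a common \<open>c\<close>.\<close>

lemma ld_series:
  assumes y: "y \<in> N" and a: "0 < a" "pos (y - a *\<^sub>R 1)" and c: "norm y \<le> c"
  shows "(\<lambda>n. Re (tr ((1 - (1/c) *\<^sub>R y) ^ Suc n)) / real (Suc n)) sums (ln c - ld y)"
proof -
  define x where "x = y - a *\<^sub>R 1"
  have x: "x \<in> N" "pos x" using y a by (auto simp: x_def)
  have sy: "star y = y" using pos_star[OF a(2)] by simp
  have "norm x \<le> norm y - a"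
    using pos_norm_minus[OF sy, of "norm y"] lower_bound_le_norm[OF y a(2)]
    by (intro pos_norm_le[OF x(2)]) (auto simp: x_def algebra_simps)
  then have nx: "norm x + a \<le> norm y" by simp
  obtain \<nu> :: "real measure" where \<nu>: "prob_space \<nu>" "sets \<nu> = sets borel"
      "AE s in \<nu>. 0 \<le> s \<and> s \<le> norm x" "\<And>n. (\<integral>s. s ^ n \<partial>\<nu>) = Re (tr (x ^ n))"
    using distribution[OF x] by blast
  have m: "(\<lambda>s. s) \<in> borel_measurable \<nu>" using \<nu>(2) by (simp add: measurable_ident_sets)
  have "x + a *\<^sub>R 1 = y" by (simp add: x_def)
  then have *: "(\<lambda>n. Re (tr ((1 - (1/c) *\<^sub>R y) ^ Suc n)) / real (Suc n)) sums (ln c - (\<integral>s. ln (s + a) \<partial>\<nu>))"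
    if "norm y \<le> c" for c
    using ld_integral[OF x(1) \<nu>(1) m \<nu>(3,4) a(1), of c] nx that by simp
  have "ld y = (\<integral>s. ln (s + a) \<partial>\<nu>)"
    using *[of "norm y + 1"] by (simp add: ld_def sums_iff)
  with *[OF c] show ?thesis by simp
qed

lemma ld_eq_integral:
  assumes x: "x \<in> N" "pos x" and \<nu>: "prob_space \<nu>" "h \<in> borel_measurable \<nu>" "AE s in \<nu>. 0 \<le> h s \<and> h s \<le> B"
    and mom: "\<And>n. (\<integral>s. h s ^ n \<partial>\<nu>) = Re (tr (x ^ n))" and a: "0 < a"
  shows "ld (x + a *\<^sub>R 1) = (\<integral>s. ln (h s + a) \<partial>\<nu>)"
proof -
  have "(\<lambda>n. Re (tr ((1 - (1/c) *\<^sub>R (x + a *\<^sub>R 1)) ^ Suc n)) / real (Suc n)) sums (ln c - ld (x + a *\<^sub>R 1))"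
    if "norm (x + a *\<^sub>R 1) \<le> c" for c
    using x that by (intro ld_series[OF _ a]) auto
  from this[of "max (norm (x + a *\<^sub>R 1)) (B + a)"] ld_integral[OF x(1) \<nu> mom a, of "max (norm (x + a *\<^sub>R 1)) (B + a)"]
  show ?thesis by (simp add: sums_iff)
qed

lemma ld_one: "ld 1 = 0"
proof -
  have "(\<lambda>n. Re (tr ((1 - (1/1) *\<^sub>R 1) ^ Suc n)) / real (Suc n)) sums (ln 1 - ld 1)"
    by (rule ld_series[of 1 1]) (auto simp: norm_one_cop_le)
  moreover have "(\<lambda>n. Re (tr ((1 - (1/1) *\<^sub>R 1) ^ Suc n)) / real (Suc n)) sums 0"
    by (simp add: tr_zero)
  ultimately show ?thesis using sums_unique2 by fastforce
qed

text \<open>For \<open>c \<ge> norm y\<close> the element \<open>1 - (1/c) *\<^sub>R y\<close> is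
  positive, so the series subtracted from \<open>ln c\<close> has nonnegative terms.\<close>

lemma ld_le:
  assumes y: "y \<in> N" and a: "0 < a" "pos (y - a *\<^sub>R 1)" and c: "norm y \<le> c"
  shows "ld y \<le> ln c"
proof -
  have sy: "star y = y" using pos_star[OF a(2)] by simp
  have c0: "0 < c" using lower_bound_le_norm[OF y a(2)] a c by simp
  have "pos ((1/c) *\<^sub>R (c *\<^sub>R 1 - y))"
    using c0 by (intro pos_scaleR pos_norm_minus sy c) simp
  then have C: "pos (1 - (1/c) *\<^sub>R y)" using c0 by (simp add: scaleR_diff_right)
  have "0 \<le> Re (tr ((1 - (1/c) *\<^sub>R y) ^ Suc n)) / real (Suc n)" for n
    using tr_pos[OF _ pos_power[OF C, of "Suc n"]] y by (auto simp del: power_Suc intro!: divide_nonneg_nonneg)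
  from sums_le[OF this sums_zero ld_series[OF y a c]] show ?thesis by simp
qed

lemma ld_scale:
  assumes y: "y \<in> N" and a: "0 < a" "pos (y - a *\<^sub>R 1)" and k: "0 < k"
  shows "ld (k *\<^sub>R y) = ln k + ld y"
proof -
  have c0: "0 < norm y" using lower_bound_le_norm[OF y a(2)] a(1) by linarith
  have "pos (k *\<^sub>R (y - a *\<^sub>R 1))" using k by (intro pos_scaleR a) auto
  then have p: "pos (k *\<^sub>R y - (k * a) *\<^sub>R 1)" by (simp add: scaleR_diff_right)
  have "(\<lambda>n. Re (tr ((1 - (1/(k * norm y)) *\<^sub>R (k *\<^sub>R y)) ^ Suc n)) / real (Suc n)) sums (ln (k * norm y) - ld (k *\<^sub>R y))"
    using y a k by (intro ld_series[OF _ _ p]) auto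
  moreover have "(\<lambda>n. Re (tr ((1 - (1/norm y) *\<^sub>R y) ^ Suc n)) / real (Suc n)) sums (ln (norm y) - ld y)"
    by (rule ld_series[OF y a]) simp
  ultimately show ?thesis using k c0 by (simp add: sums_iff ln_mult)
qed

text \<open>Expanded with the larger of the two norms as common constant, the two series agree
  termwise.\<close>

lemma ld_cong_moments:
  assumes y: "y \<in> N" "0 < a" "pos (y - a *\<^sub>R 1)" and z: "z \<in> N" "pos (z - a *\<^sub>R 1)"
    and eq: "\<And>\<beta> n. tr ((1 - \<beta> *\<^sub>R y) ^ n) = tr ((1 - \<beta> *\<^sub>R z) ^ n)"
  shows "ld y = ld z"
proof -
  have "(\<lambda>n. Re (tr ((1 - (1/max (norm y) (norm z)) *\<^sub>R y) ^ Suc n)) / real (Suc n)) sums (ln (max (norm y) (norm z)) - ld y)"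
    by (rule ld_series[OF y]) simp
  moreover have "(\<lambda>n. Re (tr ((1 - (1/max (norm y) (norm z)) *\<^sub>R z) ^ Suc n)) / real (Suc n)) sums (ln (max (norm y) (norm z)) - ld z)"
    by (rule ld_series[OF z(1) y(2) z(2)]) simp
  ultimately show ?thesis unfolding eq by (simp add: sums_iff)
qed

text \<open>\<open>star Z * Z\<close> and \<open>Z * star Z\<close> have the same moments:
  \<open>Z\<close> intertwines the polynomials in the two, and the trace is cyclic.\<close>

lemma ld_star_swap:
  assumes Z: "Z \<in> N" and a: "0 < a"
  shows "ld (star Z * Z + a *\<^sub>R 1) = ld (Z * star Z + a *\<^sub>R 1)"
proof (rule ld_cong_moments)
  fix \<beta> n
  have inter: "Z * (\<alpha> *\<^sub>R 1 + \<gamma> *\<^sub>R (star Z * Z)) ^ n = (\<alpha> *\<^sub>R 1 + \<gamma> *\<^sub>R (Z * star Z)) ^ n * Z" for \<alpha> \<gamma> n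
  proof (induction n)
    case (Suc n)
    have "Z * (\<alpha> *\<^sub>R 1 + \<gamma> *\<^sub>R (star Z * Z)) ^ Suc n = Z * (\<alpha> *\<^sub>R 1 + \<gamma> *\<^sub>R (star Z * Z)) ^ n * (\<alpha> *\<^sub>R 1 + \<gamma> *\<^sub>R (star Z * Z))"
      by (simp add: power_Suc2 mult.assoc del: power_Suc)
    also have "\<dots> = (\<alpha> *\<^sub>R 1 + \<gamma> *\<^sub>R (Z * star Z)) ^ n * ((\<alpha> *\<^sub>R 1 + \<gamma> *\<^sub>R (Z * star Z)) * Z)"
      by (simp add: Suc mult.assoc) (simp add: algebra_simps)
    finally show ?case by (simp add: power_Suc2 mult.assoc del: power_Suc)
  qed simp
  have "tr ((\<alpha> *\<^sub>R 1 + \<gamma> *\<^sub>R (star Z * Z)) ^ n) = tr ((\<alpha> *\<^sub>R 1 + \<gamma> *\<^sub>R (Z * star Z)) ^ n)" for \<alpha> \<gamma>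
  proof (induction n)
    case (Suc n)
    let ?P = "\<alpha> *\<^sub>R 1 + \<gamma> *\<^sub>R (star Z * Z)" and ?Q = "\<alpha> *\<^sub>R 1 + \<gamma> *\<^sub>R (Z * star Z)"
    have PQ: "?P ^ n \<in> N" "?Q ^ n \<in> N" "star Z \<in> N" "?Q ^ n * Z \<in> N" using Z by auto
    have "tr (?P ^ Suc n) = of_real \<alpha> * tr (?P ^ n) + of_real \<gamma> * tr (star Z * (Z * ?P ^ n))"
      using PQ Z by (simp add: algebra_simps tr_add tr_scaleR N_intros)
    also have "tr (star Z * (Z * ?P ^ n)) = tr (?Q ^ n * (Z * star Z))"
      using PQ Z by (simp add: inter tr_commute[of "star Z"] mult.assoc)
    also have "of_real \<alpha> * tr (?P ^ n) + of_real \<gamma> * tr (?Q ^ n * (Z * star Z)) = tr (?Q ^ Suc n)"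
      using PQ Z by (simp add: Suc power_Suc2 algebra_simps tr_add tr_scaleR N_intros del: power_Suc)
    finally show ?case .
  qed simp
  from this[of "1 - \<beta> * a" "- \<beta>"]
  show "tr ((1 - \<beta> *\<^sub>R (star Z * Z + a *\<^sub>R 1)) ^ n) = tr ((1 - \<beta> *\<^sub>R (Z * star Z + a *\<^sub>R 1)) ^ n)"
    by (simp add: algebra_simps)
qed (use Z a in auto)

lemma ld_unitary_conj:
  assumes y: "y \<in> N" "0 < a" "pos (y - a *\<^sub>R 1)" and W: "W \<in> N" "star W * W = 1" "W * star W = 1"
  shows "ld (W * y * star W) = ld y"
proof (rule ld_cong_moments)
  show "pos (W * y * star W - a *\<^sub>R 1)"
  proof -
    have "pos (star (star W) * (y - a *\<^sub>R 1) * star W)" by (rule pos_conj) (rule y)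
    then show ?thesis by (simp add: algebra_simps W)
  qed
  fix \<beta> n
  have "(1 - \<beta> *\<^sub>R (W * y * star W)) ^ n = W * (1 - \<beta> *\<^sub>R y) ^ n * star W"
  proof (induction n)
    case (Suc n)
    have "(1 - \<beta> *\<^sub>R (W * y * star W)) = W * (1 - \<beta> *\<^sub>R y) * star W" by (simp add: algebra_simps W)
    then have "(1 - \<beta> *\<^sub>R (W * y * star W)) ^ Suc n = W * (1 - \<beta> *\<^sub>R y) * (star W * W) * (1 - \<beta> *\<^sub>R y) ^ n * star W"
      using Suc by (simp only: power_Suc mult.assoc)
    then show ?case by (simp add: W mult.assoc)
  qed (simp add: W)
  moreover have "tr (W * (1 - \<beta> *\<^sub>R y) ^ n * star W) = tr ((1 - \<beta> *\<^sub>R y) ^ n)"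
  proof -
    have "tr (W * ((1 - \<beta> *\<^sub>R y) ^ n * star W)) = tr ((1 - \<beta> *\<^sub>R y) ^ n * star W * W)"
      using y W by (intro tr_commute) auto
    then show ?thesis by (simp add: mult.assoc W)
  qed
  ultimately show "tr ((1 - \<beta> *\<^sub>R (W * y * star W)) ^ n) = tr ((1 - \<beta> *\<^sub>R y) ^ n)" by simp
qed (use y W in auto)

end

text \<open>From \<open>norm x \<le> K * norm (ap Y x)\<close>. The \<open>+ 1\<close> keeps the
  bound defined and positive when \<open>K = 0\<close>.\<close>

lemma pos_star_mult_lower:
  assumes inv: "Yi * Y = 1" and K: "norm Yi \<le> K"
  shows "pos (star Y * Y - (1 / (K\<^sup>2 + 1)) *\<^sub>R 1)"
proof (rule posI)
  fix x
  have "norm x \<le> norm Yi * norm (ap Y x)" using norm_ap[of Yi "ap Y x"] inv by (metis ap_one ap_times)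
  also have "\<dots> \<le> K * norm (ap Y x)" by (rule mult_right_mono[OF K norm_ge_zero])
  finally have "(norm x)\<^sup>2 \<le> (K * norm (ap Y x))\<^sup>2" by (intro power_mono) auto
  also have "\<dots> \<le> (K\<^sup>2 + 1) * (norm (ap Y x))\<^sup>2" by (simp add: power_mult_distrib algebra_simps)
  finally have "1 / (K\<^sup>2 + 1) * (norm x)\<^sup>2 \<le> (norm (ap Y x))\<^sup>2"
    by (simp add: divide_simps mult.commute add_nonneg_pos)
  then show "0 \<le> Re (cinner (ap (star Y * Y - (1 / (K\<^sup>2 + 1)) *\<^sub>R 1) x) x)"
    by (simp add: cinner_algebra cinner_self cinner_star_left)
qed simp

section \<open>Differentiation of the trace of the logarithm and its consequences\<close>

context tracial_algebra
begin

lemma Re_tr_scaleR: "X \<in> N \<Longrightarrow> Re (tr (r *\<^sub>R X)) = r * Re (tr X)"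
  by (simp add: tr_scaleR)

text \<open>Linearity of \<open>tr\<close> is known only on \<open>N\<close>, so it is no bounded
  linear map on the whole type, and the chain rule is replaced by an estimate of the difference
  quotient with \<open>tr_norm\<close>.\<close>

lemma tr_has_derivative:
  assumes f: "(f has_vector_derivative D) (at s within S)" and N: "\<And>q. q \<in> S \<Longrightarrow> f q \<in> N" "D \<in> N" "s \<in> S"
  shows "((\<lambda>q. Re (tr (f q))) has_real_derivative Re (tr D)) (at s within S)"
  unfolding has_field_derivative_def has_derivative_within
proof
  show "bounded_linear ((*) (Re (tr D)))" by (rule bounded_linear_mult_right)
  have "((\<lambda>q. (1 / norm (q - s)) *\<^sub>R (f q - (f s + (q - s) *\<^sub>R D))) \<longlongrightarrow> 0) (at s within S)"
    using f unfolding has_vector_derivative_def has_derivative_within by blast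
  from tendsto_mult_right_zero[OF tendsto_norm_zero[OF this], of 2]
  have lim: "((\<lambda>q. 2 * norm ((1 / norm (q - s)) *\<^sub>R (f q - (f s + (q - s) *\<^sub>R D)))) \<longlongrightarrow> 0) (at s within S)" .
  show "((\<lambda>q. (1 / norm (q - s)) *\<^sub>R (Re (tr (f q)) - (Re (tr (f s)) + Re (tr D) * (q - s)))) \<longlongrightarrow> 0) (at s within S)"
  proof (rule Lim_null_comparison[OF _ lim])
    have "norm ((1 / norm (q - s)) *\<^sub>R (Re (tr (f q)) - (Re (tr (f s)) + Re (tr D) * (q - s))))
        \<le> 2 * norm ((1 / norm (q - s)) *\<^sub>R (f q - (f s + (q - s) *\<^sub>R D)))" if q: "q \<in> S" for q
    proof -
      let ?X = "(1 / norm (q - s)) *\<^sub>R (f q - (f s + (q - s) *\<^sub>R D))"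
      have X: "?X \<in> N" using N q by auto
      have m: "f q \<in> N" "f s \<in> N" "(q - s) *\<^sub>R D \<in> N" using N q by auto
      then have "Re (tr ?X) = (1 / norm (q - s)) * (Re (tr (f q)) - (Re (tr (f s)) + (q - s) * Re (tr D)))"
        by (subst Re_tr_scaleR) (auto simp: tr_diff tr_add N_intros Re_tr_scaleR N(2))
      then have eq: "norm (Re (tr ?X)) = norm ((1 / norm (q - s)) *\<^sub>R (Re (tr (f q)) - (Re (tr (f s)) + Re (tr D) * (q - s))))"
        by (simp only: real_scaleR_def mult.commute[of "q - s"])
      show ?thesis
        unfolding eq[symmetric] using order_trans[OF abs_Re_le_cmod tr_norm[OF X]] by (simp only: real_norm_def)
    qed
    then show "\<forall>\<^sub>F q in at s within S. norm ((1 / norm (q - s)) *\<^sub>R (Re (tr (f q)) - (Re (tr (f s)) + Re (tr D) * (q - s))))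
        \<le> 2 * norm ((1 / norm (q - s)) *\<^sub>R (f q - (f s + (q - s) *\<^sub>R D)))"
      by (auto simp: eventually_at_filter)
  qed
qed

lemma power_has_vector_derivative:
  fixes C :: "real \<Rightarrow> 'h cop"
  assumes "(C has_vector_derivative C') (at s within S)"
  shows "((\<lambda>q. C q ^ n) has_vector_derivative (\<Sum>i<n. C s ^ i * C' * C s ^ (n - Suc i))) (at s within S)"
proof (induction n)
  case (Suc n)
  have "((\<lambda>q. C q ^ n * C q) has_vector_derivative
      (C s ^ n * C' + (\<Sum>i<n. C s ^ i * C' * C s ^ (n - Suc i)) * C s)) (at s within S)"
    by (rule has_vector_derivative_mult[OF Suc assms])
  moreover have "(\<Sum>i<n. C s ^ i * C' * C s ^ (n - Suc i)) * C s = (\<Sum>i<n. C s ^ i * C' * C s ^ (n - i))"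
    unfolding sum_distrib_right
  proof (intro sum.cong refl)
    fix i assume "i \<in> {..<n}"
    then have "n - i = Suc (n - Suc i)" by auto
    then show "C s ^ i * C' * C s ^ (n - Suc i) * C s = C s ^ i * C' * C s ^ (n - i)"
      by (simp only: power_Suc2 mult.assoc)
  qed
  ultimately show ?case by (simp add: power_commutes add.commute)
qed simp

text \<open>Under the trace the \<open>n + 1\<close> terms of the noncommutative power rule coincide
  by cyclicity, so the formula is that of the commutative case.\<close>

lemma tr_power_has_derivative:
  assumes C: "(C has_vector_derivative C') (at s within S)" and N: "\<And>q. q \<in> S \<Longrightarrow> C q \<in> N" "C' \<in> N" "s \<in> S"
  shows "((\<lambda>q. Re (tr (C q ^ Suc n))) has_real_derivative real (Suc n) * Re (tr (C s ^ n * C'))) (at s within S)"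
proof -
  have Cs: "C s \<in> N" using N by auto
  have "(\<Sum>i<Suc n. C s ^ i * C' * C s ^ (Suc n - Suc i)) \<in> N"
    using Cs N by (intro csub_sum[OF csub]) auto
  from tr_has_derivative[OF power_has_vector_derivative[OF C, of "Suc n"] _ this] N
  have *: "((\<lambda>q. Re (tr (C q ^ Suc n))) has_real_derivative Re (tr (\<Sum>i<Suc n. C s ^ i * C' * C s ^ (Suc n - Suc i)))) (at s within S)"
    by auto
  have "tr (C s ^ i * C' * C s ^ (Suc n - Suc i)) = tr (C s ^ n * C')" if "i < Suc n" for i
  proof -
    have "tr (C s ^ i * C' * C s ^ (Suc n - Suc i)) = tr (C s ^ (Suc n - Suc i) * (C s ^ i * C'))"
      using Cs N by (intro tr_commute) auto
    also have "C s ^ (Suc n - Suc i) * (C s ^ i * C') = C s ^ (Suc n - Suc i + i) * C'"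
      by (simp only: power_add mult.assoc)
    finally show ?thesis using that by simp
  qed
  then have "tr (\<Sum>i<Suc n. C s ^ i * C' * C s ^ (Suc n - Suc i)) = of_nat (Suc n) * tr (C s ^ n * C')"
    using Cs N by (subst tr_sum) (auto simp del: sum.lessThan_Suc)
  with * show ?thesis by simp
qed

text \<open>The formula \<open>d/ds tr (ln B) = tr (B^(-1) B')\<close>. The uniform bounds
  \<open>a\<close> and \<open>c\<close> make the differentiated series converge geometrically and
  uniformly in \<open>s\<close>; its sum is, up to sign, the Neumann series of the inverse
  \<open>G s\<close> paired with \<open>B' s\<close>.\<close>

lemma ld_path:
  assumes N: "\<And>s. s \<in> {0..1} \<Longrightarrow> B s \<in> N" "\<And>s. s \<in> {0..1} \<Longrightarrow> B' s \<in> N" "\<And>s. s \<in> {0..1} \<Longrightarrow> G s \<in> N"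
    and a: "0 < a" "\<And>s. s \<in> {0..1} \<Longrightarrow> pos (B s - a *\<^sub>R 1)"
    and c: "\<And>s. s \<in> {0..1} \<Longrightarrow> norm (B s) \<le> c" and K: "\<And>s. s \<in> {0..1} \<Longrightarrow> norm (B' s) \<le> K"
    and deriv: "\<And>s. s \<in> {0..1} \<Longrightarrow> (B has_vector_derivative B' s) (at s within {0..1})"
    and G: "\<And>s. s \<in> {0..1} \<Longrightarrow> G s * B s = 1"
    and s: "s \<in> {0..1}"
  shows "((\<lambda>s. ld (B s)) has_real_derivative Re (tr (G s * B' s))) (at s within {0..1})"
proof -
  have ac: "a \<le> c" using lower_bound_le_norm[OF N(1) a(2), of 0] c[of 0] by simp
  then have c0: "0 < c" using a(1) by linarith
  define \<rho> where "\<rho> = 1 - a / c"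
  have \<rho>: "0 \<le> \<rho>" "\<rho> < 1" using a(1) ac c0 by (auto simp: \<rho>_def)
  have K0: "0 \<le> K" using K[of 0] norm_ge_zero[of "B' 0"] by (auto intro: order_trans simp del: norm_ge_zero)
  define C where "C s = 1 - (1/c) *\<^sub>R B s" for s
  have CN: "C s \<in> N" if "s \<in> {0..1}" for s using N(1)[OF that] by (auto simp: C_def)
  have nC: "norm (C s) \<le> \<rho>" if s: "s \<in> {0..1}" for s
  proof (rule pos_norm_le[OF _ _ \<rho>(1)])
    have sB: "star (B s) = B s" using pos_star[OF a(2)[OF s]] by simp
    have "pos ((1/c) *\<^sub>R (c *\<^sub>R 1 - B s))"
      using c0 by (intro pos_scaleR pos_norm_minus sB c s) simp
    then show "pos (C s)" using c0 by (simp add: C_def scaleR_diff_right)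
    have "pos ((1/c) *\<^sub>R (B s - a *\<^sub>R 1))" using a(2)[OF s] c0 by (intro pos_scaleR) auto
    moreover have "\<rho> *\<^sub>R 1 - C s = (1/c) *\<^sub>R (B s - a *\<^sub>R 1)" by (simp add: C_def \<rho>_def algebra_simps)
    ultimately show "pos (\<rho> *\<^sub>R 1 - C s)" by simp
  qed
  have nCn: "norm (C s ^ n) \<le> \<rho> ^ n" if "s \<in> {0..1}" for s n
    using norm_power_cop_le[of "C s" n] power_mono[OF nC[OF that], of n] by simp
  define f where "f n s = Re (tr (C s ^ Suc n)) / real (Suc n)" for n s
  define f' where "f' n s = Re (tr (C s ^ n * (- ((1/c) *\<^sub>R B' s))))" for n s
  have fd: "(f n has_real_derivative f' n s) (at s within {0..1})" if s: "s \<in> {0..1}" for n s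
  proof -
    have "(C has_vector_derivative - ((1/c) *\<^sub>R B' s)) (at s within {0..1})"
      unfolding C_def[abs_def] by (auto intro!: derivative_eq_intros deriv[OF s])
    from tr_power_has_derivative[OF this CN, of n] N s
    have "((\<lambda>q. Re (tr (C q ^ Suc n))) has_real_derivative real (Suc n) * f' n s) (at s within {0..1})"
      unfolding f'_def by auto
    from DERIV_cdivide[OF this, of "real (Suc n)"] show ?thesis
      unfolding f_def[abs_def] by (simp del: power_Suc of_nat_Suc)
  qed
  have f'_bound: "norm (f' n s) \<le> 2 * (\<rho> ^ n * (K / c))" if s: "s \<in> {0..1}" for n s
  proof -
    have m: "C s ^ n * (- ((1/c) *\<^sub>R B' s)) \<in> N" using CN[OF s] N(2)[OF s] by auto
    have "norm (f' n s) \<le> 2 * norm (C s ^ n * (- ((1/c) *\<^sub>R B' s)))"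
      unfolding f'_def real_norm_def by (rule order_trans[OF abs_Re_le_cmod tr_norm[OF m]])
    also have "norm (C s ^ n * (- ((1/c) *\<^sub>R B' s))) \<le> norm (C s ^ n) * norm (- ((1/c) *\<^sub>R B' s))"
      by (rule norm_mult_ineq)
    also have "\<dots> \<le> \<rho> ^ n * (K / c)"
      using nCn[OF s, of n] K[OF s] c0 \<rho> by (intro mult_mono) (auto simp: divide_right_mono)
    finally show ?thesis by simp
  qed
  have unif: "uniform_limit {0..1} (\<lambda>n s. \<Sum>i<n. f' i s) (\<lambda>s. \<Sum>i. f' i s) sequentially"
    by (rule Weierstrass_m_test[OF f'_bound])
      (use \<rho> in \<open>auto intro!: summable_mult summable_mult2 summable_geometric\<close>)
  have val: "(\<Sum>i. f' i s) = - Re (tr (G s * B' s))" if s: "s \<in> {0..1}" for s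
  proof -
    have BC: "B s = c *\<^sub>R (1 - C s)" using c0 by (simp add: C_def)
    have tele: "(1 - C s) * (\<Sum>i<n. C s ^ i) = 1 - C s ^ n" for n
    proof (induction n)
      case (Suc n)
      have "(1 - C s) * (\<Sum>i<Suc n. C s ^ i) = (1 - C s ^ n) + (1 - C s) * C s ^ n"
        by (simp add: distrib_left Suc)
      then show ?case by (simp add: left_diff_distrib)
    qed simp
    have part: "(\<Sum>i<n. C s ^ i * (- ((1/c) *\<^sub>R B' s))) = - ((G s - G s * C s ^ n) * B' s)" for n
    proof -
      have "(1/c) *\<^sub>R (\<Sum>i<n. C s ^ i) = (G s * B s) * ((1/c) *\<^sub>R (\<Sum>i<n. C s ^ i))" by (simp add: G[OF s])
      also have "\<dots> = G s * ((1 - C s) * (\<Sum>i<n. C s ^ i))" using c0 by (simp add: BC mult.assoc)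
      also have "\<dots> = G s - G s * C s ^ n" by (simp add: tele right_diff_distrib)
      finally have "(1/c) *\<^sub>R (\<Sum>i<n. C s ^ i) = G s - G s * C s ^ n" .
      then have "((1/c) *\<^sub>R (\<Sum>i<n. C s ^ i)) * B' s = (G s - G s * C s ^ n) * B' s" by simp
      then show ?thesis by (simp add: sum_distrib_right sum_negf scaleR_sum_right)
    qed
    have Cn: "(\<lambda>n. C s ^ n) \<longlonglongrightarrow> 0"
      by (rule Lim_null_comparison[where g="\<lambda>n. \<rho> ^ n"]) (use nCn[OF s] \<rho> in \<open>auto intro!: LIMSEQ_realpow_zero\<close>)
    have "(\<lambda>n. - ((G s - G s * C s ^ n) * B' s)) \<longlonglongrightarrow> - ((G s - G s * 0) * B' s)"
      by (intro tendsto_intros Cn)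
    then have "(\<lambda>n. tr (- ((G s - G s * C s ^ n) * B' s))) \<longlonglongrightarrow> tr (- (G s * B' s))"
      using N s CN by (intro tr_tendsto) auto
    from tendsto_Re[OF this] have "(\<lambda>n. \<Sum>i<n. f' i s) \<longlonglongrightarrow> - Re (tr (G s * B' s))"
      unfolding part[symmetric] f'_def using N s CN
      by (subst (asm) tr_sum) (auto simp: tr_uminus N_intros)
    then show ?thesis using sums_unique by (fastforce simp: sums_def)
  qed
  have sums: "(\<lambda>n. f n s) sums (ln c - ld (B s))" if s: "s \<in> {0..1}" for s
    unfolding f_def C_def by (rule ld_series[OF N(1)[OF s] a(1) a(2)[OF s] c[OF s]])
  obtain g where g: "\<forall>s\<in>{0..1}. (\<lambda>n. f n s) sums g s \<and> (g has_real_derivative (\<Sum>i. f' i s)) (at s within {0..1})"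
    using has_field_derivative_series[OF _ fd unif, of 0] sums[of 0] by (auto simp: sums_iff)
  have "((\<lambda>s. ln c - g s) has_real_derivative 0 - (\<Sum>i. f' i s)) (at s within {0..1})"
    using g s by (intro DERIV_diff DERIV_const) blast
  then have D: "((\<lambda>s. ln c - g s) has_real_derivative Re (tr (G s * B' s))) (at s within {0..1})"
    by (simp add: val[OF s])
  have eq: "ln c - g s = ld (B s)" if "s \<in> {0..1}" for s
  proof -
    have "(\<lambda>n. f n s) sums g s" using g that by blast
    from sums_unique2[OF this sums[OF that]] show ?thesis by simp
  qed
  show ?thesis
    by (rule has_field_derivative_transform_within[OF D zero_less_one s]) (rule eq)
qed

lemma pos_segment:
  assumes "pos (y - a *\<^sub>R 1)" "pos (z - a *\<^sub>R 1)" "s \<in> {0..1::real}"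
  shows "pos (y + s *\<^sub>R (z - y) - a *\<^sub>R 1)"
proof -
  have "pos ((1 - s) *\<^sub>R (y - a *\<^sub>R 1) + s *\<^sub>R (z - a *\<^sub>R 1))"
    using assms by (intro pos_add pos_scaleR) auto
  moreover have "(1 - s) *\<^sub>R (y - a *\<^sub>R 1) + s *\<^sub>R (z - a *\<^sub>R 1) = y + s *\<^sub>R (z - y) - a *\<^sub>R 1"
    by (simp add: algebra_simps)
  ultimately show ?thesis by simp
qed

lemma norm_segment: "s \<in> {0..1::real} \<Longrightarrow> norm (y + s *\<^sub>R (z - y)) \<le> norm y + norm (z - y)" for y z :: "'h cop"
  by (rule order_trans[OF norm_triangle_ineq]) (auto simp: mult_left_le_one_le)

lemma segment_derivative: "((\<lambda>s. y + s *\<^sub>R (z - y)) has_vector_derivative z - y) (at s within S)" for y z :: "'h cop"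
  by (auto intro!: derivative_eq_intros)

text \<open>Along the segment from \<open>y\<close> to \<open>z\<close> the derivative is the trace
  of \<open>G s * (z - y)\<close>, which cyclicity turns into the trace of the positive element
  \<open>k * G s * k\<close>, where \<open>k\<close> is the root of \<open>z - y\<close>.\<close>

lemma ld_mono:
  assumes y: "y \<in> N" "z \<in> N" and a: "0 < a" "pos (y - a *\<^sub>R 1)" and le: "pos (z - y)"
  shows "ld y \<le> ld z"
proof -
  define B where "B s = y + s *\<^sub>R (z - y)" for s :: real
  have za: "pos (z - a *\<^sub>R 1)" using pos_add[OF a(2) le] by simp
  have pB: "pos (B s - a *\<^sub>R 1)" if "s \<in> {0..1}" for s
    unfolding B_def by (rule pos_segment[OF a(2) za that])
  have "\<forall>s\<in>{0..1}. \<exists>G. G * B s = 1 \<and> pos G \<and> G \<in> N"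
  proof
    fix s :: real assume s: "s \<in> {0..1}"
    have "B s \<in> N" using y by (auto simp: B_def)
    with pos_inverse_exists[OF pB[OF s] a(1)] csub show "\<exists>G. G * B s = 1 \<and> pos G \<and> G \<in> N" by blast
  qed
  then obtain G where G: "\<And>s. s \<in> {0..1} \<Longrightarrow> G s * B s = 1" "\<And>s. s \<in> {0..1} \<Longrightarrow> pos (G s)"
    "\<And>s. s \<in> {0..1} \<Longrightarrow> G s \<in> N" by metis
  have d: "((\<lambda>s. ld (B s)) has_real_derivative Re (tr (G s * (z - y)))) (at s within {0..1})" if "s \<in> {0..1}" for s
    using that y G(3) G(1) pB a(1)
    by (intro ld_path[where a=a and c="norm y + norm (z - y)" and K="norm (z - y)"])
      (auto simp: B_def norm_segment segment_derivative)
  have nn: "0 \<le> Re (tr (G s * (z - y)))" if s: "s \<in> {0..1}" for s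
  proof -
    let ?k = "op_sqrt (z - y)"
    have k: "?k \<in> N" using y by (intro csub_op_sqrt[OF le csub]) auto
    have "tr (G s * (z - y)) = tr (G s * ?k * ?k)" by (simp add: op_sqrt_square[OF le] mult.assoc)
    also have "\<dots> = tr (?k * (G s * ?k))" using k G(3)[OF s] by (intro tr_commute) auto
    also have "?k * (G s * ?k) = star ?k * G s * ?k" by (simp add: pos_star[OF pos_op_sqrt[OF le]] mult.assoc)
    finally have e: "tr (G s * (z - y)) = tr (star ?k * G s * ?k)" .
    show ?thesis unfolding e using k G(3)[OF s] by (intro conjunct2[OF tr_pos] pos_conj G(2)[OF s]) auto
  qed
  have "\<exists>s\<in>{0<..<1::real}. ld (B 1) - ld (B 0) = Re (tr (G s * (z - y))) * (1 - 0)"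
    by (rule mvt_simple[of 0 1 "\<lambda>s. ld (B s)" "\<lambda>s. (*) (Re (tr (G s * (z - y))))"])
      (use d in \<open>auto simp: has_field_derivative_def\<close>)
  then obtain s where "s \<in> {0<..<1}" "ld (B 1) - ld (B 0) = Re (tr (G s * (z - y))) * (1 - 0)" by blast
  with nn[of s] show ?thesis by (simp add: B_def)
qed

text \<open>Replace \<open>P\<close> by the segment \<open>Q s\<close> from \<open>1\<close> to
  \<open>P\<close>. Both sides have the derivative \<open>Re (tr (G s * (P - 1)))\<close>, the left
  one because \<open>Y\<close> cancels against its inverse under the trace, and at
  \<open>s = 0\<close> they agree since \<open>ld 1 = 0\<close>.\<close>

lemma ld_mult:
  assumes P: "P \<in> N" "0 < a" "pos (P - a *\<^sub>R 1)" and Y: "Y \<in> N" "Yi \<in> N" "Yi * Y = 1" "Y * Yi = 1"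
  shows "ld (star Y * P * Y) = ld P + ld (star Y * Y)"
proof -
  \<comment> \<open>A common lower bound of both ends of the segment, \<open>1\<close> and
    \<open>P\<close>.\<close>
  define b where "b = min a 1"
  have b: "0 < b" using P by (simp add: b_def)
  have "pos (P - a *\<^sub>R 1 + (a - b) *\<^sub>R 1)" by (intro pos_add P pos_scaleR pos_one) (simp add: b_def)
  then have Pb: "pos (P - b *\<^sub>R 1)" by (simp add: algebra_simps)
  have "pos ((1 - b) *\<^sub>R 1)" by (intro pos_scaleR pos_one) (simp add: b_def)
  then have ob: "pos (1 - b *\<^sub>R 1)" by (simp add: algebra_simps)
  define Q where "Q s = 1 + s *\<^sub>R (P - 1)" for s :: real
  define B where "B s = star Y * Q s * Y" for s
  have QN: "Q s \<in> N" "B s \<in> N" for s using P Y by (auto simp: Q_def B_def)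
  have pQ: "pos (Q s - b *\<^sub>R 1)" if "s \<in> {0..1}" for s
    unfolding Q_def by (rule pos_segment[OF ob Pb that])
  have "\<forall>s\<in>{0..1}. \<exists>G. G * Q s = 1 \<and> Q s * G = 1 \<and> G \<in> N"
    using pos_inverse_exists[OF pQ b] csub QN by blast
  then obtain G where G: "\<And>s. s \<in> {0..1} \<Longrightarrow> G s * Q s = 1" "\<And>s. s \<in> {0..1} \<Longrightarrow> G s \<in> N" by metis
  have nQ: "norm (Q s) \<le> 1 + norm (P - 1)" if "s \<in> {0..1}" for s
    unfolding Q_def using norm_segment[OF that, of 1 P] norm_one_cop_le[where 'h='h] by simp
  have dQ: "((\<lambda>s. ld (Q s)) has_real_derivative Re (tr (G s * (P - 1)))) (at s within {0..1})" if "s \<in> {0..1}" for s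
    using that P G pQ b nQ QN
    by (intro ld_path[where a=b and c="1 + norm (P - 1)" and K="norm (P - 1)"])
      (auto simp: Q_def segment_derivative)
  have YY: "star Yi * (star Y * X) = X" "star Y * (star Yi * X) = X" "Y * (Yi * X) = X" "Yi * (Y * X) = X" for X
  proof -
    have s: "star Yi * star Y = 1" "star Y * star Yi = 1"
      using arg_cong[OF Y(4), of star] arg_cong[OF Y(3), of star] by simp_all
    show "star Yi * (star Y * X) = X" "star Y * (star Yi * X) = X" "Y * (Yi * X) = X" "Yi * (Y * X) = X"
      unfolding mult.assoc[symmetric] s Y by simp_all
  qed
  have pYY: "pos (star Y * Y - (1 / ((norm Yi)\<^sup>2 + 1)) *\<^sub>R 1)"
    by (rule pos_star_mult_lower[OF Y(3)]) simp
  define d where "d = b * (1 / ((norm Yi)\<^sup>2 + 1))"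
  have d: "0 < d" using b by (simp add: d_def add_nonneg_pos)
  have pB: "pos (B s - d *\<^sub>R 1)" if "s \<in> {0..1}" for s
  proof -
    have "pos (star Y * (Q s - b *\<^sub>R 1) * Y + b *\<^sub>R (star Y * Y - (1 / ((norm Yi)\<^sup>2 + 1)) *\<^sub>R 1))"
      using b by (intro pos_add pos_conj pQ that pos_scaleR pYY) simp
    then show ?thesis by (simp add: B_def d_def algebra_simps)
  qed
  have nB: "norm (B s) \<le> norm Y * (1 + norm (P - 1)) * norm Y" if "s \<in> {0..1}" for s
  proof -
    have "norm (B s) \<le> norm (star Y) * norm (Q s) * norm Y"
      unfolding B_def by (meson norm_mult_ineq mult_right_mono norm_ge_zero order_trans)
    also have "\<dots> \<le> norm Y * (1 + norm (P - 1)) * norm Y"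
      using nQ[OF that] by (auto intro!: mult_right_mono mult_left_mono)
    finally show ?thesis .
  qed
  have dB: "((\<lambda>s. ld (B s)) has_real_derivative Re (tr (Yi * G s * star Yi * (star Y * (P - 1) * Y)))) (at s within {0..1})"
    if s: "s \<in> {0..1}" for s
  proof (rule ld_path[where a=d and c="norm Y * (1 + norm (P - 1)) * norm Y" and K="norm (star Y * (P - 1) * Y)"])
    fix s :: real assume s: "s \<in> {0..1}"
    show "(B has_vector_derivative star Y * (P - 1) * Y) (at s within {0..1})"
      unfolding B_def[abs_def] Q_def[abs_def] by (auto intro!: derivative_eq_intros simp: mult.assoc)
    have "Yi * G s * star Yi * B s = Yi * (G s * Q s) * Y"
      unfolding B_def by (simp only: mult.assoc YY)
    then show "Yi * G s * star Yi * B s = 1" using G(1)[OF s] Y(3) by simp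
  qed (use d pB nB QN G P Y s in auto)
  have eq: "tr (Yi * G s * star Yi * (star Y * (P - 1) * Y)) = tr (G s * (P - 1))" if s: "s \<in> {0..1}" for s
  proof -
    have "Yi * G s * star Yi * (star Y * (P - 1) * Y) = Yi * (G s * (P - 1) * Y)"
      by (simp only: mult.assoc YY)
    also have "tr \<dots> = tr (G s * (P - 1) * Y * Yi)" using Y P G(2)[OF s] by (intro tr_commute) auto
    also have "G s * (P - 1) * Y * Yi = G s * (P - 1)" using Y(4) by (simp add: mult.assoc)
    finally show ?thesis .
  qed
  have "((\<lambda>s. ld (B s) - ld (Q s)) has_real_derivative 0) (at s within {0..1})" if s: "s \<in> {0..1}" for s
    using DERIV_diff[OF dB[OF s] dQ[OF s]] by (simp add: eq[OF s])
  then have "\<exists>k. \<forall>s\<in>{0..1}. ld (B s) - ld (Q s) = k"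
    by (intro has_field_derivative_zero_constant) auto
  then have "ld (B 1) - ld (Q 1) = ld (B 0) - ld (Q 0)" by (metis atLeastAtMost_iff order_refl zero_le_one)
  then show ?thesis by (simp add: B_def Q_def ld_one)
qed

text \<open>\<open>tr (ln x) \<ge> r\<close> for positive, not necessarily invertible \<open>x\<close>.\<close>

definition ld_ge :: "'h cop \<Rightarrow> real \<Rightarrow> bool" where
  "ld_ge x r \<longleftrightarrow> (\<forall>e>0. r \<le> ld (x + e *\<^sub>R 1))"

text \<open>\<open>ld_mult\<close> needs an invertible factor, so \<open>star X * X\<close> is
  raised by \<open>d\<close> to \<open>P\<close>, and \<open>X\<close> is replaced by
  \<open>H = op_sqrt P\<close>. Multiplicativity then applies to \<open>H\<close> and
  \<open>Y * star Y\<close> raised by \<open>h\<close>; \<open>ld_star_swap\<close> exchanges the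
  order of a factor and its adjoint, and the perturbations \<open>d\<close> and \<open>h\<close>
  each cost at most \<open>e / 2\<close>.\<close>

lemma ld_ge_mult:
  assumes X: "X \<in> N" "ld_ge (star X * X) r1" and Y: "Y \<in> N" "ld_ge (star Y * Y) r2"
  shows "ld_ge (star (X * Y) * (X * Y)) (r1 + r2)"
  unfolding ld_ge_def
proof (intro allI impI)
  fix e :: real assume e: "0 < e"
  define d where "d = e / (2 * ((norm Y)\<^sup>2 + 1))"
  have dp: "0 < (norm Y)\<^sup>2 + 1" by (simp add: add_nonneg_pos)
  have d: "0 < d" "d * (norm Y)\<^sup>2 \<le> e / 2" using e dp by (auto simp: d_def field_simps)
  define P where "P = star X * X + d *\<^sub>R 1"
  have P: "P \<in> N" "pos (P - d *\<^sub>R 1)" "pos P" using X d by (auto simp: P_def intro!: pos_add pos_scaleR)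
  obtain G where G: "G * P = 1" "P * G = 1" "G \<in> N" using pos_inverse_exists[OF P(2) d(1)] P(1) csub by blast
  define H where "H = op_sqrt P"
  have H: "H \<in> N" "pos H" "H * H = P" "star H = H"
    using csub_op_sqrt[OF P(3) csub P(1)] pos_op_sqrt[OF P(3)] op_sqrt_square[OF P(3)]
    by (auto simp: H_def pos_star)
  have "H * (H * G) = 1" "G * H * H = 1" using G H(3) by (simp_all add: mult.assoc[symmetric]) (simp add: mult.assoc)
  moreover have "H * G = (G * H * H) * (H * G)" by (simp add: \<open>G * H * H = 1\<close>)
  then have "H * G = G * H" using G H(3) by (metis mult.assoc mult.right_neutral)
  ultimately have Hi: "H * (H * G) = 1" "H * G * H = 1" by simp_all
  define h where "h = e / (2 * (norm P + 1))"
  have hp: "0 < norm P + 1" by (simp add: add_nonneg_pos)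
  have h: "0 < h" "h * norm P \<le> e / 2" using e hp by (auto simp: h_def field_simps)
  have XY: "X * Y \<in> N" "H * Y \<in> N" using X Y H by auto
  have "r1 + r2 \<le> ld (star H * H) + ld (Y * star Y + h *\<^sub>R 1)"
  proof (intro add_mono)
    show "r1 \<le> ld (star H * H)" using X(2) d by (simp add: ld_ge_def H P_def)
    show "r2 \<le> ld (Y * star Y + h *\<^sub>R 1)"
      using Y(2) h by (simp add: ld_ge_def ld_star_swap[OF Y(1) h(1), symmetric])
  qed
  also have "\<dots> = ld (star H * (Y * star Y + h *\<^sub>R 1) * H)"
    using Y h H G Hi by (subst ld_mult[where a=h and Yi="H * G"]) auto
  also have "\<dots> \<le> ld (H * Y * star (H * Y) + (e / 2) *\<^sub>R 1)"
  proof (rule ld_mono[where a="h * d"])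
    show "pos (star H * (Y * star Y + h *\<^sub>R 1) * H - (h * d) *\<^sub>R 1)"
    proof -
      have "pos (H * Y * star (H * Y) + h *\<^sub>R (P - d *\<^sub>R 1))"
        using h by (intro pos_add pos_mult_star pos_scaleR P) auto
      then show ?thesis by (simp add: H algebra_simps)
    qed
    have "pos ((e / 2 - h * norm P) *\<^sub>R 1 + h *\<^sub>R (norm P *\<^sub>R 1 - P))"
      using h pos_norm_minus[OF pos_star[OF P(3)], of "norm P"] by (intro pos_add pos_scaleR) auto
    then show "pos (H * Y * star (H * Y) + (e / 2) *\<^sub>R 1 - star H * (Y * star Y + h *\<^sub>R 1) * H)"
      by (simp add: H algebra_simps)
  qed (use h d Y H XY in auto)
  also have "\<dots> = ld (star (H * Y) * (H * Y) + (e / 2) *\<^sub>R 1)"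
    using ld_star_swap[OF XY(2), of "e / 2"] e by simp
  also have "\<dots> \<le> ld (star (X * Y) * (X * Y) + e *\<^sub>R 1)"
  proof (rule ld_mono[where a="e / 2"])
    have "pos ((e / 2 - d * (norm Y)\<^sup>2) *\<^sub>R 1 + d *\<^sub>R ((norm Y)\<^sup>2 *\<^sub>R 1 - star Y * Y))"
      using d by (intro pos_add pos_scaleR pos_norm_minus) (auto simp: norm_star_mult_self)
    then have p: "pos ((e / 2) *\<^sub>R 1 - d *\<^sub>R (star Y * Y))"
      by (simp add: scaleR_diff_left scaleR_diff_right)
    have "H * (H * Y) = P * Y" by (simp add: H(3) flip: mult.assoc)
    then have HY: "star (H * Y) * (H * Y) = star Y * P * Y" by (simp add: H(4) mult.assoc)
    have e2: "e *\<^sub>R (1 :: 'h cop) = (e / 2) *\<^sub>R 1 + (e / 2) *\<^sub>R 1"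
      by (simp flip: scaleR_add_left)
    have "star (X * Y) * (X * Y) + e *\<^sub>R 1 - (star (H * Y) * (H * Y) + (e / 2) *\<^sub>R 1) = (e / 2) *\<^sub>R 1 - d *\<^sub>R (star Y * Y)"
      unfolding HY e2 P_def by (simp add: distrib_left distrib_right mult.assoc)
    with p show "pos (star (X * Y) * (X * Y) + e *\<^sub>R 1 - (star (H * Y) * (H * Y) + (e / 2) *\<^sub>R 1))"
      by simp
  qed (use e X(1) Y(1) H(1) pos_star_mult[of "H * Y"] in auto)
  finally show "r1 + r2 \<le> ld (star (X * Y) * (X * Y) + e *\<^sub>R 1)" .
qed

lemma ld_ge_prod:
  assumes X: "\<And>k. X k \<in> N" "\<And>k. ld_ge (star (X k) * X k) r"
  shows "ld_ge (star (foldr (\<lambda>k Z. X k * Z) ks 1) * foldr (\<lambda>k Z. X k * Z) ks 1) (real (length ks) * r)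
    \<and> foldr (\<lambda>k Z. X k * Z) ks 1 \<in> N"
proof (induction ks)
  case Nil
  have "ld 1 \<le> ld (1 + e *\<^sub>R 1)" if "0 < e" for e
    using that by (intro ld_mono[where a=1]) (auto intro!: pos_scaleR)
  then have "0 \<le> ld (1 + e *\<^sub>R 1)" if "0 < e" for e
    using that ld_one by simp
  then show ?case by (auto simp: ld_ge_def)
next
  case (Cons k ks)
  let ?Z = "foldr (\<lambda>k Z. X k * Z) ks 1"
  from Cons have Z: "?Z \<in> N" "ld_ge (star ?Z * ?Z) (real (length ks) * r)" by auto
  have "r + real (length ks) * r = real (length (k # ks)) * r" by (simp add: algebra_simps)
  with ld_ge_mult[OF X(1)[of k] X(2)[of k] Z] X(1)[of k] Z(1) show ?case by auto
qed

text \<open>The crude choice \<open>e = 1\<close> suffices, because the bound is applied to products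
  of \<open>n\<close> factors, whose determinants grow with \<open>n\<close>, and is then compared
  at large \<open>n\<close>.\<close>

lemma ld_ge_le_norm:
  assumes X: "X \<in> N" "ld_ge (star X * X) r"
  shows "r \<le> ln ((norm X)\<^sup>2 + 1)"
proof -
  have "r \<le> ld (star X * X + 1 *\<^sub>R 1)" using X(2) unfolding ld_ge_def by (metis zero_less_one)
  also have "\<dots> \<le> ln ((norm X)\<^sup>2 + 1)"
  proof (rule ld_le[where a=1])
    show "norm (star X * X + 1 *\<^sub>R 1) \<le> (norm X)\<^sup>2 + 1"
      using norm_triangle_ineq[of "star X * X" 1] norm_one_cop_le[where 'h='h] by (simp add: norm_star_mult_self)
  qed (use X in auto)
  finally show ?thesis .
qed

end

section \<open>Growth of the q-binomial products\<close>

text \<open>\<open>qcoeff q n j\<close> is \<open>q^(j (j - 1) / 2)\<close> times the Gaussian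
  binomial coefficient; the recursion is a form of the q-Pascal rule.\<close>

primrec qcoeff :: "complex \<Rightarrow> nat \<Rightarrow> nat \<Rightarrow> complex" where
  "qcoeff q 0 j = (if j = 0 then 1 else 0)"
| "qcoeff q (Suc n) j = qcoeff q n j + (if j = 0 then 0 else q ^ n * qcoeff q n (j - 1))"

lemma qcoeff_0 [simp]: "qcoeff q n 0 = 1"
  by (induction n) auto

lemma qcoeff_eq_0: "n < j \<Longrightarrow> qcoeff q n j = 0"
  by (induction n arbitrary: j) auto

lemma qcoeff_prod: "(\<Prod>k<n. 1 + q ^ k * \<zeta>) = (\<Sum>j\<le>n. qcoeff q n j * \<zeta> ^ j)"
proof (induction n)
  case (Suc n)
  have "(\<Sum>j\<le>Suc n. qcoeff q (Suc n) j * \<zeta> ^ j) =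
      (\<Sum>j\<le>Suc n. qcoeff q n j * \<zeta> ^ j) + (\<Sum>j\<le>Suc n. (if j = 0 then 0 else q ^ n * qcoeff q n (j - 1)) * \<zeta> ^ j)"
    unfolding sum.distrib[symmetric] by (intro sum.cong refl) (simp add: distrib_right)
  also have "(\<Sum>j\<le>Suc n. qcoeff q n j * \<zeta> ^ j) = (\<Sum>j\<le>n. qcoeff q n j * \<zeta> ^ j)"
    by (simp add: qcoeff_eq_0)
  also have "(\<Sum>j\<le>Suc n. (if j = 0 then 0 else q ^ n * qcoeff q n (j - 1)) * \<zeta> ^ j) =
      q ^ n * \<zeta> * (\<Sum>j\<le>n. qcoeff q n j * \<zeta> ^ j)"
    by (subst sum.atMost_Suc_shift) (simp add: sum_distrib_left mult_ac)
  finally show ?case using Suc by (simp add: algebra_simps)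
qed simp

text \<open>Cauchy's estimate, with the mean over the \<open>n + 1\<close> roots of unity of that
  order in place of a contour integral: they are enough in number to separate the exponents up to
  \<open>n\<close>.\<close>

lemma coefficient_bound:
  fixes c :: "nat \<Rightarrow> complex"
  assumes B: "\<And>\<zeta>. cmod \<zeta> = \<rho> \<Longrightarrow> cmod (\<Sum>j\<le>n. c j * \<zeta> ^ j) \<le> B" and j: "j \<le> n" and \<rho>: "0 \<le> \<rho>"
  shows "cmod (c j) * \<rho> ^ j \<le> B"
proof -
  define M where "M = Suc n"
  define w where "w l = exp (2 * of_real pi * \<i> * of_nat l / of_nat M)" for l :: nat
  have nw: "cmod (w l) = 1" for l
    unfolding w_def by (simp add: norm_exp_eq_Re)
  have w0: "w l \<noteq> 0" for l by (simp add: w_def)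
  have wM: "w l ^ M = 1" for l
    unfolding w_def by (rule complex_root_unity) (simp add: M_def)
  have wpow: "w m ^ l = w l ^ m" for m l
    unfolding w_def exp_of_nat_mult[symmetric] by (simp add: mult_ac)
  have inner: "(\<Sum>m<M. (w m ^ l) / (w m ^ j)) = (if l = j then of_nat M else 0)" if l: "l \<le> n" for l
  proof (cases "l = j")
    case True
    then show ?thesis using w0 by simp
  next
    case False
    have "w l \<noteq> w j"
      unfolding w_def using False l j by (subst complex_root_unity_eq) (auto simp: M_def)
    then have r: "w l / w j \<noteq> 1" using w0 by simp
    have "(\<Sum>m<M. (w m ^ l) / (w m ^ j)) = (\<Sum>m<M. (w l / w j) ^ m)"
      by (simp add: wpow[of _ l] wpow[of _ j] power_divide)
    also have "\<dots> = ((w l / w j) ^ M - 1) / (w l / w j - 1)" by (rule geometric_sum[OF r])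
    also have "\<dots> = 0" by (simp add: power_divide wM)
    finally show ?thesis using False by simp
  qed
  have "(\<Sum>m<M. (\<Sum>l\<le>n. c l * (of_real \<rho> * w m) ^ l) / w m ^ j) =
      (\<Sum>l\<le>n. c l * of_real \<rho> ^ l * (\<Sum>m<M. (w m ^ l) / (w m ^ j)))"
    unfolding sum_divide_distrib sum_distrib_left
    by (subst sum.swap) (simp add: power_mult_distrib mult_ac)
  also have "\<dots> = (\<Sum>l\<le>n. if l = j then c l * of_real \<rho> ^ l * of_nat M else 0)"
    by (intro sum.cong refl) (simp add: inner)
  also have "\<dots> = c j * of_real \<rho> ^ j * of_nat M" using j by simp
  finally have eq: "c j * of_real \<rho> ^ j * of_nat M = (\<Sum>m<M. (\<Sum>l\<le>n. c l * (of_real \<rho> * w m) ^ l) / w m ^ j)" ..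
  have "real M * (cmod (c j) * \<rho> ^ j) = cmod (c j * of_real \<rho> ^ j * of_nat M)"
    using \<rho> by (simp add: norm_mult norm_power)
  also have "\<dots> \<le> (\<Sum>m<M. cmod ((\<Sum>l\<le>n. c l * (of_real \<rho> * w m) ^ l) / w m ^ j))"
    unfolding eq by (rule norm_sum)
  also have "\<dots> \<le> (\<Sum>m<M. B)"
    using \<rho> by (intro sum_mono) (simp add: norm_divide norm_power nw B norm_mult)
  also have "\<dots> = real M * B" by simp
  finally show ?thesis by (simp add: M_def)
qed

text \<open>Expanding the logarithm, the \<open>j\<close>-th term of the sum over \<open>k < n\<close> carries the factor
  \<open>1 + q ^ j + \<dots> + q ^ (j * (n - 1))\<close>, which is bounded in \<open>n\<close>.\<close>

lemma q_product_bound: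
  assumes q: "cmod q = 1" "\<And>j. 0 < j \<Longrightarrow> q ^ j \<noteq> 1" and \<rho>: "0 < \<rho>" "\<rho> < 1" and \<eta>: "0 < \<eta>"
  shows "\<exists>A. \<forall>n \<zeta>. cmod \<zeta> = \<rho> \<longrightarrow> cmod (\<Prod>k<n. 1 + q ^ k * \<zeta>) \<le> exp (A + \<eta> * real n)"
proof -
  \<comment> \<open>\<open>J\<close> splits the logarithmic series. Beyond \<open>J\<close> the
    trivial bound \<open>n\<close> for the inner sum leaves a tail of at most
    \<open>\<eta> * n\<close>; the finitely many terms before \<open>J\<close> contribute a constant
    independent of \<open>n\<close>.\<close>
  have "(\<lambda>J. \<rho> ^ J * (1 / (1 - \<rho>))) \<longlonglongrightarrow> 0"
    using \<rho> by (intro tendsto_mult_left_zero LIMSEQ_realpow_zero) auto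
  then have "\<forall>\<^sub>F J in sequentially. \<rho> ^ J * (1 / (1 - \<rho>)) < \<eta>" using \<eta> by (rule order_tendstoD)
  then obtain J where J: "\<rho> ^ J * (1 / (1 - \<rho>)) < \<eta>" by (auto simp: eventually_sequentially)
  \<comment> \<open>At \<open>j = 0\<close> division by zero gives the value \<open>0\<close>, which
    agrees with the vanishing of the term \<open>t 0\<close>.\<close>
  define u where "u j = (if j < J then 2 / cmod (1 - q ^ j) else 0)" for j
  define v where "v j = (if j < J then 0 else \<rho> ^ j)" for j
  have "(\<lambda>j. \<rho> ^ (j + J)) sums (\<rho> ^ J * (1 / (1 - \<rho>)))"
    using sums_mult[OF geometric_sums[of \<rho>], of "\<rho> ^ J"] \<rho> by (simp add: power_add mult.commute)
  then have "(\<lambda>j. v (j + J)) sums (\<rho> ^ J * (1 / (1 - \<rho>)))" by (simp add: v_def)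
  then have vs: "v sums (\<rho> ^ J * (1 / (1 - \<rho>)))"
    unfolding sums_iff_shift by (simp add: v_def)
  define A where "A = (\<Sum>j<J. u j)"
  have us: "u sums A" unfolding A_def by (rule sums_finite) (auto simp: u_def)
  have "cmod (\<Prod>k<n. 1 + q ^ k * \<zeta>) \<le> exp (A + \<eta> * real n)" if \<zeta>: "cmod \<zeta> = \<rho>" for n \<zeta>
  proof -
    define \<sigma> where "\<sigma> j = (\<Sum>k<n. (q ^ k) ^ j)" for j
    define t where "t j = (-1) ^ Suc j / of_nat j * \<zeta> ^ j * \<sigma> j" for j
    have nx: "cmod (q ^ k * \<zeta>) < 1" for k using q \<zeta> \<rho> by (simp add: norm_mult norm_power)
    have ne: "1 + q ^ k * \<zeta> \<noteq> 0" for k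
      using nx[of k] by (metis add_eq_0_iff less_irrefl norm_minus_cancel norm_one)
    have "(\<lambda>j. \<Sum>k<n. (-1) ^ Suc j / of_nat j * (q ^ k * \<zeta>) ^ j) sums (\<Sum>k<n. Ln (1 + q ^ k * \<zeta>))"
      by (intro sums_sum Ln_series nx)
    moreover have "(\<Sum>k<n. (-1) ^ Suc j / of_nat j * (q ^ k * \<zeta>) ^ j) = t j" for j
      by (simp only: t_def \<sigma>_def sum_distrib_left) (simp add: power_mult_distrib mult_ac)
    ultimately have ts: "t sums (\<Sum>k<n. Ln (1 + q ^ k * \<zeta>))" by simp
    have tb: "cmod (t j) \<le> u j + real n * v j" for j
    proof (cases "j = 0")
      case True
      then show ?thesis by (simp add: t_def u_def v_def)
    next
      case False
      have "cmod (t j) = 1 / real j * (\<rho> ^ j * cmod (\<sigma> j))"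
        by (simp add: t_def norm_mult norm_divide norm_power \<zeta>)
      also have "\<dots> \<le> 1 * (\<rho> ^ j * cmod (\<sigma> j))"
        using False \<rho> by (intro mult_right_mono) auto
      finally have tj: "cmod (t j) \<le> \<rho> ^ j * cmod (\<sigma> j)" by simp
      show ?thesis
      proof (cases "j < J")
        case True
        have "\<sigma> j = (\<Sum>k<n. (q ^ j) ^ k)" by (simp add: \<sigma>_def power_mult[symmetric] mult.commute)
        also have "\<dots> = ((q ^ j) ^ n - 1) / (q ^ j - 1)" using q(2) False by (intro geometric_sum) auto
        finally have "cmod (\<sigma> j) = cmod ((q ^ j) ^ n - 1) / cmod (1 - q ^ j)"
          by (simp add: norm_divide norm_minus_commute)
        also have "\<dots> \<le> 2 / cmod (1 - q ^ j)"
          using norm_triangle_ineq4[of "(q ^ j) ^ n" 1] q(1)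
          by (intro divide_right_mono) (auto simp: norm_power)
        finally have "\<rho> ^ j * cmod (\<sigma> j) \<le> 1 * (2 / cmod (1 - q ^ j))"
          using \<rho> by (intro mult_mono power_le_one) auto
        then show ?thesis using tj True by (simp add: u_def v_def)
      next
        case False
        have "cmod (\<sigma> j) \<le> real n"
          unfolding \<sigma>_def by (rule order_trans[OF norm_sum]) (simp add: norm_power q)
        then have "\<rho> ^ j * cmod (\<sigma> j) \<le> \<rho> ^ j * real n" using \<rho> by (intro mult_left_mono) auto
        then show ?thesis using tj False by (simp add: u_def v_def mult.commute)
      qed
    qed
    have gs: "(\<lambda>j. u j + real n * v j) sums (A + real n * (\<rho> ^ J * (1 / (1 - \<rho>))))"
      by (intro sums_add sums_mult us vs)
    have "cmod (\<Sum>k<n. Ln (1 + q ^ k * \<zeta>)) \<le> A + real n * (\<rho> ^ J * (1 / (1 - \<rho>)))"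
      using norm_suminf_le[OF tb sums_summable[OF gs]]
      by (simp only: sums_unique[OF ts, symmetric] sums_unique[OF gs, symmetric])
    also have "\<dots> \<le> A + \<eta> * real n"
      unfolding mult.commute[of \<eta>] by (rule add_left_mono[OF mult_left_mono[OF less_imp_le[OF J]]]) simp
    finally have 1: "cmod (\<Sum>k<n. Ln (1 + q ^ k * \<zeta>)) \<le> A + \<eta> * real n" .
    have "(\<Prod>k<n. 1 + q ^ k * \<zeta>) = exp (\<Sum>k<n. Ln (1 + q ^ k * \<zeta>))"
      by (simp add: exp_sum ne)
    then have "cmod (\<Prod>k<n. 1 + q ^ k * \<zeta>) = exp (Re (\<Sum>k<n. Ln (1 + q ^ k * \<zeta>)))"
      by (simp add: norm_exp_eq_Re)
    also have "\<dots> \<le> exp (A + \<eta> * real n)"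
      using 1 complex_Re_le_cmod[of "\<Sum>k<n. Ln (1 + q ^ k * \<zeta>)"] by (simp only: exp_le_cancel_iff)
    finally show ?thesis .
  qed
  then show ?thesis by blast
qed

text \<open>A third of the rate \<open>\<eta>\<close> each goes to the product on the circle of
  radius \<open>\<rho>\<close>, to the factor \<open>\<rho>^(-n)\<close> from Cauchy's estimate, and
  to the number \<open>n + 1\<close> of coefficients.\<close>

lemma qcoeff_growth:
  assumes q: "cmod q = 1" "\<And>j. 0 < j \<Longrightarrow> q ^ j \<noteq> 1" and \<eta>: "0 < \<eta>"
  obtains C where "0 < C" "\<And>n. (\<Sum>j\<le>n. cmod (qcoeff q n j)) \<le> C * exp (\<eta> * real n)"
proof -
  define \<rho> where "\<rho> = exp (- \<eta> / 3)"
  have \<rho>: "0 < \<rho>" "\<rho> < 1" using \<eta> by (auto simp: \<rho>_def)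
  obtain A where A: "\<And>n \<zeta>. cmod \<zeta> = \<rho> \<Longrightarrow> cmod (\<Prod>k<n. 1 + q ^ k * \<zeta>) \<le> exp (A + \<eta> / 3 * real n)"
    using q_product_bound[OF q \<rho>, of "\<eta> / 3"] \<eta> by auto
  have bound: "cmod (qcoeff q n j) \<le> exp (A + \<eta> / 3 * real n) * exp (\<eta> / 3 * real n)" if j: "j \<le> n" for n j
  proof -
    have "cmod (qcoeff q n j) * \<rho> ^ n \<le> cmod (qcoeff q n j) * \<rho> ^ j"
      using \<rho> j by (intro mult_left_mono power_decreasing) auto
    also have "\<dots> \<le> exp (A + \<eta> / 3 * real n)"
      by (rule coefficient_bound[OF _ j]) (use A \<rho> in \<open>auto simp: qcoeff_prod[symmetric]\<close>)
    finally have F: "cmod (qcoeff q n j) * \<rho> ^ n \<le> exp (A + \<eta> / 3 * real n)" .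
    have "\<rho> ^ n * exp (\<eta> / 3 * real n) = 1"
      by (simp add: \<rho>_def exp_of_nat_mult[symmetric] exp_add[symmetric])
    then have "cmod (qcoeff q n j) = cmod (qcoeff q n j) * \<rho> ^ n * exp (\<eta> / 3 * real n)"
      by (simp only: mult.assoc mult_1_right)
    also have "\<dots> \<le> exp (A + \<eta> / 3 * real n) * exp (\<eta> / 3 * real n)"
      by (intro mult_right_mono F) simp
    finally show ?thesis .
  qed
  show thesis
  proof (rule that[of "exp A * (3 / \<eta> + 1)"])
    show "0 < exp A * (3 / \<eta> + 1)" using \<eta> by (simp add: add_pos_pos)
    fix n
    have "real n + 1 \<le> (3 / \<eta> + 1) * (1 + \<eta> / 3 * real n)" using \<eta> by (simp add: field_simps)
    also have "\<dots> \<le> (3 / \<eta> + 1) * exp (\<eta> / 3 * real n)"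
      using \<eta> by (intro mult_left_mono exp_ge_add_one_self) (auto simp: add_nonneg_nonneg)
    finally have n: "real n + 1 \<le> (3 / \<eta> + 1) * exp (\<eta> / 3 * real n)" .
    have "(\<Sum>j\<le>n. cmod (qcoeff q n j)) \<le> (\<Sum>j\<le>n. exp (A + \<eta> / 3 * real n) * exp (\<eta> / 3 * real n))"
      by (intro sum_mono bound) simp
    also have "\<dots> = (real n + 1) * (exp (A + \<eta> / 3 * real n) * exp (\<eta> / 3 * real n))" by simp
    also have "\<dots> \<le> ((3 / \<eta> + 1) * exp (\<eta> / 3 * real n)) * (exp (A + \<eta> / 3 * real n) * exp (\<eta> / 3 * real n))"
      by (intro mult_right_mono n) simp
    also have "\<dots> = exp A * (3 / \<eta> + 1) * exp (\<eta> * real n)"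
      by (simp add: mult_ac flip: exp_add)
    finally show "(\<Sum>j\<le>n. cmod (qcoeff q n j)) \<le> exp A * (3 / \<eta> + 1) * exp (\<eta> * real n)" .
  qed
qed

section \<open>Two commuting unitaries up to a phase\<close>

context tracial_algebra
begin

text \<open>The infimum over \<open>e > 0\<close> of \<open>ld (x + e *\<^sub>R 1)\<close> is
  \<open>r\<close>, in a form that excludes the value minus infinity. For
  \<open>x = star X * X\<close> this says that the determinant of \<open>X\<close> is
  \<open>exp (r / 2)\<close>.\<close>

definition ld_inf :: "'h cop \<Rightarrow> real \<Rightarrow> bool" where
  "ld_inf x r \<longleftrightarrow> ld_ge x r \<and> (\<forall>r'. ld_ge x r' \<longrightarrow> r' \<le> r)"

lemma ld_ge_scale:
  assumes x: "x \<in> N" "pos x" and k: "0 < k"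
  shows "ld_ge (k *\<^sub>R x) r \<longleftrightarrow> ld_ge x (r - ln k)"
proof -
  have eq: "ld (k *\<^sub>R x + e *\<^sub>R 1) = ln k + ld (x + (e / k) *\<^sub>R 1)" if e: "0 < e" for e
  proof -
    have "ld (k *\<^sub>R (x + (e / k) *\<^sub>R 1)) = ln k + ld (x + (e / k) *\<^sub>R 1)"
      using x k e by (intro ld_scale[where a="e / k"]) auto
    then show ?thesis using k by (simp add: scaleR_add_right)
  qed
  show ?thesis
    unfolding ld_ge_def
  proof safe
    fix e :: real assume *: "\<forall>e>0. r \<le> ld (k *\<^sub>R x + e *\<^sub>R 1)" "0 < e"
    then have "r \<le> ld (k *\<^sub>R x + (k * e) *\<^sub>R 1)" using k by simp
    then show "r - ln k \<le> ld (x + e *\<^sub>R 1)" using eq[of "k * e"] k *(2) by simp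
  next
    fix e :: real assume *: "\<forall>e>0. r - ln k \<le> ld (x + e *\<^sub>R 1)" "0 < e"
    then have "r - ln k \<le> ld (x + (e / k) *\<^sub>R 1)" using k by simp
    then show "r \<le> ld (k *\<^sub>R x + e *\<^sub>R 1)" using eq[OF *(2)] by simp
  qed
qed

lemma ld_inf_scale:
  assumes "x \<in> N" "pos x" "0 < k" "ld_inf x r"
  shows "ld_inf (k *\<^sub>R x) (r + ln k)"
  using assms by (force simp: ld_inf_def ld_ge_scale)

end

lemma norm_unitary_le: "star U * U = 1 \<Longrightarrow> norm (U :: 'h::complex_hilbert_space cop) \<le> 1"
  using norm_star_mult_self[of U] norm_one_cop_le[where 'h='h]
  by (metis abs_le_square_iff abs_norm_cancel abs_one power_one)

lemma norm_unitary_power_le: "star U * U = 1 \<Longrightarrow> norm ((U :: 'h::complex_hilbert_space cop) ^ n) \<le> 1"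
  by (meson norm_power_cop_le norm_unitary_le norm_ge_zero order_trans power_le_one)

locale q_commuting = tracial_algebra N tr
  for N :: "'h::complex_hilbert_space cop set" and tr :: "'h cop \<Rightarrow> complex" +
  fixes U V :: "'h cop" and q :: complex
  assumes U: "U \<in> N" "star U * U = 1" "U * star U = 1"
    and V: "V \<in> N" "star V * V = 1" "V * star V = 1"
    and VU: "V * U = sc q * (U * V)"
    and q: "cmod q = 1" "\<And>j. 0 < j \<Longrightarrow> q ^ j \<noteq> 1"
begin

lemma cancel: "star U * (U * X) = X" "U * (star U * X) = X" "star V * (V * X) = X" "V * (star V * X) = X"
  by (simp_all add: U V flip: mult.assoc)

lemma q_cnj: "cnj q * q = 1" "q * cnj q = 1" "q \<noteq> 0"
  using q(1) complex_norm_square[of q] by (auto simp: mult.commute)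

definition W :: "'h cop" where "W = star U * V"

lemma sc_sc: "sc a * (sc b * X) = sc (a * b) * (X :: 'h cop)"
  by (simp add: sc_mult mult.assoc)

lemmas sc_left = sc_sc sc_times_left_commute[of U] sc_times_left_commute[of V]
  sc_times_left_commute[of "star U"] sc_times_left_commute[of "star V"]
  sc_times_left_commute[of W] sc_times_left_commute[of "star W"]

lemma W: "W \<in> N" "star W * W = 1" "W * star W = 1"
  using U V by (auto simp: W_def mult.assoc cancel)

lemma VU': "V * (U * X) = sc q * (U * (V * X))"
  using VU by (metis mult.assoc)

lemma W_conj: "W * (sc a * U + sc b * V) * star W = sc q * (sc a * U + sc b * V)"
proof -
  have 1: "W * (U * star W) = sc q * U" "W * (V * star W) = sc q * V"
    by (simp_all add: W_def mult.assoc VU' cancel sc_left U V VU)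
  show ?thesis
    by (simp add: distrib_left distrib_right sc_left mult.assoc 1 mult.commute[of q])
qed

lemma W_conj_power: "W ^ k * (sc a * U + sc b * V) * star W ^ k = sc (q ^ k) * (sc a * U + sc b * V)"
proof (induction k)
  case (Suc k)
  let ?S = "sc a * U + sc b * V"
  have "W ^ Suc k * ?S * star W ^ Suc k = W * (W ^ k * ?S * star W ^ k) * star W"
    by (simp only: power_Suc[of W] power_Suc2[of "star W"] mult.assoc)
  also have "\<dots> = sc (q ^ k) * (W * ?S * star W)"
    unfolding Suc by (simp only: sc_left mult.assoc)
  also have "\<dots> = sc (q ^ Suc k) * ?S"
    unfolding W_conj by (simp only: sc_sc power_Suc2)
  finally show ?case .
qed simp

lemma W_power: "W ^ k \<in> N" "star (W ^ k) * W ^ k = 1" "W ^ k * star (W ^ k) = 1"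
proof -
  show "W ^ k \<in> N" using W by auto
  have "star W ^ k * W ^ k = 1 \<and> W ^ k * star W ^ k = 1"
  proof (induction k)
    case (Suc k)
    have "star W ^ Suc k * W ^ Suc k = star W ^ k * (star W * W) * W ^ k"
      by (simp only: power_Suc2[of "star W"] power_Suc[of W] mult.assoc)
    moreover have "W ^ Suc k * star W ^ Suc k = W ^ k * (W * star W) * star W ^ k"
      by (simp only: power_Suc[of "star W"] power_Suc2[of W] mult.assoc)
    ultimately show ?case using Suc W by simp
  qed simp
  then show "star (W ^ k) * W ^ k = 1" "W ^ k * star (W ^ k) = 1" by simp_all
qed

lemma S_in_N: "sc a * U + sc b * V \<in> N"
  using U V by auto

text \<open>Conjugation by \<open>W\<close> multiplies \<open>S = a U + b V\<close> by \<open>q\<close>, but preserves the trace.\<close>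

lemma tr_S_power:
  assumes n: "0 < n"
  shows "tr ((sc a * U + sc b * V) ^ n) = 0"
proof -
  let ?S = "sc a * U + sc b * V"
  have "W * ?S ^ n * star W = sc (q ^ n) * ?S ^ n" for n
  proof (induction n)
    case (Suc n)
    have "W * ?S ^ Suc n * star W = (W * ?S * star W) * (W * ?S ^ n * star W)"
    proof -
      have "star W * (W * X) = X" for X using W(2) by (simp flip: mult.assoc)
      then show ?thesis by (simp only: power_Suc mult.assoc)
    qed
    also have "\<dots> = sc (q ^ Suc n) * ?S ^ Suc n"
      unfolding Suc W_conj by (simp only: mult.assoc sc_times_left_commute[of ?S] sc_sc power_Suc)
    finally show ?case .
  qed (simp add: W)
  then have e1: "tr (W * (?S ^ n * star W)) = q ^ n * tr (?S ^ n)"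
    using U(1) V(1) W(1) by (simp add: tr_sc mult.assoc N_intros)
  have e2: "tr (W * (?S ^ n * star W)) = tr (?S ^ n)"
  proof -
    have m: "?S ^ n \<in> N" using U(1) V(1) by auto
    have "tr (W * (?S ^ n * star W)) = tr (?S ^ n * star W * W)" using W(1) m by (intro tr_commute) auto
    then show ?thesis by (simp add: mult.assoc W)
  qed
  have "(1 - q ^ n) * tr (?S ^ n) = tr (?S ^ n) - q ^ n * tr (?S ^ n)" by (simp only: left_diff_distrib mult_1_left)
  also have "\<dots> = 0" by (simp only: e1[symmetric]) (simp only: e2 diff_self)
  finally have "(1 - q ^ n) * tr (?S ^ n) = 0" .
  then show ?thesis using q(2)[OF n] by simp
qed

text \<open>Used for two different arguments: \<open>X = W\<close>, to expand the powers of
  \<open>S\<close>, and \<open>X = S\<close> with \<open>a = 1\<close>, \<open>b = - 1\<close>, for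
  the product of the factors \<open>1 - q^k S\<close>.\<close>

primrec qprod :: "complex \<Rightarrow> complex \<Rightarrow> 'h cop \<Rightarrow> nat \<Rightarrow> 'h cop" where
  "qprod a b X 0 = 1"
| "qprod a b X (Suc n) = (sc a + sc (b * q ^ n) * X) * qprod a b X n"

lemma qprod_expand:
  "qprod a b X n = (\<Sum>j\<le>n. sc (qcoeff q n j * (a ^ (n - j) * b ^ j)) * X ^ j)"
proof (induction n)
  case (Suc n)
  have 1: "sc a * (\<Sum>j\<le>n. sc (qcoeff q n j * (a ^ (n - j) * b ^ j)) * X ^ j)
      = (\<Sum>j\<le>Suc n. sc (qcoeff q n j * (a ^ (Suc n - j) * b ^ j)) * X ^ j)"
  proof -
    have st: "sc a * (sc (qcoeff q n j * (a ^ (n - j) * b ^ j)) * X ^ j) = sc (qcoeff q n j * (a ^ (Suc n - j) * b ^ j)) * X ^ j"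
      if "j \<in> {..n}" for j
    proof -
      have "a * (qcoeff q n j * (a ^ (n - j) * b ^ j)) = qcoeff q n j * (a ^ (Suc n - j) * b ^ j)"
        using that by (simp add: Suc_diff_le)
      then show ?thesis by (simp only: sc_sc)
    qed
    show ?thesis by (simp add: qcoeff_eq_0 sum_distrib_left) (intro sum.cong refl st)
  qed
  have 2: "sc (b * q ^ n) * X * (\<Sum>j\<le>n. sc (qcoeff q n j * (a ^ (n - j) * b ^ j)) * X ^ j)
      = (\<Sum>j\<le>Suc n. sc ((if j = 0 then 0 else q ^ n * qcoeff q n (j - 1)) * (a ^ (Suc n - j) * b ^ j)) * X ^ j)"
  proof -
    have "sc (b * q ^ n) * X * (sc (qcoeff q n j * (a ^ (n - j) * b ^ j)) * X ^ j)
        = sc (q ^ n * qcoeff q n j * (a ^ (n - j) * b ^ Suc j)) * X ^ Suc j" for j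
    proof -
      have "b * q ^ n * (qcoeff q n j * (a ^ (n - j) * b ^ j)) = q ^ n * qcoeff q n j * (a ^ (n - j) * b ^ Suc j)"
        by simp
      then show ?thesis by (simp only: mult.assoc[of "sc _" X] sc_times_left_commute[of X] sc_sc power_Suc[of X])
    qed
    then show ?thesis by (subst sum.atMost_Suc_shift) (simp add: sum_distrib_left del: power_Suc)
  qed
  show ?case
    by (simp only: qprod.simps Suc distrib_right 1 2 sum.distrib[symmetric])
      (intro sum.cong refl, simp add: distrib_right sc_add)
qed simp

lemma norm_qprod_le:
  assumes "cmod a \<le> 1" "cmod b \<le> 1" "\<And>j. j \<le> n \<Longrightarrow> norm (X ^ j) \<le> K" "0 \<le> K"
  shows "norm (qprod a b X n) \<le> (\<Sum>j\<le>n. cmod (qcoeff q n j)) * K"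
proof -
  have "norm (qprod a b X n) \<le> (\<Sum>j\<le>n. norm (sc (qcoeff q n j * (a ^ (n - j) * b ^ j)) * X ^ j))"
    unfolding qprod_expand by (rule norm_sum)
  also have "\<dots> \<le> (\<Sum>j\<le>n. cmod (qcoeff q n j) * K)"
  proof (intro sum_mono)
    fix j assume j: "j \<in> {..n}"
    have "norm (sc (qcoeff q n j * (a ^ (n - j) * b ^ j)) * X ^ j) \<le> cmod (qcoeff q n j * (a ^ (n - j) * b ^ j)) * norm (X ^ j)"
      by (rule norm_sc_times_le)
    also have "\<dots> \<le> (cmod (qcoeff q n j) * 1) * K"
    proof (intro mult_mono)
      have "cmod (a ^ (n - j) * b ^ j) \<le> 1"
        using assms(1,2) by (simp add: norm_mult norm_power mult_le_one power_le_one)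
      then show "cmod (qcoeff q n j * (a ^ (n - j) * b ^ j)) \<le> cmod (qcoeff q n j) * 1"
        unfolding norm_mult[of "qcoeff q n j"] by (intro mult_left_mono) auto
    qed (use assms j in auto)
    finally show "norm (sc (qcoeff q n j * (a ^ (n - j) * b ^ j)) * X ^ j) \<le> cmod (qcoeff q n j) * K" by simp
  qed
  finally show ?thesis by (simp add: sum_distrib_right)
qed

lemma V_U_power: "V * U ^ n = sc (q ^ n) * (U ^ n * V)"
proof (induction n)
  case (Suc n)
  have "V * U ^ Suc n = sc q * (U * (V * U ^ n))" by (simp add: VU')
  also have "\<dots> = sc (q ^ Suc n) * (U ^ Suc n * V)"
    unfolding Suc by (simp add: sc_left mult.assoc)
  finally show ?case .
qed simp

text \<open>Since \<open>V = U * W\<close>, moving \<open>U ^ n\<close> to the left past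
  \<open>sc a * U + sc b * V\<close> leaves \<open>U ^ Suc n\<close> and one factor
  \<open>sc a + sc (b * q ^ n) * W\<close> in the single unitary \<open>W\<close>.\<close>

lemma S_power: "(sc a * U + sc b * V) ^ n = U ^ n * qprod a b W n"
proof (induction n)
  case (Suc n)
  have "V * U ^ n = sc (q ^ n) * (U ^ Suc n * W)"
    unfolding V_U_power by (simp only: W_def power_Suc2 mult.assoc cancel)
  then have "(sc a * U + sc b * V) * U ^ n = U ^ Suc n * (sc a + sc (b * q ^ n) * W)"
    by (simp add: distrib_left distrib_right sc_left sc_times_left_commute[of "U ^ n"] sc_commute[of "U ^ n"] mult.assoc)
  then show ?case using Suc by (simp only: power_Suc[of "sc a * U + sc b * V"] qprod.simps mult.assoc[symmetric])
qed simp

lemma norm_S_power_le: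
  assumes "cmod a \<le> 1" "cmod b \<le> 1"
  shows "norm ((sc a * U + sc b * V) ^ n) \<le> (\<Sum>j\<le>n. cmod (qcoeff q n j))"
proof -
  have "norm ((sc a * U + sc b * V) ^ n) \<le> norm (U ^ n) * norm (qprod a b W n)"
    unfolding S_power by (rule norm_mult_ineq)
  also have "\<dots> \<le> 1 * ((\<Sum>j\<le>n. cmod (qcoeff q n j)) * 1)"
    using assms by (intro mult_mono norm_unitary_power_le norm_qprod_le U W) auto
  finally show ?thesis by simp
qed

text \<open>The factors \<open>1 - q ^ k S\<close> are unitarily equivalent to \<open>1 - S\<close>, so by supermultiplicativity the
  product of \<open>n\<close> of them contributes at least \<open>n r\<close>, while its norm grows subexponentially.\<close>

lemma ld_ge_upper:
  assumes ab: "cmod a \<le> 1" "cmod b \<le> 1" and r: "ld_ge (star (1 - (sc a * U + sc b * V)) * (1 - (sc a * U + sc b * V))) r"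
  shows "r \<le> 0"
proof (rule field_le_epsilon)
  define S where "S = sc a * U + sc b * V"
  have SN: "S \<in> N" unfolding S_def by (rule S_in_N)
  define X where "X k = 1 + sc (- 1 * q ^ k) * S" for k
  have XN: "X k \<in> N" for k using SN by (auto simp: X_def)
  have conj: "W ^ k * (1 - S) * star (W ^ k) = X k" for k
  proof -
    have "W ^ k * (1 - S) * star (W ^ k) = W ^ k * star (W ^ k) - W ^ k * S * star W ^ k"
      by (simp add: left_diff_distrib right_diff_distrib)
    then show ?thesis unfolding S_def W_conj_power by (simp add: W_power[unfolded star_power] X_def S_def sc_minus)
  qed
  have ge: "ld_ge (star (X k) * X k) r" for k
    unfolding ld_ge_def
  proof (intro allI impI)
    fix e :: real assume e: "0 < e"
    let ?y = "star (1 - S) * (1 - S) + e *\<^sub>R 1"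
    have "W ^ k * ?y * star (W ^ k) = W ^ k * (star (1 - S) * (1 - S)) * star (W ^ k) + e *\<^sub>R (W ^ k * star (W ^ k))"
      by (simp add: distrib_left distrib_right del: star_power star_diff star_mult)
    also have "W ^ k * (star (1 - S) * (1 - S)) * star (W ^ k)
        = (W ^ k * star (1 - S) * star (W ^ k)) * (W ^ k * (1 - S) * star (W ^ k))"
    proof -
      have "star (W ^ k) * (W ^ k * Z) = Z" for Z using W_power(2)[of k] by (simp flip: mult.assoc)
      then show ?thesis by (simp only: mult.assoc)
    qed
    also have "W ^ k * star (1 - S) * star (W ^ k) = star (X k)"
      unfolding conj[symmetric] star_mult star_star by (simp only: mult.assoc)
    finally have "W ^ k * ?y * star (W ^ k) = star (X k) * X k + e *\<^sub>R 1"
      by (simp only: conj W_power(3))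
    moreover have "ld (W ^ k * ?y * star (W ^ k)) = ld ?y"
      using e SN by (intro ld_unitary_conj[where a=e] W_power) (auto simp del: star_diff)
    ultimately show "r \<le> ld (star (X k) * X k + e *\<^sub>R 1)"
      using r e unfolding ld_ge_def S_def by simp
  qed
  have Z: "qprod 1 (- 1) S n = foldr (\<lambda>k Z. X k * Z) (rev [0..<n]) 1" for n
    by (induction n) (simp_all add: X_def)
  fix \<epsilon> :: real assume \<epsilon>: "0 < \<epsilon>"
  \<comment> \<open>The growth bound \<open>K\<close> enters once for the coefficients and once for
    the powers of \<open>S\<close>, and the resulting \<open>K * K\<close> is squared by
    \<open>ld_ge_le_norm\<close>; four times \<open>\<epsilon> / 8\<close> leaves the rate
    \<open>\<epsilon> / 2\<close>.\<close>
  obtain C where C: "0 < C" "\<And>n. (\<Sum>j\<le>n. cmod (qcoeff q n j)) \<le> C * exp (\<epsilon> / 8 * real n)"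
    using qcoeff_growth[OF q, of "\<epsilon> / 8"] \<epsilon> by auto
  have main: "real n * r \<le> ln (C ^ 4 + 1) + \<epsilon> / 2 * real n" for n
  proof -
    define K where "K = C * exp (\<epsilon> / 8 * real n)"
    have K0: "0 \<le> K" using C by (simp add: K_def)
    have nS: "norm (S ^ j) \<le> K" if "j \<le> n" for j
    proof -
      have "norm (S ^ j) \<le> C * exp (\<epsilon> / 8 * real j)"
        unfolding S_def using norm_S_power_le[OF ab] C(2) order_trans by blast
      also have "\<dots> \<le> K" unfolding K_def using that \<epsilon> C by (intro mult_left_mono) auto
      finally show ?thesis .
    qed
    have "norm (qprod 1 (- 1) S n) \<le> (\<Sum>j\<le>n. cmod (qcoeff q n j)) * K"
      by (rule norm_qprod_le) (use nS K0 in auto)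
    also have "\<dots> \<le> K * K" using C(2)[of n] K0 by (intro mult_right_mono) (auto simp: K_def)
    finally have nZ: "norm (qprod 1 (- 1) S n) \<le> K * K" .
    have "ld_ge (star (qprod 1 (- 1) S n) * qprod 1 (- 1) S n) (real n * r) \<and> qprod 1 (- 1) S n \<in> N"
      using ld_ge_prod[where X=X and ks="rev [0..<n]", OF XN ge] unfolding Z by simp
    then have "real n * r \<le> ln ((norm (qprod 1 (- 1) S n))\<^sup>2 + 1)" by (intro ld_ge_le_norm) auto
    also have "\<dots> \<le> ln ((K * K)\<^sup>2 + 1)"
      using nZ by (intro ln_mono add_right_mono power_mono) (auto simp: add_nonneg_pos)
    also have "\<dots> \<le> ln ((C ^ 4 + 1) * exp (\<epsilon> / 2 * real n))"
    proof (intro ln_mono)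
      have "(K * K)\<^sup>2 = C ^ 4 * exp (\<epsilon> / 2 * real n)"
        by (simp add: K_def power2_eq_square power4_eq_xxxx mult_ac flip: exp_add)
      moreover have "1 \<le> exp (\<epsilon> / 2 * real n)" using \<epsilon> by simp
      ultimately show "(K * K)\<^sup>2 + 1 \<le> (C ^ 4 + 1) * exp (\<epsilon> / 2 * real n)" by (simp add: distrib_right)
    qed (auto simp: add_nonneg_pos)
    also have "\<dots> = ln (C ^ 4 + 1) + \<epsilon> / 2 * real n"
    proof -
      have "0 < C ^ 4 + 1" using C(1) by (intro add_pos_pos) auto
      then show ?thesis by (simp add: ln_mult)
    qed
    finally show ?thesis .
  qed
  show "r \<le> 0 + \<epsilon>"
  proof (rule ccontr)
    assume "\<not> r \<le> 0 + \<epsilon>"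
    then have r: "\<epsilon> < r" by simp
    obtain n :: nat where n: "2 * ln (C ^ 4 + 1) / \<epsilon> < real n" using reals_Archimedean2 by blast
    then have "ln (C ^ 4 + 1) < \<epsilon> / 2 * real n" using \<epsilon> by (simp add: field_simps)
    moreover have "\<epsilon> * real n \<le> r * real n" using r by (intro mult_right_mono) auto
    ultimately show False using main[of n] by (simp add: mult.commute)
  qed
qed

end

text \<open>Summability is assumed instead of \<open>norm Y < 1\<close>, as the operators concerned
  have spectral radius below \<open>1\<close> but possibly a larger norm.\<close>

lemma neumann_inverse:
  fixes Y :: "'h::complex_hilbert_space cop"
  assumes "summable (\<lambda>n. Y ^ n)"
  shows "(\<Sum>n. Y ^ n) * (1 - Y) = 1" "(1 - Y) * (\<Sum>n. Y ^ n) = 1"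
proof -
  define S where "S = (\<Sum>n. Y ^ n)"
  have sums: "(\<lambda>n. Y ^ n) sums S" unfolding S_def by (rule summable_sums[OF assms])
  have "(\<lambda>n. Y ^ Suc n) sums (S - 1)" using sums_Suc_iff[of "\<lambda>n. Y ^ n" "S - 1"] sums by simp
  moreover have "(\<lambda>n. Y ^ Suc n) sums (Y * S)"
    unfolding power_Suc by (rule bounded_linear.sums[OF bounded_linear_mult_right sums])
  moreover have "(\<lambda>n. Y ^ Suc n) sums (S * Y)"
    unfolding power_Suc2 by (rule bounded_linear.sums[OF bounded_linear_mult_left sums])
  ultimately have "Y * S = S - 1" "S * Y = S - 1" using sums_unique2 by blast+
  then show "(\<Sum>n. Y ^ n) * (1 - Y) = 1" "(1 - Y) * (\<Sum>n. Y ^ n) = 1"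
    unfolding S_def[symmetric] by (simp_all add: left_diff_distrib right_diff_distrib)
qed

lemma scaleR_power_cop: "(r *\<^sub>R X) ^ n = r ^ n *\<^sub>R (X :: 'h::complex_hilbert_space cop) ^ n"
  by (induction n) simp_all

context q_commuting
begin

text \<open>Along \<open>s \<mapsto> 1 - s T\<close> the derivative is the real part of the trace of a power series in \<open>T\<close>
  without constant term.\<close>

lemma ld_strict:
  assumes ab: "cmod a \<le> 1" "cmod b \<le> 1" and t: "0 \<le> t" "t < 1"
  defines "T \<equiv> t *\<^sub>R (sc a * U + sc b * V)"
  shows "ld (star (1 - T) * (1 - T)) = 0" "\<exists>d>0. pos (star (1 - T) * (1 - T) - d *\<^sub>R 1)"
proof -
  define S where "S = sc a * U + sc b * V"
  have SN: "S \<in> N" unfolding S_def by (rule S_in_N)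
  have T: "T = t *\<^sub>R S" by (simp add: T_def S_def)
  have TN: "T \<in> N" using SN by (auto simp: T)
  \<comment> \<open>With this choice
    \<open>exp (- \<eta>) \<ge> 1 - \<eta> = (1 + t) / 2 > t\<close>, so the factor \<open>t\<close>
    outweighs the growth rate \<open>exp \<eta>\<close> of the powers of \<open>S\<close>.\<close>
  define \<eta> where "\<eta> = (1 - t) / 2"
  have \<eta>: "0 < \<eta>" using t by (simp add: \<eta>_def)
  have "t < 1 + (- \<eta>)" using t by (simp add: \<eta>_def field_simps)
  also have "\<dots> \<le> exp (- \<eta>)" by (rule exp_ge_add_one_self)
  finally have "t * exp \<eta> < exp (- \<eta>) * exp \<eta>" by (intro mult_strict_right_mono) auto
  then have \<beta>1: "t * exp \<eta> < 1" by (simp add: exp_minus)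
  define \<beta> where "\<beta> = t * exp \<eta>"
  have \<beta>: "0 \<le> \<beta>" "\<beta> < 1" using t \<beta>1 by (auto simp: \<beta>_def)
  obtain C where C: "0 < C" "\<And>n. (\<Sum>j\<le>n. cmod (qcoeff q n j)) \<le> C * exp (\<eta> * real n)"
    using qcoeff_growth[OF q \<eta>] by auto
  have nT: "norm ((s *\<^sub>R T) ^ n) \<le> C * \<beta> ^ n" if s: "s \<in> {0..1}" for s n
  proof -
    have "norm ((s *\<^sub>R T) ^ n) = s ^ n * (t ^ n * norm (S ^ n))"
      using s t by (simp add: T scaleR_power_cop power_mult_distrib abs_mult)
    also have "\<dots> \<le> 1 * (t ^ n * norm (S ^ n))"
      using s t by (intro mult_right_mono power_le_one) auto
    also have "\<dots> \<le> 1 * (t ^ n * (C * exp (\<eta> * real n)))"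
      using norm_S_power_le[OF ab, of n] C(2)[of n] t unfolding S_def[symmetric]
      by (intro mult_left_mono) auto
    also have "\<dots> = C * \<beta> ^ n" by (simp add: \<beta>_def power_mult_distrib exp_of_nat_mult[symmetric] mult_ac)
    finally show ?thesis .
  qed
  have sumC: "summable (\<lambda>n. C * \<beta> ^ n)" using \<beta> by (intro summable_mult summable_geometric) auto
  have sumT: "summable (\<lambda>n. (s *\<^sub>R T) ^ n)" if "s \<in> {0..1}" for s
    by (rule summable_norm_cancel[OF summable_comparison_test'[OF sumC, of 0]]) (use nT[OF that] in simp)
  define G where "G s = (\<Sum>n. (s *\<^sub>R T) ^ n)" for s
  define X where "X s = 1 - s *\<^sub>R T" for s :: real
  define K where "K = (\<Sum>n. C * \<beta> ^ n)"
  have G: "G s * X s = 1" "X s * G s = 1" "norm (G s) \<le> K" "G s \<in> N" if s: "s \<in> {0..1}" for s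
  proof -
    show "G s * X s = 1" "X s * G s = 1" unfolding G_def X_def by (rule neumann_inverse[OF sumT[OF s]])+
    show "norm (G s) \<le> K" unfolding G_def K_def by (rule norm_suminf_le[OF nT[OF s] sumC])
    show "G s \<in> N"
      by (rule csub_sums[OF csub _ summable_sums[OF sumT[OF s], folded G_def]]) (use TN in auto)
  qed
  have trGT: "tr (G s * T) = 0" if s: "s \<in> {0..1}" for s
  proof -
    define P where "P m = (\<Sum>n<m. (s *\<^sub>R T) ^ n)" for m
    have PN: "P m \<in> N" for m unfolding P_def by (rule csub_sum[OF csub]) (use TN in auto)
    have "P \<longlonglongrightarrow> G s" using summable_sums[OF sumT[OF s]] by (simp add: sums_def P_def[abs_def] G_def)
    then have "(\<lambda>m. tr (P m * T)) \<longlonglongrightarrow> tr (G s * T)"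
      using PN TN G(4)[OF s] by (intro tr_tendsto tendsto_intros) auto
    moreover have "tr (P m * T) = 0" for m
    proof -
      have "tr ((s *\<^sub>R T) ^ n * T) = 0" for n
      proof -
        have "(s *\<^sub>R T) ^ n * T = (s ^ n * t ^ Suc n) *\<^sub>R S ^ Suc n"
          by (simp add: T scaleR_power_cop power_commutes power_mult_distrib)
        moreover have "tr (S ^ Suc n) = 0" unfolding S_def by (rule tr_S_power) simp
        moreover have "S ^ Suc n \<in> N" by (rule csub_power[OF csub SN])
        ultimately show ?thesis by (simp only: tr_scaleR mult_zero_right)
      qed
      then show ?thesis unfolding P_def sum_distrib_right using TN by (subst tr_sum) auto
    qed
    ultimately show ?thesis by (simp add: LIMSEQ_const_iff)
  qed
  define B where "B s = star (X s) * X s" for s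
  define B' where "B' s = star (X s) * (- T) + (- star T) * X s" for s
  have XN: "X s \<in> N" for s using TN by (auto simp: X_def)
  have deriv: "(B has_vector_derivative B' s) (at s within {0..1})" for s
  proof -
    have "(X has_vector_derivative - T) (at s within {0..1})"
      unfolding X_def[abs_def] by (auto intro!: derivative_eq_intros)
    moreover have "((\<lambda>s. star (X s)) has_vector_derivative - star T) (at s within {0..1})"
      unfolding X_def[abs_def] by (auto intro!: derivative_eq_intros)
    ultimately show ?thesis unfolding B_def[abs_def] B'_def by (rule has_vector_derivative_mult[rotated])
  qed
  have nX: "norm (X s) \<le> 1 + norm T" if "s \<in> {0..1}" for s
  proof -
    have "norm (X s) \<le> norm (1 :: 'h cop) + norm (s *\<^sub>R T)" unfolding X_def by (rule norm_triangle_ineq4)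
    also have "\<dots> \<le> 1 + norm T" using that norm_one_cop_le[where 'h='h]
      by (intro add_mono) (auto simp: mult_left_le_one_le)
    finally show ?thesis .
  qed
  define d where "d = 1 / (K\<^sup>2 + 1)"
  have d: "0 < d" by (simp add: d_def add_nonneg_pos)
  have pB: "pos (B s - d *\<^sub>R 1)" if "s \<in> {0..1}" for s
    unfolding B_def d_def by (rule pos_star_mult_lower[OF G(1,3)[OF that]])
  have Gd: "((\<lambda>s. ld (B s)) has_real_derivative Re (tr (G s * star (G s) * B' s))) (at s within {0..1})" if s: "s \<in> {0..1}" for s
  proof (rule ld_path[where a=d and c="(1 + norm T)\<^sup>2" and K="(1 + norm T) * norm T + norm T * (1 + norm T)"])
    fix s :: real assume s: "s \<in> {0..1}"
    show "B s \<in> N" "B' s \<in> N" "G s * star (G s) \<in> N"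
      using XN TN G(4)[OF s] by (auto simp: B_def B'_def)
    show "norm (B s) \<le> (1 + norm T)\<^sup>2"
      unfolding B_def norm_star_mult_self using nX[OF s] by (intro power_mono) auto
    show "norm (B' s) \<le> (1 + norm T) * norm T + norm T * (1 + norm T)"
      unfolding B'_def using nX[OF s]
      by (intro norm_triangle_le add_mono order_trans[OF norm_mult_ineq] mult_mono) auto
    have "star (G s) * star (X s) = 1" using arg_cong[OF G(2)[OF s], of star] by simp
    then have "star (G s) * (star (X s) * X s) = X s" by (simp flip: mult.assoc)
    then show "G s * star (G s) * B s = 1" using G(1)[OF s] by (simp add: B_def mult.assoc)
  qed (use d pB deriv s in auto)
  \<comment> \<open>The inverse of \<open>B s\<close> is \<open>G s * star (G s)\<close>. The two
    summands of \<open>B' s\<close> contribute, up to sign, \<open>tr (G s * T)\<close> and its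
    conjugate, and both vanish because all powers of \<open>T\<close> beyond the zeroth have trace
    zero.\<close>
  have zero: "Re (tr (G s * star (G s) * B' s)) = 0" if s: "s \<in> {0..1}" for s
  proof -
    have GN: "G s \<in> N" by (rule G(4)[OF s])
    have sGX: "star (G s) * star (X s) = 1" using arg_cong[OF G(2)[OF s], of star] by simp
    then have "star (G s) * (star (X s) * T) = T" by (simp flip: mult.assoc)
    then have 1: "G s * star (G s) * (star (X s) * (- T)) = - (G s * T)" by (simp add: mult.assoc)
    have "tr (G s * (star (G s) * star T * X s)) = tr (star (G s) * star T * X s * G s)"
      using GN TN XN by (intro tr_commute) auto
    also have "star (G s) * star T * X s * G s = star (T * G s)" using G(2)[OF s] by (simp add: mult.assoc)
    also have "tr \<dots> = cnj (tr (T * G s))" using GN TN by (intro tr_star) auto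
    also have "tr (T * G s) = 0" using trGT[OF s] tr_commute[OF TN GN] by simp
    finally have 2: "tr (G s * (star (G s) * star T * X s)) = 0" by simp
    have "G s * star (G s) * B' s = - (G s * T) - G s * (star (G s) * star T * X s)"
      unfolding B'_def distrib_left 1 by (simp add: mult.assoc)
    then show ?thesis using GN TN XN trGT[OF s] 2
      by (simp add: tr_diff tr_uminus N_intros star_N)
  qed
  have "\<exists>k. \<forall>s\<in>{0..1}. ld (B s) = k"
    by (intro has_field_derivative_zero_constant) (use Gd zero in auto)
  then have "ld (B 1) = ld (B 0)" by (metis atLeastAtMost_iff order_refl zero_le_one)
  then show "ld (star (1 - T) * (1 - T)) = 0" by (simp add: B_def X_def ld_one)
  show "\<exists>d>0. pos (star (1 - T) * (1 - T) - d *\<^sub>R 1)"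
    using pB[of 1] d by (auto simp: B_def X_def)
qed

text \<open>For the lower bound, \<open>t < 1\<close> is taken so close to \<open>1\<close> that
  \<open>B t\<close> is within \<open>e / 2\<close> of \<open>B 1\<close> in norm, hence below
  \<open>B 1 + e *\<^sub>R 1\<close>; then \<open>ld (B t) = 0\<close> and monotonicity give the
  claim.\<close>

lemma ld_inf_one:
  assumes ab: "cmod a \<le> 1" "cmod b \<le> 1"
  shows "ld_inf (star (1 - (sc a * U + sc b * V)) * (1 - (sc a * U + sc b * V))) 0"
  unfolding ld_inf_def
proof (intro conjI allI impI ld_ge_upper[OF ab])
  define S where "S = sc a * U + sc b * V"
  have SN: "S \<in> N" unfolding S_def by (rule S_in_N)
  define B where "B t = star (1 - t *\<^sub>R S) * (1 - t *\<^sub>R S)" for t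
  have "ld_ge (B 1) 0"
    unfolding ld_ge_def
  proof (intro allI impI)
    fix e :: real assume e: "0 < e"
    have "((\<lambda>t. (1 - t *\<^sub>R star S) * (1 - t *\<^sub>R S)) \<longlongrightarrow> (1 - 1 *\<^sub>R star S) * (1 - 1 *\<^sub>R S)) (at_left 1)"
      by (intro tendsto_intros)
    then have "(B \<longlongrightarrow> B 1) (at_left 1)" by (simp add: B_def[abs_def])
    then have "\<forall>\<^sub>F t in at_left 1. dist (B t) (B 1) < e / 2" using e by (intro tendstoD) auto
    moreover have "\<forall>\<^sub>F t in at_left (1::real). 0 < t \<and> t < 1"
      unfolding eventually_at_left_field by (intro exI[of _ 0]) auto
    ultimately have "\<forall>\<^sub>F t in at_left (1::real). 0 < t \<and> t < 1 \<and> dist (B t) (B 1) < e / 2"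
      by eventually_elim auto
    then have "\<exists>t::real. 0 < t \<and> t < 1 \<and> dist (B t) (B 1) < e / 2"
      by (rule eventually_happens'[OF trivial_limit_at_left_real])
    then obtain t where t: "0 < t" "t < 1" "norm (B t - B 1) < e / 2"
      by (auto simp: dist_norm)
    have BN: "B t \<in> N" "B 1 \<in> N" using SN by (auto simp: B_def)
    have sB: "star (B s) = B s" for s by (simp add: B_def)
    obtain d where d: "0 < d" "pos (B t - d *\<^sub>R 1)"
      using ld_strict(2)[OF ab, of t] t unfolding B_def S_def by auto
    have "ld (B t) = 0" using ld_strict(1)[OF ab, of t] t unfolding B_def S_def by auto
    moreover have "ld (B t) \<le> ld (B 1 + e *\<^sub>R 1)"
    proof (rule ld_mono[OF BN(1) _ d])
      have "pos ((e / 2) *\<^sub>R 1 - (B t - B 1))" using t(3) by (intro pos_norm_minus) (auto simp: sB)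
      then have "pos ((e / 2) *\<^sub>R 1 - (B t - B 1) + (e / 2) *\<^sub>R 1)" using e by (intro pos_add pos_scaleR) auto
      moreover have "(e / 2) *\<^sub>R (1 :: 'h cop) + (e / 2) *\<^sub>R 1 = e *\<^sub>R 1" by (simp flip: scaleR_add_left)
      ultimately show "pos (B 1 + e *\<^sub>R 1 - B t)" by (simp add: algebra_simps)
    qed (use BN in auto)
    ultimately show "0 \<le> ld (B 1 + e *\<^sub>R 1)" by simp
  qed
  then show "ld_ge (star (1 - (sc a * U + sc b * V)) * (1 - (sc a * U + sc b * V))) 0"
    by (simp add: B_def S_def)
qed

text \<open>The isometry \<open>D\<close> cancels against its adjoint, and \<open>k\<close>
  contributes the logarithm of its squared modulus.\<close>

lemma ld_inf_multiple:
  assumes k: "k \<noteq> 0" and D: "D \<in> N" "star D * D = 1" and Y: "Y \<in> N" "ld_inf (star Y * Y) 0"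
  shows "ld_inf (star (sc k * (D * Y)) * (sc k * (D * Y))) (2 * ln (cmod k))"
proof -
  have "star D * (D * Y) = Y" using D(2) by (simp flip: mult.assoc)
  then have "star (sc k * (D * Y)) * (sc k * (D * Y)) = sc (cnj k * k) * (star Y * Y)"
    by (simp add: mult.assoc sc_times_left_commute[of "star Y"] sc_times_left_commute[of "star D"] sc_mult)
  also have "cnj k * k = complex_of_real ((cmod k)\<^sup>2)"
    using complex_norm_square[of k] by (simp add: mult.commute)
  finally have eq: "star (sc k * (D * Y)) * (sc k * (D * Y)) = (cmod k)\<^sup>2 *\<^sub>R (star Y * Y)"
    by (simp only: sc_of_real_times)
  have "ld_inf ((cmod k)\<^sup>2 *\<^sub>R (star Y * Y)) (0 + ln ((cmod k)\<^sup>2))"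
    using k Y by (intro ld_inf_scale) auto
  then show ?thesis using k unfolding eq by (simp add: ln_realpow)
qed

theorem ld_inf_linear_combination:
  assumes "a \<noteq> 0 \<or> b \<noteq> 0 \<or> c \<noteq> 0"
  defines "X \<equiv> sc a * U + sc b * V + sc c"
  shows "ld_inf (star X * X) (2 * ln (Max {cmod a, cmod b, cmod c}))"
proof -
  consider (c) "cmod a \<le> cmod c" "cmod b \<le> cmod c" | (a) "cmod b \<le> cmod a" "cmod c \<le> cmod a"
    | (b) "cmod a \<le> cmod b" "cmod c \<le> cmod b" by linarith
  then show ?thesis
  proof cases
    case c
    then have c0: "c \<noteq> 0" using assms(1) by auto
    have h1: "ld_inf (star (1 - (sc (- a / c) * U + sc (- b / c) * V)) * (1 - (sc (- a / c) * U + sc (- b / c) * V))) 0"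
      using c c0 by (intro ld_inf_one) (auto simp: norm_divide)
    have h2: "sc c * (1 * (1 - (sc (- a / c) * U + sc (- b / c) * V))) = X"
      using c0 by (simp add: X_def right_diff_distrib distrib_left sc_sc sc_minus algebra_simps)
    have YN: "1 - (sc (- a / c) * U + sc (- b / c) * V) \<in> N" using U(1) V(1) by auto
    have "ld_inf (star X * X) (2 * ln (cmod c))"
      by (rule ld_inf_multiple[OF c0 _ _ YN h1, of 1, unfolded h2]) auto
    moreover have "Max {cmod a, cmod b, cmod c} = cmod c" using c by simp
    ultimately show ?thesis by simp
  next
    case a
    then have a0: "a \<noteq> 0" using assms(1) by auto
    \<comment> \<open>\<open>X = a U (1 - S')\<close>, where \<open>S'\<close> combines
      \<open>star U\<close> and \<open>star U * V\<close> with coefficients of modulus at most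
      \<open>1\<close>. These unitaries again commute up to a phase, here
      \<open>cnj q\<close>.\<close>
    interpret A: q_commuting N tr "star U" "star U * V" "cnj q"
    proof
      show "star U * V * star U = sc (cnj q) * (star U * (star U * V))"
      proof -
        have "V * star U = sc (cnj q) * (star U * V)"
        proof -
          have "star U * (V * U) * star U = sc q * (star U * (U * V) * star U)"
            by (simp add: VU sc_left mult.assoc)
          then have "star U * V = sc q * (V * star U)" by (simp add: U cancel mult.assoc)
          then show ?thesis by (simp add: sc_sc q_cnj)
        qed
        then show ?thesis by (simp add: mult.assoc sc_left)
      qed
      show "cmod (cnj q) = 1" using q by simp
      show "cnj q ^ j \<noteq> 1" if "0 < j" for j
        using q(2)[OF that] by (metis complex_cnj_cnj complex_cnj_one complex_cnj_power)
    qed (use U V in \<open>auto simp: mult.assoc cancel\<close>)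
    have h1: "ld_inf (star (1 - (sc (- c / a) * star U + sc (- b / a) * (star U * V))) * (1 - (sc (- c / a) * star U + sc (- b / a) * (star U * V)))) 0"
      using a a0 by (intro A.ld_inf_one) (auto simp: norm_divide)
    have h2: "sc a * (U * (1 - (sc (- c / a) * star U + sc (- b / a) * (star U * V)))) = X"
      using a0 by (simp add: X_def right_diff_distrib distrib_left sc_left cancel U sc_minus algebra_simps flip: sc_mult)
    have YN: "1 - (sc (- c / a) * star U + sc (- b / a) * (star U * V)) \<in> N" using U(1) V(1) by auto
    have "ld_inf (star X * X) (2 * ln (cmod a))"
      by (rule ld_inf_multiple[OF a0 U(1,2) YN h1, unfolded h2])
    moreover have "Max {cmod a, cmod b, cmod c} = cmod a" using a by simp
    ultimately show ?thesis by simp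
  next
    case b
    then have b0: "b \<noteq> 0" using assms(1) by auto
    \<comment> \<open>The same with \<open>V\<close> factored out; the phase for
      \<open>star V\<close> and \<open>star V * U\<close> is \<open>q\<close>.\<close>
    interpret A: q_commuting N tr "star V" "star V * U" q
    proof
      have "star V * (V * U) * star V = sc q * (star V * (U * V) * star V)"
        by (simp add: VU sc_left mult.assoc)
      then have "U * star V = sc q * (star V * U)" by (simp add: V cancel mult.assoc)
      then show "star V * U * star V = sc q * (star V * (star V * U))" by (simp add: mult.assoc sc_left)
    qed (use U V q in \<open>auto simp: mult.assoc cancel\<close>)
    have h1: "ld_inf (star (1 - (sc (- c / b) * star V + sc (- a / b) * (star V * U))) * (1 - (sc (- c / b) * star V + sc (- a / b) * (star V * U)))) 0"
      using b b0 by (intro A.ld_inf_one) (auto simp: norm_divide)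
    have h2: "sc b * (V * (1 - (sc (- c / b) * star V + sc (- a / b) * (star V * U)))) = X"
      using b0 by (simp add: X_def right_diff_distrib distrib_left sc_left cancel V sc_minus algebra_simps flip: sc_mult)
    have YN: "1 - (sc (- c / b) * star V + sc (- a / b) * (star V * U)) \<in> N" using U(1) V(1) by auto
    have "ld_inf (star X * X) (2 * ln (cmod b))"
      by (rule ld_inf_multiple[OF b0 V(1,2) YN h1, unfolded h2])
    moreover have "Max {cmod a, cmod b, cmod c} = cmod b" using b by simp
    ultimately show ?thesis by simp
  qed
qed

end

section \<open>The Fuglede--Kadison determinant\<close>

text \<open>\<open>ge\<close> and \<open>le\<close> say that \<open>2 * r\<close> is the infimum
  over \<open>e > 0\<close> of the integrals of \<open>ln (s\<^sup>2 + e)\<close>. By monotone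
  convergence it is the integral of \<open>2 * ln s\<close>. Its finiteness rules out an atom at
  \<open>0\<close>, so \<open>ln\<close> is integrable and the two halves in the definition of
  \<open>trace_ln\<close> may be subtracted.\<close>

lemma integral_ln_limit:
  fixes M :: "real measure"
  assumes M: "prob_space M" "sets M = sets borel" "AE s in M. 0 \<le> s \<and> s \<le> B"
    and ge: "\<And>e. 0 < e \<Longrightarrow> 2 * r \<le> (\<integral>s. ln (s\<^sup>2 + e) \<partial>M)"
    and le: "\<And>r'. (\<And>e. 0 < e \<Longrightarrow> r' \<le> (\<integral>s. ln (s\<^sup>2 + e) \<partial>M)) \<Longrightarrow> r' \<le> 2 * r"
  shows "enn2ereal (\<integral>\<^sup>+t. (if t \<le> 0 then 0 else ennreal (ln t)) \<partial>M) -
     enn2ereal (\<integral>\<^sup>+t. (if t \<le> 0 then \<infinity> else ennreal (- ln t)) \<partial>M) = ereal r"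
proof -
  interpret prob_space M by fact
  note [measurable_cong] = M(2)
  define I where "I e = (\<integral>s. ln (s\<^sup>2 + e) \<partial>M)" for e
  \<comment> \<open>An upper bound of \<open>ln (s\<^sup>2 + \<epsilon> n)\<close>, as
    \<open>\<epsilon> n \<le> 1\<close>; subtraction from \<open>K\<close> makes the integrands
    nonnegative and increasing in \<open>n\<close>.\<close>
  define K where "K = ln (B\<^sup>2 + 1)"
  have int: "integrable M (\<lambda>s. ln (s\<^sup>2 + e))" if e: "0 < e" for e
  proof (rule integrable_const_bound[where B="\<bar>ln e\<bar> + \<bar>ln (B\<^sup>2 + e)\<bar>"])
    show "AE s in M. norm (ln (s\<^sup>2 + e)) \<le> \<bar>ln e\<bar> + \<bar>ln (B\<^sup>2 + e)\<bar>"
      using M(3)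
    proof eventually_elim
      case (elim s)
      then have "s\<^sup>2 \<le> B\<^sup>2" by (intro power_mono) auto
      then have "ln e \<le> ln (s\<^sup>2 + e)" "ln (s\<^sup>2 + e) \<le> ln (B\<^sup>2 + e)"
        using e by (auto intro!: ln_mono simp: add_nonneg_pos)
      then show ?case by auto
    qed
  qed measurable
  have Imono: "I d \<le> I e" if "0 < d" "d \<le> e" for d e
    unfolding I_def using that int by (intro integral_mono) (auto intro!: ln_mono simp: add_nonneg_pos)
  define \<epsilon> where "\<epsilon> n = 1 / real (Suc n)" for n
  have \<epsilon>: "0 < \<epsilon> n" "\<epsilon> n \<le> 1" "\<epsilon> (Suc n) \<le> \<epsilon> n" for n by (auto simp: \<epsilon>_def frac_le)
  have Ilim: "(\<lambda>n. I (\<epsilon> n)) \<longlonglongrightarrow> 2 * r"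
  proof (rule LIMSEQ_I)
    fix \<delta> :: real assume \<delta>: "0 < \<delta>"
    have "\<not> (\<forall>e>0. 2 * r + \<delta> \<le> I e)" using le[of "2 * r + \<delta>"] \<delta> unfolding I_def by auto
    then obtain e where e: "0 < e" "I e < 2 * r + \<delta>" by (auto simp: not_le)
    obtain n0 where n0: "\<epsilon> n0 < e" using reals_Archimedean[OF e(1)] by (auto simp: \<epsilon>_def inverse_eq_divide)
    have "norm (I (\<epsilon> n) - 2 * r) < \<delta>" if "n0 \<le> n" for n
    proof -
      have "\<epsilon> n \<le> \<epsilon> n0" using that by (simp add: \<epsilon>_def frac_le)
      then have "I (\<epsilon> n) \<le> I e" using n0 \<epsilon>(1) by (intro Imono) auto
      moreover have "2 * r \<le> I (\<epsilon> n)" using ge[OF \<epsilon>(1)] by (simp add: I_def)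
      ultimately show ?thesis using e(2) by simp
    qed
    then show "\<exists>no. \<forall>n\<ge>no. norm (I (\<epsilon> n) - 2 * r) < \<delta>" by blast
  qed
  define g where "g s = (if s \<le> 0 then \<infinity> else ennreal (K - 2 * ln s))" for s
  have [measurable]: "g \<in> borel_measurable M" unfolding g_def by measurable
  define f where "f n s = ennreal (K - ln (s\<^sup>2 + \<epsilon> n))" for n s
  have [measurable]: "f n \<in> borel_measurable M" for n unfolding f_def by measurable
  have nonneg: "AE s in M. 0 \<le> K - ln (s\<^sup>2 + \<epsilon> n)" for n
    using M(3)
  proof eventually_elim
    case (elim s)
    then have "s\<^sup>2 \<le> B\<^sup>2" by (intro power_mono) auto
    then have "ln (s\<^sup>2 + \<epsilon> n) \<le> K"
      unfolding K_def using \<epsilon>[of n] by (intro ln_mono) (auto simp: add_nonneg_pos intro: add_mono)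
    then show ?case by simp
  qed
  have fint: "(\<integral>\<^sup>+s. f n s \<partial>M) = ennreal (K - I (\<epsilon> n))" for n
    unfolding f_def I_def using int[OF \<epsilon>(1)[of n]] nonneg[of n]
    by (subst nn_integral_eq_integral) (auto simp: prob_space)
  have finc: "f n s \<le> f (Suc n) s" for n s
    unfolding f_def using \<epsilon>[of n] \<epsilon>(1)[of "Suc n"] by (intro ennreal_leI diff_left_mono ln_mono) (auto simp: add_nonneg_pos)
  have fg: "(\<lambda>n. f n s) \<longlonglongrightarrow> g s" if s: "0 \<le> s" for s
  proof (cases "s = 0")
    case True
    have "filterlim (\<lambda>n. K - ln (\<epsilon> n)) at_top sequentially"
      unfolding \<epsilon>_def by real_asymp
    then have "(\<lambda>n. ennreal (K - ln (\<epsilon> n))) \<longlonglongrightarrow> top"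
      by (simp only: ennreal_tendsto_top_eq_at_top)
    then show ?thesis using True by (simp add: f_def g_def)
  next
    case False
    then have s: "0 < s" using s by simp
    have "\<epsilon> \<longlonglongrightarrow> 0"
      using LIMSEQ_inverse_real_of_nat by (simp add: \<epsilon>_def[abs_def] inverse_eq_divide)
    then have "(\<lambda>n. K - ln (s\<^sup>2 + \<epsilon> n)) \<longlonglongrightarrow> K - ln (s\<^sup>2 + 0)"
      using s by (intro tendsto_intros) auto
    then have "(\<lambda>n. K - ln (s\<^sup>2 + \<epsilon> n)) \<longlonglongrightarrow> K - 2 * ln s" using s by (simp add: ln_realpow)
    then show ?thesis using s by (simp add: f_def g_def tendsto_ennrealI)
  qed
  have gint: "(\<integral>\<^sup>+s. g s \<partial>M) = ennreal (K - 2 * r)"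
  proof -
    have "AE s in M. g s = (SUP n. f n s)"
      using M(3)
    proof eventually_elim
      case (elim s)
      have "incseq (\<lambda>n. f n s)" by (intro incseq_SucI finc)
      from LIMSEQ_unique[OF fg LIMSEQ_SUP[OF this]] elim show ?case by simp
    qed
    then have "(\<integral>\<^sup>+s. g s \<partial>M) = (\<integral>\<^sup>+s. (SUP n. f n s) \<partial>M)" by (rule nn_integral_cong_AE)
    also have "\<dots> = (SUP n. \<integral>\<^sup>+s. f n s \<partial>M)"
      by (rule nn_integral_monotone_convergence_SUP) (auto intro: incseq_SucI le_funI finc)
    also have "\<dots> = ennreal (K - 2 * r)"
    proof (rule LIMSEQ_unique[OF LIMSEQ_SUP])
      show "incseq (\<lambda>n. \<integral>\<^sup>+s. f n s \<partial>M)" by (intro incseq_SucI nn_integral_mono finc)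
      show "(\<lambda>n. \<integral>\<^sup>+s. f n s \<partial>M) \<longlonglongrightarrow> ennreal (K - 2 * r)"
        unfolding fint by (intro tendsto_ennrealI tendsto_diff tendsto_const Ilim)
    qed
    finally show ?thesis .
  qed
  \<comment> \<open>\<open>g\<close> is infinite on \<open>s \<le> 0\<close>, so the finite integral
    shows that this set is null.\<close>
  have "AE s in M. g s \<noteq> \<infinity>"
    by (rule nn_integral_PInf_AE) (simp_all add: gint)
  then have pos: "AE s in M. 0 < s" by eventually_elim (auto simp: g_def split: if_splits)
  have K2: "AE s in M. 0 \<le> K - 2 * ln s"
    using pos M(3)
  proof eventually_elim
    case (elim s)
    have "2 * ln s = ln (s\<^sup>2)" using elim by (simp add: ln_realpow)
    also have "\<dots> \<le> K" unfolding K_def using elim by (intro ln_mono) (auto intro: order_trans[OF power_mono])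
    finally show ?case by simp
  qed
  have gint2: "(\<integral>\<^sup>+s. ennreal (K - 2 * ln s) \<partial>M) = ennreal (K - 2 * r)"
    unfolding gint[symmetric]
    by (rule nn_integral_cong_AE) (use pos in eventually_elim, auto simp: g_def)
  have Kr: "0 \<le> K - 2 * r"
  proof -
    have "0 \<le> (\<integral>s. K - ln (s\<^sup>2 + \<epsilon> 0) \<partial>M)" by (rule integral_nonneg_AE[OF nonneg])
    also have "\<dots> = K - I (\<epsilon> 0)" using int[OF \<epsilon>(1)] by (simp add: I_def prob_space)
    finally show ?thesis using ge[OF \<epsilon>(1)[of 0]] by (simp add: I_def)
  qed
  have i1: "integrable M (\<lambda>s. K - 2 * ln s)"
    by (rule integrableI_nonneg[OF _ K2]) (simp_all add: gint2)
  have v1: "(\<integral>s. K - 2 * ln s \<partial>M) = K - 2 * r"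
    using integral_eq_nn_integral[OF _ K2] Kr by (simp add: gint2)
  have "integrable M (\<lambda>s. (K - (K - 2 * ln s)) / 2)"
    by (intro integrable_divide_zero Bochner_Integration.integrable_diff i1) auto
  then have iln: "integrable M ln" by simp
  have vln: "(\<integral>s. ln s \<partial>M) = r" using v1 iln by (simp add: prob_space)
  define P where "P = (\<integral>\<^sup>+t. ennreal (ln t) \<partial>M)"
  define Q where "Q = (\<integral>\<^sup>+t. ennreal (- ln t) \<partial>M)"
  have fin: "P \<noteq> \<infinity>" "Q \<noteq> \<infinity>"
    using iln real_integrable_def[of M ln] by (auto simp: P_def Q_def)
  have PQ: "(\<integral>\<^sup>+t. (if t \<le> 0 then 0 else ennreal (ln t)) \<partial>M) = P" "(\<integral>\<^sup>+t. (if t \<le> 0 then \<infinity> else ennreal (- ln t)) \<partial>M) = Q"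
    unfolding P_def Q_def by (intro nn_integral_cong_AE, use pos in eventually_elim, simp)+
  have "enn2real P - enn2real Q = r"
    using real_lebesgue_integral_def[OF iln] vln by (simp add: P_def Q_def)
  then show ?thesis
    unfolding PQ using fin by (cases P; cases Q) (auto simp: enn2ereal_ennreal)
qed

context traced_vna
begin

text \<open>The squares of the spectral distribution of \<open>A = op_sqrt (star X * X)\<close> have
  the moments of \<open>star X * X\<close>, so \<open>ld (star X * X + e *\<^sub>R 1)\<close> is the
  integral of \<open>ln (s\<^sup>2 + e)\<close> against that distribution. The factor
  \<open>2\<close> comes from \<open>A * A = star X * X\<close>.\<close>

theorem fuglede_kadison_eq:
  assumes X: "X \<in> N" and r: "ld_inf (star X * X) (2 * r)"
  shows "fuglede_kadison \<tau> (ap X) = exp r"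
proof -
  define A where "A = op_sqrt (star X * X)"
  have XX: "star X * X \<in> N" using X by auto
  have A: "pos A" "A * A = star X * X" "A \<in> N"
    using csub_op_sqrt[OF _ csub XX] by (simp_all add: A_def pos_op_sqrt op_sqrt_square)
  define E0 where "E0 = spectral_resolution (ap A)"
  have "\<exists>E. resolution_of E (ap A)"
    using spectral_family_exists[OF pos_star[OF A(1)]] by (auto simp: spectral_family_def)
  then have E0: "resolution_of E0 (ap A)"
    unfolding E0_def spectral_resolution_def by (rule someI_ex)
  then have "bounded_op (E0 t)" for t by (simp add: resolution_of_def projection_def self_adjoint_def)
  define E where "E t = Op (E0 t)" for t
  have apE: "ap (E t) = E0 t" for t unfolding E_def by (rule ap_Op) fact
  then have "spectral_family E A" using E0 by (simp add: spectral_family_def)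
  then obtain b where sp: "spectral E A b" by (rule spectral_family_spectral)
  have sd: "spectral_distribution \<tau> (ap A) = interval_measure (\<lambda>t. Re (tr (E t)))"
    by (simp add: spectral_distribution_def E0_def[symmetric] tr_def apE)
  define M where "M = interval_measure (\<lambda>t. Re (tr (E t)))"
  note M = trace_distribution[OF sp A(3,1), folded M_def]
  have m: "(\<lambda>s. s\<^sup>2) \<in> borel_measurable M" using M(2) by (simp add: measurable_cong_sets[OF M(2) refl])
  have bd: "AE s in M. 0 \<le> s\<^sup>2 \<and> s\<^sup>2 \<le> (norm A)\<^sup>2"
    using M(3) by eventually_elim (auto intro: power_mono)
  have mom: "(\<integral>s. (s\<^sup>2) ^ n \<partial>M) = Re (tr ((star X * X) ^ n))" for n
    using M(4)[of "2 * n"] by (simp add: power_mult power2_eq_square A(2))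
  have ld: "ld (star X * X + e *\<^sub>R 1) = (\<integral>s. ln (s\<^sup>2 + e) \<partial>M)" if "0 < e" for e
    by (rule ld_eq_integral[OF XX pos_star_mult M(1) m bd mom that])
  have "trace_ln \<tau> (ap A) = ereal r"
    unfolding trace_ln_def sd M_def[symmetric]
    by (rule integral_ln_limit[OF M(1-3)]) (use r in \<open>auto simp: ld_inf_def ld_ge_def ld\<close>)
  then show ?thesis
    by (simp add: fuglede_kadison_def abs_op_ap A_def)
qed

end

section \<open>Test functions and uniqueness of the Brown measure\<close>

lemma dir_deriv_eq: "(f has_derivative D) (at x) \<Longrightarrow> dir_deriv v f x = D v"
  unfolding dir_deriv_def by (metis frechet_derivative_at)

lemma times_differentiable_invariant:
  assumes "\<And>f x. f \<in> S \<Longrightarrow> f differentiable (at x)" "\<And>f v. f \<in> S \<Longrightarrow> dir_deriv v f \<in> S"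
  shows "f \<in> S \<Longrightarrow> times_differentiable k f"
proof (induction k arbitrary: f)
  case 0
  then show ?case
    using assms(1) by (auto intro!: continuous_at_imp_continuous_on differentiable_imp_continuous_within)
next
  case (Suc k)
  then show ?case using assms by (auto simp: differentiable_on_def intro: differentiable_at_withinI)
qed

text \<open>The factor \<open>(1 / x) ^ k\<close> makes the family closed under differentiation up
  to linear combinations: the derivative of \<open>flat k\<close> involves
  \<open>flat (k + 2)\<close> and \<open>flat (k + 1)\<close> only.\<close>

definition flat :: "nat \<Rightarrow> real \<Rightarrow> real" where
  "flat k x = (if 0 < x then (1 / x) ^ k * exp (- (1 / x)) else 0)"

lemma flat_tendsto_0: "(flat k \<longlongrightarrow> 0) (at 0)"
proof -
  have "((\<lambda>x. (1 / x) ^ k / exp (1 / x)) \<longlongrightarrow> (0::real)) (at_right 0)"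
    using filterlim_compose[OF tendsto_power_div_exp_0[of k] filterlim_inverse_at_top_right]
    by (simp add: inverse_eq_divide)
  then have "(flat k \<longlongrightarrow> 0) (at_right 0)"
    by (rule Lim_transform_eventually)
      (auto simp: flat_def exp_minus field_simps eventually_at_filter)
  moreover have "(flat k \<longlongrightarrow> 0) (at_left 0)"
    by (rule tendsto_eventually) (auto simp: flat_def eventually_at_filter)
  ultimately show ?thesis by (simp add: filterlim_split_at)
qed

lemma flat_has_derivative: "(flat k has_real_derivative flat (k + 2) x - real k * flat (k + 1) x) (at x)"
proof (cases x "0::real" rule: linorder_cases)
  case less
  have "((\<lambda>x. 0) has_real_derivative 0) (at x)" by simp
  then have "(flat k has_real_derivative 0) (at x)"
    by (rule has_field_derivative_transform_within_open[where S="{..<0}"]) (use less in \<open>auto simp: flat_def\<close>)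
  then show ?thesis using less by (simp add: flat_def)
next
  case equal
  have "((\<lambda>h. flat (k + 1) h) \<longlongrightarrow> 0) (at 0)" by (rule flat_tendsto_0)
  moreover have "\<forall>\<^sub>F h in at 0. flat (k + 1) h = (flat k (0 + h) - flat k 0) / h"
    by (auto simp: flat_def eventually_at_filter field_simps)
  ultimately have "((\<lambda>h. (flat k (0 + h) - flat k 0) / h) \<longlongrightarrow> 0) (at 0)"
    by (rule Lim_transform_eventually)
  then show ?thesis using equal by (simp add: DERIV_def flat_def)
next
  case greater
  have d: "((\<lambda>x. 1 / x) has_real_derivative - ((1 / x)\<^sup>2)) (at x)"
    using greater by (auto intro!: derivative_eq_intros simp: power2_eq_square)
  define y where "y = 1 / x"
  have "real k * (- y\<^sup>2 * y ^ (k - Suc 0)) * exp (- y) + exp (- y) * (- (- y\<^sup>2)) * y ^ k =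
      y ^ (k + 2) * exp (- y) - real k * (y ^ (k + 1) * exp (- y))"
    by (cases k) (simp_all add: power2_eq_square algebra_simps)
  with DERIV_mult[OF DERIV_power[OF d, of k] DERIV_fun_exp[OF DERIV_minus[OF d]]] greater
  have "((\<lambda>x. (1 / x) ^ k * exp (- (1 / x))) has_real_derivative
      flat (k + 2) x - real k * flat (k + 1) x) (at x)"
    unfolding y_def by (simp add: flat_def)
  then show ?thesis
    by (rule has_field_derivative_transform_within_open[where S="{0<..}"]) (use greater in \<open>auto simp: flat_def\<close>)
qed

text \<open>An algebra of smooth functions that is closed under directional derivatives.\<close>

inductive_set bumps :: "('a::euclidean_space \<Rightarrow> real) set" where
  flat: "bounded_linear l \<Longrightarrow> (\<lambda>z. flat k (l z + c)) \<in> bumps"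
| scale: "f \<in> bumps \<Longrightarrow> (\<lambda>z. c * f z) \<in> bumps"
| add: "f \<in> bumps \<Longrightarrow> g \<in> bumps \<Longrightarrow> (\<lambda>z. f z + g z) \<in> bumps"
| mult: "f \<in> bumps \<Longrightarrow> g \<in> bumps \<Longrightarrow> (\<lambda>z. f z * g z) \<in> bumps"

lemma bumps_derivative:
  "f \<in> bumps \<Longrightarrow> (\<forall>z. f differentiable (at z)) \<and> (\<forall>v. dir_deriv v f \<in> bumps)"
proof (induction rule: bumps.induct)
  case (flat l k c)
  define D where "D x = flat (k + 2) x - real k * flat (k + 1) x" for x
  have d: "((\<lambda>z. flat k (l z + c)) has_derivative (\<lambda>h. D (l z + c) * l h)) (at z)" for z
  proof -
    have "((\<lambda>z. l z + c) has_derivative l) (at z)"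
      using has_derivative_add[OF bounded_linear_imp_has_derivative[OF flat] has_derivative_const] by simp
    from has_derivative_compose[OF this flat_has_derivative[of k "l z + c", unfolded has_field_derivative_def]]
    show ?thesis by (simp add: D_def)
  qed
  have "dir_deriv v (\<lambda>z. flat k (l z + c)) = (\<lambda>z. l v * (flat (k + 2) (l z + c) + (- real k) * flat (k + 1) (l z + c)))" for v
    by (rule ext) (simp only: dir_deriv_eq[OF d], simp add: D_def mult.commute)
  moreover have "\<dots> v \<in> bumps" for v
    by (intro bumps.scale bumps.add bumps.flat flat)
  ultimately show ?case using d by (auto simp: differentiable_def)
next
  case (scale f c)
  then have d: "((\<lambda>z. c * f z) has_derivative (\<lambda>h. c * frechet_derivative f (at z) h)) (at z)" for z
    by (auto intro!: derivative_eq_intros simp: frechet_derivative_works)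
  have "dir_deriv v (\<lambda>z. c * f z) = (\<lambda>z. c * dir_deriv v f z)" for v
    by (rule ext) (simp only: dir_deriv_eq[OF d], simp only: dir_deriv_def)
  then show ?case using d scale by (auto simp: differentiable_def intro: bumps.scale)
next
  case (add f g)
  then have d: "((\<lambda>z. f z + g z) has_derivative (\<lambda>h. frechet_derivative f (at z) h + frechet_derivative g (at z) h)) (at z)" for z
    by (auto intro!: derivative_eq_intros simp: frechet_derivative_works)
  have "dir_deriv v (\<lambda>z. f z + g z) = (\<lambda>z. dir_deriv v f z + dir_deriv v g z)" for v
    by (rule ext) (simp only: dir_deriv_eq[OF d], simp only: dir_deriv_def)
  then show ?case using d add by (auto simp: differentiable_def intro: bumps.add)
next
  case (mult f g)
  then have d: "((\<lambda>z. f z * g z) has_derivative (\<lambda>h. f z * frechet_derivative g (at z) h + frechet_derivative f (at z) h * g z)) (at z)" for z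
    by (intro has_derivative_mult) (auto simp: frechet_derivative_works)
  have "dir_deriv v (\<lambda>z. f z * g z) = (\<lambda>z. f z * dir_deriv v g z + dir_deriv v f z * g z)" for v
    by (rule ext) (simp only: dir_deriv_eq[OF d], simp only: dir_deriv_def)
  then show ?case using d mult by (auto simp: differentiable_def intro!: bumps.add bumps.mult)
qed

lemma bumps_times_differentiable: "f \<in> bumps \<Longrightarrow> times_differentiable k f"
  by (rule times_differentiable_invariant[of bumps]) (use bumps_derivative in auto)

text \<open>A product of four one-sided cutoffs. Since \<open>exp (- 1 / (n y))\<close> tends to
  \<open>1\<close> for \<open>y > 0\<close>, the functions tend to the indicator of the open box as
  \<open>n\<close> grows. The affine arguments are written in the form \<open>l z + c\<close> of the
  rule \<open>bumps.flat\<close>.\<close>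

definition box_bump :: "complex \<Rightarrow> complex \<Rightarrow> nat \<Rightarrow> complex \<Rightarrow> real" where
  "box_bump a b n z = (flat 0 (real n * Re z + - (real n * Re a)) * flat 0 (- real n * Re z + real n * Re b)) *
     (flat 0 (real n * Im z + - (real n * Im a)) * flat 0 (- real n * Im z + real n * Im b))"

lemma box_complex: "z \<in> box a b \<longleftrightarrow> Re a < Re z \<and> Re z < Re b \<and> Im a < Im z \<and> Im z < Im b"
  by (auto simp: mem_box Basis_complex_def inner_complex_def)

lemma box_bump_nonneg: "0 \<le> box_bump a b n z" and box_bump_le_1: "box_bump a b n z \<le> 1"
proof -
  have f: "0 \<le> flat 0 x" "flat 0 x \<le> 1" for x by (auto simp: flat_def)
  show "0 \<le> box_bump a b n z" unfolding box_bump_def by (intro mult_nonneg_nonneg f)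
  show "box_bump a b n z \<le> 1" unfolding box_bump_def by (intro mult_le_one mult_nonneg_nonneg f)
qed

lemma box_bump_tendsto: "(\<lambda>n. box_bump a b n z) \<longlonglongrightarrow> indicator (box a b) z"
proof -
  have pos: "(\<lambda>n. flat 0 (real n * y)) \<longlonglongrightarrow> 1" if y: "0 < y" for y
  proof -
    have "(\<lambda>n. exp (- (1 / y * inverse (real (Suc n))))) \<longlonglongrightarrow> exp (- (1 / y * 0))"
      by (intro tendsto_intros LIMSEQ_inverse_real_of_nat)
    moreover have "exp (- (1 / y * inverse (real (Suc n)))) = flat 0 (real (Suc n) * y)" for n
      using y by (simp add: flat_def field_simps add_pos_nonneg)
    ultimately have "(\<lambda>n. flat 0 (real (Suc n) * y)) \<longlonglongrightarrow> 1" by simp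
    then show ?thesis by (rule LIMSEQ_imp_Suc)
  qed
  have eq: "box_bump a b n z = (flat 0 (real n * (Re z - Re a)) * flat 0 (real n * (Re b - Re z))) *
     (flat 0 (real n * (Im z - Im a)) * flat 0 (real n * (Im b - Im z)))" for n
    by (simp add: box_bump_def algebra_simps)
  show ?thesis
  proof (cases "z \<in> box a b")
    case True
    then have "(\<lambda>n. box_bump a b n z) \<longlonglongrightarrow> (1 * 1) * (1 * 1)"
      unfolding eq by (intro tendsto_mult pos) (auto simp: box_complex)
    then show ?thesis using True by simp
  next
    case False
    then have "box_bump a b n z = 0" for n
      unfolding eq by (auto simp: box_complex flat_def zero_less_mult_iff not_less)
    then show ?thesis using False by simp
  qed
qed

lemma test_function_box_bump: "test_function (box_bump a b n)"
  unfolding test_function_def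
proof
  have l: "bounded_linear (\<lambda>z. c * Re z)" "bounded_linear (\<lambda>z. c * Im z)" for c
    by (intro bounded_linear_const_mult bounded_linear_Re bounded_linear_Im)+
  have "box_bump a b n \<in> bumps"
    unfolding box_bump_def[abs_def] by (intro bumps.mult bumps.flat l)
  then show "\<forall>k. times_differentiable k (box_bump a b n)" using bumps_times_differentiable by blast
  have "{z. box_bump a b n z \<noteq> 0} \<subseteq> cbox a b"
  proof
    fix z assume "z \<in> {z. box_bump a b n z \<noteq> 0}"
    then have "0 < real n * Re z + - (real n * Re a)" "0 < - real n * Re z + real n * Re b"
      "0 < real n * Im z + - (real n * Im a)" "0 < - real n * Im z + real n * Im b"
      by (auto simp: box_bump_def flat_def split: if_splits)
    then have "0 < real n * (Re z - Re a)" "0 < real n * (Re b - Re z)" "0 < real n * (Im z - Im a)" "0 < real n * (Im b - Im z)"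
      by (auto simp: algebra_simps)
    then show "z \<in> cbox a b" by (auto simp: zero_less_mult_iff mem_box Basis_complex_def inner_complex_def)
  qed
  then have "bounded {z. box_bump a b n z \<noteq> 0}" using bounded_cbox bounded_subset by blast
  then show "compact (closure {z. box_bump a b n z \<noteq> 0})" by (simp add: compact_closure)
qed

text \<open>The bumps determine the measure of every open box by dominated convergence, and the
  boxes are an intersection-stable generator of the Borel sets.\<close>

lemma measure_eq_if_test_functions_eq:
  fixes \<mu> \<nu> :: "complex measure"
  assumes \<mu>: "prob_space \<mu>" "sets \<mu> = sets borel" and \<nu>: "prob_space \<nu>" "sets \<nu> = sets borel"
    and eq: "\<And>\<phi>. test_function \<phi> \<Longrightarrow> (\<integral>z. \<phi> z \<partial>\<mu>) = (\<integral>z. \<phi> z \<partial>\<nu>)"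
  shows "\<mu> = \<nu>"
proof -
  have lim: "(\<lambda>n. \<integral>z. box_bump a b n z \<partial>\<rho>) \<longlonglongrightarrow> measure \<rho> (box a b)"
    if \<rho>: "prob_space \<rho>" "sets \<rho> = sets borel" for \<rho> :: "complex measure" and a b
  proof -
    interpret prob_space \<rho> by fact
    have m: "f \<in> borel_measurable \<rho>" if "f \<in> borel_measurable borel" for f :: "complex \<Rightarrow> real"
      using that by (simp add: measurable_cong_sets[OF \<rho>(2) refl])
    have "(\<lambda>n. \<integral>z. box_bump a b n z \<partial>\<rho>) \<longlonglongrightarrow> (\<integral>z. indicator (box a b) z \<partial>\<rho>)"
    proof (rule integral_dominated_convergence[where w="\<lambda>z. 1"])
      show "box_bump a b n \<in> borel_measurable \<rho>" for n
        using test_function_box_bump[of a b n] unfolding test_function_def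
        by (intro m borel_measurable_continuous_onI) (metis times_differentiable.simps(1))
    qed (auto simp: box_bump_nonneg box_bump_le_1 box_bump_tendsto intro!: m)
    then show ?thesis using \<rho>(2) by simp
  qed
  have box: "emeasure \<mu> (box a b) = emeasure \<nu> (box a b)" for a b
  proof -
    interpret M: prob_space \<mu> by fact
    interpret N: prob_space \<nu> by fact
    have "measure \<mu> (box a b) = measure \<nu> (box a b)"
      using LIMSEQ_unique[OF lim[OF \<mu>] ] lim[OF \<nu>, of a b] by (simp add: eq[OF test_function_box_bump])
    then show ?thesis by (simp add: M.emeasure_eq_measure N.emeasure_eq_measure)
  qed
  show ?thesis
  proof (rule measure_eqI_generator_eq)
    let ?E = "range (\<lambda>(a, b). box a b::complex set)"
    show "Int_stable ?E" by (auto simp: Int_stable_def box_Int_box)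
    show "?E \<subseteq> Pow UNIV" "sets \<mu> = sigma_sets UNIV ?E" "sets \<nu> = sigma_sets UNIV ?E"
      by (simp_all add: borel_eq_box \<mu> \<nu>)
    let ?A = "\<lambda>n::nat. box (- (real n *\<^sub>R One)) (real n *\<^sub>R One) :: complex set"
    show "range ?A \<subseteq> ?E" "(\<Union>i. ?A i) = UNIV" unfolding UN_box_eq_UNIV by auto
    show "emeasure \<mu> (?A i) \<noteq> \<infinity>" for i
      using finite_measure.emeasure_finite[OF prob_space.finite_measure[OF \<mu>(1)]] by simp
    show "emeasure \<mu> X = emeasure \<nu> X" if "X \<in> ?E" for X using that box by auto
  qed
qed

lemma brown_measure_eqI:
  assumes "is_brown_measure \<tau> T \<mu>"
  shows "brown_measure \<tau> T = \<mu>"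
  unfolding brown_measure_def
proof (rule the_equality)
  fix \<nu> assume \<nu>: "is_brown_measure \<tau> T \<nu>"
  show "\<nu> = \<mu>"
    by (rule measure_eq_if_test_functions_eq) (use \<nu> assms in \<open>auto simp: is_brown_measure_def\<close>)
qed fact

section \<open>Lebesgue measure on the complex plane\<close>

text \<open>This gives access to Fubini's theorem in the real and imaginary part.\<close>

lemma lborel_complex: "(lborel :: complex measure) = distr (lborel \<Otimes>\<^sub>M lborel) borel (\<lambda>(x, y). Complex x y)"
proof (rule lborel_eqI)
  have [measurable]: "(\<lambda>(x, y). Complex x y) \<in> borel_measurable (lborel \<Otimes>\<^sub>M lborel)"
    unfolding split_beta' by (rule borel_measurable_complex_iff[THEN iffD2]) simp
  fix l u :: complex assume le: "\<And>b. b \<in> Basis \<Longrightarrow> l \<bullet> b \<le> u \<bullet> b"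
  have le': "Re l \<le> Re u" "Im l \<le> Im u"
    using le[of 1] le[of \<i>] by (auto simp: Basis_complex_def inner_complex_def)
  have "(\<lambda>(x, y). Complex x y) -` box l u \<inter> space (lborel \<Otimes>\<^sub>M lborel) = {Re l<..<Re u} \<times> {Im l<..<Im u}"
    by (auto simp: box_complex space_pair_measure)
  then have "emeasure (distr (lborel \<Otimes>\<^sub>M lborel) borel (\<lambda>(x, y). Complex x y)) (box l u)
      = emeasure (lborel \<Otimes>\<^sub>M lborel) ({Re l<..<Re u} \<times> {Im l<..<Im u})"
    by (subst emeasure_distr) auto
  also have "\<dots> = ennreal (Re u - Re l) * ennreal (Im u - Im l)"
    using le' by (subst lborel.emeasure_pair_measure_Times) auto
  also have "\<dots> = ennreal (\<Prod>b\<in>Basis. (u - l) \<bullet> b)"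
    using le' by (simp add: Basis_complex_def inner_complex_def ennreal_mult)
  finally show "emeasure (distr (lborel \<Otimes>\<^sub>M lborel) borel (\<lambda>(x, y). Complex x y)) (box l u) = (\<Prod>b\<in>Basis. (u - l) \<bullet> b)" .
qed simp

lemma measurable_Complex [measurable]:
  "f \<in> borel_measurable M \<Longrightarrow> g \<in> borel_measurable M \<Longrightarrow> (\<lambda>x. Complex (f x) (g x)) \<in> borel_measurable M"
  by (rule borel_measurable_complex_iff[THEN iffD2]) simp

lemma nn_integral_complex:
  assumes [measurable]: "f \<in> borel_measurable borel"
  shows "(\<integral>\<^sup>+z. f z \<partial>lborel) = (\<integral>\<^sup>+y. \<integral>\<^sup>+x. f (Complex x y) \<partial>lborel \<partial>lborel)"
    and "(\<integral>\<^sup>+z. f z \<partial>lborel) = (\<integral>\<^sup>+x. \<integral>\<^sup>+y. f (Complex x y) \<partial>lborel \<partial>lborel)"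
proof -
  have 1: "(\<integral>\<^sup>+z. f z \<partial>lborel) = (\<integral>\<^sup>+p. f (Complex (fst p) (snd p)) \<partial>(lborel \<Otimes>\<^sub>M lborel))"
    by (subst lborel_complex, subst nn_integral_distr) (simp_all add: split_beta')
  show "(\<integral>\<^sup>+z. f z \<partial>lborel) = (\<integral>\<^sup>+y. \<integral>\<^sup>+x. f (Complex x y) \<partial>lborel \<partial>lborel)"
    unfolding 1 by (subst lborel_pair.nn_integral_snd[symmetric]) simp_all
  show "(\<integral>\<^sup>+z. f z \<partial>lborel) = (\<integral>\<^sup>+x. \<integral>\<^sup>+y. f (Complex x y) \<partial>lborel \<partial>lborel)"
    unfolding 1 by (subst lborel.nn_integral_fst[symmetric]) simp_all
qed

lemma lborel_complex_eqI:
  assumes "g \<in> borel_measurable borel"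
    and "\<And>f :: complex \<Rightarrow> ennreal. f \<in> borel_measurable borel \<Longrightarrow> (\<integral>\<^sup>+z. f (g z) \<partial>lborel) = (\<integral>\<^sup>+z. f z \<partial>lborel)"
  shows "distr lborel borel g = (lborel :: complex measure)"
proof (rule measure_eqI)
  fix A assume "A \<in> sets (distr lborel borel g)"
  then have A: "A \<in> sets borel" by simp
  have "emeasure (distr lborel borel g) A = (\<integral>\<^sup>+z. indicator A z \<partial>distr lborel borel g)"
    using A by simp
  also have "\<dots> = (\<integral>\<^sup>+z. indicator A (g z) \<partial>lborel)"
    using A assms(1) by (intro nn_integral_distr) auto
  also have "\<dots> = emeasure lborel A" using A by (subst assms(2)) auto
  finally show "emeasure (distr lborel borel g) A = emeasure lborel A" .
qed simp

text \<open>A rotation is a product of three shears, and these preserve the measure by Fubini's theorem.\<close>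

lemma lborel_shear:
  fixes f :: "complex \<Rightarrow> ennreal"
  assumes [measurable]: "f \<in> borel_measurable borel"
  shows "(\<integral>\<^sup>+z. f (Complex (Re z + t * Im z) (Im z)) \<partial>lborel) = (\<integral>\<^sup>+z. f z \<partial>lborel)"
    and "(\<integral>\<^sup>+z. f (Complex (Re z) (Im z + t * Re z)) \<partial>lborel) = (\<integral>\<^sup>+z. f z \<partial>lborel)"
proof -
  have tr: "(\<integral>\<^sup>+x. g (x + c) \<partial>lborel) = (\<integral>\<^sup>+x. g x \<partial>lborel)" if [measurable]: "g \<in> borel_measurable borel"
    for g :: "real \<Rightarrow> ennreal" and c
    using nn_integral_real_affine[of g 1 c] by (simp add: add.commute)
  have "(\<integral>\<^sup>+z. f (Complex (Re z + t * Im z) (Im z)) \<partial>lborel) = (\<integral>\<^sup>+y. \<integral>\<^sup>+x. f (Complex (x + t * y) y) \<partial>lborel \<partial>lborel)"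
    by (subst nn_integral_complex(1)) simp_all
  also have "\<dots> = (\<integral>\<^sup>+y. \<integral>\<^sup>+x. f (Complex x y) \<partial>lborel \<partial>lborel)"
    by (subst tr) simp_all
  also have "\<dots> = (\<integral>\<^sup>+z. f z \<partial>lborel)" by (subst nn_integral_complex(1)) simp_all
  finally show "(\<integral>\<^sup>+z. f (Complex (Re z + t * Im z) (Im z)) \<partial>lborel) = (\<integral>\<^sup>+z. f z \<partial>lborel)" .
  have "(\<integral>\<^sup>+z. f (Complex (Re z) (Im z + t * Re z)) \<partial>lborel) = (\<integral>\<^sup>+x. \<integral>\<^sup>+y. f (Complex x (y + t * x)) \<partial>lborel \<partial>lborel)"
    by (subst nn_integral_complex(2)) simp_all
  also have "\<dots> = (\<integral>\<^sup>+x. \<integral>\<^sup>+y. f (Complex x y) \<partial>lborel \<partial>lborel)"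
    by (subst tr) simp_all
  also have "\<dots> = (\<integral>\<^sup>+z. f z \<partial>lborel)" by (subst nn_integral_complex(2)) simp_all
  finally show "(\<integral>\<^sup>+z. f (Complex (Re z) (Im z + t * Re z)) \<partial>lborel) = (\<integral>\<^sup>+z. f z \<partial>lborel)" .
qed

lemma lborel_rotation:
  assumes w: "cmod w = 1"
  shows "distr lborel borel (\<lambda>z. w * z) = (lborel :: complex measure)"
proof (rule lborel_complex_eqI)
  have main: "(\<integral>\<^sup>+z. f (w * z) \<partial>lborel) = (\<integral>\<^sup>+z. f z \<partial>lborel)"
    if [measurable]: "f \<in> borel_measurable borel" and w: "cmod w = 1" "Im w \<noteq> 0" for f :: "complex \<Rightarrow> ennreal" and w
  proof -
    \<comment> \<open>For \<open>w = exp (\<i> * \<alpha>)\<close> this is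
      \<open>- tan (\<alpha> / 2)\<close>: a horizontal shear by \<open>t\<close>, a vertical one by
      \<open>Im w = sin \<alpha>\<close> and the first one again compose to the rotation.\<close>
    define t where "t = (Re w - 1) / Im w"
    have cs: "(Re w)\<^sup>2 + (Im w)\<^sup>2 = 1" using w(1) by (simp add: cmod_def)
    define g where "g z = f (Complex (Re z + t * Im z) (Im z))" for z
    have [measurable]: "g \<in> borel_measurable borel" unfolding g_def by measurable
    define h where "h z = g (Complex (Re z) (Im z + Im w * Re z))" for z
    have [measurable]: "h \<in> borel_measurable borel" unfolding h_def by measurable
    have "f (w * z) = h (Complex (Re z + t * Im z) (Im z))" for z
    proof -
      have st: "Im w * t = Re w - 1" using w(2) by (simp add: t_def)
      have sq: "(Re w - 1) * (Re w + 1) = - (Im w * Im w)" using cs by (simp add: power2_eq_square algebra_simps)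
      have "t * (Re w + 1) = - Im w" using w(2) sq by (simp add: t_def field_simps)
      then have t2: "t * Re w = - Im w - t" by (simp add: algebra_simps)
      have "Im z + Im w * (Re z + t * Im z) = Im w * Re z + Im z * (1 + Im w * t)" by (simp add: algebra_simps)
      also have "\<dots> = Im w * Re z + Re w * Im z" by (simp add: st)
      finally have y: "Im z + Im w * (Re z + t * Im z) = Im w * Re z + Re w * Im z" .
      have "Re z + t * Im z + t * (Im w * Re z + Re w * Im z) = Re z * (1 + Im w * t) + Im z * (t + t * Re w)"
        by (simp add: algebra_simps)
      also have "\<dots> = Re w * Re z - Im w * Im z" by (simp add: st t2)
      finally have x: "Re z + t * Im z + t * (Im w * Re z + Re w * Im z) = Re w * Re z - Im w * Im z" .
      have "w * z = Complex (Re w * Re z - Im w * Im z) (Im w * Re z + Re w * Im z)" by (simp add: complex_eq_iff)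
      then show ?thesis by (simp only: h_def g_def complex.sel y x)
    qed
    then have "(\<integral>\<^sup>+z. f (w * z) \<partial>lborel) = (\<integral>\<^sup>+z. h (Complex (Re z + t * Im z) (Im z)) \<partial>lborel)" by simp
    also have "\<dots> = (\<integral>\<^sup>+z. h z \<partial>lborel)" by (rule lborel_shear) simp
    also have "\<dots> = (\<integral>\<^sup>+z. g z \<partial>lborel)" unfolding h_def by (rule lborel_shear) simp
    also have "\<dots> = (\<integral>\<^sup>+z. f z \<partial>lborel)" unfolding g_def by (rule lborel_shear) simp
    finally show ?thesis .
  qed
  fix f :: "complex \<Rightarrow> ennreal" assume f [measurable]: "f \<in> borel_measurable borel"
  show "(\<integral>\<^sup>+z. f (w * z) \<partial>lborel) = (\<integral>\<^sup>+z. f z \<partial>lborel)"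
  proof (cases "Im w = 0")
    case False
    then show ?thesis using main[OF f w] by simp
  next
    case True
    have "w * z = (\<i> * w) * (- \<i> * z)" for z by (simp add: complex_eq_iff)
    then have "(\<integral>\<^sup>+z. f (w * z) \<partial>lborel) = (\<integral>\<^sup>+z. f ((\<i> * w) * (- \<i> * z)) \<partial>lborel)" by presburger
    also have "\<dots> = (\<integral>\<^sup>+z. f ((\<i> * w) * z) \<partial>lborel)"
      by (rule main[of "\<lambda>z. f ((\<i> * w) * z)"]) simp_all
    also have "\<dots> = (\<integral>\<^sup>+z. f z \<partial>lborel)"
    proof (rule main[OF f])
      have "\<bar>Re w\<bar> = 1" using w True by (simp add: cmod_def)
      then show "Im (\<i> * w) \<noteq> 0" by auto
    qed (use w in \<open>simp add: norm_mult\<close>)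
    finally show ?thesis .
  qed
qed simp

text \<open>Coordinates \<open>z = y (s + \<i>)\<close> in place of polar ones.\<close>

lemma lborel_line_coordinates:
  "(lborel :: complex measure) =
     distr (density (lborel \<Otimes>\<^sub>M lborel) (\<lambda>(s, y). ennreal \<bar>y\<bar>)) borel (\<lambda>(s, y). Complex (y * s) y)"
proof (rule measure_eqI)
  fix A assume "A \<in> sets (lborel :: complex measure)"
  then have A [measurable]: "A \<in> sets borel" by simp
  have "emeasure lborel A = (\<integral>\<^sup>+z. indicator A z \<partial>lborel)" by simp
  also have "\<dots> = (\<integral>\<^sup>+y. \<integral>\<^sup>+x. indicator A (Complex x y) \<partial>lborel \<partial>lborel)"
    by (subst nn_integral_complex(1)) simp_all
  also have "\<dots> = (\<integral>\<^sup>+y. \<integral>\<^sup>+s. ennreal \<bar>y\<bar> * indicator A (Complex (y * s) y) \<partial>lborel \<partial>lborel)"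
  proof (rule nn_integral_cong_AE)
    have "AE y in lborel. y \<noteq> (0::real)" by (rule AE_lborel_singleton)
    then show "AE y in lborel. (\<integral>\<^sup>+x. indicator A (Complex x y) \<partial>lborel)
        = (\<integral>\<^sup>+s. ennreal \<bar>y\<bar> * indicator A (Complex (y * s) y) \<partial>lborel)"
    proof eventually_elim
      case (elim y)
      then show ?case
        by (subst nn_integral_real_affine[of _ y 0]) (simp_all add: nn_integral_cmult)
    qed
  qed
  also have "\<dots> = (\<integral>\<^sup>+p. ennreal \<bar>snd p\<bar> * indicator A (Complex (snd p * fst p) (snd p)) \<partial>(lborel \<Otimes>\<^sub>M lborel))"
    by (subst lborel_pair.nn_integral_snd[symmetric]) simp_all
  also have "\<dots> = emeasure (distr (density (lborel \<Otimes>\<^sub>M lborel) (\<lambda>(s, y). ennreal \<bar>y\<bar>)) borel (\<lambda>(s, y). Complex (y * s) y)) A"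
  proof -
    have m: "(\<lambda>p. Complex (snd p * fst p) (snd p)) \<in> borel_measurable (lborel \<Otimes>\<^sub>M lborel)" by measurable
    from measurable_sets[OF m A]
    have S: "(\<lambda>p. Complex (snd p * fst p) (snd p)) -` A \<in> sets (lborel \<Otimes>\<^sub>M lborel)"
      by (simp only: space_pair_measure space_lborel space_borel UNIV_Times_UNIV Int_UNIV_right)
    have "emeasure (density (lborel \<Otimes>\<^sub>M lborel) (\<lambda>p. ennreal \<bar>snd p\<bar>)) ((\<lambda>p. Complex (snd p * fst p) (snd p)) -` A)
        = (\<integral>\<^sup>+p. ennreal \<bar>snd p\<bar> * indicator A (Complex (snd p * fst p) (snd p)) \<partial>(lborel \<Otimes>\<^sub>M lborel))"
      by (subst emeasure_density[OF _ S]) (simp_all add: indicator_def)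
    then show ?thesis
      by (subst emeasure_distr) (simp_all add: split_beta' space_pair_measure)
  qed
  finally show "emeasure lborel A = emeasure (distr (density (lborel \<Otimes>\<^sub>M lborel) (\<lambda>(s, y). ennreal \<bar>y\<bar>)) borel (\<lambda>(s, y). Complex (y * s) y)) A" .
qed simp

lemma integral_line_coordinates:
  fixes g :: "complex \<Rightarrow> real"
  assumes g: "integrable lborel g"
  shows "(\<integral>z. g z \<partial>lborel) = (\<integral>s. (\<integral>y. \<bar>y\<bar> * g (Complex (y * s) y) \<partial>lborel) \<partial>lborel)"
proof -
  have [measurable]: "g \<in> borel_measurable borel" using borel_measurable_integrable[OF g] by simp
  have m: "(\<lambda>(s, y). Complex (y * s) y) \<in> borel_measurable (density (lborel \<Otimes>\<^sub>M lborel) (\<lambda>(s, y). ennreal \<bar>y\<bar>))"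
    unfolding split_beta' by measurable
  have i: "integrable (lborel \<Otimes>\<^sub>M lborel) (\<lambda>p. \<bar>snd p\<bar> * g (Complex (snd p * fst p) (snd p)))"
    using g unfolding lborel_line_coordinates
    by (subst (asm) integrable_distr_eq[OF m]) (simp_all add: split_beta' integrable_density)
  have "(\<integral>z. g z \<partial>lborel) = (\<integral>p. \<bar>snd p\<bar> * g (Complex (snd p * fst p) (snd p)) \<partial>(lborel \<Otimes>\<^sub>M lborel))"
    by (subst lborel_line_coordinates, subst integral_distr[OF m]) (simp_all add: split_beta' integral_density)
  also have "\<dots> = (\<integral>s. (\<integral>y. \<bar>y\<bar> * g (Complex (y * s) y) \<partial>lborel) \<partial>lborel)"
    using lborel_pair.integral_fst'[OF i] by simp
  finally show ?thesis .
qed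

lemma integral_slices:
  fixes g :: "complex \<Rightarrow> real"
  assumes g: "integrable lborel g"
  shows "(\<integral>z. g z \<partial>lborel) = (\<integral>x. (\<integral>y. g (Complex x y) \<partial>lborel) \<partial>lborel)"
    and "(\<integral>z. g z \<partial>lborel) = (\<integral>y. (\<integral>x. g (Complex x y) \<partial>lborel) \<partial>lborel)"
proof -
  have [measurable]: "g \<in> borel_measurable borel" using borel_measurable_integrable[OF g] by simp
  have m: "(\<lambda>(x, y). Complex x y) \<in> borel_measurable (lborel \<Otimes>\<^sub>M lborel)"
    unfolding split_beta' by measurable
  have i: "integrable (lborel \<Otimes>\<^sub>M lborel) (\<lambda>p. g (Complex (fst p) (snd p)))"
    using g unfolding lborel_complex by (subst (asm) integrable_distr_eq[OF m]) (simp_all add: split_beta')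
  have e: "(\<integral>z. g z \<partial>lborel) = (\<integral>p. g (Complex (fst p) (snd p)) \<partial>(lborel \<Otimes>\<^sub>M lborel))"
    by (subst lborel_complex, subst integral_distr[OF m]) (simp_all add: split_beta')
  show "(\<integral>z. g z \<partial>lborel) = (\<integral>x. (\<integral>y. g (Complex x y) \<partial>lborel) \<partial>lborel)"
    unfolding e using lborel_pair.integral_fst'[OF i] by simp
  show "(\<integral>z. g z \<partial>lborel) = (\<integral>y. (\<integral>x. g (Complex x y) \<partial>lborel) \<partial>lborel)"
    unfolding e using lborel_pair.integral_snd[of "\<lambda>x y. g (Complex x y)"] i by (simp add: split_beta')
qed

section \<open>The Haar measure on a circle\<close>

text \<open>The radial projection of the uniform distribution on the unit disc: its rotation
  invariance comes down to that of Lebesgue measure. The value \<open>sgn 0 = 0\<close> concerns a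
  null set only.\<close>

definition circle_measure :: "real \<Rightarrow> complex measure" where
  "circle_measure m = distr (uniform_measure lborel (ball 0 1)) borel (\<lambda>z. complex_of_real m * sgn z)"

lemma emeasure_unit_disc: "emeasure lborel (ball (0::complex) 1) = ennreal pi"
  using emeasure_ball[of 1 "0::complex"] by (simp add: unit_ball_vol_2)

lemma prob_space_circle_measure: "prob_space (circle_measure m)"
  unfolding circle_measure_def
  by (intro prob_space.prob_space_distr prob_space_uniform_measure) (simp_all add: emeasure_unit_disc)

lemma sets_circle_measure: "sets (circle_measure m) = sets borel"
  by (simp add: circle_measure_def)

lemma circle_measure_haar:
  assumes m: "0 < m"
  shows "haar_on_circle m (circle_measure m)"
  unfolding haar_on_circle_def
proof (intro conjI allI impI prob_space_circle_measure sets_circle_measure)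
  have meas: "(\<lambda>z. complex_of_real m * sgn z) \<in> borel_measurable (uniform_measure lborel (ball 0 1))"
    by (simp add: measurable_cong_sets[OF sets_uniform_measure refl])
  interpret prob_space "circle_measure m" by (rule prob_space_circle_measure)
  have "AE z in lborel. z \<noteq> (0::complex)" by (rule AE_lborel_singleton)
  then have "AE z in uniform_measure lborel (ball 0 1). complex_of_real m * sgn z \<in> sphere 0 m"
    by (intro AE_uniform_measureI) (use m in \<open>auto simp: norm_mult norm_sgn elim!: eventually_mono\<close>)
  then have "AE z in circle_measure m. z \<in> sphere 0 m"
    unfolding circle_measure_def by (subst AE_distr_iff[OF meas]) auto
  then show "emeasure (circle_measure m) (sphere 0 m) = 1"
    by (intro emeasure_eq_1_AE) (simp_all add: sets_circle_measure)
  fix w :: complex assume w: "cmod w = 1"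
  have uni: "distr (uniform_measure lborel (ball 0 1)) borel (\<lambda>z. w * z) = uniform_measure lborel (ball 0 1)"
  proof (rule measure_eqI)
    fix A :: "complex set" assume "A \<in> sets (distr (uniform_measure lborel (ball 0 1)) borel (\<lambda>z. w * z))"
    then have A [measurable]: "A \<in> sets borel" by simp
    have mw: "(\<lambda>z. w * z) \<in> borel_measurable lborel" by simp
    have "emeasure (distr (uniform_measure lborel (ball 0 1)) borel (\<lambda>z. w * z)) A
        = emeasure (uniform_measure lborel (ball 0 1)) ((\<lambda>z. w * z) -` A)"
      by (subst emeasure_distr) (simp_all add: measurable_cong_sets[OF sets_uniform_measure refl])
    also have "\<dots> = emeasure lborel (ball 0 1 \<inter> (\<lambda>z. w * z) -` A) / ennreal pi"
      using measurable_sets[OF mw, of A] by (simp add: emeasure_unit_disc)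
    also have "ball 0 1 \<inter> (\<lambda>z. w * z) -` A = (\<lambda>z. w * z) -` (ball 0 1 \<inter> A)"
      using w by (auto simp: norm_mult)
    also have "emeasure lborel ((\<lambda>z. w * z) -` (ball 0 1 \<inter> A)) = emeasure (distr lborel borel (\<lambda>z. w * z)) (ball 0 1 \<inter> A)"
      by (subst emeasure_distr) simp_all
    also have "\<dots> / ennreal pi = emeasure (uniform_measure lborel (ball 0 1)) A"
      by (simp add: lborel_rotation[OF w] emeasure_unit_disc)
    finally show "emeasure (distr (uniform_measure lborel (ball 0 1)) borel (\<lambda>z. w * z)) A
        = emeasure (uniform_measure lborel (ball 0 1)) A" .
  qed simp
  have "distr (circle_measure m) borel (\<lambda>z. w * z)
      = distr (uniform_measure lborel (ball 0 1)) borel (\<lambda>z. complex_of_real m * sgn (w * z))"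
    unfolding circle_measure_def using w
    by (subst distr_distr[OF _ meas]) (simp_all add: o_def sgn_mult sgn_div_norm[of w] mult_ac)
  also have "\<dots> = distr (distr (uniform_measure lborel (ball 0 1)) borel (\<lambda>z. w * z)) borel (\<lambda>z. complex_of_real m * sgn z)"
    by (subst distr_distr) (simp_all add: o_def measurable_cong_sets[OF sets_uniform_measure refl])
  also have "\<dots> = circle_measure m" unfolding uni circle_measure_def ..
  finally show "distr (circle_measure m) borel (\<lambda>z. w * z) = circle_measure m" .
qed

section \<open>Green's formula for a truncated logarithm\<close>

lemma integrable_compact_support:
  fixes f :: "'a::euclidean_space \<Rightarrow> real"
  assumes [measurable]: "f \<in> borel_measurable borel"
    and B: "\<And>x. \<bar>f x\<bar> \<le> B" and L: "\<And>x. L < norm x \<Longrightarrow> f x = 0"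
  shows "integrable lborel f"
proof (rule Bochner_Integration.integrable_bound)
  show "integrable lborel (\<lambda>x. B * indicator (cball 0 L) x :: real)"
    by (intro integrable_mult_right integrable_real_indicator emeasure_bounded_finite) auto
  show "AE x in lborel. norm (f x) \<le> norm (B * indicator (cball 0 L) x :: real)"
  proof (rule AE_I2)
    fix x
    show "norm (f x) \<le> norm (B * indicator (cball 0 L) x :: real)"
      using B[of x] L[of x] by (cases "L < norm x") (auto simp: indicator_def)
  qed
qed simp

lemma integral_eqI_interval:
  fixes f :: "real \<Rightarrow> real"
  assumes f: "integrable lborel f" and i: "(f has_integral c) {a..b}" and z: "\<And>x. x \<notin> {a..b} \<Longrightarrow> f x = 0"
  shows "(\<integral>x. f x \<partial>lborel) = c"
proof -
  have "(f has_integral c) UNIV" by (rule has_integral_on_superset[OF i]) (use z in auto)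
  then show ?thesis using has_integral_integral_lborel[OF f] has_integral_unique by blast
qed

text \<open>At finitely many points \<open>F\<close> need only be continuous, which does not disturb
  the fundamental theorem of calculus; the boundary terms vanish with \<open>G\<close>.\<close>

lemma integral_by_parts_compact_support:
  fixes F G k g :: "real \<Rightarrow> real"
  assumes cF: "continuous_on UNIV F" and S: "finite S"
    and F: "\<And>x. x \<notin> S \<Longrightarrow> (F has_real_derivative k x) (at x)"
    and G: "\<And>x. (G has_real_derivative g x) (at x)"
    and L: "0 < L" "\<And>x. L \<le> \<bar>x\<bar> \<Longrightarrow> G x = 0" "\<And>x. L \<le> \<bar>x\<bar> \<Longrightarrow> g x = 0"
    and i: "integrable lborel (\<lambda>x. F x * g x)" "integrable lborel (\<lambda>x. k x * G x)"
  shows "(\<integral>x. F x * g x \<partial>lborel) = - (\<integral>x. k x * G x \<partial>lborel)"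
proof -
  have "((\<lambda>x. F x * g x + k x * G x) has_integral F L * G L - F (- L) * G (- L)) {- L..L}"
  proof (rule fundamental_theorem_of_calculus_interior_strong[OF S])
    have "continuous_on {- L..L} G" by (rule DERIV_continuous_on[OF DERIV_subset[OF G]]) simp
    then show "continuous_on {- L..L} (\<lambda>x. F x * G x)"
      by (intro continuous_on_mult continuous_on_subset[OF cF] subset_UNIV)
    fix x assume "x \<in> {- L<..<L} - S"
    then show "((\<lambda>x. F x * G x) has_vector_derivative F x * g x + k x * G x) (at x)"
      using DERIV_mult[OF F[of x] G[of x]]
      by (simp add: has_real_derivative_iff_has_vector_derivative algebra_simps)
  qed (use L in simp)
  then have "(\<integral>x. F x * g x + k x * G x \<partial>lborel) = F L * G L - F (- L) * G (- L)"
    by (intro integral_eqI_interval) (use L i in auto)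
  then show ?thesis using L i by simp
qed

lemma complex_has_derivative:
  fixes f :: "complex \<Rightarrow> real"
  assumes "f differentiable (at z)"
  shows "(f has_derivative (\<lambda>h. Re h * dir_deriv 1 f z + Im h * dir_deriv \<i> f z)) (at z)"
proof -
  have d: "(f has_derivative frechet_derivative f (at z)) (at z)"
    using assms frechet_derivative_works by blast
  interpret linear "frechet_derivative f (at z)"
    using d has_derivative_linear by blast
  have "frechet_derivative f (at z) h = Re h * dir_deriv 1 f z + Im h * dir_deriv \<i> f z" for h
  proof -
    have "h = Re h *\<^sub>R 1 + Im h *\<^sub>R \<i>" by (simp add: complex_eq_iff)
    then have "frechet_derivative f (at z) h = frechet_derivative f (at z) (Re h *\<^sub>R 1 + Im h *\<^sub>R \<i>)" by simp
    also have "\<dots> = Re h * dir_deriv 1 f z + Im h * dir_deriv \<i> f z"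
      unfolding add scale dir_deriv_def by simp
    finally show ?thesis .
  qed
  then have "frechet_derivative f (at z) = (\<lambda>h. Re h * dir_deriv 1 f z + Im h * dir_deriv \<i> f z)" by blast
  with d show ?thesis by simp
qed

lemma DERIV_along_line:
  fixes f :: "complex \<Rightarrow> real"
  assumes "\<And>z. f differentiable (at z)"
  shows "((\<lambda>t. f (Complex (a * t + b) (c * t + d))) has_real_derivative
    a * dir_deriv 1 f (Complex (a * t + b) (c * t + d)) + c * dir_deriv \<i> f (Complex (a * t + b) (c * t + d))) (at t)"
proof -
  have "(\<lambda>t. Complex (a * t + b) (c * t + d)) = (\<lambda>t. t *\<^sub>R Complex a c + Complex b d)"
    by (simp add: fun_eq_iff complex_eq_iff algebra_simps)
  then have "((\<lambda>t. Complex (a * t + b) (c * t + d)) has_derivative (\<lambda>h. h *\<^sub>R Complex a c)) (at t)"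
    by (auto intro!: derivative_eq_intros)
  from has_derivative_compose[OF this complex_has_derivative[OF assms]]
  moreover have "(\<lambda>h. Re (h *\<^sub>R Complex a c) * dir_deriv 1 f (Complex (a * t + b) (c * t + d)) +
      Im (h *\<^sub>R Complex a c) * dir_deriv \<i> f (Complex (a * t + b) (c * t + d)))
    = (*) (a * dir_deriv 1 f (Complex (a * t + b) (c * t + d)) + c * dir_deriv \<i> f (Complex (a * t + b) (c * t + d)))"
    by (simp add: fun_eq_iff algebra_simps)
  ultimately show ?thesis by (simp add: has_field_derivative_def)
qed

lemma dir_deriv_support:
  fixes f :: "complex \<Rightarrow> real"
  assumes "\<And>z. L < cmod z \<Longrightarrow> f z = 0" and "L < cmod z"
  shows "dir_deriv v f z = 0"
proof -
  have "open {z::complex. L < cmod z}" by (intro open_Collect_less continuous_intros)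
  then have "(f has_derivative (\<lambda>h. 0)) (at z)"
    by (rule has_derivative_transform_within_open[OF has_derivative_const[of 0]]) (use assms in auto)
  then show ?thesis by (simp add: dir_deriv_eq)
qed

lemma log_max_has_derivative:
  assumes m: "0 < m" and x: "x\<^sup>2 + y\<^sup>2 \<noteq> m\<^sup>2"
  shows "((\<lambda>x. ln (max m (sqrt (x\<^sup>2 + y\<^sup>2)))) has_real_derivative
    (if m\<^sup>2 < x\<^sup>2 + y\<^sup>2 then x / (x\<^sup>2 + y\<^sup>2) else 0)) (at x)"
proof (cases "m\<^sup>2 < x\<^sup>2 + y\<^sup>2")
  case True
  then have p: "0 < x\<^sup>2 + y\<^sup>2" using m by (smt (verit) zero_le_power2)
  have "((\<lambda>x. 1 / 2 * ln (x\<^sup>2 + y\<^sup>2)) has_real_derivative 1 / 2 * (1 / (x\<^sup>2 + y\<^sup>2) * (2 * x))) (at x)"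
    using p by (intro DERIV_cmult DERIV_chain2[OF DERIV_ln_divide]) (auto intro!: derivative_eq_intros)
  then have "((\<lambda>x. ln (x\<^sup>2 + y\<^sup>2) / 2) has_real_derivative x / (x\<^sup>2 + y\<^sup>2)) (at x)" by simp
  moreover have "open {x. m\<^sup>2 < x\<^sup>2 + y\<^sup>2}" by (intro open_Collect_less continuous_intros)
  ultimately have "((\<lambda>x. ln (max m (sqrt (x\<^sup>2 + y\<^sup>2)))) has_real_derivative x / (x\<^sup>2 + y\<^sup>2)) (at x)"
  proof (rule has_field_derivative_transform_within_open)
    fix t assume t: "t \<in> {x. m\<^sup>2 < x\<^sup>2 + y\<^sup>2}"
    then have "0 < t\<^sup>2 + y\<^sup>2" using m by (smt (verit) mem_Collect_eq zero_le_power2)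
    moreover have "m \<le> sqrt (t\<^sup>2 + y\<^sup>2)" using t m by (intro real_le_rsqrt) simp
    ultimately show "ln (t\<^sup>2 + y\<^sup>2) / 2 = ln (max m (sqrt (t\<^sup>2 + y\<^sup>2)))" by (simp add: ln_sqrt max_absorb2)
  qed (use True in simp)
  with True show ?thesis by simp
next
  case False
  have "((\<lambda>x. ln m) has_real_derivative 0) (at x)" by simp
  moreover have "open {x. x\<^sup>2 + y\<^sup>2 < m\<^sup>2}" by (intro open_Collect_less continuous_intros)
  ultimately have "((\<lambda>x. ln (max m (sqrt (x\<^sup>2 + y\<^sup>2)))) has_real_derivative 0) (at x)"
  proof (rule has_field_derivative_transform_within_open)
    fix t assume t: "t \<in> {x. x\<^sup>2 + y\<^sup>2 < m\<^sup>2}"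
    then have "sqrt (t\<^sup>2 + y\<^sup>2) \<le> m" using m by (intro real_le_lsqrt) auto
    then show "ln m = ln (max m (sqrt (t\<^sup>2 + y\<^sup>2)))" by (simp add: max_absorb1)
  qed (use False x in simp)
  with False show ?thesis by simp
qed

text \<open>A line parallel to an axis meets the circle on which \<open>ln (max m (cmod z))\<close>
  has its kink in at most two points; they form the exceptional set for the integration by
  parts.\<close>

lemma finite_circle_slice: "finite {x::real. x\<^sup>2 + c = d}"
proof (rule finite_subset)
  show "{x. x\<^sup>2 + c = d} \<subseteq> {sqrt (d - c), - sqrt (d - c)}" by (auto simp: real_sqrt_abs abs_if)
qed simp

lemma log_max_derivative_bound:
  fixes m x y :: real
  assumes m: "0 < m"
  shows "\<bar>if m\<^sup>2 < x\<^sup>2 + y\<^sup>2 then x / (x\<^sup>2 + y\<^sup>2) else 0\<bar> \<le> 1 / m"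
proof (cases "m\<^sup>2 < x\<^sup>2 + y\<^sup>2")
  case True
  have "m \<le> sqrt (x\<^sup>2 + y\<^sup>2)" using True m by (intro real_le_rsqrt) simp
  then have "\<bar>x\<bar> * m \<le> sqrt (x\<^sup>2 + y\<^sup>2) * sqrt (x\<^sup>2 + y\<^sup>2)"
    using m by (intro mult_mono) (auto intro!: real_le_rsqrt)
  then have "\<bar>x\<bar> * m \<le> x\<^sup>2 + y\<^sup>2" by simp
  moreover have "0 < x\<^sup>2 + y\<^sup>2" using True m by (smt (verit) zero_le_power2)
  ultimately show ?thesis using m True by (simp add: divide_simps)
qed (use m in simp)

lemma compact_support_bounded:
  fixes h :: "'a::euclidean_space \<Rightarrow> real"
  assumes h: "continuous_on UNIV h" "\<And>x. L \<le> norm x \<Longrightarrow> h x = 0"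
  obtains B where "\<And>x. \<bar>h x\<bar> \<le> B"
proof -
  have "bounded (h ` cball 0 L)"
    by (intro compact_imp_bounded compact_continuous_image continuous_on_subset[OF h(1)]) auto
  then obtain B where B: "\<And>x. x \<in> cball 0 L \<Longrightarrow> \<bar>h x\<bar> \<le> B" unfolding bounded_iff real_norm_def by blast
  have "\<bar>h x\<bar> \<le> max 0 B" for x using B[of x] h(2)[of x] by (cases "L \<le> norm x") auto
  then show ?thesis by (rule that)
qed

lemma log_max_times_derivative_integral:
  fixes G g :: "real \<Rightarrow> real"
  assumes m: "0 < m"
    and G: "\<And>x. (G has_real_derivative g x) (at x)" and g: "continuous_on UNIV g"
    and L: "0 < L" "\<And>x. L \<le> \<bar>x\<bar> \<Longrightarrow> G x = 0" "\<And>x. L \<le> \<bar>x\<bar> \<Longrightarrow> g x = 0"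
  shows "(\<integral>x. ln (max m (sqrt (x\<^sup>2 + y\<^sup>2))) * g x \<partial>lborel)
    = - (\<integral>x. (if m\<^sup>2 < x\<^sup>2 + y\<^sup>2 then x / (x\<^sup>2 + y\<^sup>2) else 0) * G x \<partial>lborel)"
proof (rule integral_by_parts_compact_support[OF _ finite_circle_slice[of "y\<^sup>2" "m\<^sup>2"] _ G L])
  have cF: "continuous_on UNIV (\<lambda>x. ln (max m (sqrt (x\<^sup>2 + y\<^sup>2))))"
    using m by (intro continuous_intros) (auto simp: max_def)
  then show "continuous_on UNIV (\<lambda>x. ln (max m (sqrt (x\<^sup>2 + y\<^sup>2))))" .
  have cG: "continuous_on UNIV G" using G by (intro DERIV_continuous_on) (auto intro: DERIV_subset)
  show "((\<lambda>x. ln (max m (sqrt (x\<^sup>2 + y\<^sup>2)))) has_real_derivative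
      (if m\<^sup>2 < x\<^sup>2 + y\<^sup>2 then x / (x\<^sup>2 + y\<^sup>2) else 0)) (at x)" if "x \<notin> {x. x\<^sup>2 + y\<^sup>2 = m\<^sup>2}" for x
    using log_max_has_derivative[OF m] that by blast
  have c1: "continuous_on UNIV (\<lambda>x. ln (max m (sqrt (x\<^sup>2 + y\<^sup>2))) * g x)" by (intro continuous_on_mult cF g)
  obtain B where "\<And>x. \<bar>ln (max m (sqrt (x\<^sup>2 + y\<^sup>2))) * g x\<bar> \<le> B"
    using compact_support_bounded[OF c1, of L] L by auto
  then show "integrable lborel (\<lambda>x. ln (max m (sqrt (x\<^sup>2 + y\<^sup>2))) * g x)"
    by (rule integrable_compact_support[where L=L, rotated]) (use c1 L in \<open>auto intro: borel_measurable_continuous_onI\<close>)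
  have [measurable]: "G \<in> borel_measurable borel" using cG by (rule borel_measurable_continuous_onI)
  obtain B where B: "\<And>x. \<bar>G x\<bar> \<le> B" using compact_support_bounded[OF cG, of L] L by auto
  have "\<bar>(if m\<^sup>2 < x\<^sup>2 + y\<^sup>2 then x / (x\<^sup>2 + y\<^sup>2) else 0) * G x\<bar> \<le> 1 / m * B" for x
    unfolding abs_mult using m by (intro mult_mono log_max_derivative_bound B) auto
  then show "integrable lborel (\<lambda>x. (if m\<^sup>2 < x\<^sup>2 + y\<^sup>2 then x / (x\<^sup>2 + y\<^sup>2) else 0) * G x)"
    by (rule integrable_compact_support[where L=L, rotated]) (use L in auto)
qed

text \<open>On a line through \<open>0\<close> the integrand is the outward derivative outside a
  circle that the line meets at \<open>\<rho>\<close> and \<open>- \<rho>\<close>. The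
  antiderivative \<open>\<psi> (max y \<rho>) - \<psi> (min y (- \<rho>))\<close> is constant
  between these two points.\<close>

lemma integral_signed_derivative:
  fixes \<psi> d :: "real \<Rightarrow> real"
  assumes \<psi>: "\<And>y. (\<psi> has_real_derivative d y) (at y)" and d: "continuous_on UNIV d"
    and \<rho>: "0 < \<rho>" and L: "\<And>y. L \<le> \<bar>y\<bar> \<Longrightarrow> \<psi> y = 0" "\<And>y. L \<le> \<bar>y\<bar> \<Longrightarrow> d y = 0"
  shows "(\<integral>y. (if \<rho> < y then d y else if y < - \<rho> then - d y else 0) \<partial>lborel) = - (\<psi> \<rho> + \<psi> (- \<rho>))"
proof (rule integral_eqI_interval)
  define M where "M = max L (\<rho> + 1)"
  have M: "\<rho> < M" "L \<le> M" by (auto simp: M_def)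
  have [measurable]: "d \<in> borel_measurable borel" using d by (rule borel_measurable_continuous_onI)
  obtain B where B: "\<And>y. \<bar>d y\<bar> \<le> B" using compact_support_bounded[OF d, of L] L by auto
  have "0 \<le> B" using B[of 0] by linarith
  then have "\<bar>if \<rho> < y then d y else if y < - \<rho> then - d y else 0\<bar> \<le> B" for y using B[of y] by auto
  then show "integrable lborel (\<lambda>y. if \<rho> < y then d y else if y < - \<rho> then - d y else 0)"
    by (rule integrable_compact_support[where L=L, rotated]) (use L in auto)
  have c: "continuous_on UNIV \<psi>" using \<psi> by (intro continuous_at_imp_continuous_on) (auto intro: DERIV_isCont)
  have "((\<lambda>y. if \<rho> < y then d y else if y < - \<rho> then - d y else 0) has_integral
      (\<psi> (max M \<rho>) - \<psi> (min M (- \<rho>))) - (\<psi> (max (- M) \<rho>) - \<psi> (min (- M) (- \<rho>)))) {- M..M}"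
  proof (rule fundamental_theorem_of_calculus_interior_strong[of "{\<rho>, - \<rho>}"])
    show "continuous_on {- M..M} (\<lambda>y. \<psi> (max y \<rho>) - \<psi> (min y (- \<rho>)))"
      by (intro continuous_intros continuous_on_compose2[OF c]) auto
    fix y assume y: "y \<in> {- M<..<M} - {\<rho>, - \<rho>}"
    consider "y < - \<rho>" | "- \<rho> < y" "y < \<rho>" | "\<rho> < y" using y by force
    then have "((\<lambda>y. \<psi> (max y \<rho>) - \<psi> (min y (- \<rho>))) has_real_derivative
        (if \<rho> < y then d y else if y < - \<rho> then - d y else 0)) (at y)"
    proof cases
      case 1
      have "((\<lambda>y. \<psi> \<rho> - \<psi> y) has_real_derivative 0 - d y) (at y)" by (intro DERIV_diff DERIV_const \<psi>)
      then have "((\<lambda>y. \<psi> (max y \<rho>) - \<psi> (min y (- \<rho>))) has_real_derivative 0 - d y) (at y)"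
        by (rule has_field_derivative_transform_within_open[where S="{..<- \<rho>}"]) (use 1 \<rho> in \<open>auto simp: max_def min_def\<close>)
      then show ?thesis using 1 \<rho> by simp
    next
      case 2
      have "((\<lambda>y. \<psi> \<rho> - \<psi> (- \<rho>)) has_real_derivative 0) (at y)" by simp
      then have "((\<lambda>y. \<psi> (max y \<rho>) - \<psi> (min y (- \<rho>))) has_real_derivative 0) (at y)"
        by (rule has_field_derivative_transform_within_open[where S="{- \<rho><..<\<rho>}"]) (use 2 \<rho> in \<open>auto simp: max_def min_def\<close>)
      then show ?thesis using 2 by simp
    next
      case 3
      have "((\<lambda>y. \<psi> y - \<psi> (- \<rho>)) has_real_derivative d y - 0) (at y)" by (intro DERIV_diff DERIV_const \<psi>)
      then have "((\<lambda>y. \<psi> (max y \<rho>) - \<psi> (min y (- \<rho>))) has_real_derivative d y - 0) (at y)"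
        by (rule has_field_derivative_transform_within_open[where S="{\<rho><..}"]) (use 3 \<rho> in \<open>auto simp: max_def min_def\<close>)
      then show ?thesis using 3 by simp
    qed
    then show "((\<lambda>y. \<psi> (max y \<rho>) - \<psi> (min y (- \<rho>))) has_vector_derivative
        (if \<rho> < y then d y else if y < - \<rho> then - d y else 0)) (at y)"
      by (simp only: has_real_derivative_iff_has_vector_derivative)
  qed (use M \<rho> in auto)
  moreover have "(\<psi> (max M \<rho>) - \<psi> (min M (- \<rho>))) - (\<psi> (max (- M) \<rho>) - \<psi> (min (- M) (- \<rho>))) = - (\<psi> \<rho> + \<psi> (- \<rho>))"
    using M \<rho> L(1)[of M] L(1)[of "- M"] by (auto simp: max_def min_def)
  ultimately show "((\<lambda>y. if \<rho> < y then d y else if y < - \<rho> then - d y else 0) has_integral - (\<psi> \<rho> + \<psi> (- \<rho>))) {- M..M}"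
    by (simp only:)
  show "(if \<rho> < y then d y else if y < - \<rho> then - d y else 0) = 0" if "y \<notin> {- M..M}" for y
    using that M L(2)[of y] by auto
qed

text \<open>On a line through \<open>0\<close> a function of the direction takes one value on each
  of the two rays; \<open>\<bar>y\<bar>\<close> is the Jacobian of the line coordinates, and
  \<open>b\<close> marks where the line leaves the unit disc.\<close>

lemma integral_two_sided_linear:
  fixes A B b :: real
  assumes b: "0 < b"
  shows "(\<integral>y. (if \<bar>y\<bar> < b then \<bar>y\<bar> * (if 0 < y then A else B) else 0) \<partial>lborel) = b\<^sup>2 / 2 * (A + B)"
proof (rule integral_eqI_interval)
  have "\<bar>if \<bar>y\<bar> < b then \<bar>y\<bar> * (if 0 < y then A else B) else 0\<bar> \<le> b * (\<bar>A\<bar> + \<bar>B\<bar>)" for y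
  proof (cases "\<bar>y\<bar> < b")
    case True
    then have "\<bar>y\<bar> * \<bar>if 0 < y then A else B\<bar> \<le> b * (\<bar>A\<bar> + \<bar>B\<bar>)" by (intro mult_mono) auto
    then show ?thesis using True by (simp only: if_True abs_mult abs_abs)
  qed (use b in simp)
  then show "integrable lborel (\<lambda>y. if \<bar>y\<bar> < b then \<bar>y\<bar> * (if 0 < y then A else B) else 0)"
    by (rule integrable_compact_support[where L=b, rotated]) auto
  have "((\<lambda>y. if \<bar>y\<bar> < b then \<bar>y\<bar> * (if 0 < y then A else B) else 0) has_integral
      (A * (max b 0)\<^sup>2 / 2 - B * (min b 0)\<^sup>2 / 2) - (A * (max (- b) 0)\<^sup>2 / 2 - B * (min (- b) 0)\<^sup>2 / 2)) {- b..b}"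
  proof (rule fundamental_theorem_of_calculus_interior_strong[of "{0}"])
    show "continuous_on {- b..b} (\<lambda>y. A * (max y 0)\<^sup>2 / 2 - B * (min y 0)\<^sup>2 / 2)"
      by (intro continuous_intros) auto
    fix y assume y: "y \<in> {- b<..<b} - {0}"
    consider "y < 0" | "0 < y" using y by force
    then have "((\<lambda>y. A * (max y 0)\<^sup>2 / 2 - B * (min y 0)\<^sup>2 / 2) has_real_derivative \<bar>y\<bar> * (if 0 < y then A else B)) (at y)"
    proof cases
      case 1
      have "((\<lambda>y. - B * y\<^sup>2 / 2) has_real_derivative - y * B) (at y)"
        by (auto intro!: derivative_eq_intros)
      then have "((\<lambda>y. A * (max y 0)\<^sup>2 / 2 - B * (min y 0)\<^sup>2 / 2) has_real_derivative - y * B) (at y)"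
        by (rule has_field_derivative_transform_within_open[where S="{..<0}"]) (use 1 in \<open>auto simp: max_def min_def\<close>)
      then show ?thesis using 1 by simp
    next
      case 2
      have "((\<lambda>y. A * y\<^sup>2 / 2) has_real_derivative y * A) (at y)"
        by (auto intro!: derivative_eq_intros)
      then have "((\<lambda>y. A * (max y 0)\<^sup>2 / 2 - B * (min y 0)\<^sup>2 / 2) has_real_derivative y * A) (at y)"
        by (rule has_field_derivative_transform_within_open[where S="{0<..}"]) (use 2 in \<open>auto simp: max_def min_def\<close>)
      then show ?thesis using 2 by simp
    qed
    then show "((\<lambda>y. A * (max y 0)\<^sup>2 / 2 - B * (min y 0)\<^sup>2 / 2) has_vector_derivative
        (if \<bar>y\<bar> < b then \<bar>y\<bar> * (if 0 < y then A else B) else 0)) (at y)"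
      using y by (simp add: has_real_derivative_iff_has_vector_derivative abs_less_iff)
  qed (use b in auto)
  then show "((\<lambda>y. if \<bar>y\<bar> < b then \<bar>y\<bar> * (if 0 < y then A else B) else 0) has_integral b\<^sup>2 / 2 * (A + B)) {- b..b}"
    using b by (simp add: algebra_simps add_divide_distrib)
qed auto

lemma test_function_support:
  fixes \<phi> :: "complex \<Rightarrow> real"
  assumes "test_function \<phi>"
  obtains L where "0 < L" "\<And>z. L \<le> cmod z \<Longrightarrow> \<phi> z = 0" "\<And>z v. L \<le> cmod z \<Longrightarrow> dir_deriv v \<phi> z = 0"
    "\<And>z v w. L \<le> cmod z \<Longrightarrow> dir_deriv w (dir_deriv v \<phi>) z = 0"
proof -
  have "bounded (closure {z. \<phi> z \<noteq> 0})" using assms compact_imp_bounded unfolding test_function_def by blast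
  then have "bounded {z. \<phi> z \<noteq> 0}" using bounded_subset closure_subset by blast
  then obtain L where L: "\<And>z. \<phi> z \<noteq> 0 \<Longrightarrow> cmod z \<le> L" unfolding bounded_iff by blast
  have 0: "\<phi> z = 0" if "L < cmod z" for z using L[of z] that by force
  have 1: "dir_deriv v \<phi> z = 0" if "L < cmod z" for z v by (rule dir_deriv_support[OF 0 that])
  have 2: "dir_deriv w (dir_deriv v \<phi>) z = 0" if "L < cmod z" for z v w by (rule dir_deriv_support[OF 1 that])
  show ?thesis by (rule that[of "\<bar>L\<bar> + 1"]) (auto intro!: 0 1 2)
qed

lemma test_function_regular:
  fixes \<phi> :: "complex \<Rightarrow> real"
  assumes \<phi>: "test_function \<phi>"
  shows "continuous_on UNIV \<phi>" "continuous_on UNIV (dir_deriv v \<phi>)" "continuous_on UNIV (dir_deriv w (dir_deriv v \<phi>))"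
    and "\<phi> differentiable (at z)" "dir_deriv v \<phi> differentiable (at z)"
proof -
  have d: "times_differentiable k \<phi>" for k using \<phi> by (simp add: test_function_def)
  show "continuous_on UNIV \<phi>" "continuous_on UNIV (dir_deriv v \<phi>)" "continuous_on UNIV (dir_deriv w (dir_deriv v \<phi>))"
    using d[of 0] d[of 1] d[of 2] by (auto simp: numeral_2_eq_2)
  show "\<phi> differentiable (at z)" "dir_deriv v \<phi> differentiable (at z)"
    using d[of 1] d[of 2] by (auto simp: numeral_2_eq_2 differentiable_on_def)
qed

lemma laplacian_complex: "laplacian \<phi> z = dir_deriv 1 (dir_deriv 1 \<phi>) z + dir_deriv \<i> (dir_deriv \<i> \<phi>) z"
  by (simp add: laplacian_def Basis_complex_def)

text \<open>\<open>2 * pi\<close> times the mean of \<open>\<phi>\<close> over the circle of radius \<open>m\<close>, which is parametrized by the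
  lines through \<open>0\<close>.\<close>

definition ray_average :: "real \<Rightarrow> (complex \<Rightarrow> real) \<Rightarrow> real" where
  "ray_average m \<phi> = (\<integral>s. (let \<rho> = m / sqrt (1 + s\<^sup>2) in
     (\<phi> (Complex (\<rho> * s) \<rho>) + \<phi> (Complex (- \<rho> * s) (- \<rho>))) / (1 + s\<^sup>2)) \<partial>lborel)"

lemma norm_on_line: "cmod (Complex (y * s) y) = \<bar>y\<bar> * sqrt (1 + s\<^sup>2)"
proof -
  have "(y * s)\<^sup>2 + y\<^sup>2 = y\<^sup>2 * (1 + s\<^sup>2)" by (simp add: power2_eq_square algebra_simps)
  then show ?thesis by (simp add: complex_norm real_sqrt_mult)
qed

text \<open>In line coordinates the integrand on the disc depends on \<open>y\<close> only through
  its sign and the Jacobian, so the inner integral is explicit;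
  \<open>b\<^sup>2 = 1 / (1 + s\<^sup>2)\<close> becomes the weight in
  \<open>ray_average\<close>.\<close>

lemma integral_circle_measure:
  assumes m: "0 < m" and \<phi>: "continuous_on UNIV \<phi>" "\<And>z. L \<le> cmod z \<Longrightarrow> \<phi> z = 0"
  shows "(\<integral>z. \<phi> z \<partial>circle_measure m) = 1 / (2 * pi) * ray_average m \<phi>"
proof -
  have [measurable]: "\<phi> \<in> borel_measurable borel" using \<phi>(1) by (rule borel_measurable_continuous_onI)
  have meas: "(\<lambda>z. complex_of_real m * sgn z) \<in> borel_measurable (uniform_measure lborel (ball 0 1))"
    by (simp add: measurable_cong_sets[OF sets_uniform_measure refl])
  obtain B where B: "\<And>z. \<bar>\<phi> z\<bar> \<le> B" using compact_support_bounded[OF \<phi>] by blast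
  define g where "g z = indicator (ball 0 1) z * \<phi> (complex_of_real m * sgn z)" for z
  have [measurable]: "(\<lambda>z. \<phi> (complex_of_real m * sgn z)) \<in> borel_measurable borel"
    by measurable
  have [measurable]: "ball (0::complex) 1 \<in> sets borel" by simp
  have [measurable]: "g \<in> borel_measurable borel" unfolding g_def by measurable
  have "\<bar>g z\<bar> \<le> B" for z using B[of "complex_of_real m * sgn z"] by (auto simp: g_def indicator_def)
  then have g: "integrable lborel g"
    by (rule integrable_compact_support[where L=1, rotated]) (auto simp: g_def indicator_def)
  have "(\<integral>z. \<phi> z \<partial>circle_measure m) = (\<integral>z. \<phi> (complex_of_real m * sgn z) \<partial>uniform_measure lborel (ball 0 1))"
    unfolding circle_measure_def by (subst integral_distr[OF meas]) simp_all
  also have "\<dots> = (\<integral>z. indicator (ball 0 1) z / pi * \<phi> (complex_of_real m * sgn z) \<partial>lborel)"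
  proof -
    have "uniform_measure lborel (ball (0::complex) 1) = density lborel (\<lambda>z. ennreal (indicator (ball 0 1) z / pi))"
      unfolding uniform_measure_def emeasure_unit_disc
      by (intro arg_cong2[where f=density] refl) (auto simp: fun_eq_iff indicator_def divide_ennreal[symmetric])
    then show ?thesis by (simp add: integral_density)
  qed
  also have "\<dots> = (\<integral>z. 1 / pi * g z \<partial>lborel)" by (rule Bochner_Integration.integral_cong) (simp_all add: g_def)
  also have "\<dots> = 1 / pi * (\<integral>z. g z \<partial>lborel)" by (rule integral_mult_right_zero)
  also have "(\<integral>z. g z \<partial>lborel) = (\<integral>s. (\<integral>y. \<bar>y\<bar> * g (Complex (y * s) y) \<partial>lborel) \<partial>lborel)"
    by (rule integral_line_coordinates[OF g])
  also have "\<dots> = (\<integral>s. 1 / 2 * (let \<rho> = m / sqrt (1 + s\<^sup>2) in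
      (\<phi> (Complex (\<rho> * s) \<rho>) + \<phi> (Complex (- \<rho> * s) (- \<rho>))) / (1 + s\<^sup>2)) \<partial>lborel)"
  proof (rule Bochner_Integration.integral_cong[OF refl])
    fix s :: real
    define b where "b = 1 / sqrt (1 + s\<^sup>2)"
    have p: "0 < 1 + s\<^sup>2" by (simp add: add_pos_nonneg)
    have b: "0 < b" "b\<^sup>2 = 1 / (1 + s\<^sup>2)" using p by (simp_all add: b_def power_divide)
    have "\<bar>y\<bar> * g (Complex (y * s) y) = (if \<bar>y\<bar> < b then \<bar>y\<bar> * (if 0 < y
        then \<phi> (Complex (m * b * s) (m * b)) else \<phi> (Complex (- (m * b) * s) (- (m * b)))) else 0)" for y
    proof (cases "y = 0")
      case False
      have "complex_of_real m * sgn (Complex (y * s) y) = Complex (m * b * sgn y * s) (m * b * sgn y)"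
        using False p norm_on_line[of y s] by (simp add: sgn_div_norm mult.commute[of y s] complex_eq_iff b_def sgn_if field_simps)
      moreover have "cmod (Complex (y * s) y) < 1 \<longleftrightarrow> \<bar>y\<bar> < b"
        unfolding norm_on_line b_def using p by (simp add: pos_less_divide_eq)
      ultimately show ?thesis using False by (auto simp: g_def indicator_def sgn_if)
    qed simp
    then have "(\<integral>y. \<bar>y\<bar> * g (Complex (y * s) y) \<partial>lborel)
        = b\<^sup>2 / 2 * (\<phi> (Complex (m * b * s) (m * b)) + \<phi> (Complex (- (m * b) * s) (- (m * b))))"
      by (simp only: integral_two_sided_linear[OF b(1)])
    then show "(\<integral>y. \<bar>y\<bar> * g (Complex (y * s) y) \<partial>lborel) = 1 / 2 * (let \<rho> = m / sqrt (1 + s\<^sup>2) in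
      (\<phi> (Complex (\<rho> * s) \<rho>) + \<phi> (Complex (- \<rho> * s) (- \<rho>))) / (1 + s\<^sup>2))"
      unfolding b(2) by (simp add: Let_def b_def)
  qed
  also have "\<dots> = 1 / 2 * ray_average m \<phi>" unfolding ray_average_def by (rule integral_mult_right_zero)
  finally show ?thesis by simp
qed

text \<open>One integration by parts in each variable moves a derivative from \<open>\<phi>\<close>
  to the logarithm, whose gradient is \<open>z\<close> divided by the square of
  \<open>cmod z\<close> outside the circle and \<open>0\<close> inside. The sum \<open>g\<close> of
  the two terms is then a multiple of the derivative of \<open>\<phi>\<close> along the line through
  \<open>0\<close> and \<open>z\<close>, so in line coordinates the second integration is
  one-dimensional.\<close>

lemma green_log_max:
  assumes m: "0 < m" and \<phi>: "test_function \<phi>"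
  shows "integrable lborel (\<lambda>z. ln (max m (cmod z)) * laplacian \<phi> z)"
    and "(\<integral>z. ln (max m (cmod z)) * laplacian \<phi> z \<partial>lborel) = ray_average m \<phi>"
proof -
  note reg = test_function_regular[OF \<phi>]
  obtain L where L: "0 < L" "\<And>z. L \<le> cmod z \<Longrightarrow> \<phi> z = 0" "\<And>z v. L \<le> cmod z \<Longrightarrow> dir_deriv v \<phi> z = 0"
    "\<And>z v w. L \<le> cmod z \<Longrightarrow> dir_deriv w (dir_deriv v \<phi>) z = 0"
    using test_function_support[OF \<phi>] by metis
  define P Q where "P = dir_deriv 1 \<phi>" and "Q = dir_deriv \<i> \<phi>"
  define f where "f z = ln (max m (cmod z))" for z
  define k where "k x y = (if m\<^sup>2 < x\<^sup>2 + y\<^sup>2 then x / (x\<^sup>2 + y\<^sup>2) else 0)" for x y :: real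
  have [measurable]: "P \<in> borel_measurable borel" "Q \<in> borel_measurable borel"
    unfolding P_def Q_def by (rule borel_measurable_continuous_onI[OF reg(2)])+
  have cf: "continuous_on UNIV f" unfolding f_def using m by (intro continuous_intros) (auto simp: max_def)
  have i: "integrable lborel (\<lambda>z. f z * h z)" if h: "continuous_on UNIV h" "\<And>z. L \<le> cmod z \<Longrightarrow> h z = 0" for h
  proof -
    have c: "continuous_on UNIV (\<lambda>z. f z * h z)" by (intro continuous_on_mult cf h)
    obtain B where "\<And>z. \<bar>f z * h z\<bar> \<le> B" using compact_support_bounded[OF c, of L] h(2) by auto
    then show ?thesis
      by (rule integrable_compact_support[where L=L, rotated]) (use c h(2) in \<open>auto intro: borel_measurable_continuous_onI\<close>)
  qed
  have i1: "integrable lborel (\<lambda>z. f z * dir_deriv 1 P z)" and i2: "integrable lborel (\<lambda>z. f z * dir_deriv \<i> Q z)"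
    unfolding P_def Q_def by (intro i reg L(4); assumption?)+
  have lap: "ln (max m (cmod z)) * laplacian \<phi> z = f z * dir_deriv 1 P z + f z * dir_deriv \<i> Q z" for z
    by (simp add: laplacian_complex f_def P_def Q_def distrib_left)
  show "integrable lborel (\<lambda>z. ln (max m (cmod z)) * laplacian \<phi> z)"
    unfolding lap by (intro Bochner_Integration.integrable_add i1 i2)
  have kb: "\<bar>k x y\<bar> \<le> 1 / m" for x y unfolding k_def by (rule log_max_derivative_bound[OF m])
  have [measurable]: "(\<lambda>z. k (Re z) (Im z)) \<in> borel_measurable borel" "(\<lambda>z. k (Im z) (Re z)) \<in> borel_measurable borel"
    unfolding k_def by measurable
  have ik: "integrable lborel (\<lambda>z. c z * h z)"
    if c: "\<And>z. \<bar>c z\<bar> \<le> 1 / m" and [measurable]: "c \<in> borel_measurable borel"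
      and h: "continuous_on UNIV h" "\<And>z. L \<le> cmod z \<Longrightarrow> h z = 0" for c h :: "complex \<Rightarrow> real"
  proof -
    have [measurable]: "h \<in> borel_measurable borel" using h(1) by (rule borel_measurable_continuous_onI)
    obtain B where B: "\<And>z. \<bar>h z\<bar> \<le> B" using compact_support_bounded[OF h] by blast
    have "\<bar>c z * h z\<bar> \<le> 1 / m * B" for z unfolding abs_mult using m by (intro mult_mono c B) auto
    then show ?thesis by (rule integrable_compact_support[where L=L, rotated]) (use h(2) in auto)
  qed
  have ik1: "integrable lborel (\<lambda>z. k (Re z) (Im z) * P z)" and ik2: "integrable lborel (\<lambda>z. k (Im z) (Re z) * Q z)"
    by (rule ik; (rule kb | simp add: P_def Q_def reg L(3)))+
  have P: "((\<lambda>x. P (Complex x y)) has_real_derivative dir_deriv 1 P (Complex x y)) (at x)" for x y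
    using DERIV_along_line[of P 1 0 0 y x] reg(5) by (simp add: P_def)
  have Q: "((\<lambda>y. Q (Complex x y)) has_real_derivative dir_deriv \<i> Q (Complex x y)) (at y)" for x y
    using DERIV_along_line[of Q 0 x 1 0 y] reg(5) by (simp add: Q_def)
  have bigx: "L \<le> \<bar>x\<bar> \<Longrightarrow> L \<le> cmod (Complex x y)" and bigy: "L \<le> \<bar>y\<bar> \<Longrightarrow> L \<le> cmod (Complex x y)" for x y
    using abs_Re_le_cmod[of "Complex x y"] abs_Im_le_cmod[of "Complex x y"] by auto
  have cC: "continuous_on UNIV (\<lambda>x. Complex x y)" "continuous_on UNIV (\<lambda>y. Complex x y)" for x y
    unfolding Complex_eq by (intro continuous_intros)+
  have "(\<integral>z. f z * dir_deriv 1 P z \<partial>lborel) = (\<integral>y. (\<integral>x. f (Complex x y) * dir_deriv 1 P (Complex x y) \<partial>lborel) \<partial>lborel)"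
    by (rule integral_slices(2)[OF i1])
  also have "\<dots> = (\<integral>y. - (\<integral>x. k x y * P (Complex x y) \<partial>lborel) \<partial>lborel)"
    unfolding f_def complex_norm k_def
    by (intro Bochner_Integration.integral_cong refl log_max_times_derivative_integral[OF m P _ L(1)])
      (auto simp: P_def intro!: L(3,4) bigx continuous_on_compose2[OF reg(3)] cC)
  also have "\<dots> = - (\<integral>z. k (Re z) (Im z) * P z \<partial>lborel)" by (simp add: integral_slices(2)[OF ik1])
  finally have 1: "(\<integral>z. f z * dir_deriv 1 P z \<partial>lborel) = - (\<integral>z. k (Re z) (Im z) * P z \<partial>lborel)" .
  have fC: "f (Complex x y) = ln (max m (sqrt (y\<^sup>2 + x\<^sup>2)))" for x y
    by (simp add: f_def complex_norm add.commute)
  have "(\<integral>z. f z * dir_deriv \<i> Q z \<partial>lborel) = (\<integral>x. (\<integral>y. f (Complex x y) * dir_deriv \<i> Q (Complex x y) \<partial>lborel) \<partial>lborel)"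
    by (rule integral_slices(1)[OF i2])
  also have "\<dots> = (\<integral>x. - (\<integral>y. k y x * Q (Complex x y) \<partial>lborel) \<partial>lborel)"
    unfolding fC k_def
    by (intro Bochner_Integration.integral_cong refl log_max_times_derivative_integral[OF m Q _ L(1)])
      (auto simp: Q_def intro!: L(3,4) bigy continuous_on_compose2[OF reg(3)] cC)
  also have "\<dots> = - (\<integral>z. k (Im z) (Re z) * Q z \<partial>lborel)" by (simp add: integral_slices(1)[OF ik2])
  finally have 2: "(\<integral>z. f z * dir_deriv \<i> Q z \<partial>lborel) = - (\<integral>z. k (Im z) (Re z) * Q z \<partial>lborel)" .
  define g where "g z = k (Re z) (Im z) * P z + k (Im z) (Re z) * Q z" for z
  have g: "integrable lborel g" unfolding g_def by (intro Bochner_Integration.integrable_add ik1 ik2)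
  have "(\<integral>z. ln (max m (cmod z)) * laplacian \<phi> z \<partial>lborel) = - (\<integral>z. g z \<partial>lborel)"
    unfolding lap g_def by (simp add: Bochner_Integration.integral_add i1 i2 ik1 ik2 1 2)
  also have "(\<integral>z. g z \<partial>lborel) = (\<integral>s. (\<integral>y. \<bar>y\<bar> * g (Complex (y * s) y) \<partial>lborel) \<partial>lborel)"
    by (rule integral_line_coordinates[OF g])
  also have "\<dots> = (\<integral>s. - (let \<rho> = m / sqrt (1 + s\<^sup>2) in
      (\<phi> (Complex (\<rho> * s) \<rho>) + \<phi> (Complex (- \<rho> * s) (- \<rho>))) / (1 + s\<^sup>2)) \<partial>lborel)"
  proof (rule Bochner_Integration.integral_cong[OF refl])
    fix s :: real
    define \<rho> where "\<rho> = m / sqrt (1 + s\<^sup>2)"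
    define d where "d y = s * P (Complex (y * s) y) + Q (Complex (y * s) y)" for y
    have p: "0 < 1 + s\<^sup>2" by (simp add: add_pos_nonneg)
    then have \<rho>: "0 < \<rho>" using m by (simp add: \<rho>_def)
    have d: "((\<lambda>y. \<phi> (Complex (y * s) y)) has_real_derivative d y) (at y)" for y
      using DERIV_along_line[of \<phi> s 0 1 0 y] reg(4) by (simp add: d_def P_def Q_def mult.commute)
    have cd: "continuous_on UNIV d"
      unfolding d_def P_def Q_def Complex_eq
      by (intro continuous_intros continuous_on_compose2[OF reg(2)]) auto
    \<comment> \<open>Outside the circle the Jacobian \<open>\<bar>y\<bar>\<close> cancels the
      factor \<open>1 / y\<close> of \<open>g\<close> up to sign; what remains is the signed
      derivative along the line, weighted by \<open>1 / (1 + s\<^sup>2)\<close>.\<close>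
    have "\<bar>y\<bar> * g (Complex (y * s) y) = 1 / (1 + s\<^sup>2) * (if \<rho> < y then d y else if y < - \<rho> then - d y else 0)" for y
    proof -
      have n: "(y * s)\<^sup>2 + y\<^sup>2 = y\<^sup>2 * (1 + s\<^sup>2)" by (simp add: power2_eq_square algebra_simps)
      have "m\<^sup>2 < (y * s)\<^sup>2 + y\<^sup>2 \<longleftrightarrow> m < cmod (Complex (y * s) y)"
        using m real_sqrt_less_iff[of "m\<^sup>2" "(y * s)\<^sup>2 + y\<^sup>2"] by (simp add: complex_norm del: real_sqrt_less_iff)
      also have "\<dots> \<longleftrightarrow> \<rho> < \<bar>y\<bar>" unfolding norm_on_line \<rho>_def using p by (simp add: pos_divide_less_eq)
      finally have c: "m\<^sup>2 < (y * s)\<^sup>2 + y\<^sup>2 \<longleftrightarrow> \<rho> < \<bar>y\<bar>" .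
      show ?thesis
      proof (cases "\<rho> < \<bar>y\<bar>")
        case True
        then have y: "y \<noteq> 0" using \<rho> by auto
        have "g (Complex (y * s) y) = y * d y / (y\<^sup>2 * (1 + s\<^sup>2))"
          using True c by (simp add: g_def k_def d_def n add_divide_distrib distrib_left mult_ac power_mult_distrib add.commute[of "y\<^sup>2"])
        also have "\<dots> = d y / (y * (1 + s\<^sup>2))" using y by (simp add: power2_eq_square)
        finally have "\<bar>y\<bar> * g (Complex (y * s) y) = \<bar>y\<bar> / y * (d y / (1 + s\<^sup>2))" by simp
        then show ?thesis using True \<rho> y by (cases "0 < y") (auto simp: abs_if)
      next
        case False
        then show ?thesis using c \<rho> by (auto simp: g_def k_def add.commute[of "y\<^sup>2"])
      qed
    qed
    then have "(\<integral>y. \<bar>y\<bar> * g (Complex (y * s) y) \<partial>lborel)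
        = 1 / (1 + s\<^sup>2) * (\<integral>y. (if \<rho> < y then d y else if y < - \<rho> then - d y else 0) \<partial>lborel)" by simp
    also have "(\<integral>y. (if \<rho> < y then d y else if y < - \<rho> then - d y else 0) \<partial>lborel)
        = - (\<phi> (Complex (\<rho> * s) \<rho>) + \<phi> (Complex (- \<rho> * s) (- \<rho>)))"
      by (rule integral_signed_derivative[OF d cd \<rho>, of L]) (auto simp: d_def P_def Q_def L bigy)
    finally show "(\<integral>y. \<bar>y\<bar> * g (Complex (y * s) y) \<partial>lborel) = - (let \<rho> = m / sqrt (1 + s\<^sup>2) in
      (\<phi> (Complex (\<rho> * s) \<rho>) + \<phi> (Complex (- \<rho> * s) (- \<rho>))) / (1 + s\<^sup>2))"
      by (simp add: Let_def \<rho>_def[symmetric] diff_divide_distrib add_divide_distrib)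
  qed
  finally show "(\<integral>z. ln (max m (cmod z)) * laplacian \<phi> z \<partial>lborel) = ray_average m \<phi>"
    by (simp add: ray_average_def)
qed

text \<open>The mean over the circle and the integral against the Laplacian have both been reduced
  to \<open>ray_average\<close>.\<close>

lemma is_brown_measure_circle:
  assumes m: "0 < m" and fk: "\<And>z. fuglede_kadison \<tau> (\<lambda>x. T x - z *\<^sub>C x) = max m (cmod z)"
  shows "is_brown_measure \<tau> T (circle_measure m)"
  unfolding is_brown_measure_def
proof (intro conjI allI impI prob_space_circle_measure sets_circle_measure)
  fix \<phi> :: "complex \<Rightarrow> real" assume \<phi>: "test_function \<phi>"
  show "integrable lborel (\<lambda>z. ln (fuglede_kadison \<tau> (\<lambda>x. T x - z *\<^sub>C x)) * laplacian \<phi> z)"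
    unfolding fk by (rule green_log_max[OF m \<phi>])
  obtain L where "\<And>z. L \<le> cmod z \<Longrightarrow> \<phi> z = 0" using test_function_support[OF \<phi>] by metis
  then show "(\<integral>z. \<phi> z \<partial>circle_measure m) =
      1 / (2 * pi) * (\<integral>z. ln (fuglede_kadison \<tau> (\<lambda>x. T x - z *\<^sub>C x)) * laplacian \<phi> z \<partial>lborel)"
    unfolding fk green_log_max(2)[OF m \<phi>] by (rule integral_circle_measure[OF m test_function_regular(1)[OF \<phi>]])
qed

lemma exp_2_pi_i_power_neq_1:
  assumes "\<theta> \<notin> \<rat>" and "0 < j"
  shows "exp (2 * complex_of_real pi * \<i> * complex_of_real \<theta>) ^ j \<noteq> 1"
proof
  assume "exp (2 * complex_of_real pi * \<i> * complex_of_real \<theta>) ^ j = 1"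
  then have "exp (of_nat j * (2 * complex_of_real pi * \<i> * complex_of_real \<theta>)) = 1"
    by (simp add: exp_of_nat_mult)
  then obtain n :: int where n: "real j * (2 * pi * \<theta>) = of_int (2 * n) * pi"
    by (auto simp: exp_eq_1)
  then have "\<theta> = of_int n / of_int (int j)" using \<open>0 < j\<close> by (simp add: field_simps)
  also have "\<dots> \<in> \<rat>" by (intro Rats_divide Rats_of_int)
  finally show False using assms(1) by simp
qed

theorem theorem12p2:
  fixes \<theta> lam :: real
    and R :: "('h::complex_hilbert_space \<Rightarrow> 'h) set"
    and \<tau> :: "('h \<Rightarrow> 'h) \<Rightarrow> complex"
    and u v :: "'h \<Rightarrow> 'h"
  assumes "0 < \<theta>" "\<theta> < 1" "\<theta> \<notin> \<rat>"
    and "type_II1_factor R" "hyperfinite R"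
    and "faithful_normal_tracial_state R \<tau>"
    and "unitary u" "unitary v"
    and "R = generated_vna {u, v}"
    and "v \<circ> u = (\<lambda>x. exp (2 * complex_of_real pi * \<i> * complex_of_real \<theta>) *\<^sub>C u (v x))"
  shows "(0 < lam \<and> lam \<le> 1 \<longrightarrow>
            haar_on_circle 1 (brown_measure \<tau> (\<lambda>x. u x + lam *\<^sub>R v x))) \<and>
         (lam > 1 \<longrightarrow>
            haar_on_circle lam (brown_measure \<tau> (\<lambda>x. u x + lam *\<^sub>R v x)))"
proof -
  interpret traced_vna R \<tau>
    using assms(4,6) by unfold_locales (simp_all add: type_II1_factor_def factor_def)
  define q where "q = exp (2 * complex_of_real pi * \<i> * complex_of_real \<theta>)"
  have op: "bounded_op u" "bounded_op v" using assms(7,8) by (auto simp: unitary_def)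
  have uv: "u \<in> R" "v \<in> R" unfolding assms(9) generated_vna_def by auto
  have star: "star (Op w) * Op w = 1" "Op w * star (Op w) = 1" if "unitary w" for w :: "'h \<Rightarrow> 'h"
    using that by (auto simp: ap_star unitary_def fun_eq_iff intro!: cop_eqI)
  interpret q: q_commuting N tr "Op u" "Op v" q
  proof unfold_locales
    show "Op u \<in> N" "Op v \<in> N" using uv op by (simp_all add: N_def)
    show "Op v * Op u = sc q * (Op u * Op v)"
      using assms(10) op by (auto simp: q_def fun_eq_iff intro!: cop_eqI)
    show "cmod q = 1" by (simp add: q_def norm_exp_eq_Re)
    show "\<And>j. 0 < j \<Longrightarrow> q ^ j \<noteq> 1" unfolding q_def by (rule exp_2_pi_i_power_neq_1[OF assms(3)])
  qed (intro star assms)+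
  have haar: "haar_on_circle m (brown_measure \<tau> (\<lambda>x. u x + lam *\<^sub>R v x))" if lam: "0 < lam" and m: "m = max 1 lam" for m
  proof -
    have "fuglede_kadison \<tau> (\<lambda>x. (u x + lam *\<^sub>R v x) - z *\<^sub>C x) = max m (cmod z)" for z
    proof -
      \<comment> \<open>The coefficient \<open>1\<close> of \<open>Op u\<close> is nonzero, so the
        formula for linear combinations holds at every \<open>z\<close>, including
        \<open>z = 0\<close>.\<close>
      define X where "X = sc 1 * Op u + sc (complex_of_real lam) * Op v + sc (- z)"
      have X: "ap X = (\<lambda>x. (u x + lam *\<^sub>R v x) - z *\<^sub>C x)"
        using op by (simp add: X_def fun_eq_iff scaleR_scaleC scaleC_minus_left)
      have "ld_inf (star X * X) (2 * ln (Max {cmod 1, cmod (complex_of_real lam), cmod (- z)}))"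
        unfolding X_def by (rule q.ld_inf_linear_combination) simp
      moreover have "Max {cmod 1, cmod (complex_of_real lam), cmod (- z)} = max m (cmod z)"
        using lam m by (simp add: max.assoc)
      ultimately have "ld_inf (star X * X) (2 * ln (max m (cmod z)))" by simp
      moreover have "X \<in> N" unfolding X_def by (intro csub_add csub_mult csub_sc csub q.U(1) q.V(1))
      ultimately have "fuglede_kadison \<tau> (ap X) = exp (ln (max m (cmod z)))" by (intro fuglede_kadison_eq)
      then show ?thesis using m by (simp add: X)
    qed
    then have "brown_measure \<tau> (\<lambda>x. u x + lam *\<^sub>R v x) = circle_measure m"
      using m by (intro brown_measure_eqI is_brown_measure_circle) auto
    then show ?thesis using m by (simp add: circle_measure_haar)
  qed
  show ?thesis using haar[of 1] haar[of lam] by (simp add: max_def)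
qed

end
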